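(* Let $R$ be a complete discrete valuation ring of equal characteristic $p>2$ with perfect residue field $k$, fraction field $K$ and uniformiser $\pi$. Let $X$ be an affine formal $R$-scheme of finite type, normal, connected and flat over $R$, with integral special fibre $X_k$ with generic point $\eta$. Let $f_K:Y_K\to X_K$ be a non-trivial étale $\mathbb Z/p^2\mathbb Z$-torsor above the (rigid) generic fibre of $X$, with ramification index $1$ above $\eta$, with integral model $f:Y\to X$ (see context) whose special fibre $Y_k$ is irreducible. Assume that $f_K$ is given by an equation of Witt vectors of length two $$(T_1^p,T_2^p)-(T_1,T_2)=(\pi^{-pm_1'}a_1,\pi^{m_2}a_2),$$ where $m_1'>0$ and $m_2$ are integers, $a_1,a_2$ are regular functions on $X_K$ with $v(a_1)=v(a_2)=0$, the image $\bar a_1$ of $a_1$ modulo $\pi$ is not a $p$-power, and $m_1'(p(p-1)+1)\ge -m_2$. Then the finite cover $f:Y\to X$ does not have the structure of a torsor under a finite and flat $R$-group scheme of rank $p^2$.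
   Context: Witt vector subtraction: $(T_1^p,T_2^p)-(T_1,T_2):=\bigl(T_1^p-T_1,\;T_2^p-T_2-p^{-1}\sum_{k=1}^{p-1}\binom pk T_1^{pk}(-T_1)^{p-k}\bigr)$. $v$ is the valuation on the function field $K(X)$ given by the local ring of $X$ at $\eta$, normalised by $v(\pi)=1$. The torsor $f_K$ factors canonically as $Y_K=Y_{2,K}\to Y_{1,K}\to X_K$ with both maps étale $\mathbb Z/p\mathbb Z$-torsors; each extends to a torsor $f_1:Y_1\to X$, $f_2:Y_2\to Y_1$ under a finite flat $R$-group scheme of rank $p$ with $Y_1,Y_2$ normal; the integral model is $f=f_1\circ f_2:Y:=Y_2\to X$, a finite flat cover extending $f_K$. *)

theory Defs
  imports "HOL-Algebra.Algebra" "HOL-Library.Extended" "HOL-Computational_Algebra.Primes"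
begin

text \<open>
  All geometric objects are affine, so a (formal) scheme is represented by its ring of functions,
  and an algebra over \<open>S\<close> by a ring together with a structure homomorphism out of \<open>S\<close>.
\<close>


section \<open>Tensor products\<close>

text \<open>
  \<open>tensor S f M g N\<close> is the tensor product of \<open>M\<close> and \<open>N\<close> over \<open>S\<close>, where \<open>s\<close> acts on \<open>M\<close> as
  multiplication by \<open>f s\<close> and on \<open>N\<close> as multiplication by \<open>g s\<close>: the free abelian group on pairs,
  modulo the bilinearity relations.  Only its additive structure is meaningful if \<open>M\<close> is an ideal.
\<close>

definition tensor_relations ::
  "('s, 'm) ring_scheme \<Rightarrow> ('s \<Rightarrow> 'a) \<Rightarrow> ('a, 'n) ring_scheme \<Rightarrow> ('s \<Rightarrow> 'b) \<Rightarrow> ('b, 'k) ring_scheme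
    \<Rightarrow> (('a \<times> 'b) \<Rightarrow>\<^sub>0 int) set" where
  "tensor_relations S f M g N =
     {frag_of (x \<oplus>\<^bsub>M\<^esub> x', y) - frag_of (x, y) - frag_of (x', y) | x x' y.
        x \<in> carrier M \<and> x' \<in> carrier M \<and> y \<in> carrier N} \<union>
     {frag_of (x, y \<oplus>\<^bsub>N\<^esub> y') - frag_of (x, y) - frag_of (x, y') | x y y'.
        x \<in> carrier M \<and> y \<in> carrier N \<and> y' \<in> carrier N} \<union>
     {frag_of (f s \<otimes>\<^bsub>M\<^esub> x, y) - frag_of (x, g s \<otimes>\<^bsub>N\<^esub> y) | s x y.
        s \<in> carrier S \<and> x \<in> carrier M \<and> y \<in> carrier N}"

definition tensor_null ::
  "('s, 'm) ring_scheme \<Rightarrow> ('s \<Rightarrow> 'a) \<Rightarrow> ('a, 'n) ring_scheme \<Rightarrow> ('s \<Rightarrow> 'b) \<Rightarrow> ('b, 'k) ring_scheme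
    \<Rightarrow> (('a \<times> 'b) \<Rightarrow>\<^sub>0 int) set" where
  "tensor_null S f M g N =
     generate (free_Abelian_group (carrier M \<times> carrier N)) (tensor_relations S f M g N)"

definition tensor_class ::
  "('s, 'm) ring_scheme \<Rightarrow> ('s \<Rightarrow> 'a) \<Rightarrow> ('a, 'n) ring_scheme \<Rightarrow> ('s \<Rightarrow> 'b) \<Rightarrow> ('b, 'k) ring_scheme
    \<Rightarrow> (('a \<times> 'b) \<Rightarrow>\<^sub>0 int) \<Rightarrow> (('a \<times> 'b) \<Rightarrow>\<^sub>0 int) set" where
  "tensor_class S f M g N w =
     tensor_null S f M g N #>\<^bsub>free_Abelian_group (carrier M \<times> carrier N)\<^esub> w"

definition pure ::
  "('s, 'm) ring_scheme \<Rightarrow> ('s \<Rightarrow> 'a) \<Rightarrow> ('a, 'n) ring_scheme \<Rightarrow> ('s \<Rightarrow> 'b) \<Rightarrow> ('b, 'k) ring_scheme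
    \<Rightarrow> 'a \<Rightarrow> 'b \<Rightarrow> (('a \<times> 'b) \<Rightarrow>\<^sub>0 int) set" where
  "pure S f M g N x y = tensor_class S f M g N (frag_of (x, y))"

definition tensor ::
  "('s, 'm) ring_scheme \<Rightarrow> ('s \<Rightarrow> 'a) \<Rightarrow> ('a, 'n) ring_scheme \<Rightarrow> ('s \<Rightarrow> 'b) \<Rightarrow> ('b, 'k) ring_scheme
    \<Rightarrow> ((('a \<times> 'b) \<Rightarrow>\<^sub>0 int) set) ring" where
  "tensor S f M g N =
     \<lparr>carrier = rcosets\<^bsub>free_Abelian_group (carrier M \<times> carrier N)\<^esub> (tensor_null S f M g N),
      monoid.mult = (\<lambda>U V. \<Union>u\<in>U. \<Union>v\<in>V. tensor_class S f M g N
                (frag_extend (\<lambda>(x, y). frag_extend (\<lambda>(x', y'). frag_of (x \<otimes>\<^bsub>M\<^esub> x', y \<otimes>\<^bsub>N\<^esub> y')) v) u)),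
      monoid.one = pure S f M g N \<one>\<^bsub>M\<^esub> \<one>\<^bsub>N\<^esub>,
      ring.zero = tensor_null S f M g N,
      ring.add = set_mult (free_Abelian_group (carrier M \<times> carrier N))\<rparr>"

text \<open>
  The additive map induced on a tensor product by a balanced biadditive map \<open>\<beta>\<close> into \<open>C\<close>.  For such
  \<open>\<beta>\<close> the choice of the representative is irrelevant.
\<close>

definition tensor_lift ::
  "('c, 'm) ring_scheme \<Rightarrow> ('a \<Rightarrow> 'b \<Rightarrow> 'c) \<Rightarrow> (('a \<times> 'b) \<Rightarrow>\<^sub>0 int) set \<Rightarrow> 'c" where
  "tensor_lift C \<beta> U =
     (let w = (SOME w. w \<in> U)
      in \<Oplus>\<^bsub>C\<^esub>k \<in> Poly_Mapping.keys w. add_pow C (Poly_Mapping.lookup w k) (\<beta> (fst k) (snd k)))"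


section \<open>Finiteness, flatness, spectra\<close>

definition finite_over ::
  "('s, 'm) ring_scheme \<Rightarrow> ('s \<Rightarrow> 'b) \<Rightarrow> ('b, 'n) ring_scheme \<Rightarrow> bool" where
  "finite_over S f B \<longleftrightarrow>
     (\<exists>E. finite E \<and> E \<subseteq> carrier B \<and>
        (\<forall>b\<in>carrier B. \<exists>c \<in> E \<rightarrow> carrier S. b = (\<Oplus>\<^bsub>B\<^esub>x\<in>E. f (c x) \<otimes>\<^bsub>B\<^esub> x)))"

text \<open>
  Flatness by the ideal criterion, which unlike exactness of the tensor functor does not quantify
  over modules of all types.
\<close>

definition flat_over ::
  "('s, 'm) ring_scheme \<Rightarrow> ('s \<Rightarrow> 'b) \<Rightarrow> ('b, 'n) ring_scheme \<Rightarrow> bool" where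
  "flat_over S f B \<longleftrightarrow>
     (\<forall>I. ideal I S \<longrightarrow>
        inj_on (tensor_lift B (\<lambda>x b. f x \<otimes>\<^bsub>B\<^esub> b)) (carrier (tensor S id (S\<lparr>carrier := I\<rparr>) f B)))"

definition linearly_independent ::
  "('s, 'm) ring_scheme \<Rightarrow> ('s \<Rightarrow> 'b) \<Rightarrow> ('b, 'n) ring_scheme \<Rightarrow> 'b set \<Rightarrow> bool" where
  "linearly_independent S f B E \<longleftrightarrow> finite E \<and> E \<subseteq> carrier B \<and>
     (\<forall>c \<in> E \<rightarrow> carrier S. (\<Oplus>\<^bsub>B\<^esub>x\<in>E. f (c x) \<otimes>\<^bsub>B\<^esub> x) = \<zero>\<^bsub>B\<^esub> \<longrightarrow> (\<forall>x\<in>E. c x = \<zero>\<^bsub>S\<^esub>))"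

text \<open>The rank of a module over a domain.\<close>

definition has_rank ::
  "('s, 'm) ring_scheme \<Rightarrow> ('s \<Rightarrow> 'b) \<Rightarrow> ('b, 'n) ring_scheme \<Rightarrow> nat \<Rightarrow> bool" where
  "has_rank S f B n \<longleftrightarrow>
     (\<exists>E. linearly_independent S f B E \<and> card E = n) \<and>
     (\<forall>E. linearly_independent S f B E \<longrightarrow> card E \<le> n)"

definition spec :: "('a, 'm) ring_scheme \<Rightarrow> 'a set set" where
  "spec B = {Q. primeideal Q B}"

definition zero_locus :: "('a, 'm) ring_scheme \<Rightarrow> 'a set \<Rightarrow> 'a set set" where
  "zero_locus B I = {Q \<in> spec B. I \<subseteq> Q}"

definition connected_spec :: "('a, 'm) ring_scheme \<Rightarrow> bool" where
  "connected_spec B \<longleftrightarrow> spec B \<noteq> {} \<and>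
     (\<forall>I J. ideal I B \<and> ideal J B \<and> zero_locus B I \<union> zero_locus B J = spec B \<and>
        zero_locus B I \<inter> zero_locus B J = {} \<longrightarrow> zero_locus B I = {} \<or> zero_locus B J = {})"

definition irreducible_spec :: "('a, 'm) ring_scheme \<Rightarrow> bool" where
  "irreducible_spec B \<longleftrightarrow> spec B \<noteq> {} \<and>
     (\<forall>I J. ideal I B \<and> ideal J B \<and> zero_locus B I \<union> zero_locus B J = spec B \<longrightarrow>
        zero_locus B I = spec B \<or> zero_locus B J = spec B)"

definition contraction :: "('a, 'm) ring_scheme \<Rightarrow> ('a \<Rightarrow> 'b) \<Rightarrow> 'b set \<Rightarrow> 'a set" where
  "contraction A f Q = {a \<in> carrier A. f a \<in> Q}"

definition faithfully_flat_over ::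
  "('s, 'm) ring_scheme \<Rightarrow> ('s \<Rightarrow> 'b) \<Rightarrow> ('b, 'n) ring_scheme \<Rightarrow> bool" where
  "faithfully_flat_over S f B \<longleftrightarrow> flat_over S f B \<and> contraction S f ` spec B = spec S"


section \<open>Localization and normality\<close>

definition loc_rel :: "('a, 'm) ring_scheme \<Rightarrow> 'a set \<Rightarrow> (('a \<times> 'a) \<times> ('a \<times> 'a)) set" where
  "loc_rel A S =
     {((a, s), (b, t)). a \<in> carrier A \<and> b \<in> carrier A \<and> s \<in> S \<and> t \<in> S \<and>
        (\<exists>u\<in>S. u \<otimes>\<^bsub>A\<^esub> (t \<otimes>\<^bsub>A\<^esub> a \<ominus>\<^bsub>A\<^esub> s \<otimes>\<^bsub>A\<^esub> b) = \<zero>\<^bsub>A\<^esub>)}"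

definition fraction :: "('a, 'm) ring_scheme \<Rightarrow> 'a set \<Rightarrow> 'a \<Rightarrow> 'a \<Rightarrow> ('a \<times> 'a) set" where
  "fraction A S a s = loc_rel A S `` {(a, s)}"

definition localization :: "('a, 'm) ring_scheme \<Rightarrow> 'a set \<Rightarrow> (('a \<times> 'a) set) ring" where
  "localization A S =
     \<lparr>carrier = (carrier A \<times> S) // loc_rel A S,
      monoid.mult = (\<lambda>U V. \<Union>(a, s)\<in>U. \<Union>(b, t)\<in>V. fraction A S (a \<otimes>\<^bsub>A\<^esub> b) (s \<otimes>\<^bsub>A\<^esub> t)),
      monoid.one = fraction A S \<one>\<^bsub>A\<^esub> \<one>\<^bsub>A\<^esub>,
      ring.zero = fraction A S \<zero>\<^bsub>A\<^esub> \<one>\<^bsub>A\<^esub>,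
      ring.add = (\<lambda>U V. \<Union>(a, s)\<in>U. \<Union>(b, t)\<in>V.
               fraction A S (t \<otimes>\<^bsub>A\<^esub> a \<oplus>\<^bsub>A\<^esub> s \<otimes>\<^bsub>A\<^esub> b) (s \<otimes>\<^bsub>A\<^esub> t))\<rparr>"

text \<open>The fraction field of a domain.\<close>

definition nonzero :: "('a, 'm) ring_scheme \<Rightarrow> 'a set" where
  "nonzero A = carrier A - {\<zero>\<^bsub>A\<^esub>}"

definition frac_field :: "('a, 'm) ring_scheme \<Rightarrow> (('a \<times> 'a) set) ring" where
  "frac_field A = localization A (nonzero A)"

definition quot :: "('a, 'm) ring_scheme \<Rightarrow> 'a \<Rightarrow> 'a \<Rightarrow> ('a \<times> 'a) set" where
  "quot A a s = fraction A (nonzero A) a s"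

definition to_frac :: "('a, 'm) ring_scheme \<Rightarrow> 'a \<Rightarrow> ('a \<times> 'a) set" where
  "to_frac A a = quot A a \<one>\<^bsub>A\<^esub>"

definition integral_over :: "('a, 'm) ring_scheme \<Rightarrow> 'a set \<Rightarrow> 'a \<Rightarrow> bool" where
  "integral_over L D x \<longleftrightarrow>
     (\<exists>n>0. \<exists>c \<in> {..<n} \<rightarrow> D. x [^]\<^bsub>L\<^esub> (n::nat) \<oplus>\<^bsub>L\<^esub> (\<Oplus>\<^bsub>L\<^esub>i\<in>{..<n}. c i \<otimes>\<^bsub>L\<^esub> x [^]\<^bsub>L\<^esub> i) = \<zero>\<^bsub>L\<^esub>)"

definition normal_domain :: "('a, 'm) ring_scheme \<Rightarrow> bool" where
  "normal_domain D \<longleftrightarrow> domain D \<and>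
     (\<forall>x\<in>carrier (frac_field D).
        integral_over (frac_field D) (to_frac D ` carrier D) x \<longrightarrow> x \<in> to_frac D ` carrier D)"

definition normal_ring :: "('a, 'm) ring_scheme \<Rightarrow> bool" where
  "normal_ring B \<longleftrightarrow> cring B \<and> (\<forall>Q\<in>spec B. normal_domain (localization B (carrier B - Q)))"

text \<open>
  The ramification index \<open>e\<close> at a prime \<open>Q\<close> of \<open>B\<close> lying above \<open>P\<close>: in the local ring of \<open>B\<close> at \<open>Q\<close>,
  the ideal generated by \<open>P\<close> is the \<open>e\<close>-th power of the maximal ideal.
\<close>

definition has_ramification_index ::
  "('a \<Rightarrow> 'b) \<Rightarrow> 'a set \<Rightarrow> ('b, 'n) ring_scheme \<Rightarrow> 'b set \<Rightarrow> nat \<Rightarrow> bool" where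
  "has_ramification_index f P B Q e \<longleftrightarrow>
     (let S = carrier B - Q; L = localization B S
      in Idl\<^bsub>L\<^esub> ((\<lambda>a. fraction B S (f a) \<one>\<^bsub>B\<^esub>) ` P) =
         (Idl\<^bsub>L\<^esub> ((\<lambda>b. fraction B S b \<one>\<^bsub>B\<^esub>) ` Q)) [^]\<^bsub>ideals_set L\<^esub> e)"


section \<open>The base ring and formal schemes\<close>

definition adically_complete :: "('a, 'm) ring_scheme \<Rightarrow> 'a \<Rightarrow> bool" where
  "adically_complete A t \<longleftrightarrow>
     (\<forall>f. (\<forall>n. f n \<in> carrier A \<and> f (Suc n) \<ominus>\<^bsub>A\<^esub> f n \<in> PIdl\<^bsub>A\<^esub> (t [^]\<^bsub>A\<^esub> (n::nat))) \<longrightarrow>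
        (\<exists>!x. x \<in> carrier A \<and> (\<forall>n. x \<ominus>\<^bsub>A\<^esub> f n \<in> PIdl\<^bsub>A\<^esub> (t [^]\<^bsub>A\<^esub> n))))"

definition discrete_valuation_ring :: "('a, 'm) ring_scheme \<Rightarrow> bool" where
  "discrete_valuation_ring R \<longleftrightarrow>
     principal_domain R \<and> \<not> field R \<and> (\<exists>!M. maximalideal M R)"

definition uniformiser :: "('a, 'm) ring_scheme \<Rightarrow> 'a \<Rightarrow> bool" where
  "uniformiser R t \<longleftrightarrow> t \<in> carrier R \<and> maximalideal (PIdl\<^bsub>R\<^esub> t) R"

definition prime_characteristic :: "('a, 'm) ring_scheme \<Rightarrow> nat \<Rightarrow> bool" where
  "prime_characteristic R p \<longleftrightarrow> Factorial_Ring.prime p \<and> \<one>\<^bsub>R\<^esub> \<noteq> \<zero>\<^bsub>R\<^esub> \<and> add_pow R p \<one>\<^bsub>R\<^esub> = \<zero>\<^bsub>R\<^esub>"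

definition is_power :: "('a, 'm) ring_scheme \<Rightarrow> nat \<Rightarrow> 'a \<Rightarrow> bool" where
  "is_power R n x \<longleftrightarrow> (\<exists>y\<in>carrier R. y [^]\<^bsub>R\<^esub> n = x)"

definition perfect_field :: "('a, 'm) ring_scheme \<Rightarrow> nat \<Rightarrow> bool" where
  "perfect_field k p \<longleftrightarrow> field k \<and> prime_characteristic k p \<and> (\<forall>x\<in>carrier k. is_power k p x)"

text \<open>
  Restricted power series over \<open>R\<close> in the variables with index \<open>< n\<close>, given by their coefficient
  functions on exponent vectors.
\<close>

definition restricted_power_series ::
  "('r, 'm) ring_scheme \<Rightarrow> 'r \<Rightarrow> nat \<Rightarrow> ((nat \<Rightarrow>\<^sub>0 nat) \<Rightarrow> 'r) ring" where
  "restricted_power_series R t n =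
     \<lparr>carrier = {c. (\<forall>\<alpha>. c \<alpha> \<in> carrier R) \<and>
                    (\<forall>\<alpha>. \<not> Poly_Mapping.keys \<alpha> \<subseteq> {..<n} \<longrightarrow> c \<alpha> = \<zero>\<^bsub>R\<^esub>) \<and>
                    (\<forall>N::nat. finite {\<alpha>. c \<alpha> \<notin> PIdl\<^bsub>R\<^esub> (t [^]\<^bsub>R\<^esub> N)})},
      monoid.mult = (\<lambda>c d \<alpha>. \<Oplus>\<^bsub>R\<^esub>e \<in> {e. fst e + snd e = \<alpha>}. c (fst e) \<otimes>\<^bsub>R\<^esub> d (snd e)),
      monoid.one = (\<lambda>\<alpha>. if \<alpha> = 0 then \<one>\<^bsub>R\<^esub> else \<zero>\<^bsub>R\<^esub>),
      ring.zero = (\<lambda>\<alpha>. \<zero>\<^bsub>R\<^esub>),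
      ring.add = (\<lambda>c d \<alpha>. c \<alpha> \<oplus>\<^bsub>R\<^esub> d \<alpha>)\<rparr>"

definition topologically_finite_type ::
  "('r, 'm) ring_scheme \<Rightarrow> 'r \<Rightarrow> ('r \<Rightarrow> 'a) \<Rightarrow> ('a, 'n) ring_scheme \<Rightarrow> bool" where
  "topologically_finite_type R t \<phi> A \<longleftrightarrow>
     (\<exists>n h. h \<in> ring_hom (restricted_power_series R t n) A \<and>
        h ` carrier (restricted_power_series R t n) = carrier A \<and>
        (\<forall>r\<in>carrier R. h (\<lambda>\<alpha>. if \<alpha> = 0 then r else \<zero>\<^bsub>R\<^esub>) = \<phi> r))"

text \<open>\<open>Spf A\<close> as an affine formal \<open>R\<close>-scheme of finite type.\<close>

definition affine_formal_scheme ::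
  "('r, 'm) ring_scheme \<Rightarrow> 'r \<Rightarrow> ('r \<Rightarrow> 'a) \<Rightarrow> ('a, 'n) ring_scheme \<Rightarrow> bool" where
  "affine_formal_scheme R t \<phi> A \<longleftrightarrow>
     cring A \<and> \<phi> \<in> ring_hom R A \<and> adically_complete A (\<phi> t) \<and> topologically_finite_type R t \<phi> A"

text \<open>
  In the following \<open>t\<close> is the image in \<open>A\<close> of a uniformiser of the base.  The definitions that use
  the function field \<open>frac_field A\<close> are meant for a domain \<open>A\<close>, which holds for the rings of normal
  connected affine formal schemes of finite type.  The special fibre is also used for the integral model; its spectrum is the topological space
  underlying \<open>Spf A\<close>.
\<close>

definition special_fibre :: "('a, 'm) ring_scheme \<Rightarrow> 'a \<Rightarrow> ('a set) ring" where
  "special_fibre A t = A Quot (PIdl\<^bsub>A\<^esub> t)"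

text \<open>Functions on the generic fibre: the subring \<open>A[1/t]\<close> of the function field.\<close>

definition generic_fibre :: "('a, 'm) ring_scheme \<Rightarrow> 'a \<Rightarrow> (('a \<times> 'a) set) ring" where
  "generic_fibre A t =
     (frac_field A)\<lparr>carrier := {quot A a (t [^]\<^bsub>A\<^esub> n) | a n. a \<in> carrier A \<and> n \<in> (UNIV::nat set)}\<rparr>"

text \<open>
  The local ring at the generic point of the special fibre, i.e. at the prime ideal \<open>(t)\<close>, as a
  subring of the function field; its maximal ideal; its residue field.
\<close>

definition local_ring_eta :: "('a, 'm) ring_scheme \<Rightarrow> 'a \<Rightarrow> (('a \<times> 'a) set) ring" where
  "local_ring_eta A t =
     (frac_field A)\<lparr>carrier := {quot A a s | a s. a \<in> carrier A \<and> s \<in> carrier A - PIdl\<^bsub>A\<^esub> t}\<rparr>"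

definition max_ideal_eta :: "('a, 'm) ring_scheme \<Rightarrow> 'a \<Rightarrow> ('a \<times> 'a) set set" where
  "max_ideal_eta A t = {quot A a s | a s. a \<in> PIdl\<^bsub>A\<^esub> t \<and> s \<in> carrier A - PIdl\<^bsub>A\<^esub> t}"

definition residue_field_eta :: "('a, 'm) ring_scheme \<Rightarrow> 'a \<Rightarrow> (('a \<times> 'a) set set) ring" where
  "residue_field_eta A t = local_ring_eta A t Quot max_ideal_eta A t"

definition residue_class_eta :: "('a, 'm) ring_scheme \<Rightarrow> 'a \<Rightarrow> ('a \<times> 'a) set \<Rightarrow> ('a \<times> 'a) set set" where
  "residue_class_eta A t x = max_ideal_eta A t +>\<^bsub>local_ring_eta A t\<^esub> x"

text \<open>The valuation on the function field normalised by giving \<open>t\<close> the value \<open>1\<close>.\<close>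

definition val_eta :: "('a, 'm) ring_scheme \<Rightarrow> 'a \<Rightarrow> ('a \<times> 'a) set \<Rightarrow> int extended" where
  "val_eta A t x =
     (if x = \<zero>\<^bsub>frac_field A\<^esub> then Pinf
      else Fin (THE n::int. \<exists>u\<in>Units (local_ring_eta A t).
             x = to_frac A t [^]\<^bsub>frac_field A\<^esub> n \<otimes>\<^bsub>frac_field A\<^esub> u))"


section \<open>Group schemes and torsors\<close>

text \<open>
  An affine group scheme over \<open>R\<close> is given by its Hopf algebra: the ring of functions with the
  structure map from \<open>R\<close>, comultiplication, counit and antipode.
\<close>

record ('r, 'h) hopf = "'h ring" +
  scalar :: "'r \<Rightarrow> 'h"
  comult :: "'h \<Rightarrow> (('h \<times> 'h) \<Rightarrow>\<^sub>0 int) set"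
  counit :: "'h \<Rightarrow> 'r"
  antipode :: "'h \<Rightarrow> 'h"

definition square :: "('r, 'm) ring_scheme \<Rightarrow> ('r, 'h) hopf \<Rightarrow> ((('h \<times> 'h) \<Rightarrow>\<^sub>0 int) set) ring" where
  "square R H = tensor R (scalar H) H (scalar H) H"

definition pure2 :: "('r, 'm) ring_scheme \<Rightarrow> ('r, 'h) hopf \<Rightarrow> 'h \<Rightarrow> 'h \<Rightarrow> (('h \<times> 'h) \<Rightarrow>\<^sub>0 int) set" where
  "pure2 R H = pure R (scalar H) H (scalar H) H"

definition scalar2 :: "('r, 'm) ring_scheme \<Rightarrow> ('r, 'h) hopf \<Rightarrow> 'r \<Rightarrow> (('h \<times> 'h) \<Rightarrow>\<^sub>0 int) set" where
  "scalar2 R H r = pure2 R H (scalar H r) \<one>\<^bsub>H\<^esub>"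

text \<open>
  In the coassociativity laws below, the left-hand side is \<open>(\<Delta> \<otimes> id) \<circ> \<Delta>\<close>
  (respectively \<open>(\<rho> \<otimes> id) \<circ> \<rho>\<close>), reassociated to the right.
\<close>

definition affine_group_scheme :: "('r, 'm) ring_scheme \<Rightarrow> ('r, 'h) hopf \<Rightarrow> bool" where
  "affine_group_scheme R H \<longleftrightarrow>
     cring R \<and> cring H \<and> scalar H \<in> ring_hom R H \<and>
     comult H \<in> ring_hom H (square R H) \<and>
     counit H \<in> ring_hom H R \<and>
     antipode H \<in> ring_hom H H \<and>
     (\<forall>r\<in>carrier R. comult H (scalar H r) = scalar2 R H r \<and>
        counit H (scalar H r) = r \<and> antipode H (scalar H r) = scalar H r) \<and>
     (let HHH = tensor R (scalar H) H (scalar2 R H) (square R H);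
          pure3 = pure R (scalar H) H (scalar2 R H) (square R H)
      in \<forall>h\<in>carrier H.
           tensor_lift HHH (\<lambda>a b. tensor_lift HHH (\<lambda>x y. pure3 x (pure2 R H y b)) (comult H a)) (comult H h)
           = tensor_lift HHH (\<lambda>a b. pure3 a (comult H b)) (comult H h)) \<and>
     (\<forall>h\<in>carrier H.
        tensor_lift H (\<lambda>a b. scalar H (counit H a) \<otimes>\<^bsub>H\<^esub> b) (comult H h) = h \<and>
        tensor_lift H (\<lambda>a b. a \<otimes>\<^bsub>H\<^esub> scalar H (counit H b)) (comult H h) = h \<and>
        tensor_lift H (\<lambda>a b. antipode H a \<otimes>\<^bsub>H\<^esub> b) (comult H h) = scalar H (counit H h) \<and>
        tensor_lift H (\<lambda>a b. a \<otimes>\<^bsub>H\<^esub> antipode H b) (comult H h) = scalar H (counit H h))"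

definition finite_flat_group_scheme :: "('r, 'm) ring_scheme \<Rightarrow> ('r, 'h) hopf \<Rightarrow> nat \<Rightarrow> bool" where
  "finite_flat_group_scheme R H n \<longleftrightarrow>
     affine_group_scheme R H \<and> finite_over R (scalar H) H \<and> flat_over R (scalar H) H \<and>
     has_rank R (scalar H) H n"

text \<open>
  \<open>Spec B\<close> over \<open>Spec A\<close>, where \<open>A\<close> is an \<open>R\<close>-algebra via \<open>\<phi>\<close> and \<open>B\<close> an \<open>A\<close>-algebra via \<open>\<alpha>\<close>, is a torsor
  under the finite flat \<open>R\<close>-group scheme with Hopf algebra \<open>H\<close>, the action being the coaction \<open>\<rho>\<close>.
  The last condition says that (action, projection) is an isomorphism \<open>Y \<times>\<^sub>R G \<rightarrow> Y \<times>\<^sub>X Y\<close>.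
  As \<open>B\<close> is finite over \<open>A\<close>, completions play no role, and this is also the notion for formal spectra.
\<close>

definition torsor ::
  "('r, 'm) ring_scheme \<Rightarrow> ('r, 'h) hopf \<Rightarrow> ('r \<Rightarrow> 'a) \<Rightarrow> ('a, 'n) ring_scheme \<Rightarrow> ('a \<Rightarrow> 'b)
    \<Rightarrow> ('b, 'k) ring_scheme \<Rightarrow> ('b \<Rightarrow> (('b \<times> 'h) \<Rightarrow>\<^sub>0 int) set) \<Rightarrow> bool" where
  "torsor R H \<phi> A \<alpha> B \<rho> \<longleftrightarrow>
     (let \<beta> = \<alpha> \<circ> \<phi>;
          BH = tensor R \<beta> B (scalar H) H;
          pureBH = pure R \<beta> B (scalar H) H;
          BHH = tensor R \<beta> B (scalar2 R H) (square R H);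
          pureBHH = pure R \<beta> B (scalar2 R H) (square R H)
      in cring B \<and> \<alpha> \<in> ring_hom A B \<and> finite_over A \<alpha> B \<and> faithfully_flat_over A \<alpha> B \<and>
         \<rho> \<in> ring_hom B BH \<and>
         (\<forall>a\<in>carrier A. \<rho> (\<alpha> a) = pureBH (\<alpha> a) \<one>\<^bsub>H\<^esub>) \<and>
         (\<forall>b\<in>carrier B.
            tensor_lift BHH (\<lambda>c h. tensor_lift BHH (\<lambda>x y. pureBHH x (pure2 R H y h)) (\<rho> c)) (\<rho> b)
            = tensor_lift BHH (\<lambda>c h. pureBHH c (comult H h)) (\<rho> b)) \<and>
         (\<forall>b\<in>carrier B. tensor_lift B (\<lambda>c h. c \<otimes>\<^bsub>B\<^esub> \<beta> (counit H h)) (\<rho> b) = b) \<and>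
         bij_betw (tensor_lift BH (\<lambda>b c. pureBH b \<one>\<^bsub>H\<^esub> \<otimes>\<^bsub>BH\<^esub> \<rho> c))
           (carrier (tensor A \<alpha> B \<alpha> B)) (carrier BH))"

text \<open>
  Torsors under the constant group \<open>\<int>/n\<int>\<close>, whose generator \<open>1\<close> acts by \<open>\<sigma>\<close>; they are automatically
  etale.  The last condition is the isomorphism of \<open>Y \<times>\<^sub>X Y\<close> with \<open>n\<close> copies of \<open>Y\<close>.
\<close>

definition cyclic_torsor ::
  "nat \<Rightarrow> ('a, 'n) ring_scheme \<Rightarrow> ('a \<Rightarrow> 'b) \<Rightarrow> ('b, 'k) ring_scheme \<Rightarrow> ('b \<Rightarrow> 'b) \<Rightarrow> bool" where
  "cyclic_torsor n A \<alpha> B \<sigma> \<longleftrightarrow>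
     cring B \<and> \<alpha> \<in> ring_hom A B \<and> finite_over A \<alpha> B \<and> faithfully_flat_over A \<alpha> B \<and>
     \<sigma> \<in> ring_hom B B \<and> (\<forall>a\<in>carrier A. \<sigma> (\<alpha> a) = \<alpha> a) \<and> (\<forall>b\<in>carrier B. (\<sigma> ^^ n) b = b) \<and>
     bij_betw (\<lambda>U. \<lambda>i\<in>{..<n}. tensor_lift B (\<lambda>b c. b \<otimes>\<^bsub>B\<^esub> (\<sigma> ^^ i) c) U)
       (carrier (tensor A \<alpha> B \<alpha> B)) (\<Pi>\<^sub>E i\<in>{..<n}. carrier B)"

text \<open>A torsor is trivial iff it has a section.\<close>

definition has_section ::
  "('a, 'n) ring_scheme \<Rightarrow> ('a \<Rightarrow> 'b) \<Rightarrow> ('b, 'k) ring_scheme \<Rightarrow> bool" where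
  "has_section A \<alpha> B \<longleftrightarrow> (\<exists>s\<in>ring_hom B A. \<forall>a\<in>carrier A. s (\<alpha> a) = a)"

text \<open>
  Let \<open>L\<close> be an algebra over the fraction field of \<open>R\<close> via \<open>\<kappa>\<close>, and \<open>\<rho>\<close> a coaction of \<open>H\<close> on the subring \<open>B\<close>
  of \<open>L\<close>.  On generic fibres this is the action of the constant group \<open>\<int>/n\<int>\<close> with \<open>1\<close> acting by \<open>\<tau>\<close>:
  the generic fibre of the group scheme is the disjoint union of \<open>n\<close> rational points \<open>\<chi> i\<close>, which
  add up and act as the elements of \<open>\<int>/n\<int>\<close>.
\<close>

definition cyclic_generic_action ::
  "nat \<Rightarrow> ('r, 'm) ring_scheme \<Rightarrow> ('r, 'h) hopf \<Rightarrow> (('r \<times> 'r) set \<Rightarrow> 'b) \<Rightarrow> ('b, 'k) ring_scheme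
    \<Rightarrow> 'b set \<Rightarrow> ('b \<Rightarrow> (('b \<times> 'h) \<Rightarrow>\<^sub>0 int) set) \<Rightarrow> ('b \<Rightarrow> 'b) \<Rightarrow> bool" where
  "cyclic_generic_action n R H \<kappa> L B \<rho> \<tau> \<longleftrightarrow>
     (let K = frac_field R
      in \<exists>\<chi> :: nat \<Rightarrow> 'h \<Rightarrow> ('r \<times> 'r) set.
         (\<forall>i<n. \<chi> i \<in> ring_hom H K \<and> (\<forall>r\<in>carrier R. \<chi> i (scalar H r) = to_frac R r)) \<and>
         (\<forall>i<n. \<forall>j<n. \<forall>h\<in>carrier H.
            \<chi> ((i + j) mod n) h = tensor_lift K (\<lambda>a b. \<chi> i a \<otimes>\<^bsub>K\<^esub> \<chi> j b) (comult H h)) \<and>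
         bij_betw (\<lambda>U. \<lambda>i\<in>{..<n}. tensor_lift K (\<lambda>c h. c \<otimes>\<^bsub>K\<^esub> \<chi> i h) U)
           (carrier (tensor R (to_frac R) K (scalar H) H)) (\<Pi>\<^sub>E i\<in>{..<n}. carrier K) \<and>
         (\<forall>i<n. \<forall>b\<in>B. (\<tau> ^^ i) b = tensor_lift L (\<lambda>c h. c \<otimes>\<^bsub>L\<^esub> \<kappa> (\<chi> i h)) (\<rho> b)))"

text \<open>The map on fraction fields induced by \<open>\<phi>\<close>.\<close>

definition frac_map :: "('a \<Rightarrow> 'b) \<Rightarrow> ('b, 'n) ring_scheme \<Rightarrow> ('a \<times> 'a) set \<Rightarrow> ('b \<times> 'b) set" where
  "frac_map \<phi> B U = (\<Union>(a, s)\<in>U. quot B (\<phi> a) (\<phi> s))"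


section \<open>Witt vectors of length two\<close>

text \<open>
  The integer \<open>(p choose k) div p\<close> replaces the formal expression \<open>p\<^sup>-\<^sup>1 (p choose k)\<close>, the division
  being exact.
\<close>

definition witt_carry :: "nat \<Rightarrow> ('a, 'm) ring_scheme \<Rightarrow> 'a \<Rightarrow> 'a \<Rightarrow> 'a" where
  "witt_carry p S x y =
     (\<Oplus>\<^bsub>S\<^esub>k\<in>{1..p - 1}. add_pow S ((p choose k) div p) (x [^]\<^bsub>S\<^esub> k \<otimes>\<^bsub>S\<^esub> y [^]\<^bsub>S\<^esub> (p - k)))"

definition witt_add :: "nat \<Rightarrow> ('a, 'm) ring_scheme \<Rightarrow> 'a \<times> 'a \<Rightarrow> 'a \<times> 'a \<Rightarrow> 'a \<times> 'a" where
  "witt_add p S x y =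
     (fst x \<oplus>\<^bsub>S\<^esub> fst y, (snd x \<oplus>\<^bsub>S\<^esub> snd y) \<ominus>\<^bsub>S\<^esub> witt_carry p S (fst x) (fst y))"

text \<open>For odd \<open>p\<close>, negation of Witt vectors is componentwise.\<close>

definition witt_sub :: "nat \<Rightarrow> ('a, 'm) ring_scheme \<Rightarrow> 'a \<times> 'a \<Rightarrow> 'a \<times> 'a \<Rightarrow> 'a \<times> 'a" where
  "witt_sub p S x y =
     (fst x \<ominus>\<^bsub>S\<^esub> fst y, (snd x \<ominus>\<^bsub>S\<^esub> snd y) \<ominus>\<^bsub>S\<^esub> witt_carry p S (fst x) (\<ominus>\<^bsub>S\<^esub> fst y))"

text \<open>
  \<open>B\<close> is the quotient of the polynomial ring \<open>S[X1, X2]\<close> by the two components of the equation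
  \<open>(X1\<^sup>p, X2\<^sup>p) - (X1, X2) = (c1, c2)\<close>, the variables being mapped to \<open>T1\<close>, \<open>T2\<close>; and \<open>\<sigma>\<close> is
  translation by the Witt vector \<open>(1, 0)\<close>, a generator of \<open>W\<^sub>2(\<int>/p\<int>) = \<int>/p\<^sup>2\<int>\<close>.
\<close>

definition given_by_witt_equation ::
  "nat \<Rightarrow> ('a, 'm) ring_scheme \<Rightarrow> ('a \<Rightarrow> 'b) \<Rightarrow> ('b, 'n) ring_scheme \<Rightarrow> ('b \<Rightarrow> 'b) \<Rightarrow> 'b \<times> 'b \<Rightarrow> 'a \<times> 'a
    \<Rightarrow> bool" where
  "given_by_witt_equation p S \<psi> B \<sigma> T c \<longleftrightarrow>
     (let P1 = UP S; P2 = UP P1;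
          const = (\<lambda>a. monom P2 (monom P1 a 0) 0);
          X1 = monom P2 (monom P1 \<one>\<^bsub>S\<^esub> 1) 0;
          X2 = monom P2 \<one>\<^bsub>P1\<^esub> 1;
          w = witt_sub p P2 (X1 [^]\<^bsub>P2\<^esub> p, X2 [^]\<^bsub>P2\<^esub> p) (X1, X2);
          ev = eval P1 B (eval S B \<psi> (fst T)) (snd T)
      in fst T \<in> carrier B \<and> snd T \<in> carrier B \<and>
         ev ` carrier P2 = carrier B \<and>
         a_kernel P2 B ev =
           Idl\<^bsub>P2\<^esub> {fst w \<ominus>\<^bsub>P2\<^esub> const (fst c), snd w \<ominus>\<^bsub>P2\<^esub> const (snd c)} \<and>
         (\<sigma> (fst T), \<sigma> (snd T)) = witt_add p B T (\<one>\<^bsub>B\<^esub>, \<zero>\<^bsub>B\<^esub>))"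


section \<open>Integral models\<close>

text \<open>
  \<open>X = Spf A\<close>, and \<open>L\<close> is the ring of the generic cover, an algebra via \<open>\<psi>\<close> over the generic fibre
  of \<open>A\<close>.  The integral model is the tower \<open>A \<rightarrow> B1 \<rightarrow> B\<close> of subrings of \<open>L\<close>; they are torsors extending
  the torsors whose rings are the invariants of \<open>\<sigma>\<^sup>p\<close> in \<open>L\<close> (with group \<open>\<int>/p\<int>\<close> generated
  by \<open>\<sigma>\<close>), respectively \<open>L\<close> (with group generated by \<open>\<sigma>\<^sup>p\<close>).
\<close>

definition invariants :: "('b, 'n) ring_scheme \<Rightarrow> ('b \<Rightarrow> 'b) \<Rightarrow> 'b set" where
  "invariants L \<tau> = {b \<in> carrier L. \<tau> b = b}"

definition generic_part :: "('b, 'n) ring_scheme \<Rightarrow> 'b \<Rightarrow> 'b set \<Rightarrow> 'b set" where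
  "generic_part L t B = {x \<in> carrier L. \<exists>n::nat. t [^]\<^bsub>L\<^esub> n \<otimes>\<^bsub>L\<^esub> x \<in> B}"

definition integral_model ::
  "nat \<Rightarrow> ('r, 'm) ring_scheme \<Rightarrow> 'r \<Rightarrow> ('r \<Rightarrow> 'a) \<Rightarrow> ('a, 'n) ring_scheme \<Rightarrow> (('a \<times> 'a) set \<Rightarrow> 'b)
    \<Rightarrow> ('b, 'k) ring_scheme \<Rightarrow> ('b \<Rightarrow> 'b)
    \<Rightarrow> ('r, 'g) hopf \<Rightarrow> 'b set \<Rightarrow> ('b \<Rightarrow> (('b \<times> 'g) \<Rightarrow>\<^sub>0 int) set)
    \<Rightarrow> ('r, 'h) hopf \<Rightarrow> 'b set \<Rightarrow> ('b \<Rightarrow> (('b \<times> 'h) \<Rightarrow>\<^sub>0 int) set) \<Rightarrow> bool" where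
  "integral_model p R \<pi> \<phi> A \<psi> L \<sigma> G1 B1 \<rho>1 G2 B \<rho>2 \<longleftrightarrow>
     (let \<alpha> = \<psi> \<circ> to_frac A;
          \<kappa> = \<psi> \<circ> frac_map \<phi> A;
          t = \<alpha> (\<phi> \<pi>)
      in subring B1 L \<and> subring B L \<and> B1 \<subseteq> B \<and>
         normal_ring (L\<lparr>carrier := B1\<rparr>) \<and> normal_ring (L\<lparr>carrier := B\<rparr>) \<and>
         generic_part L t B1 = invariants L (\<sigma> ^^ p) \<and>
         generic_part L t B = carrier L \<and>
         finite_flat_group_scheme R G1 p \<and>
         torsor R G1 \<phi> A \<alpha> (L\<lparr>carrier := B1\<rparr>) \<rho>1 \<and>
         cyclic_generic_action p R G1 \<kappa> L B1 \<rho>1 \<sigma> \<and>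
         finite_flat_group_scheme R G2 p \<and>
         torsor R G2 (\<alpha> \<circ> \<phi>) (L\<lparr>carrier := B1\<rparr>) id (L\<lparr>carrier := B\<rparr>) \<rho>2 \<and>
         cyclic_generic_action p R G2 \<kappa> L B \<rho>2 (\<sigma> ^^ p))"

end

theory Submission
  imports Defs
begin

text \<open>
  Let \<open>t\<close> be the image of \<open>\<pi>\<close>, and let \<open>V\<close> be the localization of the model at a prime above \<open>\<eta>\<close>.  As the
  ramification index is 1, \<open>t\<close> is prime in \<open>V\<close>.  Since \<open>a1\<close> is not a \<open>p\<close>-th power modulo \<open>t\<close>, the conditions
  on \<open>m1\<close> and \<open>m2\<close> force \<open>V = A[Z1][Z2]\<close> (with \<open>A\<close> localized at \<open>\<eta>\<close>) for \<open>Z1 = t\<^sup>p\<^sup>m T1\<close> and \<open>Z2 = t\<^sup>n T2\<close>, where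
  \<open>m1 = p m\<close> and \<open>n = m (p (p - 1) + 1)\<close>.  The carry of Witt addition makes \<open>\<sigma>\<close> move \<open>Z2\<close> by
  \<open>- t\<^sup>m Z1\<^sup>p\<^sup>-\<^sup>1\<close> to first order, while \<open>\<sigma>\<^sup>p\<close> moves it by \<open>t\<^sup>n\<close>.  Hence every \<open>x\<close> in \<open>V\<close> has a \<open>\<delta>\<close> in \<open>V\<close> such that
  \<open>\<sigma> x - x = - t\<^sup>m Z1\<^sup>p\<^sup>-\<^sup>1 \<delta>\<close> and \<open>\<sigma>\<^sup>p x - x = t\<^sup>n \<delta>\<close> to first order.

  If the model were a torsor under \<open>Spec G\<close>, then \<open>\<sigma>\<close>, \<open>\<sigma>\<^sup>p\<close> and the identity would give points
  \<open>\<chi>\<^sub>1\<close>, \<open>\<chi>\<^sub>p\<close>, \<open>\<chi>\<^sub>0\<close> of \<open>G\<close> in the generic cover.  Choose \<open>h\<close> in \<open>G\<close> whose \<open>\<delta>\<close> is nonzero modulo \<open>t\<close> and put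
  \<open>u = \<chi>\<^sub>1 h - \<chi>\<^sub>0 h\<close>, \<open>v = \<chi>\<^sub>p h - \<chi>\<^sub>0 h\<close>.  As \<open>G\<close> is finite over \<open>R\<close>, all monomials in \<open>u\<close> and \<open>v\<close> lie in one finitely
  generated \<open>R\<close>-module, so \<open>u\<close> and \<open>v\<close> satisfy a homogeneous equation over \<open>R\<close>.  Its leading terms make
  \<open>Z1\<^sup>p\<^sup>-\<^sup>1\<close>, and so the residue class of \<open>a1\<close>, algebraic over the perfect field \<open>k\<close>; but then \<open>a1\<close> would be a
  \<open>p\<close>-th power modulo \<open>t\<close>.
\<close>


section \<open>Rings of prime characteristic\<close>

text \<open>The obstacle is that nothing is known beforehand about the generic fibre of an arbitrary
  \<open>G\<close>: its points need not be rational over the base, so they can only be compared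
  inside the ring of the generic cover. Two scales make this sufficient. Since
  \<open>n = m1 * (p - 1) + m\<close>, multiplying \<open>T2\<close> by \<open>t^n\<close> turns the
  top term \<open>T1^(p - 1)\<close> of the carry into \<open>t^m Z1^(p - 1)\<close>, and every
  other term has higher order. A homogeneous relation is the right kind to use: its leading part
  contains the unknown common factor \<open>\<delta>\<close> only through one power, which cancels,
  and a polynomial in \<open>Z1^(p - 1)\<close> alone remains.

  The bound on \<open>m2\<close> ensures that \<open>\<pi>^m2 a2\<close> has no larger pole than the
  carry of \<open>T1^p\<close> and \<open>- T1\<close>, whose pole has order
  \<open>m1 (p (p - 1) + 1)\<close>. After scaling, the right-hand side of the equation for
  \<open>T2\<close> is congruent to \<open>c0 - a1^(p - 1) Z1\<close> with \<open>c0\<close> in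
  \<open>A\<close>. This is nonzero modulo \<open>t\<close>, because its \<open>p\<close>-th power
  would otherwise exhibit \<open>a1\<close> as a quotient of \<open>p\<close>-th powers. Comparing
  pole orders then shows that \<open>p\<close> divides \<open>m1\<close>.\<close>

lemma (in cring) binomial_theorem:
  assumes x: "x \<in> carrier R" and y: "y \<in> carrier R"
  shows "(x \<oplus> y) [^] (n::nat) = (\<Oplus>k\<in>{..n}. add_pow R (n choose k) (x [^] k \<otimes> y [^] (n - k)))"
proof (induction n)
  case 0
  show ?case using x y by simp
next
  case (Suc n)
  define f where "f k = x [^] k \<otimes> y [^] (Suc n - k)" for k
  have fc: "f k \<in> carrier R" for k using x y by (simp add: f_def)
  let ?S = "\<Oplus>k\<in>{..n}. add_pow R (n choose k) (x [^] k \<otimes> y [^] (n - k))"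
  have sc: "add_pow R m (x [^] k \<otimes> y [^] j) \<in> carrier R" for m k j :: nat
    using x y by simp
  have 1: "?S \<otimes> x = (\<Oplus>k\<in>{..n}. add_pow R (n choose k) (f (Suc k)))"
  proof -
    have "?S \<otimes> x = (\<Oplus>k\<in>{..n}. add_pow R (n choose k) (x [^] k \<otimes> y [^] (n - k)) \<otimes> x)"
      by (rule finsum_ldistr) (use x sc in auto)
    also have "\<dots> = (\<Oplus>k\<in>{..n}. add_pow R (n choose k) (f (Suc k)))"
      by (rule finsum_cong') (use x y in \<open>auto simp: f_def add_pow_ldistr add_pow_rdistr m_ac\<close>)
    finally show ?thesis .
  qed
  have 2: "?S \<otimes> y = (\<Oplus>k\<in>{..n}. add_pow R (n choose k) (f k))"
  proof -
    have "?S \<otimes> y = (\<Oplus>k\<in>{..n}. add_pow R (n choose k) (x [^] k \<otimes> y [^] (n - k)) \<otimes> y)"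
      by (rule finsum_ldistr) (use y sc in auto)
    also have "\<dots> = (\<Oplus>k\<in>{..n}. add_pow R (n choose k) (f k))"
      by (rule finsum_cong') (use x y in \<open>auto simp: f_def add_pow_ldistr add_pow_rdistr m_ac Suc_diff_le\<close>)
    finally show ?thesis .
  qed
  have 3: "(\<Oplus>k\<in>{..n}. add_pow R (n choose k) (f k)) = (\<Oplus>k\<in>{..Suc n}. add_pow R (n choose k) (f k))"
    using fc by (subst finsum_Suc) (auto simp: Pi_def binomial_eq_0)
  have 4: "\<dots> = (\<Oplus>k\<in>{..n}. add_pow R (n choose (Suc k)) (f (Suc k))) \<oplus> f 0"
    using fc by (subst finsum_Suc2) (auto simp: Pi_def)
  have 5: "(\<Oplus>k\<in>{..Suc n}. add_pow R (Suc n choose k) (f k))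
      = (\<Oplus>k\<in>{..n}. add_pow R (Suc n choose (Suc k)) (f (Suc k))) \<oplus> f 0"
    using fc by (subst finsum_Suc2) (auto simp: Pi_def)
  have 6: "(\<Oplus>k\<in>{..n}. add_pow R (Suc n choose (Suc k)) (f (Suc k))) =
      (\<Oplus>k\<in>{..n}. add_pow R (n choose k) (f (Suc k))) \<oplus> (\<Oplus>k\<in>{..n}. add_pow R (n choose (Suc k)) (f (Suc k)))"
    using fc by (subst finsum_addf[symmetric]) (auto simp: Pi_def add.nat_pow_mult intro!: finsum_cong')
  have "(x \<oplus> y) [^] Suc n = ?S \<otimes> (x \<oplus> y)"
    using Suc by simp
  also have "\<dots> = ?S \<otimes> x \<oplus> ?S \<otimes> y"
    by (rule r_distr) (use x y sc in \<open>auto intro!: finsum_closed\<close>)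
  also have "\<dots> = (\<Oplus>k\<in>{..Suc n}. add_pow R (Suc n choose k) (f k))"
    unfolding 1 2 3 4 5 6
    by (rule a_assoc[symmetric]) (use fc in \<open>auto intro!: finsum_closed\<close>)
  finally show ?case by (simp add: f_def)
qed

text \<open>Stated without domain hypotheses because it is applied to the ring \<open>L\<close> of
  the generic cover, which is not known to be a domain.\<close>

locale char_p_ring = cring +
  fixes p :: nat
  assumes prime_p: "Factorial_Ring.prime p" and char_p: "add_pow R p \<one> = \<zero>"
begin

lemma p_pos: "p > 0" "p \<noteq> 0"
  using prime_p prime_gt_0_nat by auto

lemma add_pow_char: "x \<in> carrier R \<Longrightarrow> add_pow R p x = \<zero>"
  using add_pow_ldistr[of \<one> x p] char_p by simp

lemma add_pow_char_dvd: assumes "p dvd n" "x \<in> carrier R" shows "add_pow R n x = \<zero>"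
proof -
  obtain k where "n = p * k" using assms(1) by blast
  then show ?thesis using add.nat_pow_pow[OF assms(2), of p k] assms(2) by (simp add: add_pow_char mult.commute)
qed

lemma frob_add:
  assumes x: "x \<in> carrier R" and y: "y \<in> carrier R"
  shows "(x \<oplus> y) [^] p = x [^] p \<oplus> y [^] p"
proof -
  let ?g = "\<lambda>k. add_pow R (p choose k) (x [^] k \<otimes> y [^] (p - k))"
  have set: "{..p} = insert 0 (insert p {1..<p})" using p_pos by auto
  have z: "(\<Oplus>k\<in>{1..<p}. ?g k) = \<zero>"
  proof -
    have "(\<Oplus>k\<in>{1..<p}. ?g k) = (\<Oplus>k\<in>{1..<p}. \<zero>)"
      by (rule finsum_cong')
        (use x y prime_p in \<open>auto intro!: add_pow_char_dvd dvd_choose_prime\<close>)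
    then show ?thesis by simp
  qed
  have "(x \<oplus> y) [^] p = (\<Oplus>k\<in>{..p}. ?g k)"
    by (rule binomial_theorem[OF x y])
  also have "\<dots> = ?g 0 \<oplus> (?g p \<oplus> (\<Oplus>k\<in>{1..<p}. ?g k))"
    unfolding set using x y p_pos by (subst finsum_insert; (subst finsum_insert)?; force)
  also have "\<dots> = x [^] p \<oplus> y [^] p"
    unfolding z using x y by (simp add: a_comm)
  finally show ?thesis .
qed

lemma frob_hom: "(\<lambda>x. x [^] p) \<in> ring_hom R R"
  by (rule ring_hom_memI) (auto simp: frob_add nat_pow_distrib)

lemma frob_cring: "ring_hom_cring R R (\<lambda>x. x [^] p)"
  by unfold_locales (rule frob_hom)

lemma frob_minus: "x \<in> carrier R \<Longrightarrow> (\<ominus> x) [^] p = \<ominus> (x [^] p)"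
  using ring_hom_cring.hom_a_inv[OF frob_cring] .

lemma frob_diff: "x \<in> carrier R \<Longrightarrow> y \<in> carrier R \<Longrightarrow> (x \<ominus> y) [^] p = x [^] p \<ominus> y [^] p"
  by (simp add: minus_eq frob_add frob_minus)

lemma frob_finsum: "f \<in> A \<rightarrow> carrier R \<Longrightarrow> (\<Oplus>i\<in>A. f i) [^] p = (\<Oplus>i\<in>A. f i [^] p)"
  using ring_hom_cring.hom_finsum[OF frob_cring, of f A] by (simp add: comp_def)

lemma frob_nat: "(add_pow R n \<one>) [^] p = add_pow R (n::nat) \<one>"
  by (induction n) (auto simp: frob_add nat_pow_zero p_pos)

text \<open>An integer prime to \<open>p\<close> is invertible modulo \<open>p\<close> by Bezout, so
  multiplication by it is injective even in the presence of zero divisors.\<close>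

lemma nat_unit:
  assumes "0 < n" "n < p" "x \<in> carrier R" "add_pow R n x = \<zero>"
  shows "x = \<zero>"
proof -
  have "coprime n p"
    using assms(1,2) prime_p by (metis coprime_commute prime_imp_coprime nat_dvd_not_less)
  then obtain u v where "n * u = p * v + 1"
    using assms(1) bezout_nat[of n p] by (auto simp: coprime_iff_gcd_eq_1)
  then have "add_pow R (n * u) x = add_pow R (p * v) x \<oplus> x"
    using assms(3) by simp
  moreover have "add_pow R (n * u) x = \<zero>"
    using add.nat_pow_pow[OF assms(3), of u n] assms(3,4) add.nat_pow_pow[OF assms(3), of n u] by (simp add: mult.commute)
  moreover have "add_pow R (p * v) x = \<zero>" using assms(3) by (intro add_pow_char_dvd) auto
  ultimately show ?thesis using assms(3) by simp
qed

end


section \<open>Tensor products\<close>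

text \<open>Neither factor has to be a ring. In the flatness criterion the first factor is an ideal,
  for which only the additive group and the action of \<open>S\<close> make sense.\<close>

locale tensor_product =
  fixes S :: "('s, 'm) ring_scheme" and f :: "'s \<Rightarrow> 'a" and M :: "('a, 'n) ring_scheme"
    and g :: "'s \<Rightarrow> 'b" and N :: "('b, 'k) ring_scheme"
  assumes M: "abelian_group M" and N: "abelian_group N"
    and M_act: "\<And>s x. s \<in> carrier S \<Longrightarrow> x \<in> carrier M \<Longrightarrow> f s \<otimes>\<^bsub>M\<^esub> x \<in> carrier M"
    and N_act: "\<And>s y. s \<in> carrier S \<Longrightarrow> y \<in> carrier N \<Longrightarrow> g s \<otimes>\<^bsub>N\<^esub> y \<in> carrier N"
begin

abbreviation "T \<equiv> tensor S f M g N"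
abbreviation "FA \<equiv> free_Abelian_group (carrier M \<times> carrier N)"
abbreviation "null \<equiv> tensor_null S f M g N"
abbreviation "rel \<equiv> tensor_relations S f M g N"
abbreviation "cls \<equiv> tensor_class S f M g N"
abbreviation "pr \<equiv> Defs.pure S f M g N"

sublocale M: abelian_group M by (rule M)
sublocale N: abelian_group N by (rule N)
sublocale FA: comm_group FA by (rule abelian_free_Abelian_group)

lemma keys_diff_subset: "Poly_Mapping.keys a \<subseteq> D \<Longrightarrow> Poly_Mapping.keys b \<subseteq> D \<Longrightarrow> Poly_Mapping.keys (a - b) \<subseteq> D"
  using keys_diff[of a b] by blast

lemma keys_add_subset: "Poly_Mapping.keys a \<subseteq> D \<Longrightarrow> Poly_Mapping.keys b \<subseteq> D \<Longrightarrow> Poly_Mapping.keys (a + b) \<subseteq> D"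
  using keys_add[of a b] by blast

lemma FA_induct [consumes 1, case_names zero diff of]:
  assumes "Poly_Mapping.keys u \<subseteq> carrier M \<times> carrier N" "P 0"
    "\<And>u v. Poly_Mapping.keys u \<subseteq> carrier M \<times> carrier N \<Longrightarrow> Poly_Mapping.keys v \<subseteq> carrier M \<times> carrier N \<Longrightarrow> P u \<Longrightarrow> P v \<Longrightarrow> P (u - v)"
    "\<And>x y. x \<in> carrier M \<Longrightarrow> y \<in> carrier N \<Longrightarrow> P (frag_of (x, y))"
  shows "P u"
  by (rule free_Abelian_group_induct[OF assms(1)]) (use assms(2-4) in auto)

lemma rel_subset: "rel \<subseteq> carrier FA"
proof
  fix r assume "r \<in> rel"
  then show "r \<in> carrier FA"
    unfolding tensor_relations_def carrier_free_Abelian_group_iff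
    by (elim UnE CollectE exE conjE; hypsubst; intro keys_diff_subset; simp add: M_act N_act)
qed

lemma null_subgroup: "subgroup null FA"
  unfolding tensor_null_def by (rule FA.generate_is_subgroup[OF rel_subset])

lemma null_normal: "null \<lhd> FA"
  by (rule FA.subgroup_imp_normal[OF null_subgroup])

lemma null_diff: "u \<in> null \<Longrightarrow> v \<in> null \<Longrightarrow> u - v \<in> null"
  using subgroup.m_closed[OF null_subgroup, of u "- v"] subgroup.m_inv_closed[OF null_subgroup, of v]
    subgroup.mem_carrier[OF null_subgroup, of v]
  by simp

lemma null_zero: "0 \<in> null"
  using subgroup.one_closed[OF null_subgroup] by simp

lemma null_keys: "u \<in> null \<Longrightarrow> Poly_Mapping.keys u \<subseteq> carrier M \<times> carrier N"
  using subgroup.mem_carrier[OF null_subgroup, of u] by simp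

lemma null_add: "u \<in> null \<Longrightarrow> v \<in> null \<Longrightarrow> u + v \<in> null"
  using subgroup.m_closed[OF null_subgroup, of u v] by simp

lemma cls_eq_set: "cls w = {n + w | n. n \<in> null}"
  unfolding tensor_class_def r_coset_def by auto

lemma cls_eqI: assumes "w - w' \<in> null" shows "cls w = cls w'"
proof -
  have "w' - w \<in> null" using null_diff[OF null_zero assms] by simp
  then show ?thesis
    using assms unfolding cls_eq_set
    by (auto intro: exI[of _ "_ + (w - w')"] exI[of _ "_ + (w' - w)"] null_add)
qed

lemma cls_self: "w \<in> cls w"
  unfolding cls_eq_set using null_zero by force

lemma cls_mem: "v \<in> cls w \<Longrightarrow> v - w \<in> null"
  unfolding cls_eq_set by auto

lemma carrier_T: "carrier T = cls ` carrier FA"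
  unfolding tensor_def RCOSETS_def tensor_class_def by auto

lemma T_add_monoid: "add_monoid T = FA Mod null"
  by (simp add: tensor_def FactGroup_def)

lemma add_cls:
  "Poly_Mapping.keys u \<subseteq> carrier M \<times> carrier N \<Longrightarrow> Poly_Mapping.keys v \<subseteq> carrier M \<times> carrier N
    \<Longrightarrow> cls u \<oplus>\<^bsub>T\<^esub> cls v = cls (u + v)"
  using normal.rcos_sum[OF null_normal, of u v]
  by (simp add: tensor_def tensor_class_def)

lemma zero_cls: "\<zero>\<^bsub>T\<^esub> = cls 0"
  by (simp add: tensor_def cls_eq_set)

lemma T_abelian: "abelian_group T"
proof (rule comm_group_abelian_groupI)
  show "comm_group (add_monoid T)"
    unfolding T_add_monoid by (rule FA.abelian_FactGroup[OF null_subgroup])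
qed

sublocale T: abelian_group T by (rule T_abelian)

lemma cls_closed: "Poly_Mapping.keys u \<subseteq> carrier M \<times> carrier N \<Longrightarrow> cls u \<in> carrier T"
  unfolding carrier_T by simp

lemma minus_cls:
  assumes "Poly_Mapping.keys u \<subseteq> carrier M \<times> carrier N" "Poly_Mapping.keys v \<subseteq> carrier M \<times> carrier N"
  shows "cls u \<ominus>\<^bsub>T\<^esub> cls v = cls (u - v)"
proof -
  have "cls (u - v) \<oplus>\<^bsub>T\<^esub> cls v = cls u"
    using add_cls[OF keys_diff_subset[OF assms] assms(2)] by simp
  then show ?thesis
    using cls_closed[OF assms(1)] cls_closed[OF assms(2)] cls_closed[OF keys_diff_subset[OF assms]]
    by (metis T.add.inv_solve_right' a_minus_def)
qed

lemma pr_closed [simp]: "x \<in> carrier M \<Longrightarrow> y \<in> carrier N \<Longrightarrow> pr x y \<in> carrier T"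
  unfolding pure_def by (rule cls_closed) simp

lemma T_cases:
  assumes "U \<in> carrier T"
  obtains u where "Poly_Mapping.keys u \<subseteq> carrier M \<times> carrier N" "U = cls u"
  using assms unfolding carrier_T by auto

text \<open>Closure under differences covers sums and negatives at once, so a property has to be
  checked on pure tensors and for a single operation.\<close>

lemma T_induct [consumes 1, case_names pr minus]:
  assumes U: "U \<in> carrier T"
    and pr: "\<And>x y. x \<in> carrier M \<Longrightarrow> y \<in> carrier N \<Longrightarrow> P (pr x y)"
    and minus: "\<And>U V. U \<in> carrier T \<Longrightarrow> V \<in> carrier T \<Longrightarrow> P U \<Longrightarrow> P V \<Longrightarrow> P (U \<ominus>\<^bsub>T\<^esub> V)"
  shows "P U"
proof -
  obtain u where u: "Poly_Mapping.keys u \<subseteq> carrier M \<times> carrier N" "U = cls u"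
    using U by (rule T_cases)
  have "P (cls u)" using u(1)
  proof (induction u rule: FA_induct)
    case zero
    \<comment> \<open>Zero is the difference of two equal pure tensors and needs no case of its
      own.\<close>
    have "P (pr \<zero>\<^bsub>M\<^esub> \<zero>\<^bsub>N\<^esub> \<ominus>\<^bsub>T\<^esub> pr \<zero>\<^bsub>M\<^esub> \<zero>\<^bsub>N\<^esub>)" by (intro minus pr) simp_all
    then show ?case by (simp add: zero_cls[symmetric] a_minus_def T.r_neg)
  next
    case (diff x y)
    then show ?case using minus[of "cls x" "cls y"] by (simp add: minus_cls cls_closed)
  next
    case (of x y)
    then show ?case using pr[of x y] by (simp add: pure_def)
  qed
  then show ?thesis using u by simp
qed

lemma rel_null: "r \<in> rel \<Longrightarrow> r \<in> null"
  unfolding tensor_null_def by (rule generate.incl)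

lemma pr_add_left:
  assumes "x \<in> carrier M" "x' \<in> carrier M" "y \<in> carrier N"
  shows "pr (x \<oplus>\<^bsub>M\<^esub> x') y = pr x y \<oplus>\<^bsub>T\<^esub> pr x' y"
proof -
  have "frag_of (x \<oplus>\<^bsub>M\<^esub> x', y) - frag_of (x, y) - frag_of (x', y) \<in> null"
    by (rule rel_null) (use assms in \<open>auto simp: tensor_relations_def\<close>)
  then show ?thesis unfolding pure_def using assms
    by (subst add_cls) (auto intro!: cls_eqI simp: diff_diff_eq)
qed

lemma pr_add_right:
  assumes "x \<in> carrier M" "y \<in> carrier N" "y' \<in> carrier N"
  shows "pr x (y \<oplus>\<^bsub>N\<^esub> y') = pr x y \<oplus>\<^bsub>T\<^esub> pr x y'"
proof -
  have "frag_of (x, y \<oplus>\<^bsub>N\<^esub> y') - frag_of (x, y) - frag_of (x, y') \<in> null"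
    by (rule rel_null) (use assms in \<open>auto simp: tensor_relations_def\<close>)
  then show ?thesis unfolding pure_def using assms
    by (subst add_cls) (auto intro!: cls_eqI simp: diff_diff_eq)
qed

lemma pr_balanced:
  assumes "s \<in> carrier S" "x \<in> carrier M" "y \<in> carrier N"
  shows "pr (f s \<otimes>\<^bsub>M\<^esub> x) y = pr x (g s \<otimes>\<^bsub>N\<^esub> y)"
  unfolding pure_def
  by (rule cls_eqI, rule rel_null) (use assms in \<open>auto simp: tensor_relations_def\<close>)

end

section \<open>Additive maps out of a tensor product\<close>

locale tensor_balanced = tensor_product S f M g N + C: abelian_group C
  for S :: "('s, 'm) ring_scheme" and f :: "'s \<Rightarrow> 'a" and M :: "('a, 'n) ring_scheme"
    and g :: "'s \<Rightarrow> 'b" and N :: "('b, 'k) ring_scheme" and C :: "('c, 'l) ring_scheme" +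
  fixes \<beta> :: "'a \<Rightarrow> 'b \<Rightarrow> 'c"
  assumes closed: "\<And>x y. x \<in> carrier M \<Longrightarrow> y \<in> carrier N \<Longrightarrow> \<beta> x y \<in> carrier C"
    and add_left: "\<And>x x' y. x \<in> carrier M \<Longrightarrow> x' \<in> carrier M \<Longrightarrow> y \<in> carrier N
      \<Longrightarrow> \<beta> (x \<oplus>\<^bsub>M\<^esub> x') y = \<beta> x y \<oplus>\<^bsub>C\<^esub> \<beta> x' y"
    and add_right: "\<And>x y y'. x \<in> carrier M \<Longrightarrow> y \<in> carrier N \<Longrightarrow> y' \<in> carrier N
      \<Longrightarrow> \<beta> x (y \<oplus>\<^bsub>N\<^esub> y') = \<beta> x y \<oplus>\<^bsub>C\<^esub> \<beta> x y'"
    and balanced: "\<And>s x y. s \<in> carrier S \<Longrightarrow> x \<in> carrier M \<Longrightarrow> y \<in> carrier N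
      \<Longrightarrow> \<beta> (f s \<otimes>\<^bsub>M\<^esub> x) y = \<beta> x (g s \<otimes>\<^bsub>N\<^esub> y)"
begin

text \<open>The value that \<open>tensor_lift\<close> computes once a representative has been
  chosen.\<close>

definition frag_lift :: "(('a \<times> 'b) \<Rightarrow>\<^sub>0 int) \<Rightarrow> 'c" where
  "frag_lift w = (\<Oplus>\<^bsub>C\<^esub>k\<in>Poly_Mapping.keys w. add_pow C (Poly_Mapping.lookup w k) (\<beta> (fst k) (snd k)))"

lemma add_pow_zero_int: "add_pow C (0::int) z = \<zero>\<^bsub>C\<^esub>"
  by (simp add: add_pow_def int_pow_def nat_pow_def)

lemma frag_lift_eq:
  assumes "finite F" "Poly_Mapping.keys w \<subseteq> F" "F \<subseteq> carrier M \<times> carrier N"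
  shows "frag_lift w = (\<Oplus>\<^bsub>C\<^esub>k\<in>F. add_pow C (Poly_Mapping.lookup w k) (\<beta> (fst k) (snd k)))"
  unfolding frag_lift_def
  by (rule C.add.finprod_mono_neutral_cong_left)
    (use assms in \<open>auto simp: in_keys_iff add_pow_zero_int intro!: C.add.int_pow_closed closed\<close>)

lemma frag_lift_closed:
  "Poly_Mapping.keys w \<subseteq> carrier M \<times> carrier N \<Longrightarrow> frag_lift w \<in> carrier C"
  unfolding frag_lift_def by (intro C.finsum_closed) (auto intro!: C.add.int_pow_closed closed)

lemma frag_lift_add:
  assumes "Poly_Mapping.keys u \<subseteq> carrier M \<times> carrier N" "Poly_Mapping.keys v \<subseteq> carrier M \<times> carrier N"
  shows "frag_lift (u + v) = frag_lift u \<oplus>\<^bsub>C\<^esub> frag_lift v"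
proof -
  let ?F = "Poly_Mapping.keys u \<union> Poly_Mapping.keys v"
  have F: "finite ?F" "?F \<subseteq> carrier M \<times> carrier N" using assms by auto
  have c: "\<beta> (fst k) (snd k) \<in> carrier C" if "k \<in> ?F" for k using F(2) that by (auto intro!: closed)
  let ?t = "\<lambda>w k. add_pow C (Poly_Mapping.lookup w k) (\<beta> (fst k) (snd k))"
  have "frag_lift (u + v) = (\<Oplus>\<^bsub>C\<^esub>k\<in>?F. ?t (u + v) k)"
    by (rule frag_lift_eq[OF F(1) keys_add F(2)])
  also have "\<dots> = (\<Oplus>\<^bsub>C\<^esub>k\<in>?F. ?t u k \<oplus>\<^bsub>C\<^esub> ?t v k)"
    by (rule C.finsum_cong') (use c in \<open>auto simp: lookup_add C.add.int_pow_mult C.add.int_pow_closed\<close>)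
  also have "\<dots> = (\<Oplus>\<^bsub>C\<^esub>k\<in>?F. ?t u k) \<oplus>\<^bsub>C\<^esub> (\<Oplus>\<^bsub>C\<^esub>k\<in>?F. ?t v k)"
    by (rule C.finsum_addf) (use c in \<open>auto simp: C.add.int_pow_closed\<close>)
  also have "\<dots> = frag_lift u \<oplus>\<^bsub>C\<^esub> frag_lift v"
    using frag_lift_eq[OF F(1) Un_upper1 F(2)] frag_lift_eq[OF F(1) Un_upper2 F(2)] by simp
  finally show ?thesis .
qed

lemma frag_lift_zero: "frag_lift 0 = \<zero>\<^bsub>C\<^esub>"
  by (simp add: frag_lift_def)

lemma frag_lift_diff:
  assumes "Poly_Mapping.keys u \<subseteq> carrier M \<times> carrier N" "Poly_Mapping.keys v \<subseteq> carrier M \<times> carrier N"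
  shows "frag_lift (u - v) = frag_lift u \<ominus>\<^bsub>C\<^esub> frag_lift v"
proof -
  have "frag_lift (u - v) \<oplus>\<^bsub>C\<^esub> frag_lift v = frag_lift u"
    using frag_lift_add[OF keys_diff_subset[OF assms] assms(2)] by simp
  then show ?thesis
    using frag_lift_closed[OF assms(1)] frag_lift_closed[OF assms(2)] frag_lift_closed[OF keys_diff_subset[OF assms]]
    by (metis C.add.inv_solve_right' a_minus_def)
qed

lemma frag_lift_of: "x \<in> carrier M \<Longrightarrow> y \<in> carrier N \<Longrightarrow> frag_lift (frag_of (x, y)) = \<beta> x y"
  using closed by (simp add: frag_lift_def)

lemma frag_lift_rel:
  assumes "r \<in> rel"
  shows "frag_lift r = \<zero>\<^bsub>C\<^esub>"
proof -
  have *: "z \<ominus>\<^bsub>C\<^esub> a \<ominus>\<^bsub>C\<^esub> b = \<zero>\<^bsub>C\<^esub>" if "z = a \<oplus>\<^bsub>C\<^esub> b" "a \<in> carrier C" "b \<in> carrier C" for z a b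
  proof -
    have "z \<ominus>\<^bsub>C\<^esub> a \<ominus>\<^bsub>C\<^esub> b = z \<oplus>\<^bsub>C\<^esub> (\<ominus>\<^bsub>C\<^esub> (a \<oplus>\<^bsub>C\<^esub> b))"
      using that by (simp add: a_minus_def C.minus_add C.a_assoc)
    then show ?thesis using that by (simp add: C.r_neg)
  qed
  have k: "Poly_Mapping.keys (frag_of (x, y)) \<subseteq> carrier M \<times> carrier N" if "x \<in> carrier M" "y \<in> carrier N" for x y
    using that by simp
  have d: "frag_lift (u - v - w) = frag_lift u \<ominus>\<^bsub>C\<^esub> frag_lift v \<ominus>\<^bsub>C\<^esub> frag_lift w"
    if "Poly_Mapping.keys u \<subseteq> carrier M \<times> carrier N" "Poly_Mapping.keys v \<subseteq> carrier M \<times> carrier N"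
      "Poly_Mapping.keys w \<subseteq> carrier M \<times> carrier N" for u v w
    using frag_lift_diff[OF keys_diff_subset[OF that(1,2)] that(3)] frag_lift_diff[OF that(1,2)] by simp
  show ?thesis
    using assms unfolding tensor_relations_def
  proof (elim UnE CollectE exE conjE)
    fix x x' y assume r: "r = frag_of (x \<oplus>\<^bsub>M\<^esub> x', y) - frag_of (x, y) - frag_of (x', y)"
      and c: "x \<in> carrier M" "x' \<in> carrier M" "y \<in> carrier N"
    show ?thesis unfolding r d[OF k[OF M.a_closed[OF c(1,2)] c(3)] k[OF c(1,3)] k[OF c(2,3)]]
      by (rule *) (use c in \<open>simp_all add: frag_lift_of add_left closed\<close>)
  next
    fix x y y' assume r: "r = frag_of (x, y \<oplus>\<^bsub>N\<^esub> y') - frag_of (x, y) - frag_of (x, y')"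
      and c: "x \<in> carrier M" "y \<in> carrier N" "y' \<in> carrier N"
    show ?thesis unfolding r d[OF k[OF c(1) N.a_closed[OF c(2,3)]] k[OF c(1,2)] k[OF c(1,3)]]
      by (rule *) (use c in \<open>simp_all add: frag_lift_of add_right closed\<close>)
  next
    fix s x y assume r: "r = frag_of (f s \<otimes>\<^bsub>M\<^esub> x, y) - frag_of (x, g s \<otimes>\<^bsub>N\<^esub> y)"
      and c: "s \<in> carrier S" "x \<in> carrier M" "y \<in> carrier N"
    show ?thesis unfolding r frag_lift_diff[OF k[OF M_act[OF c(1,2)] c(3)] k[OF c(2) N_act[OF c(1,3)]]]
      using c by (simp add: frag_lift_of M_act N_act balanced closed a_minus_def C.r_neg)
  qed
qed

lemma frag_lift_null: assumes "r \<in> null" shows "frag_lift r = \<zero>\<^bsub>C\<^esub>"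
proof -
  \<comment> \<open>Membership in \<open>null\<close> is carried through the induction because
    additivity of \<open>frag_lift\<close> requires supports inside the carriers.\<close>
  have "frag_lift r = \<zero>\<^bsub>C\<^esub> \<and> r \<in> null"
    using assms[unfolded tensor_null_def]
  proof (induction rule: generate.induct)
    case one
    then show ?case by (simp add: frag_lift_zero null_zero)
  next
    case (incl h)
    then show ?case by (simp add: frag_lift_rel rel_null)
  next
    case (inv h)
    have k: "Poly_Mapping.keys h \<subseteq> carrier M \<times> carrier N" using subsetD[OF rel_subset inv] by simp
    have "frag_lift (0 - h) = \<zero>\<^bsub>C\<^esub>"
      using inv k by (subst frag_lift_diff) (auto simp: frag_lift_zero frag_lift_rel a_minus_def)
    then show ?case using k null_diff[OF null_zero rel_null[OF inv]] by simp
  next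
    case (eng h1 h2)
    then show ?case using frag_lift_add[OF null_keys null_keys, of h1 h2] null_add by simp
  qed
  then show ?thesis by simp
qed

abbreviation "lift \<equiv> tensor_lift C \<beta>"

text \<open>The representative picked by the choice operator differs from \<open>u\<close> by an
  element of \<open>null\<close>, on which \<open>frag_lift\<close> vanishes.\<close>

lemma lift_cls:
  assumes "Poly_Mapping.keys u \<subseteq> carrier M \<times> carrier N"
  shows "lift (cls u) = frag_lift u"
proof -
  define w where "w = (SOME w. w \<in> cls u)"
  have "w \<in> cls u" unfolding w_def by (rule someI) (rule cls_self)
  then have n: "w - u \<in> null" by (rule cls_mem)
  have "frag_lift (u + (w - u)) = frag_lift u"
    using assms frag_lift_add[OF assms null_keys[OF n]] frag_lift_null[OF n] frag_lift_closed[OF assms] by simp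
  then show ?thesis by (simp add: tensor_lift_def frag_lift_def w_def)
qed

lemma lift_closed: "U \<in> carrier T \<Longrightarrow> lift U \<in> carrier C"
  by (metis T_cases lift_cls frag_lift_closed)

lemma lift_add: "U \<in> carrier T \<Longrightarrow> V \<in> carrier T \<Longrightarrow> lift (U \<oplus>\<^bsub>T\<^esub> V) = lift U \<oplus>\<^bsub>C\<^esub> lift V"
  by (elim T_cases) (simp add: add_cls lift_cls frag_lift_add keys_add_subset)

lemma lift_diff: "U \<in> carrier T \<Longrightarrow> V \<in> carrier T \<Longrightarrow> lift (U \<ominus>\<^bsub>T\<^esub> V) = lift U \<ominus>\<^bsub>C\<^esub> lift V"
  by (elim T_cases) (simp add: minus_cls lift_cls frag_lift_diff keys_diff_subset)

lemma lift_pr: "x \<in> carrier M \<Longrightarrow> y \<in> carrier N \<Longrightarrow> lift (pr x y) = \<beta> x y"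
  unfolding pure_def by (subst lift_cls) (auto simp: frag_lift_of)

end

section \<open>The ring structure on the tensor product of two algebras\<close>

locale tensor_algebra =
  S: cring S + M: cring M + N: cring N
  for S :: "('s, 'm) ring_scheme" and f :: "'s \<Rightarrow> 'a" and M :: "('a, 'n) ring_scheme"
    and g :: "'s \<Rightarrow> 'b" and N :: "('b, 'k) ring_scheme" +
  assumes f_closed: "\<And>s. s \<in> carrier S \<Longrightarrow> f s \<in> carrier M"
    and g_closed: "\<And>s. s \<in> carrier S \<Longrightarrow> g s \<in> carrier N"
begin

sublocale tensor_product S f M g N
  by unfold_locales (simp_all add: f_closed g_closed)

text \<open>The product of representatives used inside the multiplication of \<open>tensor\<close>,
  already bilinear on formal sums before any quotient is taken.\<close>

definition fmul :: "(('a \<times> 'b) \<Rightarrow>\<^sub>0 int) \<Rightarrow> (('a \<times> 'b) \<Rightarrow>\<^sub>0 int) \<Rightarrow> (('a \<times> 'b) \<Rightarrow>\<^sub>0 int)" where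
  "fmul u v = frag_extend (\<lambda>(x, y). frag_extend (\<lambda>(x', y'). frag_of (x \<otimes>\<^bsub>M\<^esub> x', y \<otimes>\<^bsub>N\<^esub> y')) v) u"

lemma fmul_of: "fmul (frag_of (x, y)) (frag_of (x', y')) = frag_of (x \<otimes>\<^bsub>M\<^esub> x', y \<otimes>\<^bsub>N\<^esub> y')"
  by (simp add: fmul_def)

lemma fmul_diff_left: "fmul (u - u') v = fmul u v - fmul u' v"
  by (simp add: fmul_def frag_extend_diff)

lemma fmul_zero_left: "fmul 0 v = 0"
  by (simp add: fmul_def)

lemma fmul_diff_right: "fmul u (v - v') = fmul u v - fmul u v'"
  using subset_UNIV[of "Poly_Mapping.keys u"]
proof (induction u rule: frag_induction)
  case (one x)
  then show ?case by (cases x) (simp add: fmul_def frag_extend_diff)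
qed (simp_all add: fmul_zero_left fmul_diff_left)

lemma fmul_zero_right: "fmul u 0 = 0"
  using fmul_diff_right[of u 0 0] by simp

lemma fmul_add_left: "fmul (u + u') v = fmul u v + fmul u' v"
  using fmul_diff_left[of u "- u'" v] fmul_diff_left[of 0 u' v] by (simp add: fmul_zero_left)

lemma fmul_comm:
  assumes "Poly_Mapping.keys u \<subseteq> carrier M \<times> carrier N" "Poly_Mapping.keys v \<subseteq> carrier M \<times> carrier N"
  shows "fmul u v = fmul v u"
  using assms(1)
proof (induction u rule: FA_induct)
  case (of x y)
  show ?case using assms(2)
    by (induction v rule: FA_induct)
      (use of in \<open>simp_all add: fmul_zero_left fmul_zero_right fmul_diff_left fmul_diff_right fmul_of M.m_comm N.m_comm\<close>)
qed (simp_all add: fmul_zero_left fmul_zero_right fmul_diff_left fmul_diff_right)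

lemma fmul_closed:
  assumes "Poly_Mapping.keys u \<subseteq> carrier M \<times> carrier N" "Poly_Mapping.keys v \<subseteq> carrier M \<times> carrier N"
  shows "Poly_Mapping.keys (fmul u v) \<subseteq> carrier M \<times> carrier N"
  using assms(1)
proof (induction u rule: FA_induct)
  case (of x y)
  show ?case using assms(2)
    by (induction v rule: FA_induct)
      (use of in \<open>simp_all add: fmul_zero_right fmul_diff_right fmul_of keys_diff_subset\<close>)
qed (simp_all add: fmul_zero_left fmul_diff_left keys_diff_subset)

lemma fmul_assoc:
  assumes "Poly_Mapping.keys u \<subseteq> carrier M \<times> carrier N" "Poly_Mapping.keys v \<subseteq> carrier M \<times> carrier N"
    "Poly_Mapping.keys w \<subseteq> carrier M \<times> carrier N"
  shows "fmul (fmul u v) w = fmul u (fmul v w)"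
  using assms(1)
proof (induction u rule: FA_induct)
  case (of x y)
  show ?case using assms(2)
  proof (induction v rule: FA_induct)
    case (of x' y')
    show ?case using assms(3)
      by (induction w rule: FA_induct)
        (use of \<open>x \<in> carrier M\<close> \<open>y \<in> carrier N\<close> in \<open>simp_all add: fmul_zero_right fmul_diff_right fmul_of M.m_assoc N.m_assoc\<close>)
  qed (simp_all add: fmul_zero_left fmul_zero_right fmul_diff_left fmul_diff_right)
qed (simp_all add: fmul_zero_left fmul_diff_left)

lemma fmul_one:
  assumes "Poly_Mapping.keys u \<subseteq> carrier M \<times> carrier N"
  shows "fmul (frag_of (\<one>\<^bsub>M\<^esub>, \<one>\<^bsub>N\<^esub>)) u = u"
  using assms
  by (induction u rule: FA_induct) (simp_all add: fmul_zero_right fmul_diff_right fmul_of)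

text \<open>A relation times a generator is again a relation of the same kind. This is what makes
  \<open>null\<close> an ideal and not only a subgroup.\<close>

lemma fmul_rel:
  assumes "r \<in> rel" "a \<in> carrier M" "b \<in> carrier N"
  shows "fmul r (frag_of (a, b)) \<in> null"
proof (rule rel_null)
  have add_left: "frag_of (x \<oplus>\<^bsub>M\<^esub> x', y) - frag_of (x, y) - frag_of (x', y) \<in> rel"
    if "x \<in> carrier M" "x' \<in> carrier M" "y \<in> carrier N" for x x' y
    using that by (auto simp: tensor_relations_def)
  have add_right: "frag_of (x, y \<oplus>\<^bsub>N\<^esub> y') - frag_of (x, y) - frag_of (x, y') \<in> rel"
    if "x \<in> carrier M" "y \<in> carrier N" "y' \<in> carrier N" for x y y'
    using that by (auto simp: tensor_relations_def)
  have bal: "frag_of (f s \<otimes>\<^bsub>M\<^esub> x, y) - frag_of (x, g s \<otimes>\<^bsub>N\<^esub> y) \<in> rel"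
    if "s \<in> carrier S" "x \<in> carrier M" "y \<in> carrier N" for s x y
    using that by (auto simp: tensor_relations_def)
  show "fmul r (frag_of (a, b)) \<in> rel"
    using assms(1)[unfolded tensor_relations_def]
  proof (elim UnE CollectE exE conjE)
    fix x x' y assume r: "r = frag_of (x \<oplus>\<^bsub>M\<^esub> x', y) - frag_of (x, y) - frag_of (x', y)"
      and c: "x \<in> carrier M" "x' \<in> carrier M" "y \<in> carrier N"
    show ?thesis unfolding r using c assms(2,3) add_left[of "x \<otimes>\<^bsub>M\<^esub> a" "x' \<otimes>\<^bsub>M\<^esub> a" "y \<otimes>\<^bsub>N\<^esub> b"]
      by (simp add: fmul_diff_left fmul_of M.l_distr)
  next
    fix x y y' assume r: "r = frag_of (x, y \<oplus>\<^bsub>N\<^esub> y') - frag_of (x, y) - frag_of (x, y')"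
      and c: "x \<in> carrier M" "y \<in> carrier N" "y' \<in> carrier N"
    show ?thesis unfolding r using c assms(2,3) add_right[of "x \<otimes>\<^bsub>M\<^esub> a" "y \<otimes>\<^bsub>N\<^esub> b" "y' \<otimes>\<^bsub>N\<^esub> b"]
      by (simp add: fmul_diff_left fmul_of N.l_distr)
  next
    fix s x y assume r: "r = frag_of (f s \<otimes>\<^bsub>M\<^esub> x, y) - frag_of (x, g s \<otimes>\<^bsub>N\<^esub> y)"
      and c: "s \<in> carrier S" "x \<in> carrier M" "y \<in> carrier N"
    show ?thesis unfolding r using c assms(2,3) bal[of s "x \<otimes>\<^bsub>M\<^esub> a" "y \<otimes>\<^bsub>N\<^esub> b"]
      by (simp add: fmul_diff_left fmul_of M.m_assoc N.m_assoc f_closed g_closed)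
  qed
qed

lemma fmul_null_left:
  assumes "n \<in> null" "Poly_Mapping.keys v \<subseteq> carrier M \<times> carrier N"
  shows "fmul n v \<in> null"
  using assms(2)
proof (induction v rule: FA_induct)
  case (of a b)
  have "fmul n (frag_of (a, b)) \<in> null \<and> n \<in> null"
    using assms(1)[unfolded tensor_null_def]
  proof (induction rule: generate.induct)
    case one
    then show ?case by (simp add: fmul_zero_left null_zero)
  next
    case (incl h)
    then show ?case using of by (simp add: fmul_rel rel_null)
  next
    case (inv h)
    have k: "Poly_Mapping.keys h \<subseteq> carrier M \<times> carrier N" using subsetD[OF rel_subset inv] by simp
    have "fmul (0 - h) (frag_of (a, b)) \<in> null"
      unfolding fmul_diff_left fmul_zero_left using of inv by (intro null_diff null_zero fmul_rel)
    then show ?case using k null_diff[OF null_zero rel_null[OF inv]] by simp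
  next
    case (eng h1 h2)
    then show ?case by (simp add: fmul_add_left null_add)
  qed
  then show ?case by simp
qed (simp_all add: fmul_zero_right fmul_diff_right null_zero null_diff)

lemma cls_fmul_cong:
  assumes "Poly_Mapping.keys u \<subseteq> carrier M \<times> carrier N" "Poly_Mapping.keys v \<subseteq> carrier M \<times> carrier N"
    "u' \<in> cls u" "v' \<in> cls v"
  shows "cls (fmul u' v') = cls (fmul u v)"
proof (rule cls_eqI)
  have n: "u' - u \<in> null" "v' - v \<in> null" using assms cls_mem by auto
  have k: "Poly_Mapping.keys v' \<subseteq> carrier M \<times> carrier N"
    using keys_add_subset[OF null_keys[OF n(2)] assms(2)] by simp
  \<comment> \<open>Both terms have their factor from \<open>null\<close> on the left; commutativity
    is used to turn the second one round.\<close>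
  have "fmul u' v' - fmul u v = fmul (u' - u) v' + fmul (v' - v) u"
    using fmul_comm[OF assms(1) k] fmul_comm[OF assms(1,2)] by (simp add: fmul_diff_left)
  also have "\<dots> \<in> null"
    by (intro null_add fmul_null_left n k assms)
  finally show "fmul u' v' - fmul u v \<in> null" .
qed

lemma mult_cls:
  assumes "Poly_Mapping.keys u \<subseteq> carrier M \<times> carrier N" "Poly_Mapping.keys v \<subseteq> carrier M \<times> carrier N"
  shows "cls u \<otimes>\<^bsub>T\<^esub> cls v = cls (fmul u v)"
proof -
  have "cls u \<otimes>\<^bsub>T\<^esub> cls v = (\<Union>u'\<in>cls u. \<Union>v'\<in>cls v. cls (fmul u' v'))"
    by (simp add: tensor_def fmul_def)
  also have "\<dots> = (\<Union>u'\<in>cls u. \<Union>v'\<in>cls v. cls (fmul u v))"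
    by (intro SUP_cong refl cls_fmul_cong[OF assms])
  also have "\<dots> = cls (fmul u v)"
  proof -
    have "cls u \<noteq> {}" "cls v \<noteq> {}" using cls_self by (metis empty_iff)+
    then show ?thesis by simp
  qed
  finally show ?thesis .
qed

lemma one_cls: "\<one>\<^bsub>T\<^esub> = cls (frag_of (\<one>\<^bsub>M\<^esub>, \<one>\<^bsub>N\<^esub>))"
  by (simp add: tensor_def pure_def)

lemma T_cring: "cring T"
proof (rule cringI)
  have one: "\<one>\<^bsub>T\<^esub> \<in> carrier T" unfolding one_cls by (rule cls_closed) simp
  show "comm_monoid T"
  proof (rule comm_monoidI)
    fix U V W assume "U \<in> carrier T" "V \<in> carrier T" "W \<in> carrier T"
    then show "U \<otimes>\<^bsub>T\<^esub> V \<otimes>\<^bsub>T\<^esub> W = U \<otimes>\<^bsub>T\<^esub> (V \<otimes>\<^bsub>T\<^esub> W)"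
      by (elim T_cases) (simp add: mult_cls fmul_closed fmul_assoc)
  next
    fix U V assume "U \<in> carrier T" "V \<in> carrier T"
    then show "U \<otimes>\<^bsub>T\<^esub> V \<in> carrier T" "U \<otimes>\<^bsub>T\<^esub> V = V \<otimes>\<^bsub>T\<^esub> U"
      by (auto elim!: T_cases simp: mult_cls fmul_closed cls_closed fmul_comm)
  next
    fix U assume "U \<in> carrier T"
    then show "\<one>\<^bsub>T\<^esub> \<otimes>\<^bsub>T\<^esub> U = U"
      by (elim T_cases) (simp add: one_cls mult_cls fmul_one)
  qed (rule one)
  fix U V W assume "U \<in> carrier T" "V \<in> carrier T" "W \<in> carrier T"
  then show "(U \<oplus>\<^bsub>T\<^esub> V) \<otimes>\<^bsub>T\<^esub> W = U \<otimes>\<^bsub>T\<^esub> W \<oplus>\<^bsub>T\<^esub> V \<otimes>\<^bsub>T\<^esub> W"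
    by (elim T_cases) (simp add: mult_cls add_cls fmul_closed keys_add_subset fmul_add_left)
qed (rule T_abelian)

lemma pr_mult:
  "x \<in> carrier M \<Longrightarrow> x' \<in> carrier M \<Longrightarrow> y \<in> carrier N \<Longrightarrow> y' \<in> carrier N
    \<Longrightarrow> pr x y \<otimes>\<^bsub>T\<^esub> pr x' y' = pr (x \<otimes>\<^bsub>M\<^esub> x') (y \<otimes>\<^bsub>N\<^esub> y')"
  unfolding pure_def by (subst mult_cls) (simp_all add: fmul_of)

end


section \<open>Independence of \<open>p\<close>-th powers\<close>

lemma (in "domain") pow_eq_zero_iff [simp]:
  "a \<in> carrier R \<Longrightarrow> a [^] (n::nat) = \<zero> \<longleftrightarrow> n \<noteq> 0 \<and> a = \<zero>"
  by (induction n) (auto simp: integral_iff)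

lemma (in "domain") pow_non_zero:
  "a \<in> carrier R \<Longrightarrow> a \<noteq> \<zero> \<Longrightarrow> a [^] (n::nat) \<noteq> \<zero>"
  by (induction n) (auto simp: integral_iff)

lemma least_nonzero:
  "f (n::nat) \<noteq> z \<Longrightarrow> \<exists>k\<le>n. f k \<noteq> z \<and> (\<forall>i<k. f i = z)"
  using exists_least_iff[of "\<lambda>k. f k \<noteq> z"] by (metis not_le)

locale char_p_domain = char_p_ring + "domain"
begin

text \<open>Over a field this is the irreducibility of \<open>X^p - x\<close> when \<open>x\<close>
  is no \<open>p\<close>-th power. Here nothing is inverted and no root is adjoined: evaluating with
  coefficients raised to the power \<open>p\<close> plays the part of the \<open>p\<close>-th power
  of the value at a \<open>p\<close>-th root of \<open>x\<close>. By minimality \<open>f\<close>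
  divides a constant multiple of \<open>X^p - x\<close>. Twisting the coefficients by Frobenius and
  replacing \<open>X\<close> by \<open>X + x\<close> turns the latter into a monomial, hence also
  \<open>f\<close>, and the vanishing coefficient just below the top yields the root.\<close>

lemma p_independent_aux:
  fixes P (structure)
  defines "P \<equiv> UP R"
  assumes x: "x \<in> carrier R"
    and f: "f \<in> carrier P" "f \<noteq> \<zero>\<^bsub>P\<^esub>" "deg R f < p"
    and Ef: "UnivPoly.eval R R (\<lambda>a. a [^]\<^bsub>R\<^esub> p) x f = \<zero>\<^bsub>R\<^esub>"
    and min: "\<And>g. g \<in> carrier P \<Longrightarrow> g \<noteq> \<zero>\<^bsub>P\<^esub> \<Longrightarrow> UnivPoly.eval R R (\<lambda>a. a [^]\<^bsub>R\<^esub> p) x g = \<zero>\<^bsub>R\<^esub> \<Longrightarrow> deg R f \<le> deg R g"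
  shows "\<exists>y s. y \<in> carrier R \<and> s \<in> carrier R \<and> s \<noteq> \<zero>\<^bsub>R\<^esub> \<and> y [^]\<^bsub>R\<^esub> p = x \<otimes>\<^bsub>R\<^esub> s [^]\<^bsub>R\<^esub> p"
proof -
  note R_pow_non_zero = pow_non_zero and R_finsum_cong' = finsum_cong'
    and R_finsum_singleton = finsum_singleton and R_integral_iff = integral_iff
    and R_one_closed = one_closed
    and R_r_neg = r_neg and R_a_inv_closed = a_inv_closed and R_m_closed = m_closed
    and R_nat_pow_closed = nat_pow_closed
    and R_add_pow_closed = add.nat_pow_closed and R_m_comm = m_comm
  \<comment> \<open>Elements of the prime field are their own \<open>p\<close>-th powers, so an
    integer factor can be moved inside a \<open>p\<close>-th power.\<close>
  have scale: "add_pow R n x \<otimes>\<^bsub>R\<^esub> a [^]\<^bsub>R\<^esub> p = x \<otimes>\<^bsub>R\<^esub> (add_pow R n \<one>\<^bsub>R\<^esub> \<otimes>\<^bsub>R\<^esub> a) [^]\<^bsub>R\<^esub> p"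
    if "a \<in> carrier R" for a and n :: nat
  proof -
    have "(add_pow R n \<one>\<^bsub>R\<^esub> \<otimes>\<^bsub>R\<^esub> a) [^]\<^bsub>R\<^esub> p = add_pow R n \<one>\<^bsub>R\<^esub> \<otimes>\<^bsub>R\<^esub> a [^]\<^bsub>R\<^esub> p"
      using that by (subst nat_pow_distrib) (simp_all only: frob_nat add.nat_pow_closed one_closed)
    then show ?thesis using x that by (simp add: add_pow_ldistr add_pow_rdistr)
  qed
  have scale_nonzero: "add_pow R n \<one>\<^bsub>R\<^esub> \<otimes>\<^bsub>R\<^esub> a \<noteq> \<zero>\<^bsub>R\<^esub>"
    if "0 < n" "n < p" "a \<in> carrier R" "a \<noteq> \<zero>\<^bsub>R\<^esub>" for n a
    using nat_unit[of n a] that by (auto simp: add_pow_ldistr)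
  have minus_power: "(\<ominus>\<^bsub>R\<^esub> y) [^]\<^bsub>R\<^esub> p = z"
    if "y \<in> carrier R" "z \<in> carrier R" "z \<oplus>\<^bsub>R\<^esub> y [^]\<^bsub>R\<^esub> p = \<zero>\<^bsub>R\<^esub>" for y z
    using minus_equality[of z "y [^]\<^bsub>R\<^esub> p"] that by (simp add: frob_minus)
  let ?frob = "\<lambda>a. a [^]\<^bsub>R\<^esub> p"
  interpret UP_domain R P by unfold_locales (simp add: P_def)
  have cp: "char_p_ring P p"
  proof unfold_locales
    have "add_pow P k \<one>\<^bsub>P\<^esub> = up_ring.monom P (add_pow R k \<one>\<^bsub>R\<^esub>) 0" for k :: nat
      by (induction k) (simp_all add: monom_one)
    then show "add_pow P p \<one>\<^bsub>P\<^esub> = \<zero>\<^bsub>P\<^esub>" by (simp add: char_p)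
  qed (rule prime_p)
  interpret PC: char_p_ring P p by (rule cp)
  interpret fr: ring_hom_cring R R ?frob by (rule frob_cring)
  interpret E: UP_pre_univ_prop R R ?frob P
    by unfold_locales (simp add: P_def)
  let ?E = "UnivPoly.eval R R ?frob x"
  interpret EH: ring_hom_cring P R ?E
    by unfold_locales (rule E.eval_ring_hom[OF x])
  define n where "n = deg R f"
  define a where "a = up_ring.coeff P f n"
  have ac: "a \<in> carrier R" "a \<noteq> \<zero>\<^bsub>R\<^esub>"
    using f lcoeff_nonzero by (auto simp: a_def n_def)
  have n0: "n \<noteq> 0"
  proof
    assume n: "n = 0"
    then have "f = up_ring.monom P a 0" using deg_zero_impl_monom f n_def a_def by metis
    then have "?E f = ?frob a" using E.eval_const[OF x ac(1)] by simp
    then show False using Ef ac R_pow_non_zero[of a p] by simp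
  qed
  let ?X = "up_ring.monom P \<one>\<^bsub>R\<^esub> 1" and ?c = "\<lambda>a. up_ring.monom P a 0"
  \<comment> \<open>This is \<open>X^p - x\<close>. The twisted evaluation sends both of its terms
    to \<open>x^p\<close>.\<close>
  define g where "g = up_ring.monom P \<one>\<^bsub>R\<^esub> p \<ominus>\<^bsub>P\<^esub> ?c x"
  have gc: "g \<in> carrier P" using x by (simp add: g_def)
  have Eg: "?E g = \<zero>\<^bsub>R\<^esub>"
    using x E.eval_const[OF x x] E.eval_monom[OF R_one_closed x, of p]
    by (simp add: g_def a_minus_def R_r_neg)
  obtain q r k where qr: "q \<in> carrier P" "r \<in> carrier P"
    "a [^]\<^bsub>R\<^esub> (k::nat) \<odot>\<^bsub>P\<^esub> g = f \<otimes>\<^bsub>P\<^esub> q \<oplus>\<^bsub>P\<^esub> r" "r = \<zero>\<^bsub>P\<^esub> \<or> deg R r < n"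
    using long_div_theorem[OF f(1) gc f(2)] unfolding a_def n_def by blast
  let ?b = "a [^]\<^bsub>R\<^esub> k"
  have bc: "?b \<in> carrier R" "?b \<noteq> \<zero>\<^bsub>R\<^esub>" using ac by (auto dest: R_pow_non_zero)
  have bg: "?b \<odot>\<^bsub>P\<^esub> g = ?c ?b \<otimes>\<^bsub>P\<^esub> g" using bc gc by (simp add: monom_mult_is_smult)
  have "?E (?c ?b \<otimes>\<^bsub>P\<^esub> g) = \<zero>\<^bsub>R\<^esub>" using bc gc Eg by simp
  moreover have "?E (f \<otimes>\<^bsub>P\<^esub> q \<oplus>\<^bsub>P\<^esub> r) = ?E r" using f qr Ef by simp
  ultimately have Er: "?E r = \<zero>\<^bsub>R\<^esub>" using qr(3) bg by simp
  \<comment> \<open>The remainder is annihilated by the evaluation as well and has smaller degree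
    than the minimal \<open>f\<close>.\<close>
  have r0: "r = \<zero>\<^bsub>P\<^esub>"
  proof (rule ccontr)
    assume "r \<noteq> \<zero>\<^bsub>P\<^esub>"
    then show False using min[OF qr(2) _ Er] qr(4) unfolding n_def by linarith
  qed
  have fq: "f \<otimes>\<^bsub>P\<^esub> q = ?c ?b \<otimes>\<^bsub>P\<^esub> g" using qr f r0 bg by simp

  let ?h = "\<lambda>a. ?c (?frob a)"
  have hh: "?h \<in> ring_hom R P"
    using ring_hom_trans[OF frob_hom const_ring_hom] by (simp add: comp_def)
  interpret h: ring_hom_cring R P ?h by unfold_locales (rule hh)
  interpret Psi: UP_pre_univ_prop R P ?h P
    by (rule UP_pre_univ_prop.intro[OF h.ring_hom_cring_axioms UP_cring_axioms], rule P_def)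
  \<comment> \<open>With this substitution \<open>X^p - x\<close> becomes
    \<open>(X + x)^p - x^p = X^p\<close>.\<close>
  define Y where "Y = ?X \<oplus>\<^bsub>P\<^esub> ?c x"
  have Yc: "Y \<in> carrier P" using x by (simp add: Y_def)
  let ?Psi = "UnivPoly.eval R P ?h Y"
  interpret PsiH: ring_hom_cring P P ?Psi
    by unfold_locales (rule Psi.eval_ring_hom[OF Yc])
  have Yp: "Y [^]\<^bsub>P\<^esub> p = up_ring.monom P \<one>\<^bsub>R\<^esub> p \<oplus>\<^bsub>P\<^esub> ?c (?frob x)"
    using x by (simp add: Y_def PC.frob_add monom_pow)
  have Psig: "?Psi g = up_ring.monom P \<one>\<^bsub>R\<^esub> p"
  proof -
    have "?Psi g = Y [^]\<^bsub>P\<^esub> p \<ominus>\<^bsub>P\<^esub> ?c (?frob x)"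
      using x Yc Psi.eval_const[OF Yc x] Psi.eval_monom[OF R_one_closed Yc, of p]
      by (simp add: g_def a_minus_def)
    also have "\<dots> = up_ring.monom P \<one>\<^bsub>R\<^esub> p"
      unfolding Yp using x by (simp add: a_minus_def P.a_assoc P.r_neg)
    finally show ?thesis .
  qed
  \<comment> \<open>Of the powers of \<open>X + x\<close> only the two top coefficients matter: they
    determine the coefficients of \<open>F\<close> at \<open>n\<close> and
    \<open>n - 1\<close>.\<close>
  have Ycoeff: "up_ring.coeff P (Y [^]\<^bsub>P\<^esub> Suc i) i = add_pow R (Suc i) x \<and> up_ring.coeff P (Y [^]\<^bsub>P\<^esub> i) i = \<one>\<^bsub>R\<^esub> \<and> (\<forall>m>i. up_ring.coeff P (Y [^]\<^bsub>P\<^esub> i) m = \<zero>\<^bsub>R\<^esub>)" for i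
  proof (induction i)
    have st0: "up_ring.coeff P (Y [^]\<^bsub>P\<^esub> Suc i) m = up_ring.coeff P (?X \<otimes>\<^bsub>P\<^esub> Y [^]\<^bsub>P\<^esub> i) m \<oplus>\<^bsub>R\<^esub> x \<otimes>\<^bsub>R\<^esub> up_ring.coeff P (Y [^]\<^bsub>P\<^esub> i) m" for i m
    proof -
      have "Y [^]\<^bsub>P\<^esub> Suc i = ?X \<otimes>\<^bsub>P\<^esub> Y [^]\<^bsub>P\<^esub> i \<oplus>\<^bsub>P\<^esub> ?c x \<otimes>\<^bsub>P\<^esub> Y [^]\<^bsub>P\<^esub> i"
        using Yc x unfolding P.nat_pow_Suc
        by (subst (2) Y_def) (simp add: P.r_distr P.m_comm)
      then show ?thesis unfolding P.nat_pow_Suc using x Yc coeff_monom_mult[OF x P.nat_pow_closed[OF Yc], of 0 i m] by (simp del: coeff_mult)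
    qed
    have st: "up_ring.coeff P (Y [^]\<^bsub>P\<^esub> Suc i) (Suc m) = up_ring.coeff P (Y [^]\<^bsub>P\<^esub> i) m \<oplus>\<^bsub>R\<^esub> x \<otimes>\<^bsub>R\<^esub> up_ring.coeff P (Y [^]\<^bsub>P\<^esub> i) (Suc m)" for i m
      using st0[of i "Suc m"] coeff_monom_mult[OF R_one_closed P.nat_pow_closed[OF Yc], of 1 i m] Yc by (simp del: coeff_mult)
    {
      case 0
      show ?case using x by (simp add: Y_def)
    next
      case (Suc i)
      have "up_ring.coeff P (Y [^]\<^bsub>P\<^esub> Suc i) (Suc i) = \<one>\<^bsub>R\<^esub>"
        using Suc st[of i i] x by simp
      moreover have "up_ring.coeff P (Y [^]\<^bsub>P\<^esub> Suc i) m = \<zero>\<^bsub>R\<^esub>" if "m > Suc i" for m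
        using Suc that st[of i "m - 1"] x by simp
      moreover have "up_ring.coeff P (Y [^]\<^bsub>P\<^esub> Suc (Suc i)) (Suc i) = add_pow R (Suc (Suc i)) x"
        using Suc st[of "Suc i" i] x calculation(1) by simp
      ultimately show ?case by blast
    }
  qed
  define F where "F = ?Psi f"
  define Q where "Q = ?Psi q"
  have Fc: "F \<in> carrier P" and Qc: "Q \<in> carrier P" using f qr by (simp_all add: F_def Q_def)
  have FQ: "F \<otimes>\<^bsub>P\<^esub> Q = up_ring.monom P (?frob ?b) p"
  proof -
    have "F \<otimes>\<^bsub>P\<^esub> Q = ?Psi (?c ?b \<otimes>\<^bsub>P\<^esub> g)" unfolding F_def Q_def fq[symmetric]
      by (rule PsiH.hom_mult[OF f(1) qr(1), symmetric])
    also have "\<dots> = ?h ?b \<otimes>\<^bsub>P\<^esub> up_ring.monom P \<one>\<^bsub>R\<^esub> p"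
      using bc gc Psig Psi.eval_const[OF Yc bc(1)] by simp
    finally show ?thesis using bc by (simp flip: monom_mult)
  qed
  have Fcoeff: "up_ring.coeff P F m = (\<Oplus>\<^bsub>R\<^esub>i\<in>{..n}. ?frob (up_ring.coeff P f i) \<otimes>\<^bsub>R\<^esub> up_ring.coeff P (Y [^]\<^bsub>P\<^esub> i) m)" for m
  proof -
    have "F = (\<Oplus>\<^bsub>P\<^esub>i\<in>{..n}. ?h (up_ring.coeff P f i) \<otimes>\<^bsub>P\<^esub> Y [^]\<^bsub>P\<^esub> i)"
      using f by (simp add: F_def eval_on_carrier n_def)
    then show ?thesis
      using f Yc coeff_monom_mult[of _ _ 0 m]
      by (simp add: coeff_finsum Pi_def del: coeff_mult)
  qed
  have Fn: "up_ring.coeff P F n = ?frob a"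
  proof -
    have "up_ring.coeff P F n = (\<Oplus>\<^bsub>R\<^esub>i\<in>{..n}. if n = i then ?frob (up_ring.coeff P f i) else \<zero>\<^bsub>R\<^esub>)"
      unfolding Fcoeff by (rule R_finsum_cong') (use Ycoeff f in auto)
    then show ?thesis using f R_finsum_singleton[of n "{..n}" "\<lambda>i. ?frob (up_ring.coeff P f i)"] by (simp add: a_def)
  qed
  have Fabove: "up_ring.coeff P F m = \<zero>\<^bsub>R\<^esub>" if "m > n" for m
  proof -
    have "up_ring.coeff P F m = (\<Oplus>\<^bsub>R\<^esub>i\<in>{..n}. \<zero>\<^bsub>R\<^esub>)"
      unfolding Fcoeff by (rule R_finsum_cong') (use Ycoeff f that in auto)
    then show ?thesis by simp
  qed
  obtain n' where n': "n = Suc n'" using n0 not0_implies_Suc by blast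
  let ?a' = "up_ring.coeff P f n'"
  have a'c: "?a' \<in> carrier R" using f by simp
  have Fn': "up_ring.coeff P F n' = add_pow R n x \<otimes>\<^bsub>R\<^esub> ?frob a \<oplus>\<^bsub>R\<^esub> ?frob ?a'"
  proof -
    have "up_ring.coeff P F n' = ?frob (up_ring.coeff P f n) \<otimes>\<^bsub>R\<^esub> up_ring.coeff P (Y [^]\<^bsub>P\<^esub> n) n' \<oplus>\<^bsub>R\<^esub>
       (\<Oplus>\<^bsub>R\<^esub>i\<in>{..n'}. ?frob (up_ring.coeff P f i) \<otimes>\<^bsub>R\<^esub> up_ring.coeff P (Y [^]\<^bsub>P\<^esub> i) n')"
      unfolding Fcoeff n' using f Yc by (simp add: Pi_def)
    also have "(\<Oplus>\<^bsub>R\<^esub>i\<in>{..n'}. ?frob (up_ring.coeff P f i) \<otimes>\<^bsub>R\<^esub> up_ring.coeff P (Y [^]\<^bsub>P\<^esub> i) n') =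
        (\<Oplus>\<^bsub>R\<^esub>i\<in>{..n'}. if n' = i then ?frob (up_ring.coeff P f i) else \<zero>\<^bsub>R\<^esub>)"
      by (rule R_finsum_cong') (use Ycoeff f in auto)
    also have "\<dots> = ?frob ?a'" using f R_finsum_singleton[of n' "{..n'}" "\<lambda>i. ?frob (up_ring.coeff P f i)"] by simp
    finally show ?thesis using Ycoeff[of n'] ac x by (simp add: n' a_def R_m_comm)
  qed
  have bp: "?frob ?b \<noteq> \<zero>\<^bsub>R\<^esub>" "?frob ?b \<in> carrier R" "?frob a \<noteq> \<zero>\<^bsub>R\<^esub>"
    using bc ac by (auto dest: R_pow_non_zero)
  have Fne: "F \<noteq> \<zero>\<^bsub>P\<^esub>" using Fn bp by auto
  have Qne: "Q \<noteq> \<zero>\<^bsub>P\<^esub>"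
  proof
    assume "Q = \<zero>\<^bsub>P\<^esub>"
    then have "up_ring.monom P (?frob ?b) p = \<zero>\<^bsub>P\<^esub>" using FQ Fc by simp
    then show False using bp(1) coeff_monom[OF bp(2), of p p] by simp
  qed
  have degF: "deg R F = n" using Fn Fabove bp Fc by (intro antisym deg_aboveI deg_belowI) auto
  have degsum: "n + deg R Q = p"
    using deg_mult[OF Fne Qne Fc Qc] FQ degF bp by simp
  \<comment> \<open>Over a domain the lowest coefficients of \<open>F\<close> and \<open>Q\<close>
    multiply to the lowest coefficient of their product, which is a monomial of degree
    \<open>p\<close>. Since \<open>k1 \<le> n\<close>, \<open>k2 \<le> deg R Q\<close> and the
    degrees add up to \<open>p\<close>, \<open>F\<close> has no term below degree
    \<open>n\<close>.\<close>
  obtain k1 where k1: "up_ring.coeff P F k1 \<noteq> \<zero>\<^bsub>R\<^esub>" "k1 \<le> n" "\<And>i. i < k1 \<Longrightarrow> up_ring.coeff P F i = \<zero>\<^bsub>R\<^esub>"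
    using least_nonzero[of "up_ring.coeff P F" n "\<zero>\<^bsub>R\<^esub>"] Fn bp(3) by metis
  obtain k2 where k2: "up_ring.coeff P Q k2 \<noteq> \<zero>\<^bsub>R\<^esub>" "k2 \<le> deg R Q" "\<And>i. i < k2 \<Longrightarrow> up_ring.coeff P Q i = \<zero>\<^bsub>R\<^esub>"
    using least_nonzero[of "up_ring.coeff P Q" "deg R Q" "\<zero>\<^bsub>R\<^esub>"] lcoeff_nonzero[OF Qne Qc] by metis
  have "up_ring.coeff P (F \<otimes>\<^bsub>P\<^esub> Q) (k1 + k2) = (\<Oplus>\<^bsub>R\<^esub>i\<in>{..k1 + k2}. up_ring.coeff P F i \<otimes>\<^bsub>R\<^esub> up_ring.coeff P Q (k1 + k2 - i))"
    using Fc Qc by simp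
  also have "\<dots> = (\<Oplus>\<^bsub>R\<^esub>i\<in>{..k1 + k2}. if k1 = i then up_ring.coeff P F i \<otimes>\<^bsub>R\<^esub> up_ring.coeff P Q k2 else \<zero>\<^bsub>R\<^esub>)"
  proof (rule R_finsum_cong'[OF refl])
    fix i assume "i \<in> {..k1 + k2}"
    then have "i < k1 \<or> i = k1 \<or> k1 + k2 - i < k2" by auto
    then show "up_ring.coeff P F i \<otimes>\<^bsub>R\<^esub> up_ring.coeff P Q (k1 + k2 - i) = (if k1 = i then up_ring.coeff P F i \<otimes>\<^bsub>R\<^esub> up_ring.coeff P Q k2 else \<zero>\<^bsub>R\<^esub>)"
      using k1(3)[of i] k2(3)[of "k1 + k2 - i"] Fc Qc by auto
  qed (use Fc Qc in auto)
  also have "\<dots> = up_ring.coeff P F k1 \<otimes>\<^bsub>R\<^esub> up_ring.coeff P Q k2"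
    using R_finsum_singleton[of k1 "{..k1 + k2}" "\<lambda>i. up_ring.coeff P F i \<otimes>\<^bsub>R\<^esub> up_ring.coeff P Q k2"] Fc Qc by simp
  finally have "up_ring.coeff P (up_ring.monom P (?frob ?b) p) (k1 + k2) \<noteq> \<zero>\<^bsub>R\<^esub>"
    using FQ k1(1) k2(1) Fc Qc by (auto simp: R_integral_iff)
  then have "k1 + k2 = p" using bp by (auto split: if_splits)
  then have "k1 = n" using k1 k2 degsum by linarith
  \<comment> \<open>The coefficient of \<open>F\<close> at \<open>n - 1\<close> now vanishes, which
    says that \<open>n x a^p\<close> is minus a \<open>p\<close>-th power.\<close>
  then have "add_pow R n x \<otimes>\<^bsub>R\<^esub> ?frob a \<oplus>\<^bsub>R\<^esub> ?frob ?a' = \<zero>\<^bsub>R\<^esub>"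
    using k1(3)[of n'] Fn' n' by simp
  then have "?frob (\<ominus>\<^bsub>R\<^esub> ?a') = add_pow R n x \<otimes>\<^bsub>R\<^esub> ?frob a"
    by (rule minus_power[OF a'c R_m_closed[OF R_add_pow_closed[OF x] R_nat_pow_closed[OF ac(1)]]])
  then have "?frob (\<ominus>\<^bsub>R\<^esub> ?a') = x \<otimes>\<^bsub>R\<^esub> ?frob (add_pow R n \<one>\<^bsub>R\<^esub> \<otimes>\<^bsub>R\<^esub> a)"
    unfolding scale[OF ac(1)] .
  moreover have "add_pow R n \<one>\<^bsub>R\<^esub> \<otimes>\<^bsub>R\<^esub> a \<noteq> \<zero>\<^bsub>R\<^esub>"
    using scale_nonzero[OF _ _ ac] n0 f(3) by (simp add: n_def)
  moreover have "\<ominus>\<^bsub>R\<^esub> ?a' \<in> carrier R" "add_pow R n \<one>\<^bsub>R\<^esub> \<otimes>\<^bsub>R\<^esub> a \<in> carrier R"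
    by (rule R_a_inv_closed[OF a'c], rule R_m_closed[OF R_add_pow_closed[OF R_one_closed] ac(1)])
  ultimately show ?thesis
    by (intro exI[of _ "\<ominus>\<^bsub>R\<^esub> ?a'"] exI[of _ "add_pow R n \<one>\<^bsub>R\<^esub> \<otimes>\<^bsub>R\<^esub> a"] conjI)
qed

text \<open>The hypothesis \<open>nonpower\<close> says, without denominators, that \<open>x\<close>
  is not a \<open>p\<close>-th power in the fraction field. The relation is read as a polynomial of
  degree below \<open>p\<close> annihilated by the twisted evaluation.\<close>

lemma p_independent:
  assumes x: "x \<in> carrier R"
    and nonpower: "\<And>y s. y \<in> carrier R \<Longrightarrow> s \<in> carrier R \<Longrightarrow> y [^] p = x \<otimes> s [^] p \<Longrightarrow> s = \<zero>"
    and b: "\<And>j. j < p \<Longrightarrow> b j \<in> carrier R"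
    and rel: "(\<Oplus>j\<in>{..<p}. b j [^] p \<otimes> x [^] j) = \<zero>"
    and j: "j < p"
  shows "b j = \<zero>"
proof (rule ccontr)
  assume nz: "b j \<noteq> \<zero>"
  define P where "P = UP R"
  note R_sum_neutral = add.finprod_mono_neutral_cong and R_nat_pow_zero = nat_pow_zero
  define f where "f = (\<lambda>n. if n < p then b n else \<zero>)"
  have "f \<in> up R"
    by (rule mem_upI) (use b in \<open>auto simp: f_def bound_def intro!: exI[of _ p]\<close>)
  then have f: "f \<in> carrier P" and fco: "up_ring.coeff P f i = f i" for i
    unfolding P_def UP_def by simp_all
  interpret UP_domain R P by unfold_locales (simp add: P_def)
  let ?E = "UnivPoly.eval R R (\<lambda>a. a [^] p) x"
  have fne: "f \<noteq> \<zero>\<^bsub>P\<^esub>"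
  proof
    assume "f = \<zero>\<^bsub>P\<^esub>"
    then have "f j = \<zero>" using fco[of j] coeff_zero[of j] by simp
    then show False using nz j by (simp add: f_def)
  qed
  have deg: "deg R f < p"
  proof -
    have "deg R f \<le> p - 1" by (rule deg_aboveI) (use f fco f_def in auto)
    then show ?thesis using p_pos by linarith
  qed
  have "?E f = (\<Oplus>i\<in>{..deg R f}. f i [^] p \<otimes> x [^] i)"
    using f by (simp add: eval_on_carrier fco)
  also have "\<dots> = (\<Oplus>i\<in>{..<p}. b i [^] p \<otimes> x [^] i)"
  proof (rule R_sum_neutral)
    fix i assume "i \<in> {..<p} - {..deg R f}"
    then have "b i = \<zero>" using deg_aboveD[OF _ f, of i] by (auto simp: fco) (auto simp: f_def)
    then show "b i [^] p \<otimes> x [^] i = \<zero>" using x p_pos by (simp add: R_nat_pow_zero)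
  qed (use deg b x in \<open>auto simp: f_def\<close>)
  finally have Ef: "?E f = \<zero>" using rel by simp
  let ?ok = "\<lambda>g. g \<in> carrier P \<and> g \<noteq> \<zero>\<^bsub>P\<^esub> \<and> ?E g = \<zero>"
  \<comment> \<open>An annihilated polynomial of least degree is what
    \<open>p_independent_aux\<close> requires; \<open>f\<close> bounds that degree below
    \<open>p\<close>.\<close>
  obtain g where g: "?ok g" and min: "\<And>h. ?ok h \<Longrightarrow> deg R g \<le> deg R h"
    using ex_has_least_nat[of ?ok f "deg R"] f fne Ef by blast
  have "deg R g < p" using min[of f] f fne Ef deg by auto
  then obtain y s where "y \<in> carrier R" "s \<in> carrier R" "s \<noteq> \<zero>" "y [^] p = x \<otimes> s [^] p"
    using p_independent_aux[OF x, of g] g min unfolding P_def by blast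
  then show False using nonpower by blast
qed

end


section \<open>Rings in which the uniformiser is prime\<close>

context cring
begin

lemma subring_pow: "subring S R \<Longrightarrow> x \<in> S \<Longrightarrow> x [^] (n::nat) \<in> S"
  by (induction n) (auto simp: subringE)

lemma subring_minus: "subring S R \<Longrightarrow> x \<in> S \<Longrightarrow> y \<in> S \<Longrightarrow> x \<ominus> y \<in> S"
  by (simp add: a_minus_def subringE)

lemma subring_mem: "subring S R \<Longrightarrow> x \<in> S \<Longrightarrow> x \<in> carrier R"
  using subringE(1) by blast

lemma subring_finsum: "subring S R \<Longrightarrow> (\<And>i. i \<in> B \<Longrightarrow> f i \<in> S) \<Longrightarrow> (\<Oplus>i\<in>B. f i) \<in> S"
proof (induction B rule: infinite_finite_induct)
  case (insert b B)
  then have "f \<in> B \<rightarrow> carrier R" "f b \<in> carrier R" by (auto intro: subring_mem)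
  then show ?case using insert by (simp add: subringE)
qed (simp_all add: subringE)

lemma subring_add_pow: "subring S R \<Longrightarrow> x \<in> S \<Longrightarrow> add_pow R (n::nat) x \<in> S"
  by (induction n) (auto simp: subringE)

lemma diff_add_swap:
  assumes [simp]: "x \<in> carrier R" "y \<in> carrier R" "x' \<in> carrier R" "y' \<in> carrier R"
  shows "(x \<oplus> x') \<ominus> (y \<oplus> y') = (x \<ominus> y) \<oplus> (x' \<ominus> y')"
  using assms by algebra

lemma diff_mult_split:
  assumes [simp]: "x \<in> carrier R" "y \<in> carrier R" "x' \<in> carrier R" "y' \<in> carrier R"
  shows "x \<otimes> x' \<ominus> y \<otimes> y' = (x \<ominus> y) \<otimes> x' \<oplus> y \<otimes> (x' \<ominus> y')"
  using assms by algebra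

lemma diff_trans:
  assumes [simp]: "x \<in> carrier R" "y \<in> carrier R" "z \<in> carrier R"
  shows "x \<ominus> z = (x \<ominus> y) \<oplus> (y \<ominus> z)"
  using assms by algebra

lemma diff_add_cancel:
  assumes [simp]: "x \<in> carrier R" "y \<in> carrier R"
  shows "y \<oplus> (x \<ominus> y) = x"
  using assms by algebra

lemma diff_swap:
  assumes [simp]: "x \<in> carrier R" "y \<in> carrier R"
  shows "\<ominus> (x \<ominus> y) = y \<ominus> x"
  using assms by algebra

lemma minus_pow: "x \<in> carrier R \<Longrightarrow> (\<ominus> x) [^] (n::nat) = (\<ominus> \<one>) [^] n \<otimes> x [^] n"
  using nat_pow_distrib[of "\<ominus> \<one>" x n] by (simp add: l_minus)

text \<open>The equation for \<open>z [^] q\<close> rewrites every higher power of \<open>z\<close>,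
  so the combinations of the first \<open>q\<close> powers are closed under multiplication by
  \<open>z\<close> and hence under products.\<close>

lemma adjoin_subring:
  assumes S: "subring S R" and z: "z \<in> carrier R" and q: "0 < (q::nat)"
    and zq: "z [^] q = x \<otimes> z \<oplus> y" "x \<in> S" "y \<in> S" "q \<ge> 2"
  shows "subring {(\<Oplus>i\<in>{..<q}. f i \<otimes> z [^] i) | f. f \<in> {..<q} \<rightarrow> S} R" (is "subring ?D R")
    and "S \<subseteq> {(\<Oplus>i\<in>{..<q}. f i \<otimes> z [^] i) | f. f \<in> {..<q} \<rightarrow> S}"
    and "z \<in> {(\<Oplus>i\<in>{..<q}. f i \<otimes> z [^] i) | f. f \<in> {..<q} \<rightarrow> S}"
proof -
  note Sm = subring_mem[OF S]
  have monom: "s \<otimes> z [^] j \<in> ?D" if "s \<in> S" "j < q" for s j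
  proof -
    have "(\<Oplus>i\<in>{..<q}. (if j = i then s else \<zero>) \<otimes> z [^] i) = (\<Oplus>i\<in>{..<q}. if j = i then s \<otimes> z [^] i else \<zero>)"
      by (rule finsum_cong') (use z that Sm in auto)
    also have "\<dots> = s \<otimes> z [^] j"
      using finsum_singleton[of j "{..<q}" "\<lambda>i. s \<otimes> z [^] i"] that z Sm by simp
    finally show ?thesis using that subringE(2)[OF S]
      by (intro CollectI exI[of _ "\<lambda>i. if j = i then s else \<zero>"]) auto
  qed
  show SD: "S \<subseteq> ?D" using monom[of _ 0] q Sm by fastforce
  show zD: "z \<in> ?D" using monom[of \<one> 1] zq(4) subringE(3)[OF S] z by simp
  have Dc: "?D \<subseteq> carrier R"
    using z Sm by (auto intro!: finsum_closed)
  have add: "d \<oplus> e \<in> ?D" if "d \<in> ?D" "e \<in> ?D" for d e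
  proof -
    obtain f g where fg: "d = (\<Oplus>i\<in>{..<q}. f i \<otimes> z [^] i)" "e = (\<Oplus>i\<in>{..<q}. g i \<otimes> z [^] i)"
      "f \<in> {..<q} \<rightarrow> S" "g \<in> {..<q} \<rightarrow> S" using \<open>d \<in> ?D\<close> \<open>e \<in> ?D\<close> by blast
    have c: "f i \<in> carrier R" "g i \<in> carrier R" if "i < q" for i using fg that Sm by auto
    have "d \<oplus> e = (\<Oplus>i\<in>{..<q}. f i \<otimes> z [^] i \<oplus> g i \<otimes> z [^] i)"
      unfolding fg by (rule finsum_addf[symmetric]) (use c z in auto)
    also have "\<dots> = (\<Oplus>i\<in>{..<q}. (f i \<oplus> g i) \<otimes> z [^] i)"
      by (rule finsum_cong') (use c z in \<open>auto simp: l_distr\<close>)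
    finally show ?thesis using fg subringE(7)[OF S]
      by (intro CollectI exI[of _ "\<lambda>i. f i \<oplus> g i"]) auto
  qed
  have smul: "s \<otimes> d \<in> ?D" if "d \<in> ?D" "s \<in> S" for d s
  proof -
    obtain f where f: "d = (\<Oplus>i\<in>{..<q}. f i \<otimes> z [^] i)" "f \<in> {..<q} \<rightarrow> S" using \<open>d \<in> ?D\<close> by blast
    have c: "f i \<in> carrier R" if "i < q" for i using f that Sm by auto
    have "s \<otimes> d = (\<Oplus>i\<in>{..<q}. s \<otimes> (f i \<otimes> z [^] i))"
      unfolding f by (rule finsum_rdistr) (use c z Sm that in auto)
    also have "\<dots> = (\<Oplus>i\<in>{..<q}. (s \<otimes> f i) \<otimes> z [^] i)"
      by (rule finsum_cong') (use c z that Sm in \<open>auto simp: m_assoc\<close>)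
    finally show ?thesis using f that subringE(6)[OF S]
      by (intro CollectI exI[of _ "\<lambda>i. s \<otimes> f i"]) auto
  qed
  have zero: "\<zero> \<in> ?D" using SD subringE(2)[OF S] by blast
  have sumD: "(\<Oplus>i\<in>B. h i) \<in> ?D" if "\<And>i. i \<in> B \<Longrightarrow> h i \<in> ?D" for B and h :: "nat \<Rightarrow> 'a"
    using that
  proof (induction B rule: infinite_finite_induct)
    case (insert b B)
    then have "h \<in> B \<rightarrow> carrier R" "h b \<in> carrier R" using Dc by auto
    then show ?case using insert add by simp
  qed (use zero in auto)
  have zmul: "z \<otimes> d \<in> ?D" if "d \<in> ?D" for d
  proof -
    obtain f where f: "d = (\<Oplus>i\<in>{..<q}. f i \<otimes> z [^] i)" "f \<in> {..<q} \<rightarrow> S" using \<open>d \<in> ?D\<close> by blast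
    have c: "f i \<in> S" "f i \<in> carrier R" if "i < q" for i using f that Sm by auto
    have "z \<otimes> d = (\<Oplus>i\<in>{..<q}. z \<otimes> (f i \<otimes> z [^] i))"
      unfolding f by (rule finsum_rdistr) (use c z in auto)
    also have "\<dots> \<in> ?D"
    proof (rule sumD)
      fix i assume i: "i \<in> {..<q}"
      have eq: "z \<otimes> (f i \<otimes> z [^] i) = f i \<otimes> z [^] Suc i"
        using c i z by (simp add: m_ac)
      show "z \<otimes> (f i \<otimes> z [^] i) \<in> ?D"
      proof (cases "Suc i < q")
        case True
        then show ?thesis unfolding eq by (intro monom) (use c i in auto)
      next
        case False
        then have "Suc i = q" using i by auto
        \<comment> \<open>The power that overflows comes back with exponents 1 and 0, and 1 is a
          permitted exponent because \<open>q \<ge> 2\<close>.\<close>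
        then have "f i \<otimes> z [^] Suc i = (f i \<otimes> x) \<otimes> z [^] (1::nat) \<oplus> (f i \<otimes> y) \<otimes> z [^] (0::nat)"
          using zq c i z Sm by (simp add: r_distr m_assoc)
        also have "\<dots> \<in> ?D"
          by (intro add monom subringE(6)[OF S]) (use c i zq in auto)
        finally show ?thesis unfolding eq .
      qed
    qed
    finally show ?thesis .
  qed
  have zpmul: "z [^] i \<otimes> d \<in> ?D" if "d \<in> ?D" for d and i :: nat
  proof (induction i)
    case 0
    have "d \<in> carrier R" using Dc that by blast
    then show ?case using that by simp
  next
    case (Suc i)
    have "d \<in> carrier R" using Dc that by blast
    then have "z [^] Suc i \<otimes> d = z \<otimes> (z [^] i \<otimes> d)" using z by (simp add: m_ac)
    then show ?case using zmul[OF Suc] by simp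
  qed
  show "subring ?D R"
  proof (rule subringI)
    show "\<one> \<in> ?D" using SD subringE(3)[OF S] by blast
  next
    fix d assume d: "d \<in> ?D"
    have "\<ominus> \<one> \<otimes> d \<in> ?D" using smul[OF d] subringE(5)[OF S subringE(3)[OF S]] by blast
    moreover have "\<ominus> \<one> \<otimes> d = \<ominus> d" using subsetD[OF Dc d] by (simp add: l_minus)
    ultimately show "\<ominus> d \<in> ?D" by simp
  next
    fix d e assume d: "d \<in> ?D" and e: "e \<in> ?D"
    show "d \<oplus> e \<in> ?D" by (rule add[OF d e])
    obtain f where f: "d = (\<Oplus>i\<in>{..<q}. f i \<otimes> z [^] i)" "f \<in> {..<q} \<rightarrow> S" using d by blast
    have c: "f i \<in> S" "f i \<in> carrier R" if "i < q" for i using f that Sm by auto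
    have ec: "e \<in> carrier R" using e Dc by blast
    have "d \<otimes> e = (\<Oplus>i\<in>{..<q}. f i \<otimes> z [^] i \<otimes> e)"
      unfolding f by (rule finsum_ldistr) (use c z ec in auto)
    also have "\<dots> \<in> ?D"
    proof (rule sumD)
      fix i assume i: "i \<in> {..<q}"
      have "f i \<otimes> (z [^] i \<otimes> e) \<in> ?D" using smul[OF zpmul[OF e]] c i by blast
      then show "f i \<otimes> z [^] i \<otimes> e \<in> ?D" using c i z ec by (simp add: m_assoc)
    qed
    finally show "d \<otimes> e \<in> ?D" .
  qed (rule Dc)
qed

end

text \<open>\<open>V\<close> is treated like a valuation ring with uniformiser \<open>t\<close>, but
  only through three facts: \<open>t\<close> is prime in \<open>V\<close>, it is invertible in
  \<open>L\<close>, and every element of \<open>L\<close> enters \<open>V\<close> after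
  multiplication by a power of \<open>t\<close>. The assumption \<open>t_contract\<close> makes
  \<open>A\<close> modulo \<open>t\<close> embed into \<open>V\<close> modulo
  \<open>t\<close>.\<close>

locale valued = char_p_ring L p for L (structure) and p +
  fixes V A :: "'a set" and t :: 'a
  assumes V: "subring V L" and A: "subring A L" and A_V: "A \<subseteq> V" and t_A: "t \<in> A" and t_unit: "t \<in> Units L"
    and t_prime: "\<And>x y z. x \<in> V \<Longrightarrow> y \<in> V \<Longrightarrow> z \<in> V \<Longrightarrow> x \<otimes> y = t \<otimes> z
      \<Longrightarrow> (\<exists>w\<in>V. x = t \<otimes> w) \<or> (\<exists>w\<in>V. y = t \<otimes> w)"
    and t_nonunit: "\<And>x. x \<in> V \<Longrightarrow> t \<otimes> x \<noteq> \<one>"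
    and t_contract: "\<And>x. x \<in> V \<Longrightarrow> t \<otimes> x \<in> A \<Longrightarrow> x \<in> A"
    and t_generates: "\<And>x. x \<in> carrier L \<Longrightarrow> \<exists>n::nat. t [^] n \<otimes> x \<in> V"
begin

definition I :: "'a set" where "I = (\<lambda>x. t \<otimes> x) ` V"

text \<open>Congruence modulo \<open>t V\<close>. Membership in \<open>V\<close> is part of the
  relation, so chains of congruences also deliver membership.\<close>

definition eqv :: "'a \<Rightarrow> 'a \<Rightarrow> bool" (infix "\<asymp>" 50) where
  "x \<asymp> y \<longleftrightarrow> x \<in> V \<and> y \<in> V \<and> x \<ominus> y \<in> I"

lemma V_carrier [simp]: "x \<in> V \<Longrightarrow> x \<in> carrier L" using subring_mem[OF V] .
lemma A_in_V [simp]: "x \<in> A \<Longrightarrow> x \<in> V" using A_V by blast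
lemma t_carrier [simp]: "t \<in> carrier L" using t_A by simp
lemma t_V [simp]: "t \<in> V" using t_A by simp

lemma V_closed [simp]:
  "\<zero> \<in> V" "\<one> \<in> V" "x \<in> V \<Longrightarrow> \<ominus> x \<in> V" "x \<in> V \<Longrightarrow> y \<in> V \<Longrightarrow> x \<oplus> y \<in> V"
  "x \<in> V \<Longrightarrow> y \<in> V \<Longrightarrow> x \<otimes> y \<in> V" "x \<in> V \<Longrightarrow> y \<in> V \<Longrightarrow> x \<ominus> y \<in> V" "x \<in> V \<Longrightarrow> x [^] (n::nat) \<in> V"
  "x \<in> V \<Longrightarrow> add_pow L n x \<in> V"
  using subringE[OF V] subring_minus[OF V] subring_pow[OF V] subring_add_pow[OF V] by auto

lemma A_closed [simp]:
  "\<zero> \<in> A" "\<one> \<in> A" "x \<in> A \<Longrightarrow> \<ominus> x \<in> A" "x \<in> A \<Longrightarrow> y \<in> A \<Longrightarrow> x \<oplus> y \<in> A"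
  "x \<in> A \<Longrightarrow> y \<in> A \<Longrightarrow> x \<otimes> y \<in> A" "x \<in> A \<Longrightarrow> y \<in> A \<Longrightarrow> x \<ominus> y \<in> A" "x \<in> A \<Longrightarrow> x [^] (n::nat) \<in> A"
  "x \<in> A \<Longrightarrow> add_pow L n x \<in> A"
  using subringE[OF A] subring_minus[OF A] subring_pow[OF A] subring_add_pow[OF A] by auto

lemma V_finsum: "(\<And>i. i \<in> B \<Longrightarrow> f i \<in> V) \<Longrightarrow> (\<Oplus>i\<in>B. f i) \<in> V"
  using subring_finsum[OF V] .
lemma A_finsum: "(\<And>i. i \<in> B \<Longrightarrow> f i \<in> A) \<Longrightarrow> (\<Oplus>i\<in>B. f i) \<in> A"
  using subring_finsum[OF A] .

lemma I_V [simp]: "x \<in> I \<Longrightarrow> x \<in> V" by (auto simp: I_def)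

lemma I_I: "x \<in> V \<Longrightarrow> t \<otimes> x \<in> I" by (simp add: I_def)

lemma I_zero [simp]: "\<zero> \<in> I" using I_I[of \<zero>] by simp

lemma I_add: "x \<in> I \<Longrightarrow> y \<in> I \<Longrightarrow> x \<oplus> y \<in> I"
proof -
  assume "x \<in> I" "y \<in> I"
  then obtain v w where "x = t \<otimes> v" "y = t \<otimes> w" "v \<in> V" "w \<in> V" by (auto simp: I_def)
  then show "x \<oplus> y \<in> I" using I_I[of "v \<oplus> w"] by (simp add: r_distr)
qed

lemma I_mult: assumes "x \<in> I" "y \<in> V" shows "x \<otimes> y \<in> I" "y \<otimes> x \<in> I"
proof -
  obtain v where v: "x = t \<otimes> v" "v \<in> V" using assms(1) by (auto simp: I_def)
  then have "x \<otimes> y = t \<otimes> (v \<otimes> y)" using assms(2) by (simp add: m_assoc)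
  then show "x \<otimes> y \<in> I" using I_I[of "v \<otimes> y"] v assms(2) by simp
  then show "y \<otimes> x \<in> I" using assms by (simp add: m_comm)
qed

lemma I_neg: "x \<in> I \<Longrightarrow> \<ominus> x \<in> I"
  using I_mult(1)[of x "\<ominus> \<one>"] by (simp add: r_minus)

lemma I_one: "\<one> \<notin> I" using t_nonunit by (metis I_def imageE)

lemma I_prime: "x \<in> V \<Longrightarrow> y \<in> V \<Longrightarrow> x \<otimes> y \<in> I \<Longrightarrow> x \<in> I \<or> y \<in> I"
  unfolding I_def using t_prime by blast

lemma I_pow: "x \<in> V \<Longrightarrow> x [^] (n::nat) \<in> I \<Longrightarrow> x \<in> I"
proof (induction n)
  case (Suc n)
  then show ?case using I_prime[of "x [^] n" x] by auto
qed (simp add: I_one)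

lemma I_A: "x \<in> A \<Longrightarrow> x \<in> I \<Longrightarrow> \<exists>y\<in>A. x = t \<otimes> y"
  unfolding I_def using t_contract by blast

lemma I_t: "0 < n \<Longrightarrow> x \<in> V \<Longrightarrow> t [^] (n::nat) \<otimes> x \<in> I"
  using I_I[of "t [^] (n - 1) \<otimes> x"] by (cases n) (auto simp: m_ac)

lemma I_finsum: "(\<And>i. i \<in> B \<Longrightarrow> f i \<in> I) \<Longrightarrow> (\<Oplus>i\<in>B. f i) \<in> I"
proof (induction B rule: infinite_finite_induct)
  case (insert b B)
  then have "f \<in> B \<rightarrow> carrier L" by auto
  then show ?case using insert by (simp add: I_add)
qed auto

lemma eqv_V: "x \<asymp> y \<Longrightarrow> x \<in> V" "x \<asymp> y \<Longrightarrow> y \<in> V" by (auto simp: eqv_def)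

lemma eqv_refl: "x \<in> V \<Longrightarrow> x \<asymp> x" by (simp add: eqv_def a_minus_def r_neg)

lemma eqv_sym: "x \<asymp> y \<Longrightarrow> y \<asymp> x"
  using I_neg[of "x \<ominus> y"] diff_swap[of x y] by (auto simp: eqv_def)

lemma eqv_trans [trans]: "x \<asymp> y \<Longrightarrow> y \<asymp> z \<Longrightarrow> x \<asymp> z"
  using I_add[of "x \<ominus> y" "y \<ominus> z"] diff_trans[of x y z] by (auto simp: eqv_def)

lemma eqv_add: "x \<asymp> y \<Longrightarrow> x' \<asymp> y' \<Longrightarrow> x \<oplus> x' \<asymp> y \<oplus> y'"
  using I_add[of "x \<ominus> y" "x' \<ominus> y'"] diff_add_swap[of x y x' y'] by (auto simp: eqv_def)

lemma eqv_mult: "x \<asymp> y \<Longrightarrow> x' \<asymp> y' \<Longrightarrow> x \<otimes> x' \<asymp> y \<otimes> y'"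
  using I_add[of "(x \<ominus> y) \<otimes> x'" "y \<otimes> (x' \<ominus> y')"] diff_mult_split[of x y x' y'] I_mult
  by (auto simp: eqv_def)

lemma eqv_neg: "x \<asymp> y \<Longrightarrow> \<ominus> x \<asymp> \<ominus> y"
  using eqv_mult[of "\<ominus> \<one>" "\<ominus> \<one>" x y] eqv_V[of x y] by (simp add: eqv_refl l_minus)

lemma eqv_minus: "x \<asymp> y \<Longrightarrow> x' \<asymp> y' \<Longrightarrow> x \<ominus> x' \<asymp> y \<ominus> y'"
  unfolding a_minus_def by (intro eqv_add eqv_neg)

lemma eqv_pow: "x \<asymp> y \<Longrightarrow> x [^] (n::nat) \<asymp> y [^] n"
  by (induction n) (auto intro: eqv_mult eqv_refl)

lemma eqv_finsum: "(\<And>i. i \<in> B \<Longrightarrow> f i \<asymp> g i) \<Longrightarrow> (\<Oplus>i\<in>B. f i) \<asymp> (\<Oplus>i\<in>B. g i)"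
proof (induction B rule: infinite_finite_induct)
  case (insert b B)
  have e: "f i \<asymp> g i" if "i \<in> insert b B" for i using insert.prems that .
  have c: "f i \<in> carrier L" "g i \<in> carrier L" if "i \<in> insert b B" for i
    using eqv_V[OF e[OF that]] by simp_all
  have "(\<Oplus>i\<in>B. f i) \<asymp> (\<Oplus>i\<in>B. g i)" by (rule insert.IH) (use e in blast)
  then have "f b \<oplus> (\<Oplus>i\<in>B. f i) \<asymp> g b \<oplus> (\<Oplus>i\<in>B. g i)" using eqv_add e by blast
  then show ?case using insert.hyps c by (simp add: Pi_def)
qed (auto intro: eqv_refl)

lemma eqv_zero: "x \<asymp> \<zero> \<longleftrightarrow> x \<in> I"
  by (auto simp: eqv_def a_minus_def)

lemma eqv_I: "x \<asymp> y \<Longrightarrow> x \<in> I \<longleftrightarrow> y \<in> I"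
  using eqv_zero eqv_trans eqv_sym by blast

lemma eqvI: "y \<in> V \<Longrightarrow> v \<in> I \<Longrightarrow> x = y \<oplus> v \<Longrightarrow> x \<asymp> y"
  using eqv_add[of y y v \<zero>] eqv_refl[of y] eqv_zero[of v] by simp

lemma t_cancel: "x \<in> carrier L \<Longrightarrow> y \<in> carrier L \<Longrightarrow> t [^] (n::nat) \<otimes> x = t [^] n \<otimes> y \<Longrightarrow> x = y"
  using Units_l_cancel Units_pow_closed[OF t_unit, of n] by blast

text \<open>With the larger of two different exponents, the multiple of \<open>z\<close> would be a
  positive power of \<open>t\<close> times an element of \<open>V\<close>, hence in
  \<open>I\<close>.\<close>

lemma t_exponent_unique:
  assumes "z \<in> carrier L" "t [^] (a::nat) \<otimes> z \<in> V" "t [^] a \<otimes> z \<notin> I" "t [^] (b::nat) \<otimes> z \<in> V" "t [^] b \<otimes> z \<notin> I"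
  shows "a = b"
proof (rule ccontr)
  have *: "t [^] b \<otimes> z \<in> I" if "a < b" "t [^] (a::nat) \<otimes> z \<in> V" for a b :: nat
  proof -
    have "t [^] b \<otimes> z = t [^] (b - a) \<otimes> (t [^] a \<otimes> z)"
      using that assms(1) by (simp add: m_assoc[symmetric] nat_pow_mult)
    then show ?thesis using I_t[of "b - a"] that by simp
  qed
  assume "a \<noteq> b"
  then show False using *[of a b] *[of b a] assms by (meson nat_neq_iff)
qed

lemma p_ge_2: "p \<ge> 2" using prime_p prime_ge_2_nat by auto

lemma p_mult: "p * k = k * (p - 1) + k"
  using p_pos by (cases p) (simp_all add: algebra_simps)

text \<open>Take the least \<open>n\<close> with \<open>t^n z\<close> in \<open>V\<close>. If
  \<open>n > 0\<close>, the equation puts the \<open>p\<close>-th power of \<open>t^n z\<close> into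
  \<open>t V\<close>; as \<open>t\<close> is prime, a factor \<open>t\<close> can be removed from
  \<open>t^n z\<close>, against minimality.\<close>

lemma V_root:
  assumes z: "z \<in> carrier L" and eq: "z [^] p = x \<otimes> z \<oplus> y" and xy: "x \<in> V" "y \<in> V"
  shows "z \<in> V"
proof -
  define n where "n = (LEAST n::nat. t [^] n \<otimes> z \<in> V)"
  have n: "t [^] n \<otimes> z \<in> V" unfolding n_def using t_generates[OF z] by (rule LeastI_ex)
  have min: "t [^] k \<otimes> z \<notin> V" if "k < n" for k using not_less_Least[OF that[unfolded n_def]] .
  show ?thesis
  proof (cases n)
    case 0
    then show ?thesis using n z by simp
  next
    case (Suc k)
    define w where "w = t [^] n \<otimes> z"
    have e1: "n * p = n * (p - 1) + n" and e2: "n * (p - 1) > 0" "n * p > 0"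
      using p_mult[of n] p_ge_2 Suc by (auto simp: mult.commute)
    have "w [^] p = t [^] (n * p) \<otimes> z [^] p"
      using z by (simp add: w_def nat_pow_distrib nat_pow_pow)
    also have "\<dots> = t [^] (n * (p - 1)) \<otimes> (x \<otimes> w) \<oplus> t [^] (n * p) \<otimes> y"
    proof -
      have "t [^] (n * p) \<otimes> (x \<otimes> z) = t [^] (n * (p - 1)) \<otimes> (x \<otimes> w)"
        unfolding e1 w_def nat_pow_mult[OF t_carrier, symmetric] using z xy by (simp add: m_ac)
      then show ?thesis unfolding eq using z xy by (simp add: r_distr)
    qed
    also have "\<dots> \<in> I" using e2 xy n by (intro I_add I_t) (simp_all add: w_def)
    finally have "w \<in> I" using I_pow n w_def by blast
    then obtain v where v: "v \<in> V" "w = t \<otimes> v" by (auto simp: I_def)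
    have "t [^] (1::nat) \<otimes> (t [^] k \<otimes> z) = t [^] (1::nat) \<otimes> v"
      using v z Suc by (simp add: w_def m_ac)
    then have "t [^] k \<otimes> z = v" using t_cancel z v by (metis V_carrier m_closed nat_pow_closed t_carrier)
    then show ?thesis using min[of k] Suc v by simp
  qed
qed

end


section \<open>Extensions given by Witt equations\<close>

lemma (in cring) witt_carry_scaled:
  assumes [simp]: "x \<in> carrier R" "y \<in> carrier R" "z \<in> carrier R"
  shows "z \<otimes> witt_carry p R x y = (\<Oplus>k\<in>{1..p - 1}. add_pow R ((p choose k) div p) (z \<otimes> (x [^] k \<otimes> y [^] (p - k))))"
proof -
  have "z \<otimes> witt_carry p R x y = (\<Oplus>k\<in>{1..p - 1}. z \<otimes> add_pow R ((p choose k) div p) (x [^] k \<otimes> y [^] (p - k)))"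
    unfolding witt_carry_def by (rule finsum_rdistr) auto
  also have "\<dots> = (\<Oplus>k\<in>{1..p - 1}. add_pow R ((p choose k) div p) (z \<otimes> (x [^] k \<otimes> y [^] (p - k))))"
    by (rule finsum_cong') (auto simp: add_pow_rdistr)
  finally show ?thesis .
qed

lemma (in cring) witt_carry_closed [simp]:
  "x \<in> carrier R \<Longrightarrow> y \<in> carrier R \<Longrightarrow> witt_carry p R x y \<in> carrier R"
  unfolding witt_carry_def by (rule finsum_closed) auto

text \<open>Both components of the Witt equation are multiplied by the power of \<open>t\<close>
  that clears denominators. For the second the exponent is the one in the inequality between
  \<open>m1\<close> and \<open>m2\<close>; thus \<open>c0\<close> stands for
  \<open>t^(N + m2) a2\<close>, an element of \<open>A\<close>. The \<open>p\<close>-independence is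
  assumed for every \<open>g\<close> because it is applied both to \<open>a1\<close> and to
  \<open>g2\<close>.\<close>

locale witt_extension = valued L p V A t for L (structure) and p V A t +
  fixes a1 c0 T1 T2 :: 'a and m1 :: nat
  assumes m1: "m1 > 0" and a1: "a1 \<in> A" and c0: "c0 \<in> A"
    and nonpower: "\<And>y s. y \<in> A \<Longrightarrow> s \<in> A \<Longrightarrow> y [^] p \<asymp> a1 \<otimes> s [^] p \<Longrightarrow> s \<in> I"
    and p_independent: "\<And>g b j. g \<in> A \<Longrightarrow> (\<And>y s. y \<in> A \<Longrightarrow> s \<in> A \<Longrightarrow> y [^] p \<asymp> g \<otimes> s [^] p \<Longrightarrow> s \<in> I)
      \<Longrightarrow> (\<And>j. j < p \<Longrightarrow> b j \<in> A) \<Longrightarrow> (\<Oplus>j\<in>{..<p}. b j [^] p \<otimes> g [^] j) \<in> I \<Longrightarrow> j < p \<Longrightarrow> b j \<in> I"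
    and T1: "T1 \<in> carrier L" and T2: "T2 \<in> carrier L"
    and eq1: "t [^] (p * m1) \<otimes> (T1 [^] p \<ominus> T1) = a1"
    and eq2: "t [^] (m1 * (p * (p - 1) + 1)) \<otimes> (T2 [^] p \<ominus> T2 \<ominus> witt_carry p L (T1 [^] p) (\<ominus> T1)) = c0"
    and gen: "\<And>S. subring S L \<Longrightarrow> A \<subseteq> S \<Longrightarrow> inv t \<in> S \<Longrightarrow> T1 \<in> S \<Longrightarrow> T2 \<in> S \<Longrightarrow> S = carrier L"
begin

section \<open>Integral generators and their leading terms\<close>

definition N :: nat where "N = m1 * (p * (p - 1) + 1)"
definition Z1 :: 'a where "Z1 = t [^] m1 \<otimes> T1"

lemma Z1_carrier [simp]: "Z1 \<in> carrier L" using T1 by (simp add: Z1_def)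
lemma a1_V [simp]: "a1 \<in> V" "a1 \<in> A" using a1 by auto
lemma c0_V [simp]: "c0 \<in> V" "c0 \<in> A" using c0 by auto
declare T1 [simp] T2 [simp]

lemma t_Z1: "t [^] (e + m1 * k) \<otimes> T1 [^] k = t [^] (e::nat) \<otimes> Z1 [^] (k::nat)"
  by (simp add: Z1_def nat_pow_distrib nat_pow_pow nat_pow_mult[symmetric] m_assoc)

lemma Z1_pow: "Z1 [^] p = t [^] (m1 * (p - 1)) \<otimes> Z1 \<oplus> a1"
proof -
  have e: "p * m1 = m1 * (p - 1) + m1"
    by (rule p_mult)
  have 1: "Z1 [^] p = t [^] (p * m1) \<otimes> T1 [^] p"
    using t_Z1[of 0 p] by (simp add: mult.commute)
  have 2: "t [^] (m1 * (p - 1)) \<otimes> Z1 = t [^] (p * m1) \<otimes> T1"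
    unfolding e using t_Z1[of "m1 * (p - 1)" 1] by simp
  have 3: "a1 = t [^] (p * m1) \<otimes> T1 [^] p \<ominus> t [^] (p * m1) \<otimes> T1"
    unfolding eq1[symmetric] by (simp add: a_minus_def r_distr r_minus)
  show ?thesis unfolding 1 2 3 using diff_add_cancel[of "t [^] (p * m1) \<otimes> T1 [^] p" "t [^] (p * m1) \<otimes> T1"] by simp
qed

lemma Z1_V [simp]: "Z1 \<in> V"
  by (rule V_root[OF _ Z1_pow]) auto

lemma Z1_p: "Z1 [^] p \<asymp> a1"
  by (rule eqvI[of _ "t [^] (m1 * (p - 1)) \<otimes> Z1"])
    (use m1 p_ge_2 in \<open>auto simp: Z1_pow a_comm intro!: I_t\<close>)

text \<open>Otherwise \<open>0^p\<close> would be congruent to \<open>a1\<close> times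
  \<open>1^p\<close>, and \<open>nonpower\<close> would put 1 into \<open>I\<close>.\<close>

lemma a1_I: "a1 \<notin> I"
proof
  assume "a1 \<in> I"
  then have "\<zero> [^] p \<asymp> a1 \<otimes> \<one> [^] p"
    using eqv_sym[of a1 \<zero>] p_pos by (simp add: eqv_zero nat_pow_zero)
  then show False using nonpower[of \<zero> \<one>] I_one by simp
qed

text \<open>The \<open>k\<close>-th term of the carry of \<open>T1^p\<close> and
  \<open>- T1\<close>, scaled by \<open>t^N\<close> and written in \<open>Z1\<close>. The remaining
  exponent of \<open>t\<close> is \<open>N - m1 (p k + p - k) = m1 (p - 1) (p - 1 - k)\<close>,
  which vanishes only for \<open>k = p - 1\<close>.\<close>

definition W_term :: "nat \<Rightarrow> 'a" where
  "W_term k = add_pow L ((p choose k) div p)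
     ((\<ominus> \<one>) [^] (p - k) \<otimes> (t [^] (m1 * ((p - 1) * (p - 1 - k))) \<otimes> Z1 [^] (p * k + (p - k))))"

definition W :: 'a where "W = (\<Oplus>k\<in>{1..p - 1}. W_term k)"

lemma W_term_subring:
  assumes "subring S L" "A \<subseteq> S" "Z1 \<in> S"
  shows "W_term k \<in> S"
proof -
  have "t \<in> S" using t_A assms by blast
  then show ?thesis unfolding W_term_def
    by (intro subring_add_pow subringE(6)[OF assms(1)] subring_pow subringE(5)[OF assms(1)] subringE(3)[OF assms(1)] assms)
qed

lemma W_subring: "subring S L \<Longrightarrow> A \<subseteq> S \<Longrightarrow> Z1 \<in> S \<Longrightarrow> W \<in> S"
  unfolding W_def by (intro subring_finsum W_term_subring)

lemma W_V [simp]: "W_term k \<in> V" "W \<in> V"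
  using W_term_subring[OF V A_V] W_subring[OF V A_V] by auto

lemma carry_W: "t [^] N \<otimes> witt_carry p L (T1 [^] p) (\<ominus> T1) = W"
  unfolding W_def
proof (subst witt_carry_scaled, simp_all, rule finsum_cong'[OF refl])
  fix k assume k: "k \<in> {Suc 0..p - Suc 0}"
  have "N = m1 * ((p - 1) * (p - 1 - k)) + m1 * (p * k + (p - k))"
  proof -
    obtain q where q: "p = Suc q" using p_pos by (cases p) auto
    obtain r where r: "q = k + r" using k q by (metis atLeastAtMost_iff diff_Suc_1 One_nat_def le_Suc_ex)
    have "m1 * (p * (p - 1) + 1) = m1 * ((p - 1) * (p - 1 - k)) + m1 * (p * k + (p - k))"
      unfolding q r by (simp add: algebra_simps)
    then show ?thesis unfolding N_def .
  qed
  then have "t [^] N \<otimes> T1 [^] (p * k + (p - k)) = t [^] (m1 * ((p - 1) * (p - 1 - k))) \<otimes> Z1 [^] (p * k + (p - k))"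
    using t_Z1 by metis
  moreover have "t [^] N \<otimes> ((T1 [^] p) [^] k \<otimes> (\<ominus> T1) [^] (p - k)) = (\<ominus> \<one>) [^] (p - k) \<otimes> (t [^] N \<otimes> T1 [^] (p * k + (p - k)))"
    by (simp add: minus_pow[of T1] nat_pow_pow nat_pow_mult[symmetric] m_ac)
  ultimately show "add_pow L ((p choose k) div p) (t [^] N \<otimes> ((T1 [^] p) [^] k \<otimes> (\<ominus> T1) [^] (p - k))) = W_term k"
    by (simp add: W_term_def)
qed auto

text \<open>Modulo \<open>t\<close> only the term \<open>k = p - 1\<close> survives. Its coefficient
  is \<open>p div p = 1\<close>, its sign comes from a single factor \<open>- 1\<close>, and its
  power of \<open>Z1\<close> is \<open>(Z1^p)^(p - 1) Z1\<close>.\<close>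

lemma W_eqv: "W \<asymp> \<ominus> (a1 [^] (p - 1) \<otimes> Z1)"
proof -
  have set: "{1..p - 1} = insert (p - 1) {1..p - 2}" using p_ge_2 by auto
  have top: "W_term (p - 1) = \<ominus> ((Z1 [^] p) [^] (p - 1) \<otimes> Z1)"
  proof -
    have "p choose (p - 1) = p" using binomial_symmetric[of "p - 1" p] p_ge_2 by simp
    moreover have "p - (p - 1) = 1" using p_ge_2 by simp
    ultimately show ?thesis
      using p_pos unfolding W_term_def by (simp add: nat_pow_pow l_minus)
  qed
  have rest: "(\<Oplus>k\<in>{1..p - 2}. W_term k) \<in> I"
  proof (rule I_finsum)
    fix k assume k: "k \<in> {1..p - 2}"
    then have e: "m1 * ((p - 1) * (p - 1 - k)) > 0" using m1 by auto
    have 1: "add_pow L n (s \<otimes> (u \<otimes> v)) = (u \<otimes> v) \<otimes> add_pow L n s"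
      if "s \<in> V" "u \<in> V" "v \<in> V" for n :: nat and s u v
      using that add_pow_rdistr[of "u \<otimes> v" s n] by (simp add: m_ac)
    have 2: "t [^] (m1 * ((p - 1) * (p - 1 - k))) \<otimes> Z1 [^] (p * k + (p - k)) \<in> I"
      by (rule I_t[OF e]) simp
    have 3: "(\<ominus> \<one>) [^] (p - k) \<in> V" by simp
    show "W_term k \<in> I" unfolding W_term_def
      by (subst 1[OF 3]) (rule V_closed(7)[OF t_V], rule V_closed(7)[OF Z1_V], rule I_mult(1)[OF 2 V_closed(8)[OF 3]])
  qed
  have "W = W_term (p - 1) \<oplus> (\<Oplus>k\<in>{1..p - 2}. W_term k)"
    unfolding W_def set by (subst finsum_insert) (use p_ge_2 in auto)
  also have "\<dots> \<asymp> \<ominus> (a1 [^] (p - 1) \<otimes> Z1) \<oplus> \<zero>"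
    unfolding top using rest by (intro eqv_add eqv_neg eqv_mult eqv_pow Z1_p eqv_refl) (auto simp: eqv_zero)
  finally show ?thesis by simp
qed

text \<open>The right-hand side of the scaled equation for \<open>T2\<close> after the carry has
  been moved across; this is how \<open>Z1\<close> enters it.\<close>

definition c :: 'a where "c = c0 \<oplus> W"

lemma c_V [simp]: "c \<in> V" by (simp add: c_def)

lemma c_eq: "t [^] N \<otimes> (T2 [^] p \<ominus> T2) = c"
proof -
  have "c0 = t [^] N \<otimes> (T2 [^] p \<ominus> T2) \<ominus> W"
    unfolding eq2[symmetric] carry_W[symmetric] N_def[symmetric] by (simp add: a_minus_def r_distr r_minus)
  then show ?thesis unfolding c_def
    using diff_add_cancel[of "t [^] N \<otimes> (T2 [^] p \<ominus> T2)" W] by (simp add: a_comm)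
qed

lemma c_eqv: "c \<asymp> c0 \<ominus> a1 [^] (p - 1) \<otimes> Z1"
  unfolding c_def a_minus_def by (intro eqv_add W_eqv eqv_refl) simp

text \<open>The residue of \<open>a1^(p - 1) Z1\<close> has \<open>p\<close>-th power
  \<open>a1\<close> up to a \<open>p\<close>-th power from \<open>A\<close>. The non-power property
  of \<open>a1\<close> thereby passes to \<open>c\<close> and to \<open>g2\<close>.\<close>

lemma power_eqv: "(a1 [^] (p - 1) \<otimes> Z1) [^] p \<asymp> a1 \<otimes> (a1 [^] (p - 1)) [^] p"
proof -
  have "(a1 [^] (p - 1) \<otimes> Z1) [^] p = Z1 [^] p \<otimes> (a1 [^] (p - 1)) [^] p"
    by (simp add: nat_pow_distrib m_comm)
  also have "\<dots> \<asymp> a1 \<otimes> (a1 [^] (p - 1)) [^] p"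
    by (intro eqv_mult Z1_p eqv_refl) simp
  finally show ?thesis .
qed

text \<open>If \<open>c\<close> vanished modulo \<open>t\<close>, then \<open>c0\<close> would be
  congruent to \<open>a1^(p - 1) Z1\<close>, and taking \<open>p\<close>-th powers would make
  \<open>a1\<close> a quotient of \<open>p\<close>-th powers in \<open>A\<close> modulo
  \<open>t\<close>.\<close>

lemma c_I: "c \<notin> I"
proof
  assume "c \<in> I"
  then have "c0 \<ominus> a1 [^] (p - 1) \<otimes> Z1 \<in> I" using eqv_I[OF c_eqv] by simp
  then have "c0 \<asymp> a1 [^] (p - 1) \<otimes> Z1" by (simp add: eqv_def)
  then have "c0 [^] p \<asymp> a1 \<otimes> (a1 [^] (p - 1)) [^] p"
    using eqv_pow power_eqv eqv_trans by blast
  then have "a1 [^] (p - 1) \<in> I" by (intro nonpower[of c0]) auto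
  then show False using I_pow[of a1 "p - 1"] a1_I by simp
qed

text \<open>For the least \<open>n\<close> with \<open>w = t^n T2\<close> in \<open>V\<close>, the
  element \<open>w\<close> is not in \<open>I\<close>, and \<open>t^(p n) (T2^p - T2)\<close> is
  congruent to \<open>w^p\<close>. But \<open>t^N (T2^p - T2) = c\<close> is not in \<open>I\<close>
  either, so the two exponents agree.\<close>

lemma T2_exponent: "\<exists>n. p * n = N \<and> t [^] n \<otimes> T2 \<in> V"
proof -
  define n where "n = (LEAST n::nat. t [^] n \<otimes> T2 \<in> V)"
  have n: "t [^] n \<otimes> T2 \<in> V" unfolding n_def using t_generates[OF T2] by (rule LeastI_ex)
  have min: "t [^] k \<otimes> T2 \<notin> V" if "k < n" for k using not_less_Least[OF that[unfolded n_def]] .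
  have N0: "N > 0" using m1 by (simp add: N_def)
  \<comment> \<open>If \<open>T2\<close> itself were in \<open>V\<close>, then \<open>c\<close>
    would be a multiple of \<open>t\<close>, since \<open>N > 0\<close>.\<close>
  have "n \<noteq> 0"
  proof
    assume "n = 0"
    then have "T2 [^] p \<ominus> T2 \<in> V" using n by simp
    then show False using c_I c_eq I_t[OF N0] by metis
  qed
  then obtain k where k: "n = Suc k" using not0_implies_Suc by blast
  define w where "w = t [^] n \<otimes> T2"
  have w: "w \<in> V" "w \<notin> I"
  proof -
    show "w \<in> V" using n by (simp add: w_def)
    show "w \<notin> I"
    proof
      assume "w \<in> I"
      then obtain v where v: "v \<in> V" "w = t \<otimes> v" by (auto simp: I_def)
      have "t [^] (1::nat) \<otimes> (t [^] k \<otimes> T2) = t [^] (1::nat) \<otimes> v"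
        using v k by (simp add: w_def m_ac)
      then have "t [^] k \<otimes> T2 = v" using t_cancel v by (metis T2 V_carrier m_closed nat_pow_closed t_carrier)
      then show False using min[of k] k v by simp
    qed
  qed
  have e: "p * n = n * (p - 1) + n" "n * (p - 1) > 0"
    using p_mult p_ge_2 k by auto
  have "t [^] (p * n) \<otimes> (T2 [^] p \<ominus> T2) = w [^] p \<ominus> t [^] (n * (p - 1)) \<otimes> w"
  proof -
    have "w [^] p = t [^] (p * n) \<otimes> T2 [^] p"
      by (simp add: w_def nat_pow_distrib nat_pow_pow mult.commute)
    moreover have "t [^] (n * (p - 1)) \<otimes> w = t [^] (p * n) \<otimes> T2"
      unfolding e(1) w_def by (simp add: nat_pow_mult[symmetric] m_assoc)
    ultimately show ?thesis by (simp add: a_minus_def r_distr r_minus)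
  qed
  also have "\<dots> \<asymp> w [^] p \<ominus> \<zero>"
    using w e by (intro eqv_minus eqv_refl) (auto simp: eqv_zero intro!: I_t)
  finally have "t [^] (p * n) \<otimes> (T2 [^] p \<ominus> T2) \<asymp> w [^] p" using w by (simp add: a_minus_def)
  moreover have "w [^] p \<notin> I" using w I_pow by blast
  ultimately have "p * n = N"
    using c_eq c_I by (intro t_exponent_unique[of "T2 [^] p \<ominus> T2"]) (auto simp: eqv_I eqv_V)
  then show ?thesis using n by blast
qed

definition m :: nat where "m = m1 div p"
definition n :: nat where "n = m * (p * (p - 1) + 1)"
definition Z2 :: 'a where "Z2 = t [^] n \<otimes> T2"

text \<open>The factor \<open>p (p - 1) + 1\<close> of \<open>N\<close> is congruent to 1 modulo
  \<open>p\<close>, so the divisibility of \<open>N\<close> by \<open>p\<close> forces that of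
  \<open>m1\<close>.\<close>

lemma m1_m: "m1 = p * m" and m_pos: "m > 0" and N_n: "N = p * n" and Z2_V [simp]: "Z2 \<in> V"
proof -
  obtain k where k: "p * k = N" "t [^] k \<otimes> T2 \<in> V" using T2_exponent by blast
  have "p dvd m1 * (p * (p - 1) + 1)" using k(1) unfolding N_def by (metis dvd_triv_left)
  moreover have "coprime p (p * (p - 1) + 1)"
    by (metis coprime_1_right coprime_iff_gcd_eq_1 gcd_add_mult mult.commute add.commute)
  ultimately have "p dvd m1" using coprime_dvd_mult_left_iff by blast
  then show m1m: "m1 = p * m" by (simp add: m_def)
  then show "m > 0" using m1 by (cases m) auto
  have "m1 * (p * (p - 1) + 1) = p * m * (p * (p - 1) + 1)" by (rule arg_cong[OF m1m])
  then show N: "N = p * n" unfolding N_def n_def by (simp only: mult.assoc)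
  then have "k = n" using k p_pos by simp
  then show "Z2 \<in> V" using k by (simp add: Z2_def)
qed

text \<open>This equation separates the two scales: it gives
  \<open>t^n T1^(p - 1) = t^m Z1^(p - 1)\<close>.\<close>

lemma n_eq: "n = m1 * (p - 1) + m"
proof -
  have "m1 * (p - 1) = p * m * (p - 1)" by (rule arg_cong[OF m1_m])
  then show ?thesis unfolding n_def by (simp add: algebra_simps)
qed

lemma Z2_pow: "Z2 [^] p = t [^] (n * (p - 1)) \<otimes> Z2 \<oplus> c"
proof -
  have e: "p * n = n * (p - 1) + n"
    by (rule p_mult)
  have 1: "Z2 [^] p = t [^] (p * n) \<otimes> T2 [^] p"
    by (simp add: Z2_def nat_pow_distrib nat_pow_pow mult.commute)
  have 2: "t [^] (n * (p - 1)) \<otimes> Z2 = t [^] (p * n) \<otimes> T2"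
    unfolding e Z2_def by (simp add: nat_pow_mult[symmetric] m_assoc)
  have 3: "c = t [^] (p * n) \<otimes> T2 [^] p \<ominus> t [^] (p * n) \<otimes> T2"
    unfolding c_eq[symmetric] N_n by (simp add: a_minus_def r_distr r_minus)
  show ?thesis unfolding 1 2 3
    using diff_add_cancel[of "t [^] (p * n) \<otimes> T2 [^] p" "t [^] (p * n) \<otimes> T2"] by simp
qed

lemma n_pos: "n > 0" using m_pos by (simp add: n_def)

text \<open>A representative in \<open>A\<close> of the residue class of the \<open>p^2\<close>-th
  power of \<open>Z2\<close>. The first \<open>p\<close>-th power still involves \<open>Z1\<close>;
  only the second one is congruent to an element of \<open>A\<close>.\<close>

definition g2 :: 'a where "g2 = c0 [^] p \<ominus> a1 \<otimes> (a1 [^] (p - 1)) [^] p"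

lemma g2_A [simp]: "g2 \<in> A" "g2 \<in> V" by (auto simp: g2_def)

lemma Z2_pp: "(Z2 [^] p) [^] p \<asymp> g2"
proof -
  have "Z2 [^] p \<asymp> c"
    by (rule eqvI[of _ "t [^] (n * (p - 1)) \<otimes> Z2"])
      (use n_pos p_ge_2 in \<open>auto simp: Z2_pow a_comm intro!: I_t\<close>)
  also note c_eqv
  finally have "(Z2 [^] p) [^] p \<asymp> (c0 \<ominus> a1 [^] (p - 1) \<otimes> Z1) [^] p" by (rule eqv_pow)
  also have "\<dots> = c0 [^] p \<ominus> (a1 [^] (p - 1) \<otimes> Z1) [^] p" by (simp add: frob_diff)
  also have "\<dots> \<asymp> g2" unfolding g2_def by (intro eqv_minus eqv_refl power_eqv) simp
  finally show ?thesis .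
qed

text \<open>\<open>g2\<close> is the \<open>p\<close>-th power of \<open>c0\<close> minus
  \<open>a1\<close> times a \<open>p\<close>-th power. As Frobenius is additive, a
  \<open>p\<close>-th power congruent to \<open>g2 s^p\<close> yields one congruent to
  \<open>a1\<close> times a \<open>p\<close>-th power.\<close>

lemma g2_nonpower:
  assumes ys: "y \<in> A" "s \<in> A" and e: "y [^] p \<asymp> g2 \<otimes> s [^] p"
  shows "s \<in> I"
proof -
  have "g2 \<otimes> s [^] p = (c0 \<otimes> s) [^] p \<ominus> a1 \<otimes> (a1 [^] (p - 1) \<otimes> s) [^] p"
    using ys by (simp add: g2_def a_minus_def l_distr l_minus nat_pow_distrib m_assoc)
  then have "(c0 \<otimes> s) [^] p \<ominus> y [^] p \<asymp> (c0 \<otimes> s) [^] p \<ominus> ((c0 \<otimes> s) [^] p \<ominus> a1 \<otimes> (a1 [^] (p - 1) \<otimes> s) [^] p)"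
    using e ys by (intro eqv_minus eqv_refl) auto
  moreover have "u \<ominus> (u \<ominus> v) = v" if "u \<in> carrier L" "v \<in> carrier L" for u v
    using that by algebra
  ultimately have "(c0 \<otimes> s \<ominus> y) [^] p \<asymp> a1 \<otimes> (a1 [^] (p - 1) \<otimes> s) [^] p"
    using ys by (simp add: frob_diff)
  then have "a1 [^] (p - 1) \<otimes> s \<in> I" using ys by (intro nonpower[of "c0 \<otimes> s \<ominus> y"]) auto
  then have "a1 [^] (p - 1) \<in> I \<or> s \<in> I" using I_prime[of "a1 [^] (p - 1)" s] ys by simp
  then show ?thesis using a1_I I_pow[of a1 "p - 1"] by auto
qed

section \<open>Elements of \<open>V\<close> as polynomials in the two generators\<close>

definition D1 :: "'a set" where "D1 = {(\<Oplus>i\<in>{..<p}. f i \<otimes> Z1 [^] i) | f. f \<in> {..<p} \<rightarrow> A}"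
definition D :: "'a set" where "D = {(\<Oplus>i\<in>{..<p}. f i \<otimes> Z2 [^] i) | f. f \<in> {..<p} \<rightarrow> D1}"

lemma D1: "subring D1 L" "A \<subseteq> D1" "Z1 \<in> D1"
  unfolding D1_def
  by (rule adjoin_subring[OF A Z1_carrier p_pos(1) Z1_pow _ a1 p_ge_2], simp add: t_A)+

lemma D: "subring D L" "D1 \<subseteq> D" "Z2 \<in> D"
proof -
  have tD: "t [^] (n * (p - 1)) \<in> D1" using D1 t_A subring_pow[OF D1(1)] by blast
  have cD: "c \<in> D1" unfolding c_def using D1 c0 by (intro subringE(7)[OF D1(1)] W_subring) auto
  show "subring D L" "D1 \<subseteq> D" "Z2 \<in> D"
    unfolding D_def
    by (rule adjoin_subring[OF D1(1) V_carrier[OF Z2_V] p_pos(1) Z2_pow tD cD p_ge_2])+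
qed

text \<open>The elements that some power of \<open>t\<close> carries into \<open>D\<close> form a
  subring, and it contains all the generators of \<open>L\<close>.\<close>

lemma D_generates:
  assumes "x \<in> carrier L"
  shows "\<exists>k::nat. t [^] k \<otimes> x \<in> D"
proof -
  let ?S = "{x \<in> carrier L. \<exists>k::nat. t [^] k \<otimes> x \<in> D}"
  note Dm = subring_mem[OF D(1)]
  have tD: "t [^] (k::nat) \<in> D" for k using t_A D1 D subring_pow[OF D(1)] by blast
  have AD: "x \<in> ?S" if "x \<in> D" for x
    using that Dm[OF that] by (auto intro!: exI[of _ "0::nat"])
  have "subring ?S L"
  proof (rule subringI)
    show "\<one> \<in> ?S" by (rule AD[OF subringE(3)[OF D(1)]])
    fix x assume "x \<in> ?S"
    then show "\<ominus> x \<in> ?S" using subringE(5)[OF D(1)] by (force simp: r_minus)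
  next
    fix x y assume x: "x \<in> ?S" and y: "y \<in> ?S"
    then obtain k l where k: "t [^] (k::nat) \<otimes> x \<in> D" and l: "t [^] (l::nat) \<otimes> y \<in> D" by auto
    have c: "x \<in> carrier L" "y \<in> carrier L" using x y by auto
    have "t [^] (k + l) \<otimes> (x \<otimes> y) = (t [^] k \<otimes> x) \<otimes> (t [^] l \<otimes> y)"
      using c by (simp add: nat_pow_mult[symmetric] m_ac)
    then show "x \<otimes> y \<in> ?S" using c subringE(6)[OF D(1) k l] by (auto intro!: exI[of _ "k + l"])
    have "t [^] (k + l) \<otimes> (x \<oplus> y) = t [^] l \<otimes> (t [^] k \<otimes> x) \<oplus> t [^] k \<otimes> (t [^] l \<otimes> y)"
      using c by (simp add: nat_pow_mult[symmetric] m_ac r_distr)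
    then have "t [^] (k + l) \<otimes> (x \<oplus> y) \<in> D"
      using subringE(7)[OF D(1) subringE(6)[OF D(1) tD k] subringE(6)[OF D(1) tD l]] by simp
    then show "x \<oplus> y \<in> ?S" using c by blast
  qed auto
  moreover have "A \<subseteq> ?S" using AD D1 D by blast
  moreover have "inv t \<in> ?S"
    using t_unit subringE(3)[OF D(1)] by (auto intro!: exI[of _ "1::nat"])
  moreover have "T1 \<in> ?S" using D1 D by (auto simp: Z1_def intro!: exI[of _ m1])
  moreover have "T2 \<in> ?S" using D by (auto simp: Z2_def intro!: exI[of _ n])
  ultimately have "?S = carrier L" by (rule gen)
  then show ?thesis using assms by blast
qed

text \<open>Take the least \<open>k\<close> with \<open>t^k x\<close> in \<open>D\<close>. If
  \<open>k > 0\<close>, the expansion of \<open>t^k x\<close> vanishes modulo \<open>t\<close>. Its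
  \<open>p^2\<close>-th power is a relation between powers of \<open>g2\<close> with coefficients
  that are \<open>p\<close>-th powers from \<open>A\<close>; independence for \<open>g2\<close>
  kills these coefficients, and independence for \<open>a1\<close> kills the coordinates from which
  they are built. All coordinates are then divisible by \<open>t\<close> in \<open>A\<close>, which
  contradicts the choice of \<open>k\<close>.\<close>

lemma V_subset_D: "V \<subseteq> D"
proof
  fix x assume x: "x \<in> V"
  define k where "k = (LEAST k::nat. t [^] k \<otimes> x \<in> D)"
  have k: "t [^] k \<otimes> x \<in> D" unfolding k_def using D_generates[OF V_carrier[OF x]] by (rule LeastI_ex)
  have min: "t [^] j \<otimes> x \<notin> D" if "j < k" for j using not_less_Least[OF that[unfolded k_def]] .
  show "x \<in> D"
  proof (cases k)
    case 0
    then show ?thesis using k x by simp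
  next
    case (Suc l)
    obtain b where b: "t [^] k \<otimes> x = (\<Oplus>j\<in>{..<p}. b j \<otimes> Z2 [^] j)" "b \<in> {..<p} \<rightarrow> D1"
      using k by (auto simp: D_def)
    have "\<forall>j\<in>{..<p}. \<exists>f. b j = (\<Oplus>i\<in>{..<p}. f i \<otimes> Z1 [^] i) \<and> f \<in> {..<p} \<rightarrow> A"
      using b(2) by (auto simp: D1_def)
    then obtain a where a: "b j = (\<Oplus>i\<in>{..<p}. a j i \<otimes> Z1 [^] i)" "a j \<in> {..<p} \<rightarrow> A" if "j < p" for j
      by (metis lessThan_iff)
    have aA [simp]: "a j i \<in> A" if "j < p" "i < p" for i j using a(2) that by auto
    have bV [simp]: "b j \<in> V" if "j < p" for j
      unfolding a(1)[OF that] by (rule V_finsum) (use that in auto)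
    \<comment> \<open>A representative in \<open>A\<close> of the class of \<open>b j [^] p\<close>,
      obtained by replacing \<open>Z1^p\<close> with \<open>a1\<close>.\<close>
    define \<beta> where "\<beta> j = (\<Oplus>i\<in>{..<p}. a j i [^] p \<otimes> a1 [^] i)" for j
    have \<beta>A [simp]: "\<beta> j \<in> A" if "j < p" for j
      unfolding \<beta>_def by (rule A_finsum) (use that in auto)
    have b\<beta>: "b j [^] p \<asymp> \<beta> j" if j: "j < p" for j
    proof -
      have "b j [^] p = (\<Oplus>i\<in>{..<p}. (a j i \<otimes> Z1 [^] i) [^] p)"
        unfolding a(1)[OF j] by (rule frob_finsum) (use j in auto)
      also have "\<dots> = (\<Oplus>i\<in>{..<p}. a j i [^] p \<otimes> (Z1 [^] p) [^] i)"
        by (rule finsum_cong') (use j in \<open>auto simp: nat_pow_distrib nat_pow_pow mult.commute\<close>)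
      also have "\<dots> \<asymp> \<beta> j" unfolding \<beta>_def
        by (intro eqv_finsum eqv_mult eqv_refl eqv_pow Z1_p) (use j in auto)
      finally show ?thesis .
    qed
    have xI: "t [^] k \<otimes> x \<in> I" using Suc x by (intro I_t) auto
    have e1: "(t [^] k \<otimes> x) [^] p = (\<Oplus>j\<in>{..<p}. b j [^] p \<otimes> (Z2 [^] p) [^] j)"
    proof -
      have "(t [^] k \<otimes> x) [^] p = (\<Oplus>j\<in>{..<p}. (b j \<otimes> Z2 [^] j) [^] p)"
        unfolding b(1) by (rule frob_finsum) auto
      also have "\<dots> = (\<Oplus>j\<in>{..<p}. b j [^] p \<otimes> (Z2 [^] p) [^] j)"
        by (rule finsum_cong') (auto simp: nat_pow_distrib nat_pow_pow mult.commute)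
      finally show ?thesis .
    qed
    have "((t [^] k \<otimes> x) [^] p) [^] p = (\<Oplus>j\<in>{..<p}. (b j [^] p) [^] p \<otimes> ((Z2 [^] p) [^] p) [^] j)"
    proof -
      have "((t [^] k \<otimes> x) [^] p) [^] p = (\<Oplus>j\<in>{..<p}. (b j [^] p \<otimes> (Z2 [^] p) [^] j) [^] p)"
        unfolding e1 by (rule frob_finsum) auto
      also have "\<dots> = (\<Oplus>j\<in>{..<p}. (b j [^] p) [^] p \<otimes> ((Z2 [^] p) [^] p) [^] j)"
        by (rule finsum_cong') (auto simp: nat_pow_distrib nat_pow_pow mult.commute mult.left_commute)
      finally show ?thesis .
    qed
    also have "\<dots> \<asymp> (\<Oplus>j\<in>{..<p}. \<beta> j [^] p \<otimes> g2 [^] j)"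
      by (intro eqv_finsum eqv_mult eqv_pow Z2_pp b\<beta>) auto
    finally have \<beta>_sum: "(\<Oplus>j\<in>{..<p}. \<beta> j [^] p \<otimes> g2 [^] j) \<in> I"
    proof -
      assume *: "((t [^] k \<otimes> x) [^] p) [^] p \<asymp> (\<Oplus>j\<in>{..<p}. \<beta> j [^] p \<otimes> g2 [^] j)"
      have "y [^] p \<in> I" if "y \<in> I" for y
        using eqv_pow[of y \<zero> p] that p_pos by (simp add: eqv_zero nat_pow_zero)
      then show ?thesis using eqv_I[OF *] xI by blast
    qed
    have \<beta>I: "\<beta> j \<in> I" if "j < p" for j
      by (rule p_independent[where g = g2 and b = \<beta>]) (use g2_nonpower that \<beta>_sum in auto)
    have "a j i \<in> I" if "j < p" "i < p" for i j
      by (rule p_independent[where g = a1 and b = "a j"])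
        (use nonpower that \<beta>I[OF that(1)] in \<open>auto simp: \<beta>_def\<close>)
    \<comment> \<open>Divisibility by \<open>t\<close> in \<open>V\<close> is turned into
      divisibility in \<open>A\<close> by \<open>t_contract\<close>, so the quotient expansion again
      has coordinates in \<open>A\<close>.\<close>
    then have "\<forall>j i. \<exists>y. j < p \<longrightarrow> i < p \<longrightarrow> y \<in> A \<and> a j i = t \<otimes> y"
      using I_A aA by meson
    then obtain a' where a': "a' j i \<in> A" "a j i = t \<otimes> a' j i" if "j < p" "i < p" for j i
      by metis
    define b' where "b' j = (\<Oplus>i\<in>{..<p}. a' j i \<otimes> Z1 [^] i)" for j
    have b'D: "b' j \<in> D1" if "j < p" for j
      unfolding b'_def D1_def using a' that by blast
    have b'c: "b' j \<in> carrier L" if "j < p" for j using subring_mem[OF D1(1) b'D[OF that]] .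
    have bb': "b j = t \<otimes> b' j" if j: "j < p" for j
    proof -
      have "t \<otimes> b' j = (\<Oplus>i\<in>{..<p}. t \<otimes> (a' j i \<otimes> Z1 [^] i))"
        unfolding b'_def by (rule finsum_rdistr) (use a' j in auto)
      also have "\<dots> = b j" unfolding a(1)[OF j]
        by (rule finsum_cong') (use a' j in \<open>auto simp: m_assoc\<close>)
      finally show ?thesis by simp
    qed
    define x' where "x' = (\<Oplus>j\<in>{..<p}. b' j \<otimes> Z2 [^] j)"
    have x'D: "x' \<in> D" unfolding x'_def D_def using b'D by blast
    have "t \<otimes> x' = (\<Oplus>j\<in>{..<p}. t \<otimes> (b' j \<otimes> Z2 [^] j))"
      unfolding x'_def by (rule finsum_rdistr) (use b'c in auto)
    also have "\<dots> = t [^] k \<otimes> x" unfolding b(1)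
      by (rule finsum_cong') (use b'c bb' in \<open>auto simp: m_assoc\<close>)
    finally have "t [^] (1::nat) \<otimes> x' = t [^] (1::nat) \<otimes> (t [^] l \<otimes> x)"
      using Suc x subring_mem[OF D(1) x'D] by (simp add: m_ac)
    then have "x' = t [^] l \<otimes> x"
      by (rule t_cancel[rotated 2]) (use x subring_mem[OF D(1) x'D] in auto)
    then show ?thesis using min[of l] Suc x'D by simp
  qed
qed

end


section \<open>The action of the Galois group\<close>

lemma ring_hom_add_pow:
  assumes "cring R" "cring S" "h \<in> ring_hom R S" "x \<in> carrier R"
  shows "h (add_pow R (n::nat) x) = add_pow S n (h x)"
proof -
  interpret h: ring_hom_cring R S h using assms by (simp add: ring_hom_cring.intro ring_hom_cring_axioms.intro)
  show ?thesis using assms(4) by (induction n) simp_all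
qed

lemma ring_hom_carry:
  assumes "cring R" "cring S" and h: "h \<in> ring_hom R S" and [simp]: "x \<in> carrier R" "y \<in> carrier R"
  shows "h (witt_carry p R x y) = witt_carry p S (h x) (h y)"
proof -
  interpret h: ring_hom_cring R S h using assms by (simp add: ring_hom_cring.intro ring_hom_cring_axioms.intro)
  show ?thesis unfolding witt_carry_def
    by (simp add: comp_def Pi_def ring_hom_add_pow[OF assms(1-3)])
qed

text \<open>The sums of \<open>(i + 1)^(l + 1)\<close> and of \<open>i^(l + 1)\<close> over
  \<open>i < p\<close> differ by \<open>p^(l + 1)\<close>. The binomial theorem writes this
  difference as \<open>(l + 1)\<close> times the \<open>l\<close>-th power sum plus multiples of
  lower power sums, and \<open>l + 1\<close> is prime to \<open>p\<close>.\<close>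

lemma prime_dvd_power_sum:
  fixes p :: nat
  assumes p: "Factorial_Ring.prime p"
  shows "l + 1 < p \<Longrightarrow> p dvd (\<Sum>i<p. i ^ l)"
proof (induction l rule: less_induct)
  case (less l)
  let ?S = "\<lambda>j. \<Sum>i<p. i ^ j"
  have "(\<Sum>i<p. Suc i ^ Suc l) = (\<Sum>i<p. \<Sum>j\<le>Suc l. (Suc l choose j) * i ^ j)"
    using binomial[of _ 1 "Suc l"] by simp
  also have "\<dots> = (\<Sum>j\<le>Suc l. (Suc l choose j) * ?S j)"
    by (subst sum.swap) (simp add: sum_distrib_left)
  also have "\<dots> = ?S (Suc l) + (Suc l * ?S l + (\<Sum>j<l. (Suc l choose j) * ?S j))"
    by (simp add: lessThan_Suc_atMost[symmetric] del: sum.lessThan_Suc sum.atMost_Suc power_Suc)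
       (simp add: sum.lessThan_Suc)
  finally have 1: "(\<Sum>i<p. Suc i ^ Suc l) = ?S (Suc l) + (Suc l * ?S l + (\<Sum>j<l. (Suc l choose j) * ?S j))" .
  have "(\<Sum>i<Suc p. i ^ Suc l) = (\<Sum>i<p. Suc i ^ Suc l)"
    by (subst sum.lessThan_Suc_shift) simp
  then have 2: "(\<Sum>i<p. Suc i ^ Suc l) = ?S (Suc l) + p ^ Suc l" by simp
  \<comment> \<open>Telescoping: subtracting the two evaluations removes the power sum of exponent
    \<open>Suc l\<close>.\<close>
  have 3: "Suc l * ?S l + (\<Sum>j<l. (Suc l choose j) * ?S j) = p ^ Suc l" using 1 2 by linarith
  have "p dvd (\<Sum>j<l. (Suc l choose j) * ?S j)"
    by (rule dvd_sum) (use less in auto)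
  moreover have "p dvd Suc l * ?S l + (\<Sum>j<l. (Suc l choose j) * ?S j)" unfolding 3 by simp
  ultimately have "p dvd Suc l * ?S l" using dvd_add_left_iff by blast
  moreover have "\<not> p dvd Suc l" using less.prems by (auto dest: dvd_imp_le)
  ultimately show ?case using p prime_dvd_mult_iff by blast
qed

context cring
begin

lemma nat_mult: "add_pow R (a * b :: nat) \<one> = add_pow R a \<one> \<otimes> add_pow R b \<one>"
  using add.nat_pow_pow[of \<one> a b] by (simp add: add_pow_ldistr mult.commute)

lemma nat_power: "add_pow R (a ^ n :: nat) \<one> = add_pow R a \<one> [^] (n::nat)"
  by (induction n) (simp_all add: nat_mult m_comm)

lemma nat_sum: "finite B \<Longrightarrow> add_pow R (sum f B :: nat) \<one> = (\<Oplus>i\<in>B. add_pow R (f i) \<one>)"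
  by (induction B rule: finite_induct) (simp_all add: add.nat_pow_mult[symmetric] Pi_def)

lemma finsum_swap:
  assumes "finite A" "finite B" "\<And>i j. i \<in> A \<Longrightarrow> j \<in> B \<Longrightarrow> f i j \<in> carrier R"
  shows "(\<Oplus>i\<in>A. \<Oplus>j\<in>B. f i j) = (\<Oplus>j\<in>B. \<Oplus>i\<in>A. f i j)"
  using assms(1,3)
proof (induction A rule: finite_induct)
  case (insert a A)
  have "(\<Oplus>j\<in>B. \<Oplus>i\<in>insert a A. f i j) = (\<Oplus>j\<in>B. f a j \<oplus> (\<Oplus>i\<in>A. f i j))"
    by (rule finsum_cong') (use insert in \<open>auto intro!: finsum_closed a_closed\<close>)
  also have "\<dots> = (\<Oplus>j\<in>B. f a j) \<oplus> (\<Oplus>j\<in>B. \<Oplus>i\<in>A. f i j)"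
    by (rule finsum_addf) (use insert in \<open>auto intro!: finsum_closed\<close>)
  also have "\<dots> = (\<Oplus>i\<in>insert a A. \<Oplus>j\<in>B. f i j)"
    using insert by (subst finsum_insert) (auto intro!: finsum_closed)
  finally show ?case by simp
qed simp

lemma finsum_lessThan_add:
  assumes "\<And>i. f i \<in> carrier R"
  shows "(\<Oplus>i\<in>{..<a + b}. f i) = (\<Oplus>i\<in>{..<a}. f i) \<oplus> (\<Oplus>j\<in>{..<b}. f (a + j :: nat))"
proof (induction b)
  case (Suc b)
  have "(\<Oplus>i\<in>{..<a + Suc b}. f i) = f (a + b) \<oplus> (\<Oplus>i\<in>{..<a + b}. f i)"
    using assms by (simp add: lessThan_Suc Pi_def)
  also have "\<dots> = (\<Oplus>i\<in>{..<a}. f i) \<oplus> (f (a + b) \<oplus> (\<Oplus>j\<in>{..<b}. f (a + j)))"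
    unfolding Suc using assms by (intro a_lcomm finsum_closed) auto
  also have "f (a + b) \<oplus> (\<Oplus>j\<in>{..<b}. f (a + j)) = (\<Oplus>j\<in>{..<Suc b}. f (a + j))"
    using assms by (simp add: lessThan_Suc Pi_def)
  finally show ?case .
qed (use assms in \<open>auto intro!: finsum_closed\<close>)

text \<open>Sorts the indices by their residue modulo \<open>q\<close>; with \<open>q = p\<close>
  this splits a polynomial in \<open>a1\<close> into \<open>p\<close> parts.\<close>

lemma finsum_lessThan_mult:
  assumes "\<And>i. f i \<in> carrier R"
  shows "(\<Oplus>i\<in>{..<q * k}. f i) = (\<Oplus>j\<in>{..<q}. \<Oplus>i\<in>{..<k}. f (j + q * i :: nat))"
proof -
  have "(\<Oplus>i\<in>{..<q * k}. f i) = (\<Oplus>i\<in>{..<k}. \<Oplus>j\<in>{..<q}. f (j + q * i))"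
  proof (induction k)
    case (Suc k)
    have "(\<Oplus>i\<in>{..<q * Suc k}. f i) = (\<Oplus>i\<in>{..<q * k}. f i) \<oplus> (\<Oplus>j\<in>{..<q}. f (q * k + j))"
      using finsum_lessThan_add[of f "q * k" q] assms by (simp add: add.commute)
    also have "\<dots> = (\<Oplus>j\<in>{..<q}. f (j + q * k)) \<oplus> (\<Oplus>i\<in>{..<k}. \<Oplus>j\<in>{..<q}. f (j + q * i))"
      unfolding Suc using assms by (subst a_comm) (auto intro!: finsum_closed simp: add.commute)
    also have "\<dots> = (\<Oplus>i\<in>{..<Suc k}. \<Oplus>j\<in>{..<q}. f (j + q * i))"
      unfolding lessThan_Suc using assms by (subst finsum_insert) (auto intro!: finsum_closed)
    finally show ?case .
  qed simp
  also have "\<dots> = (\<Oplus>j\<in>{..<q}. \<Oplus>i\<in>{..<k}. f (j + q * i))"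
    by (rule finsum_swap) (use assms in auto)
  finally show ?thesis .
qed

end

section \<open>Power sums over the prime field\<close>

context char_p_ring
begin

text \<open>From \<open>i^p = i\<close> the factor \<open>i\<close> is cancelled by
  \<open>nat_unit\<close>, which avoids any appeal to a domain.\<close>

lemma fermat: "0 < i \<Longrightarrow> i < p \<Longrightarrow> add_pow R i \<one> [^] (p - 1) = \<one>"
proof -
  assume i: "0 < i" "i < p"
  let ?x = "add_pow R i \<one> [^] (p - 1)"
  have "add_pow R i (?x \<ominus> \<one>) = add_pow R i \<one> \<otimes> ?x \<ominus> add_pow R i \<one>"
    using add_pow_ldistr[of \<one> "?x \<ominus> \<one>" i] by (simp add: a_minus_def r_distr r_minus)
  also have "add_pow R i \<one> \<otimes> ?x = add_pow R i \<one> [^] p"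
    using p_pos nat_pow_Suc2[of "add_pow R i \<one>" "p - 1"] by simp
  also have "\<dots> = add_pow R i \<one>" by (rule frob_nat)
  finally have "add_pow R i (?x \<ominus> \<one>) = \<zero>" by (simp add: a_minus_def r_neg)
  then have "?x \<ominus> \<one> = \<zero>" using nat_unit[OF i] by simp
  then show ?thesis by simp
qed

text \<open>For \<open>l = p - 1\<close> every nonzero residue contributes 1 by Fermat, and there
  are \<open>p - 1\<close> of them. For smaller \<open>l\<close> the integer sum is already
  divisible by \<open>p\<close>.\<close>

lemma power_sum:
  assumes "l \<le> p - 1"
  shows "(\<Oplus>i\<in>{..<p}. add_pow R i \<one> [^] l) = (if l = p - 1 then \<ominus> \<one> else \<zero>)"
proof (cases "l = p - 1")
  case False
  then have "p dvd (\<Sum>i<p. i ^ l)" using assms by (intro prime_dvd_power_sum prime_p) auto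
  then have "add_pow R (\<Sum>i<p. i ^ l) \<one> = \<zero>" by (intro add_pow_char_dvd) auto
  then show ?thesis using False by (simp add: nat_sum nat_power)
next
  case True
  have p1: "p - 1 > 0" using prime_p prime_ge_2_nat[of p] by simp
  have "{..<p} = insert 0 {1..<p}" using p_pos by auto
  then have "(\<Oplus>i\<in>{..<p}. add_pow R i \<one> [^] l) = add_pow R (0::nat) \<one> [^] l \<oplus> (\<Oplus>i\<in>{1..<p}. add_pow R i \<one> [^] l)"
    by (simp add: Pi_def)
  also have "\<dots> = (\<Oplus>i\<in>{1..<p}. \<one>)"
  proof -
    have "(\<Oplus>i\<in>{1..<p}. add_pow R i \<one> [^] l) = (\<Oplus>i\<in>{1..<p}. \<one>)"
      by (rule finsum_cong') (use fermat True in auto)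
    then show ?thesis using True p1 by (simp add: nat_pow_zero)
  qed
  also have "\<dots> = add_pow R (p - 1) \<one>" by (simp add: add.finprod_const)
  also have "\<dots> = \<ominus> \<one>"
  proof -
    have "add_pow R (p - 1) \<one> \<oplus> \<one> = add_pow R (Suc (p - 1)) \<one>" by simp
    also have "\<dots> = \<zero>" using char_p p_pos by simp
    finally show ?thesis by (intro minus_equality[symmetric]) auto
  qed
  finally show ?thesis using True by simp
qed

text \<open>Summing a polynomial of degree at most \<open>p - 1\<close> over the prime field sees
  only its coefficient of degree \<open>p - 1\<close>; for \<open>(x + i)^k\<close> as a polynomial
  in \<open>i\<close> this is nonzero only if \<open>k = p - 1\<close>.\<close>

lemma shifted_power_sum:
  assumes x: "x \<in> carrier R" and k: "k \<le> p - 1"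
  shows "(\<Oplus>i\<in>{..<p}. (x \<oplus> add_pow R i \<one>) [^] k) = (if k = p - 1 then \<ominus> \<one> else \<zero>)"
proof -
  let ?g = "\<lambda>l i. add_pow R (k choose l) (add_pow R i \<one> [^] l \<otimes> x [^] (k - l))"
  have "(\<Oplus>i\<in>{..<p}. (x \<oplus> add_pow R i \<one>) [^] k) = (\<Oplus>i\<in>{..<p}. \<Oplus>l\<in>{..k}. ?g l i)"
  proof (rule finsum_cong'[OF refl])
    fix i :: nat
    have "x \<oplus> add_pow R i \<one> = add_pow R i \<one> \<oplus> x" using x by (intro a_comm) auto
    then show "(x \<oplus> add_pow R i \<one>) [^] k = (\<Oplus>l\<in>{..k}. ?g l i)"
      using binomial_theorem[of "add_pow R i \<one>" x k] x by simp
  qed (use x in \<open>auto intro!: finsum_closed\<close>)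
  also have "\<dots> = (\<Oplus>l\<in>{..k}. \<Oplus>i\<in>{..<p}. ?g l i)"
    by (rule finsum_swap) (use x in auto)
  also have "\<dots> = (\<Oplus>l\<in>{..k}. if p - 1 = l then \<ominus> \<one> else \<zero>)"
  proof (rule finsum_cong'[OF refl])
    fix l assume l: "l \<in> {..k}"
    define z where "z = add_pow R (k choose l) (x [^] (k - l))"
    have z: "z \<in> carrier R" using x by (simp add: z_def)
    have "(\<Oplus>i\<in>{..<p}. ?g l i) = (\<Oplus>i\<in>{..<p}. add_pow R i \<one> [^] l \<otimes> z)"
      by (rule finsum_cong') (use x in \<open>auto simp: z_def add_pow_rdistr\<close>)
    also have "\<dots> = (\<Oplus>i\<in>{..<p}. add_pow R i \<one> [^] l) \<otimes> z"
      by (rule finsum_ldistr[symmetric]) (use z in auto)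
    also have "\<dots> = (if p - 1 = l then \<ominus> \<one> else \<zero>)"
      using power_sum[of l] l k z by (auto simp: z_def)
    finally show "(\<Oplus>i\<in>{..<p}. ?g l i) = (if p - 1 = l then \<ominus> \<one> else \<zero>)" .
  qed auto
  also have "\<dots> = (if k = p - 1 then \<ominus> \<one> else \<zero>)"
  proof (cases "k = p - 1")
    case True
    then show ?thesis using finsum_singleton[of "p - 1" "{..k}" "\<lambda>_. \<ominus> \<one>"] by simp
  next
    case False
    then have "(\<Oplus>l\<in>{..k}. if p - 1 = l then \<ominus> \<one> else \<zero>) = (\<Oplus>l\<in>{..k}. \<zero>)"
      using k by (intro finsum_cong') auto
    then show ?thesis using False by simp
  qed
  finally show ?thesis .
qed

lemma carry_coefficient: "(p choose (p - 1)) div p = 1"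
  using binomial_symmetric[of "p - 1" p] p_pos by simp

text \<open>Summing the \<open>p\<close> carries of the additions of \<open>(1, 0)\<close> computes \<open>p (1, 0) = (0, 1)\<close>.\<close>

lemma carry_sum:
  assumes x: "x \<in> carrier R"
  shows "(\<Oplus>i\<in>{..<p}. witt_carry p R (x \<oplus> add_pow R i \<one>) \<one>) = \<ominus> \<one>"
proof -
  let ?c = "\<lambda>k. (p choose k) div p"
  have "(\<Oplus>i\<in>{..<p}. witt_carry p R (x \<oplus> add_pow R i \<one>) \<one>)
      = (\<Oplus>i\<in>{..<p}. \<Oplus>k\<in>{1..p - 1}. add_pow R (?c k) \<one> \<otimes> (x \<oplus> add_pow R i \<one>) [^] k)"
    unfolding witt_carry_def using x
    by (intro finsum_cong' finsum_cong) (auto simp: add_pow_ldistr simp_implies_def intro!: finsum_cong' finsum_closed)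
  also have "\<dots> = (\<Oplus>k\<in>{1..p - 1}. \<Oplus>i\<in>{..<p}. add_pow R (?c k) \<one> \<otimes> (x \<oplus> add_pow R i \<one>) [^] k)"
    by (rule finsum_swap) (use x in auto)
  \<comment> \<open>After interchanging the sums only the top exponent survives, and its carry
    coefficient is 1.\<close>
  also have "\<dots> = (\<Oplus>k\<in>{1..p - 1}. if p - 1 = k then \<ominus> \<one> else \<zero>)"
  proof (rule finsum_cong'[OF refl])
    fix k assume k: "k \<in> {1..p - 1}"
    have "(\<Oplus>i\<in>{..<p}. add_pow R (?c k) \<one> \<otimes> (x \<oplus> add_pow R i \<one>) [^] k)
        = add_pow R (?c k) \<one> \<otimes> (\<Oplus>i\<in>{..<p}. (x \<oplus> add_pow R i \<one>) [^] k)"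
      by (rule finsum_rdistr[symmetric]) (use x in auto)
    then show "(\<Oplus>i\<in>{..<p}. add_pow R (?c k) \<one> \<otimes> (x \<oplus> add_pow R i \<one>) [^] k) = (if p - 1 = k then \<ominus> \<one> else \<zero>)"
      using shifted_power_sum[OF x, of k] k carry_coefficient by auto
  qed auto
  also have "\<dots> = \<ominus> \<one>"
    using finsum_singleton[of "p - 1" "{1..p - 1}" "\<lambda>_. \<ominus> \<one>"] prime_p prime_ge_2_nat[of p] by simp
  finally show ?thesis .
qed

end

locale witt_action = witt_extension L p V A t a1 c0 T1 T2 m1 for L (structure) and p V A t a1 c0 T1 T2 m1 +
  fixes \<sigma> :: "'a \<Rightarrow> 'a"
  assumes \<sigma>_hom: "\<sigma> \<in> ring_hom L L" and \<sigma>_A: "\<And>a. a \<in> A \<Longrightarrow> \<sigma> a = a"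
    and \<sigma>_T1: "\<sigma> T1 = T1 \<oplus> \<one>" and \<sigma>_T2: "\<sigma> T2 = T2 \<ominus> witt_carry p L T1 \<one>"
begin

section \<open>Powers of the Galois generator and their first-order effect\<close>

lemma \<sigma>_pow_hom: "\<sigma> ^^ i \<in> ring_hom L L"
proof (induction i)
  case 0
  then show ?case by (simp add: ring_hom_memI)
next
  case (Suc i)
  then show ?case using ring_hom_trans[OF Suc \<sigma>_hom] by (simp only: funpow.simps)
qed

lemma \<sigma>_pow_A: "a \<in> A \<Longrightarrow> (\<sigma> ^^ i) a = a"
  by (induction i) (auto simp: \<sigma>_A)

lemma \<sigma>_pow_T1: "(\<sigma> ^^ i) T1 = T1 \<oplus> add_pow L i \<one>"
proof (induction i)
  case (Suc i)
  have "\<sigma> (add_pow L i \<one>) = add_pow L i \<one>" by (rule \<sigma>_A) simp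
  then show ?case using Suc ring_hom_add[OF \<sigma>_hom, of T1 "add_pow L i \<one>"] by (simp add: \<sigma>_T1 a_ac)
qed simp

lemma \<sigma>_pow_T2: "(\<sigma> ^^ i) T2 = T2 \<ominus> (\<Oplus>j\<in>{..<i}. witt_carry p L (T1 \<oplus> add_pow L j \<one>) \<one>)"
proof (induction i)
  case (Suc i)
  interpret s: ring_hom_cring L L "\<sigma> ^^ i" by unfold_locales (rule \<sigma>_pow_hom)
  let ?w = "\<lambda>j. witt_carry p L (T1 \<oplus> add_pow L j \<one>) \<one>"
  have c: "(\<Oplus>j\<in>{..<i}. ?w j) \<in> carrier L" by (intro finsum_closed) auto
  \<comment> \<open>Splitting off the innermost \<open>\<sigma>\<close> lets the homomorphism
    \<open>\<sigma> ^^ i\<close> carry the carry at \<open>T1\<close> to the carry at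
    \<open>T1 + i\<close>.\<close>
  have "(\<sigma> ^^ Suc i) T2 = (\<sigma> ^^ i) (T2 \<ominus> witt_carry p L T1 \<one>)"
    unfolding funpow_Suc_right comp_def \<sigma>_T2 ..
  also have "\<dots> = (T2 \<ominus> (\<Oplus>j\<in>{..<i}. ?w j)) \<ominus> ?w i"
    using ring_hom_carry[OF is_cring is_cring \<sigma>_pow_hom, of T1 \<one> i p] by (simp add: a_minus_def Suc \<sigma>_pow_T1)
  also have "\<dots> = T2 \<ominus> (?w i \<oplus> (\<Oplus>j\<in>{..<i}. ?w j))"
    using c by (simp add: a_minus_def minus_add a_ac)
  also have "?w i \<oplus> (\<Oplus>j\<in>{..<i}. ?w j) = (\<Oplus>j\<in>{..<Suc i}. ?w j)"
    by (simp add: lessThan_Suc Pi_def)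
  finally show ?case .
qed (simp add: a_minus_def)

lemma \<sigma>_p_T1: "(\<sigma> ^^ p) T1 = T1" by (simp add: \<sigma>_pow_T1 char_p)

lemma \<sigma>_p_T2: "(\<sigma> ^^ p) T2 = T2 \<oplus> \<one>"
  by (simp add: \<sigma>_pow_T2 carry_sum a_minus_def)

text \<open>On \<open>V\<close> the differences \<open>\<sigma> x - x\<close> and \<open>\<sigma>\<^sup>p x - x\<close> are multiples of one and the same \<open>\<delta> x\<close> to first order.\<close>

definition first_order :: "('a \<Rightarrow> 'a) \<Rightarrow> nat \<Rightarrow> 'a \<Rightarrow> 'a \<Rightarrow> 'a \<Rightarrow> bool" where
  "first_order \<tau> k e x \<delta> \<longleftrightarrow> x \<in> V \<and> \<delta> \<in> V \<and> (\<exists>r\<in>V. \<tau> x = x \<oplus> t [^] k \<otimes> (\<delta> \<otimes> e \<oplus> t \<otimes> r))"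

lemma first_order_add:
  assumes \<tau>: "\<tau> \<in> ring_hom L L" and e [simp]: "e \<in> V" and x: "first_order \<tau> k e x \<delta>" and y: "first_order \<tau> k e y \<epsilon>"
  shows "first_order \<tau> k e (x \<oplus> y) (\<delta> \<oplus> \<epsilon>)"
proof -
  obtain r where r: "r \<in> V" "\<tau> x = x \<oplus> t [^] k \<otimes> (\<delta> \<otimes> e \<oplus> t \<otimes> r)" "x \<in> V" "\<delta> \<in> V" using x by (auto simp: first_order_def)
  obtain s where s: "s \<in> V" "\<tau> y = y \<oplus> t [^] k \<otimes> (\<epsilon> \<otimes> e \<oplus> t \<otimes> s)" "y \<in> V" "\<epsilon> \<in> V" using y by (auto simp: first_order_def)
  have id: "(x \<oplus> u \<otimes> (\<delta> \<otimes> e \<oplus> t \<otimes> r)) \<oplus> (y \<oplus> u \<otimes> (\<epsilon> \<otimes> e \<oplus> t \<otimes> s))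
      = (x \<oplus> y) \<oplus> u \<otimes> ((\<delta> \<oplus> \<epsilon>) \<otimes> e \<oplus> t \<otimes> (r \<oplus> s))"
    if "x \<in> carrier L" "y \<in> carrier L" "\<delta> \<in> carrier L" "\<epsilon> \<in> carrier L" "r \<in> carrier L" "s \<in> carrier L"
      "u \<in> carrier L" "t \<in> carrier L" "e \<in> carrier L" for x y \<delta> \<epsilon> r s u t e
    using that by algebra
  have "\<tau> (x \<oplus> y) = (x \<oplus> y) \<oplus> t [^] k \<otimes> ((\<delta> \<oplus> \<epsilon>) \<otimes> e \<oplus> t \<otimes> (r \<oplus> s))"
    using r s ring_hom_add[OF \<tau>, of x y] id by simp
  moreover have "r \<oplus> s \<in> V" using r s by simp
  ultimately show ?thesis unfolding first_order_def using r s by auto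
qed

text \<open>A Leibniz rule. The product of the two increments contains \<open>t^(2 k)\<close> and
  disappears into the remainder because \<open>k > 0\<close>.\<close>

lemma first_order_mult:
  assumes \<tau>: "\<tau> \<in> ring_hom L L" and e [simp]: "e \<in> V" and k: "k > 0" and x: "first_order \<tau> k e x \<delta>" and y: "first_order \<tau> k e y \<epsilon>"
  shows "first_order \<tau> k e (x \<otimes> y) (\<delta> \<otimes> y \<oplus> x \<otimes> \<epsilon>)"
proof -
  obtain r where r: "r \<in> V" "\<tau> x = x \<oplus> t [^] k \<otimes> (\<delta> \<otimes> e \<oplus> t \<otimes> r)" "x \<in> V" "\<delta> \<in> V" using x by (auto simp: first_order_def)
  obtain s where s: "s \<in> V" "\<tau> y = y \<oplus> t [^] k \<otimes> (\<epsilon> \<otimes> e \<oplus> t \<otimes> s)" "y \<in> V" "\<epsilon> \<in> V" using y by (auto simp: first_order_def)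
  \<comment> \<open>One factor of the second \<open>t^k\<close> becomes the \<open>t\<close> in
    front of the remainder; the others stay inside it.\<close>
  obtain l where l: "k = Suc l" using k not0_implies_Suc by blast
  have id: "(x \<oplus> (u \<otimes> t) \<otimes> (\<delta> \<otimes> e \<oplus> t \<otimes> r)) \<otimes> (y \<oplus> (u \<otimes> t) \<otimes> (\<epsilon> \<otimes> e \<oplus> t \<otimes> s))
      = (x \<otimes> y) \<oplus> (u \<otimes> t) \<otimes> ((\<delta> \<otimes> y \<oplus> x \<otimes> \<epsilon>) \<otimes> e \<oplus> t \<otimes> (r \<otimes> y \<oplus> x \<otimes> s \<oplus> u \<otimes> ((\<delta> \<otimes> e \<oplus> t \<otimes> r) \<otimes> (\<epsilon> \<otimes> e \<oplus> t \<otimes> s))))"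
    if "x \<in> carrier L" "y \<in> carrier L" "\<delta> \<in> carrier L" "\<epsilon> \<in> carrier L" "r \<in> carrier L" "s \<in> carrier L"
      "u \<in> carrier L" "t \<in> carrier L" "e \<in> carrier L" for x y \<delta> \<epsilon> r s u t e
    using that by algebra
  let ?r = "r \<otimes> y \<oplus> x \<otimes> s \<oplus> t [^] l \<otimes> ((\<delta> \<otimes> e \<oplus> t \<otimes> r) \<otimes> (\<epsilon> \<otimes> e \<oplus> t \<otimes> s))"
  have "\<tau> (x \<otimes> y) = (x \<otimes> y) \<oplus> t [^] k \<otimes> ((\<delta> \<otimes> y \<oplus> x \<otimes> \<epsilon>) \<otimes> e \<oplus> t \<otimes> ?r)"
    unfolding l nat_pow_Suc using r s ring_hom_mult[OF \<tau>, of x y] id[of x y \<delta> \<epsilon> r s "t [^] l" t e]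
    by (simp only: l nat_pow_Suc V_carrier e nat_pow_closed t_carrier)
  moreover have "?r \<in> V" using r s by simp
  ultimately show ?thesis unfolding first_order_def using r s by auto
qed

lemma first_order_const:
  assumes "\<tau> x = x" "x \<in> V" "e \<in> V"
  shows "first_order \<tau> k e x \<zero>"
  unfolding first_order_def using assms by (auto intro!: bexI[of _ \<zero>])

text \<open>The same \<open>\<delta>\<close> serves both automorphisms, at different scales and with
  different coefficients. It behaves like the partial derivative with respect to \<open>Z2\<close>:
  constants and \<open>Z1\<close> have 0, and \<open>Z2\<close> has 1.\<close>

definition derivative :: "'a \<Rightarrow> 'a \<Rightarrow> bool" where
  "derivative x \<delta> \<longleftrightarrow> first_order \<sigma> m (\<ominus> (Z1 [^] (p - 1))) x \<delta> \<and> first_order (\<sigma> ^^ p) n \<one> x \<delta>"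

lemma \<sigma>_t: "\<sigma> (t [^] (k::nat)) = t [^] k" "(\<sigma> ^^ p) (t [^] (k::nat)) = t [^] k"
  using t_A by (auto intro: \<sigma>_A \<sigma>_pow_A)

text \<open>\<open>\<sigma>\<close> moves \<open>Z1\<close> by \<open>t^m1\<close>, and
  \<open>m1 = p m\<close> exceeds \<open>m\<close>, so at scale \<open>t^m\<close> the change is
  absorbed by the remainder. \<open>\<sigma>^p\<close> fixes \<open>Z1\<close>.\<close>

lemma derivative_Z1: "derivative Z1 \<zero>"
  unfolding derivative_def
proof
  have m1': "m1 = m + 1 + (m1 - m - 1)"
  proof -
    have "p * m \<ge> 2 * m" using p_ge_2 by simp
    then show ?thesis using m_pos m1_m by linarith
  qed
  have "t [^] m1 = t [^] m \<otimes> (t \<otimes> t [^] (m1 - m - 1))"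
    by (subst m1') (simp add: nat_pow_mult[symmetric] m_ac)
  moreover have "\<sigma> Z1 = Z1 \<oplus> t [^] m1"
    unfolding Z1_def using ring_hom_mult[OF \<sigma>_hom, of "t [^] m1" T1] by (simp add: \<sigma>_t \<sigma>_T1 r_distr)
  ultimately show "first_order \<sigma> m (\<ominus> (Z1 [^] (p - 1))) Z1 \<zero>"
    unfolding first_order_def by (auto intro!: bexI[of _ "t [^] (m1 - m - 1)"])
  show "first_order (\<sigma> ^^ p) n \<one> Z1 \<zero>"
    by (rule first_order_const)
      (use ring_hom_mult[OF \<sigma>_pow_hom, of "t [^] m1" T1 p] in \<open>simp_all add: Z1_def[symmetric] \<sigma>_t \<sigma>_p_T1\<close>)
qed

text \<open>Scaled by \<open>t^n\<close>, the \<open>k\<close>-th term of the carry of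
  \<open>T1\<close> and 1 has order \<open>m + m1 (p - 1 - k)\<close>, so only
  \<open>k = p - 1\<close> contributes at order \<open>m\<close>.\<close>

lemma carry_one: "\<exists>r\<in>V. t [^] n \<otimes> witt_carry p L T1 \<one> = t [^] m \<otimes> (Z1 [^] (p - 1) \<oplus> t \<otimes> r)"
proof -
  let ?w = "\<lambda>k. add_pow L ((p choose k) div p) (t [^] (m1 * (p - 1 - k)) \<otimes> Z1 [^] k)"
  have set: "{1..p - 1} = insert (p - 1) {1..p - 2}" using p_ge_2 by auto
  have "t [^] n \<otimes> witt_carry p L T1 \<one> = (\<Oplus>k\<in>{1..p - 1}. t [^] m \<otimes> ?w k)"
  proof (subst witt_carry_scaled, simp_all, rule finsum_cong'[OF refl])
    fix k assume k: "k \<in> {Suc 0..p - Suc 0}"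
    have "n = (m + m1 * (p - 1 - k)) + m1 * k"
    proof -
      have "p - 1 - k + k = p - 1" using k by auto
      then have "m1 * (p - 1 - k) + m1 * k = m1 * (p - 1)" by (simp only: add_mult_distrib2[symmetric])
      then show ?thesis using n_eq by linarith
    qed
    then have "t [^] n \<otimes> T1 [^] k = t [^] (m + m1 * (p - 1 - k)) \<otimes> Z1 [^] k"
      using t_Z1 by metis
    then show "add_pow L ((p choose k) div p) (t [^] n \<otimes> T1 [^] k) = t [^] m \<otimes> add_pow L ((p choose k) div p) (t [^] (m1 * (p - Suc k)) \<otimes> Z1 [^] k)"
      by (simp add: nat_pow_mult[symmetric] add_pow_rdistr m_assoc)
  qed auto
  also have "\<dots> = t [^] m \<otimes> (\<Oplus>k\<in>{1..p - 1}. ?w k)"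
    by (rule finsum_rdistr[symmetric]) auto
  also have "(\<Oplus>k\<in>{1..p - 1}. ?w k) = Z1 [^] (p - 1) \<oplus> (\<Oplus>k\<in>{1..p - 2}. ?w k)"
    unfolding set using carry_coefficient p_ge_2 by (subst finsum_insert) auto
  also have "(\<Oplus>k\<in>{1..p - 2}. ?w k) \<in> I"
  proof (rule I_finsum)
    fix k assume "k \<in> {1..p - 2}"
    then have e: "m1 * (p - 1 - k) > 0" using m1 by auto
    then have "t [^] (m1 * (p - 1 - k)) \<otimes> add_pow L ((p choose k) div p) (Z1 [^] k) \<in> I" by (intro I_t) auto
    then show "?w k \<in> I" by (simp add: add_pow_rdistr)
  qed
  then obtain r where "r \<in> V" "(\<Oplus>k\<in>{1..p - 2}. ?w k) = t \<otimes> r" by (auto simp: I_def)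
  ultimately show ?thesis by auto
qed

lemma derivative_Z2: "derivative Z2 \<one>"
  unfolding derivative_def
proof
  obtain r where r: "r \<in> V" "t [^] n \<otimes> witt_carry p L T1 \<one> = t [^] m \<otimes> (Z1 [^] (p - 1) \<oplus> t \<otimes> r)"
    using carry_one by blast
  have "\<sigma> Z2 = Z2 \<ominus> t [^] n \<otimes> witt_carry p L T1 \<one>"
    unfolding Z2_def using ring_hom_mult[OF \<sigma>_hom, of "t [^] n" T2]
    by (simp add: \<sigma>_t \<sigma>_T2 a_minus_def r_distr r_minus)
  also have "\<dots> = Z2 \<oplus> t [^] m \<otimes> (\<one> \<otimes> \<ominus> (Z1 [^] (p - 1)) \<oplus> t \<otimes> (\<ominus> r))"
    unfolding r(2) using r(1) by (simp add: a_minus_def r_distr r_minus minus_add)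
  finally show "first_order \<sigma> m (\<ominus> (Z1 [^] (p - 1))) Z2 \<one>"
    unfolding first_order_def using r(1) by (auto intro!: bexI[of _ "\<ominus> r"])
  have "(\<sigma> ^^ p) Z2 = Z2 \<oplus> t [^] n \<otimes> (\<one> \<otimes> \<one> \<oplus> t \<otimes> \<zero>)"
    unfolding Z2_def using ring_hom_mult[OF \<sigma>_pow_hom, of "t [^] n" T2 p]
    by (simp add: \<sigma>_t \<sigma>_p_T2 r_distr)
  then show "first_order (\<sigma> ^^ p) n \<one> Z2 \<one>"
    unfolding first_order_def by (intro conjI bexI[of _ \<zero>]) auto
qed

text \<open>By the sum and product rules the elements having a derivative form a subring. It
  contains \<open>A\<close>, \<open>Z1\<close> and \<open>Z2\<close>, hence \<open>D\<close>, hence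
  \<open>V\<close>.\<close>

lemma derivative_exists:
  assumes "x \<in> V"
  shows "\<exists>\<delta>. derivative x \<delta>"
proof -
  let ?S = "{x. \<exists>\<delta>. derivative x \<delta>}"
  have V: "x \<in> V" if "derivative x \<delta>" for x \<delta> using that by (simp add: derivative_def first_order_def)
  have A: "A \<subseteq> ?S"
    by (auto simp: derivative_def intro!: exI[of _ \<zero>] first_order_const \<sigma>_A \<sigma>_pow_A)
  have mult: "x \<otimes> y \<in> ?S" if "x \<in> ?S" "y \<in> ?S" for x y
    using that m_pos n_pos unfolding derivative_def
    by (auto 0 4 intro: first_order_mult[OF \<sigma>_hom] first_order_mult[OF \<sigma>_pow_hom])
  have S: "subring ?S L"
  proof (rule subringI)
    show "?S \<subseteq> carrier L" using V by auto
    show "\<one> \<in> ?S" by (rule subsetD[OF A]) simp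
    show "\<ominus> x \<in> ?S" if "x \<in> ?S" for x
    proof -
      have "\<ominus> \<one> \<in> ?S" by (rule subsetD[OF A]) simp
      then have "\<ominus> \<one> \<otimes> x \<in> ?S" using that by (rule mult)
      moreover have "x \<in> V" using V that by auto
      ultimately show ?thesis by (simp add: l_minus)
    qed
    show "x \<oplus> y \<in> ?S" if "x \<in> ?S" "y \<in> ?S" for x y
      using that unfolding derivative_def
      by (auto 0 4 intro: first_order_add[OF \<sigma>_hom] first_order_add[OF \<sigma>_pow_hom])
  qed (rule mult)
  have Z: "Z1 \<in> ?S" "Z2 \<in> ?S" using derivative_Z1 derivative_Z2 by auto
  have combination: "(\<Oplus>i\<in>{..<p}. f i \<otimes> z [^] i) \<in> ?S" if "\<And>i. i < p \<Longrightarrow> f i \<in> ?S" "z \<in> ?S" for f and z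
    by (rule subring_finsum[OF S], rule subringE(6)[OF S], use that in blast, rule subring_pow[OF S that(2)])
  have D1S: "D1 \<subseteq> ?S"
  proof
    fix x assume "x \<in> D1"
    then obtain f where f: "x = (\<Oplus>i\<in>{..<p}. f i \<otimes> Z1 [^] i)" "f \<in> {..<p} \<rightarrow> A" unfolding D1_def by blast
    show "x \<in> ?S" unfolding f(1) by (rule combination[OF subsetD[OF A] Z(1)]) (use f(2) in auto)
  qed
  have "D \<subseteq> ?S"
  proof
    fix x assume "x \<in> D"
    then obtain f where f: "x = (\<Oplus>i\<in>{..<p}. f i \<otimes> Z2 [^] i)" "f \<in> {..<p} \<rightarrow> D1" unfolding D_def by blast
    show "x \<in> ?S" unfolding f(1) by (rule combination[OF subsetD[OF D1S] Z(2)]) (use f(2) in auto)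
  qed
  then show ?thesis using assms V_subset_D by blast
qed

end


section \<open>Linear dependence\<close>

text \<open>Elimination over a domain without division: a row with nonzero entry in column
  \<open>k\<close> is used to clear that column by cross-multiplication, which leaves one row and
  one column fewer.\<close>

lemma (in "domain") homogeneous_system:
  assumes "finite J" "finite I" "card J < card I" "\<And>i j. i \<in> I \<Longrightarrow> j \<in> J \<Longrightarrow> r i j \<in> carrier R"
  shows "\<exists>c. (\<forall>i\<in>I. c i \<in> carrier R) \<and> (\<exists>i\<in>I. c i \<noteq> \<zero>) \<and> (\<forall>j\<in>J. (\<Oplus>i\<in>I. c i \<otimes> r i j) = \<zero>)"
  using assms
proof (induction J arbitrary: I r rule: finite_induct)
  case empty
  then obtain i where "i \<in> I" by (cases "I = {}") auto
  then show ?case by (intro exI[of _ "\<lambda>_. \<one>"]) auto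
next
  case (insert k J)
  show ?case
  proof (cases "\<forall>i\<in>I. r i k = \<zero>")
    case True
    have "card J < card I" using insert by simp
    then obtain c where c: "\<forall>i\<in>I. c i \<in> carrier R" "\<exists>i\<in>I. c i \<noteq> \<zero>" "\<forall>j\<in>J. (\<Oplus>i\<in>I. c i \<otimes> r i j) = \<zero>"
      using insert.IH[of I r] insert.prems by auto
    have "(\<Oplus>i\<in>I. c i \<otimes> r i k) = (\<Oplus>i\<in>I. \<zero>)"
      by (rule finsum_cong') (use True c in auto)
    then show ?thesis using c by (intro exI[of _ c]) auto
  next
    case False
    then obtain l where l: "l \<in> I" "r l k \<noteq> \<zero>" by blast
    define I' where "I' = I - {l}"
    have I': "finite I'" "l \<notin> I'" "I = insert l I'" using l insert.prems by (auto simp: I'_def)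
    have rc [simp]: "r i j \<in> carrier R" if "i \<in> I" "j \<in> insert k J" for i j using insert.prems(3) that by blast
    have rc' [simp]: "r i k \<in> carrier R" if "i \<in> I" for i using that by simp
    have lk [simp]: "r l k \<in> carrier R" using l by simp
    \<comment> \<open>Twice-two minors with the pivot entry, so column \<open>k\<close> of
      \<open>r'\<close> vanishes identically.\<close>
    define r' where "r' i j = r l k \<otimes> r i j \<ominus> r i k \<otimes> r l j" for i j
    have "card J < card I'" using insert.prems(2) insert.hyps I' by simp
    moreover have "r' i j \<in> carrier R" if "i \<in> I'" "j \<in> J" for i j
      unfolding r'_def using that l I' by auto
    ultimately obtain c where c: "\<forall>i\<in>I'. c i \<in> carrier R" "\<exists>i\<in>I'. c i \<noteq> \<zero>" "\<forall>j\<in>J. (\<Oplus>i\<in>I'. c i \<otimes> r' i j) = \<zero>"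
      using insert.IH[of I' r'] I'(1) by auto
    define s where "s = (\<Oplus>i\<in>I'. c i \<otimes> r i k)"
    have s: "s \<in> carrier R" unfolding s_def by (rule finsum_closed) (use c I' in auto)
    \<comment> \<open>Chosen so that combining the rows of \<open>r\<close> with \<open>c'\<close>
      gives the combination of the rows of \<open>r'\<close> with \<open>c\<close>: the pivot row
      collects all the subtracted multiples.\<close>
    define c' where "c' i = (if i = l then \<ominus> s else c i \<otimes> r l k)" for i
    have c'c: "c' i \<in> carrier R" if "i \<in> I" for i using that c s I' l by (auto simp: c'_def)
    obtain i where i: "i \<in> I'" "c i \<noteq> \<zero>" using c by blast
    have nz: "c' i \<noteq> \<zero>" using i I'(2) c l(2) by (auto simp: c'_def integral_iff)
    have col: "(\<Oplus>i\<in>I. c' i \<otimes> r i j) = (\<Oplus>i\<in>I'. c i \<otimes> r' i j)" if j: "j \<in> insert k J" for j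
    proof -
      have rj: "r i j \<in> carrier R" if "i \<in> I" for i using that j by simp
      have "(\<Oplus>i\<in>I. c' i \<otimes> r i j) = c' l \<otimes> r l j \<oplus> (\<Oplus>i\<in>I'. c' i \<otimes> r i j)"
        unfolding I'(3) by (rule finsum_insert) (use I' c'c rj l in auto)
      also have "(\<Oplus>i\<in>I'. c' i \<otimes> r i j) = (\<Oplus>i\<in>I'. c i \<otimes> r' i j \<oplus> c i \<otimes> r i k \<otimes> r l j)"
      proof (rule finsum_cong'[OF refl])
        fix i assume i: "i \<in> I'"
        have cc: "c i \<in> carrier R" "r i j \<in> carrier R" "r i k \<in> carrier R" "r l j \<in> carrier R"
          using i c rj l I' by auto
        have id: "a \<otimes> x \<otimes> b = a \<otimes> (x \<otimes> b \<ominus> y \<otimes> z) \<oplus> a \<otimes> y \<otimes> z"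
          if "a \<in> carrier R" "x \<in> carrier R" "b \<in> carrier R" "y \<in> carrier R" "z \<in> carrier R" for a x b y z
          using that by algebra
        have "i \<noteq> l" using i I' by auto
        then show "c' i \<otimes> r i j = c i \<otimes> r' i j \<oplus> c i \<otimes> r i k \<otimes> r l j"
          unfolding c'_def r'_def using id[of "c i" "r l k" "r i j" "r i k" "r l j"] cc by simp
      qed (use c rj l I' in \<open>auto simp: r'_def\<close>)
      also have "\<dots> = (\<Oplus>i\<in>I'. c i \<otimes> r' i j) \<oplus> (\<Oplus>i\<in>I'. c i \<otimes> r i k \<otimes> r l j)"
        by (rule finsum_addf) (use c rj l I' in \<open>auto simp: r'_def\<close>)
      also have "(\<Oplus>i\<in>I'. c i \<otimes> r i k \<otimes> r l j) = s \<otimes> r l j"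
        unfolding s_def by (rule finsum_ldistr[symmetric]) (use c rj l I' in auto)
      also have "c' l \<otimes> r l j \<oplus> ((\<Oplus>i\<in>I'. c i \<otimes> r' i j) \<oplus> s \<otimes> r l j) = (\<Oplus>i\<in>I'. c i \<otimes> r' i j)"
      proof -
        have f: "(\<Oplus>i\<in>I'. c i \<otimes> r' i j) \<in> carrier R"
          by (rule finsum_closed) (use c rj l I' in \<open>auto simp: r'_def\<close>)
        have id: "\<ominus> a \<otimes> b \<oplus> (f \<oplus> a \<otimes> b) = f" if "a \<in> carrier R" "b \<in> carrier R" "f \<in> carrier R" for a b f
          using that by algebra
        show ?thesis unfolding c'_def using id[OF s rj[OF l(1)] f] by simp
      qed
      finally show ?thesis .
    qed
    have "(\<Oplus>i\<in>I'. c i \<otimes> r' i k) = \<zero>"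
    proof -
      have "(\<Oplus>i\<in>I'. c i \<otimes> r' i k) = (\<Oplus>i\<in>I'. \<zero>)"
        by (rule finsum_cong') (use c I' l in \<open>auto simp: r'_def m_comm a_minus_def r_neg\<close>)
      then show ?thesis by simp
    qed
    then have "\<forall>j\<in>insert k J. (\<Oplus>i\<in>I. c' i \<otimes> r i j) = \<zero>" using col c(3) by auto
    moreover have "\<exists>i\<in>I. c' i \<noteq> \<zero>" using nz i I' by blast
    ultimately show ?thesis using c'c by blast
  qed
qed

text \<open>The generators form an indexed family, so equal values at different indices do no harm
  and a product of spans is indexed by a product of index sets.\<close>

definition span_of :: "('r, 'm) ring_scheme \<Rightarrow> ('r \<Rightarrow> 'b) \<Rightarrow> ('b, 'n) ring_scheme \<Rightarrow> ('i \<Rightarrow> 'b) \<Rightarrow> 'i set \<Rightarrow> 'b set" where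
  "span_of R h L g J = {(\<Oplus>\<^bsub>L\<^esub>j\<in>J. h (c j) \<otimes>\<^bsub>L\<^esub> g j) | c. \<forall>j\<in>J. c j \<in> carrier R}"

section \<open>Finite spans over the base ring\<close>

locale algebra_hom = R: cring R + L: cring L for R :: "('r, 'm) ring_scheme" and L :: "('b, 'n) ring_scheme" (structure) +
  fixes h :: "'r \<Rightarrow> 'b"
  assumes h: "h \<in> ring_hom R L"
begin

sublocale h: ring_hom_cring R L h by unfold_locales (rule h)

lemma span_closed:
  assumes "\<And>j. j \<in> J \<Longrightarrow> g j \<in> carrier L" "x \<in> span_of R h L g J"
  shows "x \<in> carrier L"
  using assms by (auto simp: span_of_def intro!: L.finsum_closed)

lemma span_add:
  assumes g: "\<And>j. j \<in> J \<Longrightarrow> g j \<in> carrier L" and x: "x \<in> span_of R h L g J" and y: "y \<in> span_of R h L g J"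
  shows "x \<oplus> y \<in> span_of R h L g J"
proof -
  obtain c where c: "x = (\<Oplus>j\<in>J. h (c j) \<otimes> g j)" "\<forall>j\<in>J. c j \<in> carrier R" using x by (auto simp: span_of_def)
  obtain d where d: "y = (\<Oplus>j\<in>J. h (d j) \<otimes> g j)" "\<forall>j\<in>J. d j \<in> carrier R" using y by (auto simp: span_of_def)
  have "x \<oplus> y = (\<Oplus>j\<in>J. h (c j) \<otimes> g j \<oplus> h (d j) \<otimes> g j)"
    unfolding c d by (rule L.finsum_addf[symmetric]) (use c d g in auto)
  also have "\<dots> = (\<Oplus>j\<in>J. h (c j \<oplus>\<^bsub>R\<^esub> d j) \<otimes> g j)"
    by (rule L.finsum_cong') (use c d g in \<open>auto simp: L.l_distr\<close>)
  finally show ?thesis using c d unfolding span_of_def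
    by (intro CollectI exI[of _ "\<lambda>j. c j \<oplus>\<^bsub>R\<^esub> d j"]) auto
qed

lemma span_smult:
  assumes g: "\<And>j. j \<in> J \<Longrightarrow> g j \<in> carrier L" and x: "x \<in> span_of R h L g J" and r: "r \<in> carrier R" and J: "finite J"
  shows "h r \<otimes> x \<in> span_of R h L g J"
proof -
  obtain c where c: "x = (\<Oplus>j\<in>J. h (c j) \<otimes> g j)" "\<forall>j\<in>J. c j \<in> carrier R" using x by (auto simp: span_of_def)
  have "h r \<otimes> x = (\<Oplus>j\<in>J. h r \<otimes> (h (c j) \<otimes> g j))"
    unfolding c by (rule L.finsum_rdistr) (use c g r J in auto)
  also have "\<dots> = (\<Oplus>j\<in>J. h (r \<otimes>\<^bsub>R\<^esub> c j) \<otimes> g j)"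
    by (rule L.finsum_cong') (use c r g in \<open>auto simp: L.m_assoc\<close>)
  finally show ?thesis using c r unfolding span_of_def
    by (intro CollectI exI[of _ "\<lambda>j. r \<otimes>\<^bsub>R\<^esub> c j"]) auto
qed

lemma span_zero: "(\<And>j. j \<in> J \<Longrightarrow> g j \<in> carrier L) \<Longrightarrow> finite J \<Longrightarrow> \<zero> \<in> span_of R h L g J"
proof -
  assume g: "\<And>j. j \<in> J \<Longrightarrow> g j \<in> carrier L"
  have "(\<Oplus>j\<in>J. h \<zero>\<^bsub>R\<^esub> \<otimes> g j) = (\<Oplus>j\<in>J. \<zero>)" by (rule L.finsum_cong') (use g in auto)
  then show ?thesis unfolding span_of_def by (intro CollectI exI[of _ "\<lambda>_. \<zero>\<^bsub>R\<^esub>"]) auto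
qed

lemma span_finsum:
  assumes g: "\<And>j. j \<in> J \<Longrightarrow> g j \<in> carrier L" and J: "finite J" and f: "\<And>i. i \<in> B \<Longrightarrow> f i \<in> span_of R h L g J"
  shows "(\<Oplus>i\<in>B. f i) \<in> span_of R h L g J"
  using f
proof (induction B rule: infinite_finite_induct)
  case (insert b B)
  have "f i \<in> carrier L" if "i \<in> insert b B" for i
    using span_closed[where J = J and g = g] g insert.prems[OF that] by blast
  then have "f b \<in> carrier L" "f \<in> B \<rightarrow> carrier L" by auto
  then show ?case using insert span_add[where J = J and g = g] g by simp
qed (use span_zero[where J = J and g = g] g J in auto)

lemma span_generator:
  assumes g: "\<And>j. j \<in> J \<Longrightarrow> g j \<in> carrier L" and J: "finite J" "k \<in> J"
  shows "g k \<in> span_of R h L g J"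
proof -
  have "(\<Oplus>j\<in>J. h (if k = j then \<one>\<^bsub>R\<^esub> else \<zero>\<^bsub>R\<^esub>) \<otimes> g j) = (\<Oplus>j\<in>J. if k = j then g j else \<zero>)"
    by (rule L.finsum_cong') (use g in auto)
  also have "\<dots> = g k" using L.finsum_singleton[of k J g] g J by auto
  finally show ?thesis unfolding span_of_def
    by (intro CollectI exI[of _ "\<lambda>j. if k = j then \<one>\<^bsub>R\<^esub> else \<zero>\<^bsub>R\<^esub>"]) auto
qed

lemma span_mult:
  assumes g: "\<And>j. j \<in> J \<Longrightarrow> g j \<in> carrier L" and g': "\<And>j. j \<in> J' \<Longrightarrow> g' j \<in> carrier L"
    and J: "finite J" "finite J'" and x: "x \<in> span_of R h L g J" and y: "y \<in> span_of R h L g' J'"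
  shows "x \<otimes> y \<in> span_of R h L (\<lambda>(i, j). g i \<otimes> g' j) (J \<times> J')"
proof -
  let ?G = "\<lambda>(i, j). g i \<otimes> g' j"
  have G: "?G k \<in> carrier L" if "k \<in> J \<times> J'" for k using that g g' by auto
  have JJ: "finite (J \<times> J')" using J by simp
  obtain c where c: "x = (\<Oplus>j\<in>J. h (c j) \<otimes> g j)" "\<forall>j\<in>J. c j \<in> carrier R" using x by (auto simp: span_of_def)
  obtain d where d: "y = (\<Oplus>j\<in>J'. h (d j) \<otimes> g' j)" "\<forall>j\<in>J'. d j \<in> carrier R" using y by (auto simp: span_of_def)
  have yc: "y \<in> carrier L" using span_closed[where J = J' and g = g'] g' y by blast
  have "x \<otimes> y = (\<Oplus>i\<in>J. h (c i) \<otimes> g i \<otimes> y)"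
    unfolding c by (rule L.finsum_ldistr) (use c g yc J in auto)
  also have "\<dots> \<in> span_of R h L ?G (J \<times> J')"
  proof (rule span_finsum[where J = "J \<times> J'" and g = ?G, OF G JJ])
    fix i assume i: "i \<in> J"
    have "g i \<otimes> y = (\<Oplus>j\<in>J'. g i \<otimes> (h (d j) \<otimes> g' j))"
      unfolding d by (rule L.finsum_rdistr) (use d g' g i J in auto)
    also have "\<dots> = (\<Oplus>j\<in>J'. h (d j) \<otimes> ?G (i, j))"
      by (rule L.finsum_cong') (use d g g' i in \<open>auto simp: L.m_ac\<close>)
    also have "\<dots> \<in> span_of R h L ?G (J \<times> J')"
    proof (rule span_finsum[where J = "J \<times> J'" and g = ?G, OF G JJ])
      fix j assume "j \<in> J'"
      then show "h (d j) \<otimes> ?G (i, j) \<in> span_of R h L ?G (J \<times> J')"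
        using span_smult[where J = "J \<times> J'" and g = ?G, OF G span_generator[where J = "J \<times> J'" and g = ?G and k = "(i, j)", OF G JJ] _ JJ] i d by blast
    qed
    finally have "h (c i) \<otimes> (g i \<otimes> y) \<in> span_of R h L ?G (J \<times> J')"
      using span_smult[where J = "J \<times> J'" and g = ?G, OF G _ _ JJ] c i by blast
    then show "h (c i) \<otimes> g i \<otimes> y \<in> span_of R h L ?G (J \<times> J')"
      using c g i yc by (simp add: L.m_assoc)
  qed
  finally show ?thesis .
qed

text \<open>The coordinates with respect to the generators give fewer equations than there are
  elements, so the homogeneous system has a nonzero solution; the generators may themselves be
  dependent.\<close>

lemma span_dependent:
  assumes dom: "domain R" and g: "\<And>j. j \<in> J \<Longrightarrow> g j \<in> carrier L" and J: "finite J"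
    and x: "\<And>i. i \<in> I \<Longrightarrow> x i \<in> span_of R h L g J" and I: "finite I" "card J < card I"
  shows "\<exists>c. (\<forall>i\<in>I. c i \<in> carrier R) \<and> (\<exists>i\<in>I. c i \<noteq> \<zero>\<^bsub>R\<^esub>) \<and> (\<Oplus>i\<in>I. h (c i) \<otimes> x i) = \<zero>"
proof -
  have "\<forall>i. \<exists>r. i \<in> I \<longrightarrow> x i = (\<Oplus>j\<in>J. h (r j) \<otimes> g j) \<and> (\<forall>j\<in>J. r j \<in> carrier R)"
    using x unfolding span_of_def by blast
  then obtain r where r: "x i = (\<Oplus>j\<in>J. h (r i j) \<otimes> g j)" "\<forall>j\<in>J. r i j \<in> carrier R" if "i \<in> I" for i
    by metis
  obtain c where c: "\<forall>i\<in>I. c i \<in> carrier R" "\<exists>i\<in>I. c i \<noteq> \<zero>\<^bsub>R\<^esub>" "\<forall>j\<in>J. (\<Oplus>\<^bsub>R\<^esub>i\<in>I. c i \<otimes>\<^bsub>R\<^esub> r i j) = \<zero>\<^bsub>R\<^esub>"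
    using domain.homogeneous_system[OF dom J I, of r] r by auto
  have hc: "h (c i) \<in> carrier L" "h (r i j) \<in> carrier L" if "i \<in> I" "j \<in> J" for i j using c r that by auto
  have "(\<Oplus>i\<in>I. h (c i) \<otimes> x i) = (\<Oplus>i\<in>I. \<Oplus>j\<in>J. h (c i \<otimes>\<^bsub>R\<^esub> r i j) \<otimes> g j)"
  proof (rule L.finsum_cong'[OF refl])
    fix i assume i: "i \<in> I"
    have "h (c i) \<otimes> x i = (\<Oplus>j\<in>J. h (c i) \<otimes> (h (r i j) \<otimes> g j))"
      unfolding r(1)[OF i] by (rule L.finsum_rdistr) (use c r g i J in auto)
    also have "\<dots> = (\<Oplus>j\<in>J. h (c i \<otimes>\<^bsub>R\<^esub> r i j) \<otimes> g j)"
      by (rule L.finsum_cong') (use c r g i in \<open>auto simp: L.m_assoc\<close>)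
    finally show "h (c i) \<otimes> x i = (\<Oplus>j\<in>J. h (c i \<otimes>\<^bsub>R\<^esub> r i j) \<otimes> g j)" .
  qed (use c r g in \<open>auto intro!: L.finsum_closed\<close>)
  also have "\<dots> = (\<Oplus>j\<in>J. \<Oplus>i\<in>I. h (c i \<otimes>\<^bsub>R\<^esub> r i j) \<otimes> g j)"
    by (rule L.finsum_swap) (use J I c r g in auto)
  also have "\<dots> = (\<Oplus>j\<in>J. \<zero>)"
  proof (rule L.finsum_cong'[OF refl])
    fix j assume j: "j \<in> J"
    have "(\<Oplus>i\<in>I. h (c i \<otimes>\<^bsub>R\<^esub> r i j) \<otimes> g j) = (\<Oplus>i\<in>I. h (c i \<otimes>\<^bsub>R\<^esub> r i j)) \<otimes> g j"
      by (rule L.finsum_ldistr[symmetric]) (use c r g j I in auto)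
    also have "(\<Oplus>i\<in>I. h (c i \<otimes>\<^bsub>R\<^esub> r i j)) = h (\<Oplus>\<^bsub>R\<^esub>i\<in>I. c i \<otimes>\<^bsub>R\<^esub> r i j)"
      using h.hom_finsum[of "\<lambda>i. c i \<otimes>\<^bsub>R\<^esub> r i j" I] c r j by (simp add: comp_def Pi_def)
    finally show "(\<Oplus>i\<in>I. h (c i \<otimes>\<^bsub>R\<^esub> r i j) \<otimes> g j) = \<zero>" using c(3) j g by simp
  qed auto
  finally show ?thesis using c by auto
qed

end


text \<open>\<open>K\<close> is the image of the base ring \<open>R\<close> in \<open>L\<close>. Its
  perfect residue field and its valuation are phrased through congruence modulo \<open>t\<close>, so
  that everything takes place in \<open>L\<close>.\<close>

locale witt_base = witt_action L p V A t a1 c0 T1 T2 m1 \<sigma> for L (structure) and p V A t a1 c0 T1 T2 m1 \<sigma> +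
  fixes K :: "'a set"
  assumes K: "subring K L" and K_A: "K \<subseteq> A" and t_K: "t \<in> K"
    and K_perfect: "\<And>r. r \<in> K \<Longrightarrow> \<exists>s\<in>K. r \<asymp> s [^] p"
    and K_valuation: "\<And>r. r \<in> K \<Longrightarrow> r \<noteq> \<zero> \<Longrightarrow> \<exists>(e::nat) r0. r0 \<in> K \<and> r0 \<notin> I \<and> r = t [^] e \<otimes> r0"
begin

lemma K_A' [simp]: "x \<in> K \<Longrightarrow> x \<in> A" using K_A by blast

lemma K_closed [simp]:
  "\<zero> \<in> K" "\<one> \<in> K" "x \<in> K \<Longrightarrow> \<ominus> x \<in> K" "x \<in> K \<Longrightarrow> y \<in> K \<Longrightarrow> x \<otimes> y \<in> K" "x \<in> K \<Longrightarrow> x [^] (k::nat) \<in> K"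
  using subringE[OF K] subring_pow[OF K] by auto

text \<open>As the residue field of \<open>K\<close> is perfect, an algebraic relation for \<open>a1\<close> of degree \<open>d\<close> splits by
  \<open>p\<close>-independence into relations of degree at most \<open>d div p\<close>.\<close>

lemma algebraic_independent:
  fixes r :: "nat \<Rightarrow> 'a"
  shows "(\<And>i. i \<le> d \<Longrightarrow> r i \<in> K) \<Longrightarrow> (\<Oplus>i\<in>{..d}. r i \<otimes> a1 [^] i) \<in> I \<Longrightarrow> i \<le> d \<Longrightarrow> r i \<in> I"
proof (induction d arbitrary: r i rule: less_induct)
  case (less d)
  show ?case
  proof (cases "d = 0")
    case True
    then show ?thesis using less.prems by simp
  next
    case False
    have "\<forall>i. \<exists>s. i \<le> d \<longrightarrow> s \<in> K \<and> r i \<asymp> s [^] p" using less.prems(1) K_perfect by meson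
    then obtain s where s: "s i \<in> K" "r i \<asymp> s i [^] p" if "i \<le> d" for i by metis
    \<comment> \<open>Extending by zero lets the indices run over all \<open>j + p * q\<close> with
      \<open>j < p\<close> and \<open>q < M\<close>, although \<open>d + 1\<close> need not be a
      multiple of \<open>p\<close>.\<close>
    define s' where "s' i = (if i \<le> d then s i else \<zero>)" for i
    have s'K [simp]: "s' i \<in> K" for i using s by (simp add: s'_def)
    define M where "M = Suc (d div p)"
    \<comment> \<open>Writing exponents as \<open>j + p q\<close>, the terms with fixed
      \<open>j\<close> combine, modulo \<open>t\<close>, to
      \<open>b j [^] p \<otimes> a1 [^] j\<close>, because each coefficient is congruent to a
      \<open>p\<close>-th power.\<close>
    define b where "b j = (\<Oplus>q\<in>{..<M}. s' (j + p * q) \<otimes> a1 [^] q)" for j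
    have bA [simp]: "b j \<in> A" for j unfolding b_def by (rule A_finsum) auto
    have dM: "d < p * M"
      using p_pos unfolding M_def by (metis dividend_less_times_div mult_Suc_right add.commute)
    have "(\<Oplus>j\<in>{..<p}. b j [^] p \<otimes> a1 [^] j) = (\<Oplus>j\<in>{..<p}. \<Oplus>q\<in>{..<M}. s' (j + p * q) [^] p \<otimes> a1 [^] (j + p * q))"
    proof (rule finsum_cong'[OF refl])
      fix j assume "j \<in> {..<p}"
      have "b j [^] p = (\<Oplus>q\<in>{..<M}. (s' (j + p * q) \<otimes> a1 [^] q) [^] p)"
        unfolding b_def by (rule frob_finsum) auto
      then have "b j [^] p \<otimes> a1 [^] j = (\<Oplus>q\<in>{..<M}. (s' (j + p * q) \<otimes> a1 [^] q) [^] p \<otimes> a1 [^] j)"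
        using finsum_ldistr[of "{..<M}" "a1 [^] j" "\<lambda>q. (s' (j + p * q) \<otimes> a1 [^] q) [^] p"] by simp
      also have "\<dots> = (\<Oplus>q\<in>{..<M}. s' (j + p * q) [^] p \<otimes> a1 [^] (j + p * q))"
        by (rule finsum_cong') (auto simp: nat_pow_distrib nat_pow_pow nat_pow_mult[symmetric] m_ac mult.commute)
      finally show "b j [^] p \<otimes> a1 [^] j = (\<Oplus>q\<in>{..<M}. s' (j + p * q) [^] p \<otimes> a1 [^] (j + p * q))" .
    qed (auto intro!: finsum_closed)
    also have "\<dots> = (\<Oplus>i\<in>{..<p * M}. s' i [^] p \<otimes> a1 [^] i)"
      by (rule finsum_lessThan_mult[symmetric]) simp
    also have "\<dots> = (\<Oplus>i\<in>{..d}. s' i [^] p \<otimes> a1 [^] i)"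
      by (rule add.finprod_mono_neutral_cong_right)
        (use dM p_pos in \<open>auto simp: s'_def nat_pow_zero s\<close>)
    also have "\<dots> \<asymp> (\<Oplus>i\<in>{..d}. r i \<otimes> a1 [^] i)"
      by (intro eqv_finsum eqv_mult eqv_refl) (use s in \<open>auto simp: s'_def intro: eqv_sym\<close>)
    finally have bI: "(\<Oplus>j\<in>{..<p}. b j [^] p \<otimes> a1 [^] j) \<in> I" using less.prems(2) eqv_I by blast
    have "b (i mod p) \<in> I"
      by (rule p_independent[where g = a1 and b = b]) (use nonpower bI p_pos in auto)
    then have "(\<Oplus>q\<in>{..d div p}. s' (i mod p + p * q) \<otimes> a1 [^] q) \<in> I"
      by (simp add: b_def M_def lessThan_Suc_atMost)
    \<comment> \<open>Each \<open>b (i mod p)\<close> is again a polynomial in \<open>a1\<close>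
      over \<open>K\<close>, now of degree at most \<open>d div p\<close>, so the induction
      applies.\<close>
    moreover have "d div p < d" using False p_ge_2 by simp
    ultimately have "s' (i mod p + p * (i div p)) \<in> I"
      using less.prems(3) by (intro less.IH[of "d div p" "\<lambda>q. s' (i mod p + p * q)" "i div p"]) (auto simp: div_le_mono)
    then have "s i \<in> I" using less.prems(3) by (simp add: s'_def)
    then have "s i [^] p \<asymp> \<zero> [^] p" by (intro eqv_pow) (simp add: eqv_zero)
    then show ?thesis using s[OF less.prems(3)] p_pos eqv_I by (simp add: nat_pow_zero eqv_zero)
  qed
qed

lemma algebraic_independent_set:
  fixes r :: "nat \<Rightarrow> 'a"
  assumes J: "finite J" "\<And>i. i \<in> J \<Longrightarrow> r i \<in> K" "(\<Oplus>i\<in>J. r i \<otimes> a1 [^] (i::nat)) \<in> I" "i \<in> J"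
  shows "r i \<in> I"
proof -
  obtain d where d: "J \<subseteq> {..d}" using J(1) by (metis finite_nat_iff_bounded_le)
  define r' where "r' i = (if i \<in> J then r i else \<zero>)" for i
  have r'K: "r' i \<in> K" for i using J by (simp add: r'_def)
  have "(\<Oplus>i\<in>{..d}. r' i \<otimes> a1 [^] i) = (\<Oplus>i\<in>J. r i \<otimes> a1 [^] i)"
    by (rule add.finprod_mono_neutral_cong_right) (use d J in \<open>auto simp: r'_def\<close>)
  then have "r' i \<in> I" using J d r'K by (intro algebraic_independent[of d r' i]) auto
  then show ?thesis using J by (simp add: r'_def)
qed

text \<open>The \<open>i\<close>-th monomial has leading part \<open>U^d z^(d - i)\<close> with
  \<open>z = - Z1^(p - 1)\<close>, times \<open>t^(m (d - i) + n i)\<close>. Dividing the relation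
  by the least power of \<open>t\<close> that occurs and reducing modulo \<open>t\<close>, one
  cancels \<open>U^d\<close> and obtains a polynomial relation for \<open>z\<close> over
  \<open>K\<close> with a coefficient that is nonzero modulo \<open>t\<close>. Its
  \<open>p\<close>-th power is a relation for \<open>a1\<close>, excluded by
  \<open>algebraic_independent_set\<close>.\<close>

lemma no_relation:
  fixes \<rho> :: "nat \<Rightarrow> 'a"
  assumes U: "U \<in> V" "U \<notin> I" and rs: "r \<in> V" "s \<in> V"
    and u: "u = t [^] m \<otimes> (U \<otimes> \<ominus> (Z1 [^] (p - 1)) \<oplus> t \<otimes> r)" and v: "v = t [^] n \<otimes> (U \<otimes> \<one> \<oplus> t \<otimes> s)"
    and \<rho>: "\<And>i. i \<le> d \<Longrightarrow> \<rho> i \<in> K" and rel: "(\<Oplus>i\<in>{..d}. \<rho> i \<otimes> (u [^] (d - i) \<otimes> v [^] i)) = \<zero>"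
    and i: "i \<le> d"
  shows "\<rho> i = \<zero>"
proof (rule ccontr)
  assume nz: "\<rho> i \<noteq> \<zero>"
  define J where "J = {i. i \<le> d \<and> \<rho> i \<noteq> \<zero>}"
  have J: "finite J" "J \<noteq> {}" "\<And>i. i \<in> J \<Longrightarrow> i \<le> d" using nz i by (auto simp: J_def intro: finite_subset[of _ "{..d}"])
  have "\<forall>i. \<exists>e r0. i \<in> J \<longrightarrow> r0 \<in> K \<and> r0 \<notin> I \<and> \<rho> i = t [^] (e::nat) \<otimes> r0"
    using K_valuation \<rho> unfolding J_def by (metis (mono_tags, lifting) mem_Collect_eq)
  then obtain e r0 where er: "r0 i \<in> K" "r0 i \<notin> I" "\<rho> i = t [^] (e i :: nat) \<otimes> r0 i" if "i \<in> J" for i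
    by metis
  \<comment> \<open>The full order in \<open>t\<close> of the \<open>i\<close>-th term: the
    valuation of its coefficient together with the orders of \<open>u\<close> and
    \<open>v\<close>.\<close>
  define \<epsilon> where "\<epsilon> i = e i + (m * (d - i) + n * i)" for i
  define \<mu> where "\<mu> = Min (\<epsilon> ` J)"
  have \<mu>: "\<mu> \<le> \<epsilon> i" if "i \<in> J" for i unfolding \<mu>_def using J that by simp
  have "\<mu> \<in> \<epsilon> ` J" unfolding \<mu>_def using J by (intro Min_in) auto
  then obtain i0 where i0: "i0 \<in> J" "\<epsilon> i0 = \<mu>" by auto
  \<comment> \<open>The coefficient left after dividing by \<open>t^\<mu>\<close>. It is in
    \<open>K\<close>, and outside \<open>I\<close> at the index \<open>i0\<close> where the minimum
    is attained.\<close>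
  define \<kappa> where "\<kappa> i = t [^] (\<epsilon> i - \<mu>) \<otimes> r0 i" for i
  have \<kappa>K [simp]: "\<kappa> i \<in> K" if "i \<in> J" for i unfolding \<kappa>_def using er that t_K by simp
  define u' where "u' = U \<otimes> \<ominus> (Z1 [^] (p - 1)) \<oplus> t \<otimes> r"
  define v' where "v' = U \<otimes> \<one> \<oplus> t \<otimes> s"
  have uv [simp]: "u' \<in> V" "v' \<in> V" using U rs by (auto simp: u'_def v'_def)
  have uu: "u = t [^] m \<otimes> u'" and vv: "v = t [^] n \<otimes> v'" by (simp_all add: u v u'_def v'_def)
  have uvL: "u \<in> carrier L" "v \<in> carrier L" unfolding uu vv by simp_all
  let ?h = "\<lambda>i. \<kappa> i \<otimes> (u' [^] (d - i) \<otimes> v' [^] i)"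
  have hV: "?h i \<in> V" if "i \<in> J" for i using that by simp
  have term_eq: "\<rho> i \<otimes> (u [^] (d - i) \<otimes> v [^] i) = t [^] \<mu> \<otimes> ?h i" if iJ: "i \<in> J" for i
  proof -
    have [simp]: "r0 i \<in> V" using er iJ by simp
    have e: "e i + (m * (d - i) + n * i) = \<mu> + (\<epsilon> i - \<mu>)" using \<mu>[OF iJ] by (simp add: \<epsilon>_def)
    have "\<rho> i \<otimes> (u [^] (d - i) \<otimes> v [^] i)
        = (t [^] e i \<otimes> (t [^] (m * (d - i)) \<otimes> t [^] (n * i))) \<otimes> (r0 i \<otimes> (u' [^] (d - i) \<otimes> v' [^] i))"
      unfolding er(3)[OF iJ] uu vv by (simp add: nat_pow_distrib nat_pow_pow m_ac)
    also have "t [^] e i \<otimes> (t [^] (m * (d - i)) \<otimes> t [^] (n * i)) = t [^] \<mu> \<otimes> t [^] (\<epsilon> i - \<mu>)"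
      by (simp add: nat_pow_mult e)
    finally show ?thesis by (simp add: \<kappa>_def m_assoc)
  qed
  have "(\<Oplus>i\<in>{..d}. \<rho> i \<otimes> (u [^] (d - i) \<otimes> v [^] i)) = (\<Oplus>i\<in>J. t [^] \<mu> \<otimes> ?h i)"
    by (rule add.finprod_mono_neutral_cong_right) (use \<rho> uvL term_eq in \<open>auto simp: J_def\<close>)
  also have "\<dots> = t [^] \<mu> \<otimes> (\<Oplus>i\<in>J. ?h i)"
    by (rule finsum_rdistr[symmetric]) (use J hV in \<open>auto simp del: \<kappa>K\<close>)
  finally have "\<zero> = t [^] \<mu> \<otimes> (\<Oplus>i\<in>J. ?h i)" unfolding rel .
  then have "t [^] \<mu> \<otimes> (\<Oplus>i\<in>J. ?h i) = t [^] \<mu> \<otimes> \<zero>" using r_null[of "t [^] \<mu>"] by (metis nat_pow_closed t_carrier)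
  then have sum0: "(\<Oplus>i\<in>J. ?h i) = \<zero>"
    by (rule t_cancel[rotated 2]) (auto intro!: finsum_closed)
  define z where "z = \<ominus> (Z1 [^] (p - 1))"
  have zV [simp]: "z \<in> V" by (simp add: z_def)
  have u'_eqv: "u' \<asymp> U \<otimes> z" unfolding u'_def z_def[symmetric]
    by (rule eqvI[of _ "t \<otimes> r"]) (use U rs I_I in auto)
  have v'_eqv: "v' \<asymp> U" unfolding v'_def
    by (rule eqvI[of _ "t \<otimes> s"]) (use U rs I_I in auto)
  have "(\<Oplus>i\<in>J. ?h i) \<asymp> (\<Oplus>i\<in>J. \<kappa> i \<otimes> ((U \<otimes> z) [^] (d - i) \<otimes> U [^] i))"
    by (intro eqv_finsum eqv_mult eqv_pow u'_eqv v'_eqv eqv_refl) simp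
  also have "(\<Oplus>i\<in>J. \<kappa> i \<otimes> ((U \<otimes> z) [^] (d - i) \<otimes> U [^] i)) = (\<Oplus>i\<in>J. U [^] d \<otimes> (\<kappa> i \<otimes> z [^] (d - i)))"
  proof (rule finsum_cong'[OF refl])
    fix i assume i: "i \<in> J"
    have "U [^] d = U [^] (d - i) \<otimes> U [^] i" using J(3)[OF i] U by (simp add: nat_pow_mult)
    then show "\<kappa> i \<otimes> ((U \<otimes> z) [^] (d - i) \<otimes> U [^] i) = U [^] d \<otimes> (\<kappa> i \<otimes> z [^] (d - i))"
      using U i by (simp add: nat_pow_distrib m_ac)
  qed (use U in auto)
  also have "\<dots> = U [^] d \<otimes> (\<Oplus>i\<in>J. \<kappa> i \<otimes> z [^] (d - i))"
    by (rule finsum_rdistr[symmetric]) (use J U in auto)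
  finally have "U [^] d \<otimes> (\<Oplus>i\<in>J. \<kappa> i \<otimes> z [^] (d - i)) \<in> I"
    using sum0 eqv_I by (metis I_zero)
  moreover have XV: "(\<Oplus>i\<in>J. \<kappa> i \<otimes> z [^] (d - i)) \<in> V" by (rule V_finsum) simp
  ultimately have XI: "(\<Oplus>i\<in>J. \<kappa> i \<otimes> z [^] (d - i)) \<in> I"
    using I_prime[of "U [^] d"] I_pow[of U d] U by auto
  \<comment> \<open>\<open>Z1\<close> is not an element of \<open>A\<close>, but its
    \<open>p\<close>-th power is congruent to \<open>a1\<close>; this is why the relation is raised
    to the power \<open>p\<close>.\<close>
  have zp: "z [^] p \<asymp> \<ominus> (a1 [^] (p - 1))"
  proof -
    have "z [^] p = \<ominus> ((Z1 [^] p) [^] (p - 1))"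
      unfolding z_def by (simp add: frob_minus nat_pow_pow mult.commute)
    also have "\<dots> \<asymp> \<ominus> (a1 [^] (p - 1))" by (intro eqv_neg eqv_pow Z1_p)
    finally show ?thesis .
  qed
  let ?w = "\<lambda>i. \<kappa> i [^] p \<otimes> (\<ominus> \<one>) [^] (d - i)"
  have "(\<Oplus>i\<in>J. \<kappa> i \<otimes> z [^] (d - i)) [^] p = (\<Oplus>i\<in>J. (\<kappa> i \<otimes> z [^] (d - i)) [^] p)"
    by (rule frob_finsum) simp
  also have "\<dots> = (\<Oplus>i\<in>J. \<kappa> i [^] p \<otimes> (z [^] p) [^] (d - i))"
    by (rule finsum_cong') (auto simp: nat_pow_distrib nat_pow_pow mult.commute)
  also have "\<dots> \<asymp> (\<Oplus>i\<in>J. \<kappa> i [^] p \<otimes> (\<ominus> (a1 [^] (p - 1))) [^] (d - i))"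
    by (intro eqv_finsum eqv_mult eqv_refl eqv_pow zp) simp
  also have "(\<Oplus>i\<in>J. \<kappa> i [^] p \<otimes> (\<ominus> (a1 [^] (p - 1))) [^] (d - i)) = (\<Oplus>i\<in>J. ?w i \<otimes> a1 [^] ((p - 1) * (d - i)))"
    by (rule finsum_cong') (auto simp: minus_pow[of "a1 [^] (p - Suc 0)"] nat_pow_pow m_assoc)
  finally have e1: "(\<Oplus>i\<in>J. \<kappa> i \<otimes> z [^] (d - i)) [^] p \<asymp> (\<Oplus>i\<in>J. ?w i \<otimes> a1 [^] ((p - 1) * (d - i)))" .
  have "(\<Oplus>i\<in>J. \<kappa> i \<otimes> z [^] (d - i)) [^] p \<asymp> \<zero> [^] p"
    using XI by (intro eqv_pow) (simp add: eqv_zero)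
  then have wI: "(\<Oplus>i\<in>J. ?w i \<otimes> a1 [^] ((p - 1) * (d - i))) \<in> I"
    using e1 p_pos eqv_I by (simp add: nat_pow_zero eqv_zero)
  \<comment> \<open>The exponents \<open>(p - 1) (d - i)\<close> of \<open>a1\<close> are distinct,
    so the coefficients cannot merge. The function \<open>w\<close> below recovers \<open>i\<close>
    from such an exponent.\<close>
  define h where "h i = (p - 1) * (d - i)" for i
  define w where "w k = ?w (d - k div (p - 1))" for k
  have wh: "w (h i) = ?w i" if "i \<in> J" for i
    using J(3)[OF that] p_ge_2 by (simp add: w_def h_def)
  have inj: "inj_on h J"
    by (rule inj_onI) (use J(3) p_ge_2 in \<open>auto simp: h_def dest!: J(3)\<close>)
  have "(\<Oplus>k\<in>h ` J. w k \<otimes> a1 [^] k) = (\<Oplus>i\<in>J. w (h i) \<otimes> a1 [^] h i)"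
    by (rule finsum_reindex[OF _ inj]) (auto simp: wh)
  also have "\<dots> = (\<Oplus>i\<in>J. ?w i \<otimes> a1 [^] ((p - 1) * (d - i)))"
  proof (rule finsum_cong'[OF refl])
    fix i assume "i \<in> J"
    then show "w (h i) \<otimes> a1 [^] h i = ?w i \<otimes> a1 [^] ((p - 1) * (d - i))" by (simp only: wh) (simp only: h_def)
  qed auto
  finally have "(\<Oplus>k\<in>h ` J. w k \<otimes> a1 [^] k) \<in> I" using wI by simp
  then have "w (h i0) \<in> I"
  proof (rule algebraic_independent_set[of "h ` J" w, rotated 2])
    show "h i0 \<in> h ` J" using i0 by blast
    show "finite (h ` J)" using J(1) by blast
    show "w k \<in> K" if k: "k \<in> h ` J" for k
    proof -
      obtain j where j: "j \<in> J" "k = h j" using k by blast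
      show ?thesis unfolding j(2) wh[OF j(1)] by (intro K_closed \<kappa>K[OF j(1)])
    qed
  qed
  then have "?w i0 \<in> I" using wh i0 by simp
  then have "\<kappa> i0 [^] p \<in> I \<or> (\<ominus> \<one>) [^] (d - i0) \<in> I" using I_prime i0 by simp
  then have "\<kappa> i0 \<in> I \<or> \<ominus> \<one> \<in> I" using I_pow[of "\<kappa> i0" p] I_pow[of "\<ominus> \<one>" "d - i0"] i0 by auto
  moreover have "\<ominus> \<one> \<notin> I" using I_neg[of "\<ominus> \<one>"] I_one by auto
  moreover have "\<kappa> i0 = r0 i0" using i0 er[OF i0(1)] by (simp add: \<kappa>_def)
  ultimately show False using er i0 by auto
qed

end


section \<open>Localization\<close>

locale ring_localization = cring B for B :: "('b, 'n) ring_scheme" (structure) +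
  fixes S :: "'b set"
  assumes S_carrier: "S \<subseteq> carrier B" and S_one: "\<one> \<in> S"
    and S_mult: "\<And>s t. s \<in> S \<Longrightarrow> t \<in> S \<Longrightarrow> s \<otimes> t \<in> S"
begin

abbreviation "fr \<equiv> fraction B S"
abbreviation "loc \<equiv> localization B S"

lemma S_in [simp]: "s \<in> S \<Longrightarrow> s \<in> carrier B" using S_carrier by blast

lemma equiv_loc_rel: "equiv (carrier B \<times> S) (loc_rel B S)"
proof (rule equivI)
  show "loc_rel B S \<subseteq> (carrier B \<times> S) \<times> (carrier B \<times> S)"
    by (auto simp: loc_rel_def)
  show "refl_on (carrier B \<times> S) (loc_rel B S)"
    using S_one by (auto simp: refl_on_def loc_rel_def a_minus_def r_neg intro!: bexI[of _ \<one>])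
  show "sym (loc_rel B S)"
  proof (rule symI, clarsimp simp: loc_rel_def)
    fix a s b t u assume ca [simp]: "a \<in> carrier B" "b \<in> carrier B" and S: "s \<in> S" "t \<in> S" "u \<in> S"
      and e: "u \<otimes> (t \<otimes> a \<ominus> s \<otimes> b) = \<zero>"
    have cs [simp]: "s \<in> carrier B" "t \<in> carrier B" "u \<in> carrier B" using S by auto
    note cc = ca cs
    have "u \<otimes> (s \<otimes> b \<ominus> t \<otimes> a) = \<ominus> (u \<otimes> (t \<otimes> a \<ominus> s \<otimes> b))"
      using cc by algebra
    then show "\<exists>u\<in>S. u \<otimes> (s \<otimes> b \<ominus> t \<otimes> a) = \<zero>" using S e by (intro bexI[of _ u]) auto
  qed
  show "trans (loc_rel B S)"
  proof (rule transI, clarsimp simp: loc_rel_def)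
    fix a s b t c r u v
    assume ca [simp]: "a \<in> carrier B" "b \<in> carrier B" "c \<in> carrier B" and S: "s \<in> S" "t \<in> S" "r \<in> S" "u \<in> S" "v \<in> S"
      and e: "u \<otimes> (t \<otimes> a \<ominus> s \<otimes> b) = \<zero>" and f: "v \<otimes> (r \<otimes> b \<ominus> t \<otimes> c) = \<zero>"
    have cs [simp]: "s \<in> carrier B" "t \<in> carrier B" "u \<in> carrier B" "r \<in> carrier B" "v \<in> carrier B" using S by auto
    note cc = ca cs
    \<comment> \<open>The middle denominator joins the multiplier, since it cannot be cancelled when
      there are zero divisors.\<close>
    have "(u \<otimes> v \<otimes> t) \<otimes> (r \<otimes> a \<ominus> s \<otimes> c) = v \<otimes> r \<otimes> (u \<otimes> (t \<otimes> a \<ominus> s \<otimes> b)) \<oplus> u \<otimes> s \<otimes> (v \<otimes> (r \<otimes> b \<ominus> t \<otimes> c))"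
      using cc by algebra
    then have "(u \<otimes> v \<otimes> t) \<otimes> (r \<otimes> a \<ominus> s \<otimes> c) = \<zero>" unfolding e f by simp
    then show "\<exists>u\<in>S. u \<otimes> (r \<otimes> a \<ominus> s \<otimes> c) = \<zero>" using S by (intro bexI[of _ "u \<otimes> v \<otimes> t"]) (auto intro!: S_mult)
  qed
qed

lemma frac_eq_iff:
  assumes "a \<in> carrier B" "s \<in> S" "b \<in> carrier B" "t \<in> S"
  shows "fr a s = fr b t \<longleftrightarrow> (\<exists>u\<in>S. u \<otimes> (t \<otimes> a \<ominus> s \<otimes> b) = \<zero>)"
  unfolding fraction_def
  using eq_equiv_class_iff[OF equiv_loc_rel, of "(a, s)" "(b, t)"] assms by (simp add: loc_rel_def)

lemma frac_eqI:
  assumes "a \<in> carrier B" "s \<in> S" "b \<in> carrier B" "t \<in> S" "t \<otimes> a = s \<otimes> b"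
  shows "fr a s = fr b t"
  using assms S_one by (subst frac_eq_iff) (auto simp: a_minus_def r_neg intro!: bexI[of _ \<one>])

lemma frac_self: "a \<in> carrier B \<Longrightarrow> s \<in> S \<Longrightarrow> (a, s) \<in> fr a s"
  unfolding fraction_def using equiv_class_self[OF equiv_loc_rel] by simp

lemma frac_mem: "(b, t) \<in> fr a s \<Longrightarrow> b \<in> carrier B \<and> t \<in> S \<and> fr b t = fr a s"
proof -
  assume "(b, t) \<in> fr a s"
  then have r: "((a, s), (b, t)) \<in> loc_rel B S" by (simp add: fraction_def)
  then have "b \<in> carrier B" "t \<in> S" by (auto simp: loc_rel_def)
  moreover have "fr b t = fr a s"
    unfolding fraction_def using equiv_class_eq[OF equiv_loc_rel r] by simp
  ultimately show ?thesis by simp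
qed

lemma carrier_loc: "carrier loc = {fr a s | a s. a \<in> carrier B \<and> s \<in> S}"
  by (auto simp: localization_def quotient_def fraction_def)

lemma frac_closed [simp]: "a \<in> carrier B \<Longrightarrow> s \<in> S \<Longrightarrow> fr a s \<in> carrier loc"
  by (auto simp: carrier_loc)

lemma loc_cases:
  assumes "x \<in> carrier loc"
  obtains a s where "a \<in> carrier B" "s \<in> S" "x = fr a s"
  using assms by (auto simp: carrier_loc)

lemma frac_mult_cong:
  assumes "a \<in> carrier B" "s \<in> S" "b \<in> carrier B" "t \<in> S" "a' \<in> carrier B" "s' \<in> S" "b' \<in> carrier B" "t' \<in> S"
    "fr a s = fr a' s'" "fr b t = fr b' t'"
  shows "fr (a \<otimes> b) (s \<otimes> t) = fr (a' \<otimes> b') (s' \<otimes> t')"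
proof -
  obtain u where u: "u \<in> S" "u \<otimes> (s' \<otimes> a \<ominus> s \<otimes> a') = \<zero>" using assms frac_eq_iff by blast
  obtain v where v: "v \<in> S" "v \<otimes> (t' \<otimes> b \<ominus> t \<otimes> b') = \<zero>" using assms frac_eq_iff by blast
  have id: "(u \<otimes> v) \<otimes> (s' \<otimes> t' \<otimes> (a \<otimes> b) \<ominus> s \<otimes> t \<otimes> (a' \<otimes> b'))
      = u \<otimes> (s' \<otimes> a \<ominus> s \<otimes> a') \<otimes> (v \<otimes> (t' \<otimes> b)) \<oplus> v \<otimes> (t' \<otimes> b \<ominus> t \<otimes> b') \<otimes> (u \<otimes> (s \<otimes> a'))"
    if "u \<in> carrier B" "v \<in> carrier B" "s \<in> carrier B" "s' \<in> carrier B" "t \<in> carrier B" "t' \<in> carrier B"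
      "a \<in> carrier B" "a' \<in> carrier B" "b \<in> carrier B" "b' \<in> carrier B" for u v s s' t t' a a' b b'
    using that by algebra
  have "(u \<otimes> v) \<otimes> (s' \<otimes> t' \<otimes> (a \<otimes> b) \<ominus> s \<otimes> t \<otimes> (a' \<otimes> b')) = \<zero>"
    using id[of u v s s' t t' a a' b b'] assms u v by simp
  then show ?thesis using assms u v S_mult by (subst frac_eq_iff) (auto intro!: bexI[of _ "u \<otimes> v"])
qed

lemma frac_add_cong:
  assumes "a \<in> carrier B" "s \<in> S" "b \<in> carrier B" "t \<in> S" "a' \<in> carrier B" "s' \<in> S" "b' \<in> carrier B" "t' \<in> S"
    "fr a s = fr a' s'" "fr b t = fr b' t'"
  shows "fr (t \<otimes> a \<oplus> s \<otimes> b) (s \<otimes> t) = fr (t' \<otimes> a' \<oplus> s' \<otimes> b') (s' \<otimes> t')"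
proof -
  obtain u where u: "u \<in> S" "u \<otimes> (s' \<otimes> a \<ominus> s \<otimes> a') = \<zero>" using assms frac_eq_iff by blast
  obtain v where v: "v \<in> S" "v \<otimes> (t' \<otimes> b \<ominus> t \<otimes> b') = \<zero>" using assms frac_eq_iff by blast
  have id: "(u \<otimes> v) \<otimes> (s' \<otimes> t' \<otimes> (t \<otimes> a \<oplus> s \<otimes> b) \<ominus> s \<otimes> t \<otimes> (t' \<otimes> a' \<oplus> s' \<otimes> b'))
      = u \<otimes> (s' \<otimes> a \<ominus> s \<otimes> a') \<otimes> (v \<otimes> (t \<otimes> t')) \<oplus> v \<otimes> (t' \<otimes> b \<ominus> t \<otimes> b') \<otimes> (u \<otimes> (s \<otimes> s'))"
    if "u \<in> carrier B" "v \<in> carrier B" "s \<in> carrier B" "s' \<in> carrier B" "t \<in> carrier B" "t' \<in> carrier B"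
      "a \<in> carrier B" "a' \<in> carrier B" "b \<in> carrier B" "b' \<in> carrier B" for u v s s' t t' a a' b b'
    using that by algebra
  have "(u \<otimes> v) \<otimes> (s' \<otimes> t' \<otimes> (t \<otimes> a \<oplus> s \<otimes> b) \<ominus> s \<otimes> t \<otimes> (t' \<otimes> a' \<oplus> s' \<otimes> b')) = \<zero>"
    using id[of u v s s' t t' a a' b b'] assms u v by simp
  then show ?thesis using assms u v S_mult by (subst frac_eq_iff) (auto intro!: bexI[of _ "u \<otimes> v"])
qed

lemma UN_frac_const:
  assumes "a \<in> carrier B" "s \<in> S" "b \<in> carrier B" "t \<in> S"
    and "\<And>a' s' b' t'. (a', s') \<in> fr a s \<Longrightarrow> (b', t') \<in> fr b t \<Longrightarrow> F a' s' b' t' = Y"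
  shows "(\<Union>(a, s)\<in>fr a s. \<Union>(b, t)\<in>fr b t. F a s b t) = Y"
  using frac_self[OF assms(1,2)] frac_self[OF assms(3,4)] assms(5) by fastforce

lemma frac_mult:
  assumes "a \<in> carrier B" "s \<in> S" "b \<in> carrier B" "t \<in> S"
  shows "fr a s \<otimes>\<^bsub>loc\<^esub> fr b t = fr (a \<otimes> b) (s \<otimes> t)"
proof -
  have "fr a s \<otimes>\<^bsub>loc\<^esub> fr b t = (\<Union>(a, s)\<in>fr a s. \<Union>(b, t)\<in>fr b t. fr (a \<otimes> b) (s \<otimes> t))"
    by (simp add: localization_def)
  also have "\<dots> = fr (a \<otimes> b) (s \<otimes> t)"
    by (rule UN_frac_const[OF assms]) (use assms frac_mem in \<open>intro frac_mult_cong; blast\<close>)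
  finally show ?thesis .
qed

lemma frac_add:
  assumes "a \<in> carrier B" "s \<in> S" "b \<in> carrier B" "t \<in> S"
  shows "fr a s \<oplus>\<^bsub>loc\<^esub> fr b t = fr (t \<otimes> a \<oplus> s \<otimes> b) (s \<otimes> t)"
proof -
  have "fr a s \<oplus>\<^bsub>loc\<^esub> fr b t = (\<Union>(a, s)\<in>fr a s. \<Union>(b, t)\<in>fr b t. fr (t \<otimes> a \<oplus> s \<otimes> b) (s \<otimes> t))"
    by (simp add: localization_def)
  also have "\<dots> = fr (t \<otimes> a \<oplus> s \<otimes> b) (s \<otimes> t)"
    by (rule UN_frac_const[OF assms]) (use assms frac_mem in \<open>intro frac_add_cong; blast\<close>)
  finally show ?thesis .
qed

lemma loc_one: "\<one>\<^bsub>loc\<^esub> = fr \<one> \<one>" and loc_zero: "\<zero>\<^bsub>loc\<^esub> = fr \<zero> \<one>"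
  by (simp_all add: localization_def)

lemma frac_neg:
  assumes a: "a \<in> carrier B" and s: "s \<in> S"
  shows "fr (\<ominus> a) s \<oplus>\<^bsub>loc\<^esub> fr a s = \<zero>\<^bsub>loc\<^esub>"
proof -
  have "fr (\<ominus> a) s \<oplus>\<^bsub>loc\<^esub> fr a s = fr \<zero> (s \<otimes> s)"
    using a s by (simp add: frac_add r_minus l_neg)
  also have "\<dots> = fr \<zero> \<one>"
    by (rule frac_eqI) (use s S_one S_mult in auto)
  finally show ?thesis unfolding loc_zero .
qed

lemma loc_cring: "cring loc"
proof (rule cringI)
  have c: "\<zero> \<in> carrier B" "\<one> \<in> carrier B" by auto
  show "abelian_group loc"
  proof (rule abelian_groupI)
    show "\<zero>\<^bsub>loc\<^esub> \<in> carrier loc" by (simp add: loc_zero S_one)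
    fix x y assume x: "x \<in> carrier loc" and y: "y \<in> carrier loc"
    obtain a s where a: "a \<in> carrier B" "s \<in> S" "x = fr a s" using x by (rule loc_cases)
    obtain b t where b: "b \<in> carrier B" "t \<in> S" "y = fr b t" using y by (rule loc_cases)
    show "x \<oplus>\<^bsub>loc\<^esub> y \<in> carrier loc" using a b by (simp add: frac_add S_mult)
    show "x \<oplus>\<^bsub>loc\<^esub> y = y \<oplus>\<^bsub>loc\<^esub> x" using a b by (simp add: frac_add a_comm m_comm)
    show "\<zero>\<^bsub>loc\<^esub> \<oplus>\<^bsub>loc\<^esub> x = x" using a by (simp add: frac_add loc_zero S_one)
    show "\<exists>y\<in>carrier loc. y \<oplus>\<^bsub>loc\<^esub> x = \<zero>\<^bsub>loc\<^esub>"
    proof (rule bexI)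
      show "fr (\<ominus> a) s \<oplus>\<^bsub>loc\<^esub> x = \<zero>\<^bsub>loc\<^esub>"
        unfolding a(3) using a by (intro frac_neg)
    qed (use a in simp)
    fix z assume z: "z \<in> carrier loc"
    obtain d u where d: "d \<in> carrier B" "u \<in> S" "z = fr d u" using z by (rule loc_cases)
    show "x \<oplus>\<^bsub>loc\<^esub> y \<oplus>\<^bsub>loc\<^esub> z = x \<oplus>\<^bsub>loc\<^esub> (y \<oplus>\<^bsub>loc\<^esub> z)"
      using a b d by (simp add: frac_add S_mult r_distr a_assoc m_ac)
  qed
  show "comm_monoid loc"
  proof (rule comm_monoidI)
    show "\<one>\<^bsub>loc\<^esub> \<in> carrier loc" by (simp add: loc_one S_one)
    fix x y assume x: "x \<in> carrier loc" and y: "y \<in> carrier loc"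
    obtain a s where a: "a \<in> carrier B" "s \<in> S" "x = fr a s" using x by (rule loc_cases)
    obtain b t where b: "b \<in> carrier B" "t \<in> S" "y = fr b t" using y by (rule loc_cases)
    show "x \<otimes>\<^bsub>loc\<^esub> y \<in> carrier loc" using a b by (simp add: frac_mult S_mult)
    show "x \<otimes>\<^bsub>loc\<^esub> y = y \<otimes>\<^bsub>loc\<^esub> x" using a b by (simp add: frac_mult m_comm)
    show "\<one>\<^bsub>loc\<^esub> \<otimes>\<^bsub>loc\<^esub> x = x" using a by (simp add: frac_mult loc_one S_one)
    fix z assume z: "z \<in> carrier loc"
    obtain d u where d: "d \<in> carrier B" "u \<in> S" "z = fr d u" using z by (rule loc_cases)
    show "x \<otimes>\<^bsub>loc\<^esub> y \<otimes>\<^bsub>loc\<^esub> z = x \<otimes>\<^bsub>loc\<^esub> (y \<otimes>\<^bsub>loc\<^esub> z)"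
      using a b d by (simp add: frac_mult S_mult m_assoc)
  qed
  fix x y z assume x: "x \<in> carrier loc" and y: "y \<in> carrier loc" and z: "z \<in> carrier loc"
  obtain a s where a: "a \<in> carrier B" "s \<in> S" "x = fr a s" using x by (rule loc_cases)
  obtain b t where b: "b \<in> carrier B" "t \<in> S" "y = fr b t" using y by (rule loc_cases)
  obtain d u where d: "d \<in> carrier B" "u \<in> S" "z = fr d u" using z by (rule loc_cases)
  have id: "(s \<otimes> u) \<otimes> (t \<otimes> u) \<otimes> ((t \<otimes> a \<oplus> s \<otimes> b) \<otimes> d) = (s \<otimes> t \<otimes> u) \<otimes> ((t \<otimes> u) \<otimes> (a \<otimes> d) \<oplus> (s \<otimes> u) \<otimes> (b \<otimes> d))"
    if "s \<in> carrier B" "t \<in> carrier B" "u \<in> carrier B" "a \<in> carrier B" "b \<in> carrier B" "d \<in> carrier B" for s t u a b d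
    using that by algebra
  show "(x \<oplus>\<^bsub>loc\<^esub> y) \<otimes>\<^bsub>loc\<^esub> z = x \<otimes>\<^bsub>loc\<^esub> z \<oplus>\<^bsub>loc\<^esub> y \<otimes>\<^bsub>loc\<^esub> z"
    using a b d id[of s t u a b d] by (simp add: frac_mult frac_add S_mult) (rule frac_eqI; simp add: S_mult)
qed

lemma frac_hom: "(\<lambda>a. fr a \<one>) \<in> ring_hom B loc"
  by (rule ring_hom_memI) (auto simp: S_one frac_mult frac_add loc_one)

text \<open>Fractions with numerator in \<open>P\<close> form an ideal of the localization that
  contains the images of \<open>Y\<close>. Equality of \<open>q / 1\<close> with such a fraction
  gives a multiple of \<open>q\<close> in \<open>P\<close>.\<close>

lemma ideal_extension_mem:
  assumes P: "ideal P B" and Y: "Y \<subseteq> P" and q: "q \<in> carrier B"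
    and mem: "fr q \<one> \<in> Idl\<^bsub>loc\<^esub> ((\<lambda>a. fr a \<one>) ` Y)"
  shows "\<exists>s\<in>S. s \<otimes> q \<in> P"
proof -
  interpret P: ideal P B by (rule P)
  interpret loc: cring loc by (rule loc_cring)
  let ?J = "{fr a s | a s. a \<in> P \<and> s \<in> S}"
  have "ideal ?J loc"
  proof (rule idealI[OF loc.ring_axioms])
    show "subgroup ?J (add_monoid loc)"
    proof (rule loc.add.subgroupI)
      show "?J \<subseteq> carrier loc" by auto
      show "?J \<noteq> {}" using P.zero_closed S_one by blast
      fix x assume "x \<in> ?J"
      then obtain a s where a: "a \<in> P" "s \<in> S" "x = fr a s" by auto
      have ac: "a \<in> carrier B" using a by simp
      have "fr (\<ominus> a) s \<oplus>\<^bsub>loc\<^esub> fr a s = \<zero>\<^bsub>loc\<^esub>"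
        using a ac by (intro frac_neg)
      then have "\<ominus>\<^bsub>loc\<^esub> x = fr (\<ominus> a) s" using a ac loc.minus_equality by auto
      then show "\<ominus>\<^bsub>loc\<^esub> x \<in> ?J" using a by auto
      fix y assume "y \<in> ?J"
      then obtain b t where b: "b \<in> P" "t \<in> S" "y = fr b t" by auto
      have "x \<oplus>\<^bsub>loc\<^esub> y = fr (t \<otimes> a \<oplus> s \<otimes> b) (s \<otimes> t)" using a b by (simp add: frac_add)
      moreover have "t \<otimes> a \<oplus> s \<otimes> b \<in> P" using a b by (simp add: P.I_l_closed)
      ultimately show "x \<oplus>\<^bsub>loc\<^esub> y \<in> ?J" using a b S_mult by blast
    qed
  next
    fix x z assume "x \<in> ?J" and z: "z \<in> carrier loc"
    then obtain a s where a: "a \<in> P" "s \<in> S" "x = fr a s" by auto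
    obtain d u where d: "d \<in> carrier B" "u \<in> S" "z = fr d u" using z by (rule loc_cases)
    have "z \<otimes>\<^bsub>loc\<^esub> x = fr (d \<otimes> a) (u \<otimes> s)" using a d by (simp add: frac_mult)
    then show zx: "z \<otimes>\<^bsub>loc\<^esub> x \<in> ?J" using a d S_mult P.I_l_closed by blast
    show "x \<otimes>\<^bsub>loc\<^esub> z \<in> ?J" using zx a d z by (simp add: loc.m_comm)
  qed
  moreover have "(\<lambda>a. fr a \<one>) ` Y \<subseteq> ?J" using Y S_one by blast
  ultimately have "fr q \<one> \<in> ?J" using mem loc.genideal_minimal by blast
  then obtain a s where a: "a \<in> P" "s \<in> S" "fr q \<one> = fr a s" by auto
  then obtain u where u: "u \<in> S" "u \<otimes> (s \<otimes> q \<ominus> \<one> \<otimes> a) = \<zero>"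
    using frac_eq_iff[of q \<one> a s] q S_one by auto
  have "(u \<otimes> s) \<otimes> q = u \<otimes> a"
  proof -
    have id: "(u \<otimes> s) \<otimes> q = u \<otimes> (s \<otimes> q \<ominus> \<one> \<otimes> a) \<oplus> u \<otimes> a"
      if "u \<in> carrier B" "s \<in> carrier B" "q \<in> carrier B" "a \<in> carrier B" for u s q a
      using that by algebra
    show ?thesis using id[of u s q a] u a q by simp
  qed
  then have "(u \<otimes> s) \<otimes> q \<in> P" using a u P.I_l_closed by simp
  then show ?thesis using S_mult[OF u(1) a(2)] by blast
qed

end

text \<open>Powers in \<open>ideals_set\<close> start from the unit ideal, so the first power is a
  product with the whole ring.\<close>

lemma (in cring) ideals_set_pow_one:
  assumes "ideal J R"
  shows "J [^]\<^bsub>ideals_set R\<^esub> (1::nat) = J"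
proof -
  have "carrier R \<cdot> J = J"
    using ideal_prod_one[OF assms] ideal_prod_commute[OF oneideal assms] by simp
  then show ?thesis by (simp add: ideals_set_def nat_pow_def)
qed


section \<open>Flatness\<close>

text \<open>Flatness is used for the principal ideal of \<open>\<pi>\<close>. Multiplication sends
  \<open>\<pi> \<otimes> a\<close> to 0, so this tensor vanishes. On the other hand, dividing the
  first factor by \<open>\<pi>\<close> is a balanced map, and it sends the same tensor to
  \<open>a\<close>.\<close>

lemma flat_regular:
  assumes R: "domain R" and A: "cring A" and \<phi>: "\<phi> \<in> ring_hom R A" and flat: "flat_over R \<phi> A"
    and \<pi>: "\<pi> \<in> carrier R" "\<pi> \<noteq> \<zero>\<^bsub>R\<^esub>" and a: "a \<in> carrier A" "\<phi> \<pi> \<otimes>\<^bsub>A\<^esub> a = \<zero>\<^bsub>A\<^esub>"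
  shows "a = \<zero>\<^bsub>A\<^esub>"
proof -
  interpret R: "domain" R by (rule R)
  interpret A: cring A by (rule A)
  interpret \<phi>: ring_hom_cring R A \<phi> by unfold_locales (rule \<phi>)
  define J where "J = PIdl\<^bsub>R\<^esub> \<pi>"
  interpret J: ideal J R unfolding J_def by (rule R.cgenideal_ideal[OF \<pi>(1)])
  let ?M = "R\<lparr>carrier := J\<rparr>"
  have J_cases: "\<exists>r\<in>carrier R. x = r \<otimes>\<^bsub>R\<^esub> \<pi>" if "x \<in> J" for x
    using that unfolding J_def cgenideal_def by blast
  have M: "abelian_group ?M"
  proof (rule abelian_groupI)
    fix x assume "x \<in> carrier ?M"
    then have "\<ominus>\<^bsub>R\<^esub> x \<in> J" "x \<in> carrier R" using J.Icarr by auto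
    then show "\<exists>y\<in>carrier ?M. y \<oplus>\<^bsub>?M\<^esub> x = \<zero>\<^bsub>?M\<^esub>"
      by (intro bexI[of _ "\<ominus>\<^bsub>R\<^esub> x"]) (simp_all add: R.l_neg)
  qed (use J.Icarr in \<open>auto simp: R.a_assoc R.a_comm R.a_lcomm\<close>)
  have tp: "tensor_product R id ?M \<phi> A"
    by (intro tensor_product.intro M A.abelian_group_axioms) (auto simp: J.I_l_closed)
  \<comment> \<open>Division by \<open>\<pi>\<close> on its principal ideal, well defined because
    \<open>R\<close> is a domain and \<open>\<pi>\<close> is nonzero.\<close>
  define c where "c x = (THE r. r \<in> carrier R \<and> x = r \<otimes>\<^bsub>R\<^esub> \<pi>)" for x
  have c_eq: "c (r \<otimes>\<^bsub>R\<^esub> \<pi>) = r" if "r \<in> carrier R" for r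
    unfolding c_def by (rule the_equality) (use that \<pi> R.m_rcancel in auto)
  have c_closed: "c x \<in> carrier R" if "x \<in> J" for x
    using J_cases[OF that] c_eq by auto
  interpret T1: tensor_balanced R id ?M \<phi> A A "\<lambda>x b. \<phi> x \<otimes>\<^bsub>A\<^esub> b"
    by (intro tensor_balanced.intro tp A.abelian_group_axioms tensor_balanced_axioms.intro)
      (simp_all add: J.Icarr A.l_distr A.r_distr A.m_ac)
  interpret T2: tensor_balanced R id ?M \<phi> A A "\<lambda>x b. \<phi> (c x) \<otimes>\<^bsub>A\<^esub> b"
  proof (intro tensor_balanced.intro tp A.abelian_group_axioms tensor_balanced_axioms.intro)
    fix x b assume "x \<in> carrier ?M" "b \<in> carrier A"
    then show "\<phi> (c x) \<otimes>\<^bsub>A\<^esub> b \<in> carrier A" using c_closed by simp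
  next
    fix x x' b assume x: "x \<in> carrier ?M" "x' \<in> carrier ?M" and b: "b \<in> carrier A"
    obtain r where r1: "r \<in> carrier R" "x = r \<otimes>\<^bsub>R\<^esub> \<pi>" using x(1) J_cases by simp blast
    obtain r' where r2: "r' \<in> carrier R" "x' = r' \<otimes>\<^bsub>R\<^esub> \<pi>" using x(2) J_cases by simp blast
    note r = r1(1) r2(1) r1(2) r2(2)
    have "x \<oplus>\<^bsub>R\<^esub> x' = (r \<oplus>\<^bsub>R\<^esub> r') \<otimes>\<^bsub>R\<^esub> \<pi>" using r \<pi> by (simp add: R.l_distr)
    then have "c (x \<oplus>\<^bsub>R\<^esub> x') = r \<oplus>\<^bsub>R\<^esub> r'" using c_eq r by simp
    then show "\<phi> (c (x \<oplus>\<^bsub>?M\<^esub> x')) \<otimes>\<^bsub>A\<^esub> b = \<phi> (c x) \<otimes>\<^bsub>A\<^esub> b \<oplus>\<^bsub>A\<^esub> \<phi> (c x') \<otimes>\<^bsub>A\<^esub> b"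
      using r b c_eq by (simp add: A.l_distr)
  next
    fix x b b' assume "x \<in> carrier ?M" "b \<in> carrier A" "b' \<in> carrier A"
    then show "\<phi> (c x) \<otimes>\<^bsub>A\<^esub> (b \<oplus>\<^bsub>A\<^esub> b') = \<phi> (c x) \<otimes>\<^bsub>A\<^esub> b \<oplus>\<^bsub>A\<^esub> \<phi> (c x) \<otimes>\<^bsub>A\<^esub> b'"
      using c_closed by (simp add: A.r_distr)
  next
    fix s x b assume s: "s \<in> carrier R" and "x \<in> carrier ?M" and b: "b \<in> carrier A"
    then obtain r where r: "r \<in> carrier R" "x = r \<otimes>\<^bsub>R\<^esub> \<pi>" using J_cases by simp blast
    have "s \<otimes>\<^bsub>R\<^esub> x = (s \<otimes>\<^bsub>R\<^esub> r) \<otimes>\<^bsub>R\<^esub> \<pi>" using r s \<pi> by (simp add: R.m_assoc)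
    then have "c (s \<otimes>\<^bsub>R\<^esub> x) = s \<otimes>\<^bsub>R\<^esub> r" using c_eq r s by simp
    then show "\<phi> (c (id s \<otimes>\<^bsub>?M\<^esub> x)) \<otimes>\<^bsub>A\<^esub> b = \<phi> (c x) \<otimes>\<^bsub>A\<^esub> (\<phi> s \<otimes>\<^bsub>A\<^esub> b)"
      using r b s c_eq by (simp add: A.m_ac)
  qed
  have \<pi>J: "\<pi> \<in> carrier ?M" using \<pi> R.cgenideal_self by (simp add: J_def)
  have inj: "inj_on T1.lift (carrier T1.T)"
    using flat J.is_ideal unfolding flat_over_def by blast
  have "T1.lift (T1.pr \<pi> a) = T1.lift (T1.pr \<pi> \<zero>\<^bsub>A\<^esub>)"
    using a \<pi>J \<pi> by (simp add: T1.lift_pr)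
  then have "T1.pr \<pi> a = T1.pr \<pi> \<zero>\<^bsub>A\<^esub>"
    using inj_onD[OF inj] T1.pr_closed[OF \<pi>J] a by (metis A.zero_closed)
  then have "\<phi> (c \<pi>) \<otimes>\<^bsub>A\<^esub> a = \<phi> (c \<pi>) \<otimes>\<^bsub>A\<^esub> \<zero>\<^bsub>A\<^esub>"
    using T2.lift_pr[OF \<pi>J a(1)] T2.lift_pr[OF \<pi>J A.zero_closed] by metis
  moreover have "c \<pi> = \<one>\<^bsub>R\<^esub>" using c_eq[of "\<one>\<^bsub>R\<^esub>"] \<pi> by simp
  ultimately show ?thesis using a by simp
qed


section \<open>The generic fibre and its valuation\<close>

lemma (in comm_monoid) unit_int_pow:
  assumes u: "u \<in> Units G" and e: "int k + z = int w"
  shows "u [^] k \<otimes> u [^] z = u [^] w"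
proof (cases "z \<ge> 0")
  case True
  then obtain j where j: "z = int j" by (metis nonneg_int_cases)
  then have "w = k + j" using e by linarith
  then show ?thesis using u j by (simp add: int_pow_int nat_pow_mult Units_closed)
next
  case False
  have k: "k = w + nat (- z)" using e False by linarith
  have c: "u [^] w \<in> carrier G" "u [^] nat (- z) \<in> Units G" using u by (auto simp: Units_pow_closed Units_closed)
  have "u [^] k = u [^] w \<otimes> u [^] nat (- z)"
    unfolding k using u by (simp only: nat_pow_mult Units_closed)
  moreover have "u [^] z = inv (u [^] nat (- z))" using False by (subst int_pow_def2) (rule if_P, linarith)
  ultimately show ?thesis using c by (simp add: m_assoc Units_closed)
qed

lemma (in comm_monoid) unit_int_pow_closed:
  assumes u: "u \<in> Units G"
  shows "u [^] (z::int) \<in> carrier G"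
proof -
  have "u [^] nat z \<in> carrier G" "inv (u [^] nat (- z)) \<in> carrier G"
    using Units_pow_closed[OF u] Units_closed Units_inv_closed by blast+
  then show ?thesis by (subst int_pow_def2) (rule if_split[THEN iffD2], blast)
qed

text \<open>Common ground for \<open>R\<close> with its uniformiser and for \<open>A\<close> with
  the image of the uniformiser: in both, a nonzero element is a power of \<open>t\<close> times an
  element outside the prime \<open>(t)\<close>.\<close>

locale adic_prime = cring A for A :: "('a, 'n) ring_scheme" (structure) +
  fixes t :: 'a
  assumes t: "t \<in> carrier A" and t_prime: "primeideal (PIdl t) A"
    and t_regular: "\<And>a. a \<in> carrier A \<Longrightarrow> t \<otimes> a = \<zero> \<Longrightarrow> a = \<zero>"
    and t_separated: "\<And>a. a \<in> carrier A \<Longrightarrow> (\<And>n. a \<in> PIdl (t [^] (n::nat))) \<Longrightarrow> a = \<zero>"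
begin

declare t [simp]

sublocale P: primeideal "PIdl t" A by (rule t_prime)

lemma mem_PIdl: "x \<in> PIdl y \<longleftrightarrow> (\<exists>r\<in>carrier A. x = r \<otimes> y)"
  unfolding cgenideal_def by blast

lemma zero_P: "\<zero> \<in> PIdl t"
  unfolding mem_PIdl by (rule bexI[of _ \<zero>]) simp_all

lemma t_regular_pow: "a \<in> carrier A \<Longrightarrow> t [^] (n::nat) \<otimes> a = \<zero> \<Longrightarrow> a = \<zero>"
proof (induction n)
  case (Suc n)
  then have "t \<otimes> (t [^] n \<otimes> a) = \<zero>" by (simp add: m_assoc m_lcomm)
  then show ?case using Suc t_regular[of "t [^] n \<otimes> a"] by simp
qed simp

text \<open>Separatedness gives a least \<open>n\<close> with \<open>a\<close> not divisible by
  \<open>t^n\<close>; the exponent is \<open>n - 1\<close>.\<close>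

lemma factor_t:
  assumes a: "a \<in> carrier A" "a \<noteq> \<zero>"
  shows "\<exists>(k::nat) b. b \<in> carrier A \<and> b \<notin> PIdl t \<and> a = t [^] k \<otimes> b"
proof -
  obtain n0 where "a \<notin> PIdl (t [^] (n0::nat))" using t_separated a by blast
  define n where "n = (LEAST n::nat. a \<notin> PIdl (t [^] n))"
  have n: "a \<notin> PIdl (t [^] n)" unfolding n_def by (rule LeastI) fact
  have min: "a \<in> PIdl (t [^] k)" if "k < n" for k using not_less_Least[OF that[unfolded n_def]] by simp
  have "a = a \<otimes> t [^] (0::nat)" using a by simp
  then have "n \<noteq> 0" using n a unfolding mem_PIdl by metis
  then obtain k where k: "n = Suc k" using not0_implies_Suc by blast
  then obtain b where b: "b \<in> carrier A" "a = b \<otimes> t [^] k" using min[of k] by (auto simp: mem_PIdl)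
  have "b \<notin> PIdl t"
  proof
    assume "b \<in> PIdl t"
    then obtain c where "c \<in> carrier A" "b = c \<otimes> t" by (auto simp: mem_PIdl)
    then show False using n b k by (auto simp: mem_PIdl m_ac)
  qed
  moreover have "a = t [^] k \<otimes> b" using b by (simp add: m_comm)
  ultimately show ?thesis using b(1) by blast
qed

text \<open>Remove the powers of \<open>t\<close> from two nonzero factors. Their product vanishes
  only if the product of the remaining factors does, and this lies outside the prime ideal
  \<open>(t)\<close>.\<close>

lemma is_domain: "domain A"
proof (rule domain.intro[OF is_cring domain_axioms.intro])
  show "\<one> \<noteq> \<zero>"
  proof
    assume "\<one> = \<zero>"
    have "x \<in> PIdl t" if "x \<in> carrier A" for x
    proof -
      have "x = \<one> \<otimes> x" using that by simp
      then show ?thesis using that zero_P unfolding \<open>\<one> = \<zero>\<close> by simp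
    qed
    then have "PIdl t = carrier A" using P.a_subset by blast
    then show False using P.I_notcarr by simp
  qed
  fix a b assume ab: "a \<otimes> b = \<zero>" and c: "a \<in> carrier A" "b \<in> carrier A"
  show "a = \<zero> \<or> b = \<zero>"
  proof (rule ccontr)
    assume "\<not> (a = \<zero> \<or> b = \<zero>)"
    then obtain k a' l b' where a': "a' \<in> carrier A" "a' \<notin> PIdl t" "a = t [^] (k::nat) \<otimes> a'"
      and b': "b' \<in> carrier A" "b' \<notin> PIdl t" "b = t [^] (l::nat) \<otimes> b'" using factor_t c by meson
    have "t [^] (k + l) \<otimes> (a' \<otimes> b') = \<zero>" using ab a' b' by (simp add: nat_pow_mult[symmetric] m_ac)
    then have "a' \<otimes> b' = \<zero>" using t_regular_pow[of "a' \<otimes> b'" "k + l"] a' b' by blast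
    then show False using P.I_prime[of a' b'] a' b' zero_P by auto
  qed
qed

sublocale "domain" A by (rule is_domain)

lemma t_nonzero: "t \<noteq> \<zero>" using t_regular[of \<one>] by auto

lemma t_exponent:
  assumes "t [^] (i::nat) \<otimes> x = t [^] (j::nat) \<otimes> y" "x \<in> carrier A" "y \<in> carrier A" "x \<notin> PIdl t" "y \<notin> PIdl t"
  shows "i = j"
proof (rule ccontr)
  have *: "x \<in> PIdl t" if ij: "i < j" and "t [^] (i::nat) \<otimes> x = t [^] (j::nat) \<otimes> y" "x \<in> carrier A" "y \<in> carrier A" for i j x y
  proof -
    obtain k where k: "j = i + Suc k" using ij less_iff_Suc_add by auto
    have "t [^] i \<otimes> x = t [^] i \<otimes> ((t [^] k \<otimes> y) \<otimes> t)"
      using that by (simp add: k nat_pow_mult[symmetric] m_ac)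
    then have "x = (t [^] k \<otimes> y) \<otimes> t"
      using that pow_non_zero[OF t t_nonzero, of i] by (subst (asm) m_lcancel) auto
    then show ?thesis using that by (auto simp: mem_PIdl)
  qed
  assume "i \<noteq> j"
  then show False using *[of i j x y] *[of j i y x] assms by (metis nat_neq_iff)
qed

sublocale loc: ring_localization A "nonzero A"
  by unfold_locales (auto simp: nonzero_def integral_iff)

section \<open>The function field\<close>

abbreviation "F \<equiv> frac_field A"

lemma F_loc: "F = localization A (nonzero A)" by (simp add: frac_field_def)

sublocale F: cring F unfolding F_loc by (rule loc.loc_cring)

lemma nonzero_mem: "s \<in> nonzero A \<longleftrightarrow> s \<in> carrier A \<and> s \<noteq> \<zero>" by (auto simp: nonzero_def)

lemma nonzero_pow [simp]: "t [^] (n::nat) \<in> nonzero A"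
  using pow_non_zero[OF t t_nonzero] by (simp add: nonzero_mem)

lemma nonzero_one [simp]: "\<one> \<in> nonzero A" by (simp add: nonzero_mem)

lemma nonzero_notin_P: "s \<in> carrier A \<Longrightarrow> s \<notin> PIdl t \<Longrightarrow> s \<in> nonzero A"
  using zero_P by (auto simp: nonzero_mem)

lemma quot_closed [simp]: "a \<in> carrier A \<Longrightarrow> s \<in> nonzero A \<Longrightarrow> quot A a s \<in> carrier F"
  unfolding quot_def F_loc by simp

lemma quot_eq:
  assumes "a \<in> carrier A" "b \<in> carrier A" "s \<in> nonzero A" "u \<in> nonzero A"
  shows "quot A a s = quot A b u \<longleftrightarrow> u \<otimes> a = s \<otimes> b"
proof -
  have "v \<otimes> (u \<otimes> a \<ominus> s \<otimes> b) = \<zero> \<longleftrightarrow> u \<otimes> a = s \<otimes> b" if "v \<in> nonzero A" for v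
    using that assms by (auto simp: integral_iff nonzero_mem)
  then show ?thesis unfolding quot_def using assms by (subst loc.frac_eq_iff) (auto intro: nonzero_one)
qed

lemma quot_mult: "a \<in> carrier A \<Longrightarrow> b \<in> carrier A \<Longrightarrow> s \<in> nonzero A \<Longrightarrow> u \<in> nonzero A
    \<Longrightarrow> quot A a s \<otimes>\<^bsub>F\<^esub> quot A b u = quot A (a \<otimes> b) (s \<otimes> u)"
  unfolding quot_def F_loc by (rule loc.frac_mult)

lemma quot_add: "a \<in> carrier A \<Longrightarrow> b \<in> carrier A \<Longrightarrow> s \<in> nonzero A \<Longrightarrow> u \<in> nonzero A
    \<Longrightarrow> quot A a s \<oplus>\<^bsub>F\<^esub> quot A b u = quot A (u \<otimes> a \<oplus> s \<otimes> b) (s \<otimes> u)"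
  unfolding quot_def F_loc by (rule loc.frac_add)

lemma nonzero_mult [simp]: "s \<in> nonzero A \<Longrightarrow> u \<in> nonzero A \<Longrightarrow> s \<otimes> u \<in> nonzero A"
  by (rule loc.S_mult)

lemma F_one: "\<one>\<^bsub>F\<^esub> = quot A \<one> \<one>" and F_zero: "\<zero>\<^bsub>F\<^esub> = quot A \<zero> \<one>"
  unfolding quot_def F_loc by (simp_all add: loc.loc_one loc.loc_zero)

lemma to_frac_hom: "to_frac A \<in> ring_hom A F"
  unfolding to_frac_def[abs_def] quot_def F_loc by (rule loc.frac_hom)

sublocale tf: ring_hom_cring A F "to_frac A" by unfold_locales (rule to_frac_hom)

lemma to_frac_quot: "to_frac A a = quot A a \<one>" by (simp add: to_frac_def)

lemma quot_uminus: "a \<in> carrier A \<Longrightarrow> s \<in> nonzero A \<Longrightarrow> \<ominus>\<^bsub>F\<^esub> quot A a s = quot A (\<ominus> a) s"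
proof -
  assume a: "a \<in> carrier A" and s: "s \<in> nonzero A"
  have sc: "s \<in> carrier A" using s by (simp add: nonzero_mem)
  have "quot A (\<ominus> a) s \<oplus>\<^bsub>F\<^esub> quot A a s = \<zero>\<^bsub>F\<^esub>"
    using a s sc by (simp add: quot_add F_zero quot_eq r_minus l_neg)
  then show ?thesis using a s by (intro F.minus_equality) auto
qed

lemma t_nz [simp]: "t \<in> nonzero A" by (simp add: nonzero_mem t_nonzero)

lemma unit_tF: "to_frac A t \<in> Units F"
proof -
  have 1: "quot A \<one> t \<otimes>\<^bsub>F\<^esub> to_frac A t = \<one>\<^bsub>F\<^esub>"
    by (simp add: to_frac_quot quot_mult F_one quot_eq)
  have 2: "quot A \<one> t \<in> carrier F" "to_frac A t \<in> carrier F" by simp_all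
  then have "to_frac A t \<otimes>\<^bsub>F\<^esub> quot A \<one> t = \<one>\<^bsub>F\<^esub>" using 1 F.m_comm by metis
  then show ?thesis using 1 2 unfolding Units_def by blast
qed

lemma tF_pow: "to_frac A t [^]\<^bsub>F\<^esub> (n::nat) = to_frac A (t [^] n)"
  by simp

lemma tF_quot: "b \<in> carrier A \<Longrightarrow> to_frac A (t [^] (n::nat)) \<otimes>\<^bsub>F\<^esub> quot A b (t [^] n) = to_frac A b"
  by (simp add: to_frac_quot quot_mult quot_eq m_ac)

lemma quot_eqI:
  assumes "x \<in> carrier F" "b \<in> carrier A" "to_frac A (t [^] (n::nat)) \<otimes>\<^bsub>F\<^esub> x = to_frac A b"
  shows "x = quot A b (t [^] n)"
proof -
  have "to_frac A (t [^] n) \<in> Units F" using F.Units_pow_closed[OF unit_tF, of n] by simp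
  moreover have "quot A b (t [^] n) \<in> carrier F" using assms by simp
  moreover have "to_frac A (t [^] n) \<otimes>\<^bsub>F\<^esub> x = to_frac A (t [^] n) \<otimes>\<^bsub>F\<^esub> quot A b (t [^] n)"
    by (rule trans[OF assms(3) tF_quot[OF assms(2), symmetric]])
  ultimately show ?thesis using F.Units_l_cancel assms(1) by blast
qed

section \<open>Functions on the generic fibre\<close>

abbreviation "GF \<equiv> generic_fibre A t"

lemma GF_carrier: "carrier GF = {quot A a (t [^] (n::nat)) | a n. a \<in> carrier A}"
  by (auto simp: generic_fibre_def)

lemma GF_simps [simp]: "x \<otimes>\<^bsub>GF\<^esub> y = x \<otimes>\<^bsub>F\<^esub> y" "x \<oplus>\<^bsub>GF\<^esub> y = x \<oplus>\<^bsub>F\<^esub> y" "\<one>\<^bsub>GF\<^esub> = \<one>\<^bsub>F\<^esub>" "\<zero>\<^bsub>GF\<^esub> = \<zero>\<^bsub>F\<^esub>"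
  by (simp_all add: generic_fibre_def)

lemma GF_subring: "subring (carrier GF) F"
proof (rule F.subringI)
  show "carrier GF \<subseteq> carrier F" by (auto simp: GF_carrier)
  show "\<one>\<^bsub>F\<^esub> \<in> carrier GF" unfolding GF_carrier F_one by (intro CollectI exI[of _ \<one>] exI[of _ 0]) simp
  fix x assume "x \<in> carrier GF"
  then obtain a n where a: "x = quot A a (t [^] (n::nat))" "a \<in> carrier A" by (auto simp: GF_carrier)
  have "\<ominus>\<^bsub>F\<^esub> x = quot A (\<ominus> a) (t [^] n)" using a by (simp add: quot_uminus)
  then show "\<ominus>\<^bsub>F\<^esub> x \<in> carrier GF" using a by (auto simp: GF_carrier)
  fix y assume "y \<in> carrier GF"
  then obtain b k where b: "y = quot A b (t [^] (k::nat))" "b \<in> carrier A" by (auto simp: GF_carrier)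
  have "x \<otimes>\<^bsub>F\<^esub> y = quot A (a \<otimes> b) (t [^] (n + k))" using a b by (simp add: quot_mult nat_pow_mult)
  then show "x \<otimes>\<^bsub>F\<^esub> y \<in> carrier GF" using a b by (auto simp: GF_carrier)
  have "x \<oplus>\<^bsub>F\<^esub> y = quot A (t [^] k \<otimes> a \<oplus> t [^] n \<otimes> b) (t [^] (n + k))"
    using a b by (simp add: quot_add nat_pow_mult)
  then show "x \<oplus>\<^bsub>F\<^esub> y \<in> carrier GF" using a b unfolding GF_carrier
    by (intro CollectI exI[of _ "t [^] k \<otimes> a \<oplus> t [^] n \<otimes> b"] exI[of _ "n + k"]) simp
qed

lemma GF_eq: "GF = F\<lparr>carrier := carrier GF\<rparr>" by (simp add: generic_fibre_def)

lemma GF_cring: "cring GF"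
  using F.subcringI'[OF GF_subring] F.subcring_iff[of "carrier GF"] subringE(1)[OF GF_subring] GF_eq by metis

lemma to_frac_GF: "a \<in> carrier A \<Longrightarrow> to_frac A a \<in> carrier GF"
  unfolding GF_carrier to_frac_quot by (intro CollectI exI[of _ a] exI[of _ 0]) simp

lemma to_frac_GF_hom: "to_frac A \<in> ring_hom A GF"
  by (rule ring_hom_memI) (auto simp: to_frac_GF)

lemma quot_GF: "a \<in> carrier A \<Longrightarrow> quot A a (t [^] (n::nat)) \<in> carrier GF"
  by (auto simp: GF_carrier)

section \<open>The local ring at the generic point of the special fibre\<close>

abbreviation "LR \<equiv> local_ring_eta A t"

lemma LR_carrier: "carrier LR = {quot A a s | a s. a \<in> carrier A \<and> s \<in> carrier A - PIdl t}"
  by (simp add: local_ring_eta_def)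

lemma LR_simps [simp]: "x \<otimes>\<^bsub>LR\<^esub> y = x \<otimes>\<^bsub>F\<^esub> y" "x \<oplus>\<^bsub>LR\<^esub> y = x \<oplus>\<^bsub>F\<^esub> y" "\<one>\<^bsub>LR\<^esub> = \<one>\<^bsub>F\<^esub>" "\<zero>\<^bsub>LR\<^esub> = \<zero>\<^bsub>F\<^esub>"
  by (simp_all add: local_ring_eta_def)

lemma notin_P_mult: "x \<in> carrier A \<Longrightarrow> y \<in> carrier A \<Longrightarrow> x \<notin> PIdl t \<Longrightarrow> y \<notin> PIdl t \<Longrightarrow> x \<otimes> y \<notin> PIdl t"
  using P.I_prime by blast

lemma one_notin_P: "\<one> \<notin> PIdl t"
  using P.one_imp_carrier P.I_notcarr by blast

lemma LR_units:
  assumes "u \<in> Units LR"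
  obtains x s where "x \<in> carrier A" "s \<in> carrier A" "x \<notin> PIdl t" "s \<notin> PIdl t" "u = quot A x s"
proof -
  obtain x s where x: "x \<in> carrier A" "s \<in> carrier A" "s \<notin> PIdl t" "u = quot A x s"
    using assms unfolding Units_def LR_carrier by blast
  obtain y r where y: "y \<in> carrier A" "r \<in> carrier A" "r \<notin> PIdl t" "quot A y r \<otimes>\<^bsub>F\<^esub> u = \<one>\<^bsub>F\<^esub>"
    using assms unfolding Units_def LR_carrier by auto
  have "y \<otimes> x = r \<otimes> s"
    using y x nonzero_notin_P by (simp add: quot_mult F_one quot_eq)
  then have "y \<otimes> x \<notin> PIdl t" using notin_P_mult[of r s] x y by simp
  then have "x \<notin> PIdl t" using P.I_l_closed[of x y] y by auto
  then show thesis using that x by blast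
qed

lemma to_frac_LR_unit:
  assumes "b \<in> carrier A" "b \<notin> PIdl t"
  shows "to_frac A b \<in> Units LR"
proof -
  have b: "b \<in> nonzero A" using assms by (rule nonzero_notin_P)
  have "quot A \<one> b \<otimes>\<^bsub>F\<^esub> quot A b \<one> = \<one>\<^bsub>F\<^esub>" "quot A b \<one> \<otimes>\<^bsub>F\<^esub> quot A \<one> b = \<one>\<^bsub>F\<^esub>"
    using assms b by (simp_all add: quot_mult F_one quot_eq)
  moreover have "quot A \<one> b \<in> carrier LR" "quot A b \<one> \<in> carrier LR"
    unfolding LR_carrier using assms one_notin_P by blast+
  ultimately show ?thesis unfolding to_frac_quot Units_def by auto
qed

text \<open>A function on the generic fibre is \<open>b / t^k\<close>. Computing its valuation from
  the power of \<open>t\<close> in \<open>b\<close> shows that value 0 means an exact cancellation,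
  so the function comes from \<open>A\<close> and does not vanish modulo \<open>t\<close>.\<close>

lemma val_eta_zero:
  assumes x: "x \<in> carrier GF" and v: "val_eta A t x = 0"
  shows "\<exists>b\<in>carrier A. b \<notin> PIdl t \<and> x = to_frac A b"
proof -
  obtain b k where b: "b \<in> carrier A" "x = quot A b (t [^] (k::nat))" using x by (auto simp: GF_carrier)
  have "x \<noteq> \<zero>\<^bsub>F\<^esub>" using v by (auto simp: val_eta_def zero_extended_def split: if_splits)
  then have "b \<noteq> \<zero>" using b by (auto simp: F_zero quot_eq)
  then obtain i b' where b': "b' \<in> carrier A" "b' \<notin> PIdl t" "b = t [^] (i::nat) \<otimes> b'" using factor_t b by blast
  let ?Q = "\<lambda>n::int. \<exists>u\<in>Units LR. x = to_frac A t [^]\<^bsub>F\<^esub> n \<otimes>\<^bsub>F\<^esub> u"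
  have tFc: "to_frac A t [^]\<^bsub>F\<^esub> (n::int) \<in> carrier F" for n
    by (rule F.unit_int_pow_closed[OF unit_tF])
  \<comment> \<open>With \<open>b = t^i b'\<close> the element is \<open>t^(i - k)\<close> times the
    unit \<open>b'\<close> of the local ring.\<close>
  have ex: "?Q (int i - int k)"
  proof (rule bexI)
    show "to_frac A b' \<in> Units LR" using b' by (intro to_frac_LR_unit) auto
    have "to_frac A (t [^] k) \<otimes>\<^bsub>F\<^esub> (to_frac A t [^]\<^bsub>F\<^esub> (int i - int k) \<otimes>\<^bsub>F\<^esub> to_frac A b') = to_frac A b"
      using F.unit_int_pow[OF unit_tF, of k "int i - int k" i] b' tFc
      by (simp add: F.m_assoc[symmetric])
    then show "x = to_frac A t [^]\<^bsub>F\<^esub> (int i - int k) \<otimes>\<^bsub>F\<^esub> to_frac A b'"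
      unfolding b(2) by (intro quot_eqI[symmetric]) (use b b' tFc in auto)
  qed
  have uniq: "n = int i - int k" if Qn: "?Q n" for n
  proof -
    obtain u where u: "u \<in> Units LR" "x = to_frac A t [^]\<^bsub>F\<^esub> n \<otimes>\<^bsub>F\<^esub> u" using Qn by blast
    obtain y s where y: "y \<in> carrier A" "s \<in> carrier A" "y \<notin> PIdl t" "s \<notin> PIdl t" "u = quot A y s"
      using u(1) by (rule LR_units)
    have s: "s \<in> nonzero A" using y nonzero_notin_P by blast
    \<comment> \<open>Multiplying by \<open>t^(k + q)\<close> makes all exponents natural numbers,
      whatever the sign of \<open>n\<close>, so they can be compared inside
      \<open>A\<close>.\<close>
    define q where "q = nat \<bar>n\<bar>"
    define K where "K = k + q"
    define w where "w = nat (int K + n)"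
    have w: "int K + n = int w" by (simp add: w_def K_def q_def)
    have 1: "to_frac A (t [^] K) \<otimes>\<^bsub>F\<^esub> x = quot A (t [^] w \<otimes> y) s"
    proof -
      have "to_frac A (t [^] K) \<otimes>\<^bsub>F\<^esub> x = to_frac A (t [^] w) \<otimes>\<^bsub>F\<^esub> u"
        unfolding u(2) using F.unit_int_pow[OF unit_tF w] tFc y s by (simp add: F.m_assoc[symmetric])
      then show ?thesis using y s by (simp add: to_frac_quot quot_mult nonzero_mem)
    qed
    have 2: "to_frac A (t [^] K) \<otimes>\<^bsub>F\<^esub> x = to_frac A (t [^] (q + i) \<otimes> b')"
    proof -
      have "t [^] K \<otimes> b = t [^] k \<otimes> (t [^] (q + i) \<otimes> b')"
        using b' by (simp add: K_def nat_pow_mult[symmetric] m_ac)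
      then show ?thesis unfolding b(2) using b b' by (simp add: to_frac_quot quot_mult quot_eq)
    qed
    have "t [^] (q + i) \<otimes> (s \<otimes> b') = t [^] w \<otimes> y"
      using 1 2 y s b' by (simp add: to_frac_quot quot_eq m_ac)
    then have "q + i = w"
      by (rule t_exponent) (use y b' notin_P_mult in auto)
    then show ?thesis using w by (simp add: K_def)
  qed
  have "(THE n. ?Q n) = int i - int k" using ex uniq by (rule the_equality)
  then have "int i = int k" using v \<open>x \<noteq> \<zero>\<^bsub>F\<^esub>\<close> by (simp add: val_eta_def zero_extended_def)
  then have "x = to_frac A b'"
    unfolding b(2) b'(3) using b' by (simp add: to_frac_quot quot_eq)
  then show ?thesis using b' by blast
qed

lemma LR_subring: "subring (carrier LR) F"
proof (rule F.subringI)
  show "carrier LR \<subseteq> carrier F" using nonzero_notin_P by (auto simp: LR_carrier)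
  show "\<one>\<^bsub>F\<^esub> \<in> carrier LR" unfolding LR_carrier F_one using one_notin_P by blast
  fix x assume "x \<in> carrier LR"
  then obtain a s where a: "x = quot A a s" "a \<in> carrier A" "s \<in> carrier A" "s \<notin> PIdl t" by (auto simp: LR_carrier)
  have "\<ominus>\<^bsub>F\<^esub> x = quot A (\<ominus> a) s" using a nonzero_notin_P by (simp add: quot_uminus)
  then show "\<ominus>\<^bsub>F\<^esub> x \<in> carrier LR" using a by (auto simp: LR_carrier)
  fix y assume "y \<in> carrier LR"
  then obtain b u where b: "y = quot A b u" "b \<in> carrier A" "u \<in> carrier A" "u \<notin> PIdl t" by (auto simp: LR_carrier)
  have "x \<otimes>\<^bsub>F\<^esub> y = quot A (a \<otimes> b) (s \<otimes> u)" using a b nonzero_notin_P by (simp add: quot_mult)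
  moreover have su: "s \<otimes> u \<notin> PIdl t" using a b notin_P_mult by blast
  ultimately show "x \<otimes>\<^bsub>F\<^esub> y \<in> carrier LR" unfolding LR_carrier using a b by blast
  have "x \<oplus>\<^bsub>F\<^esub> y = quot A (u \<otimes> a \<oplus> s \<otimes> b) (s \<otimes> u)"
    using a b nonzero_notin_P by (simp add: quot_add)
  then show "x \<oplus>\<^bsub>F\<^esub> y \<in> carrier LR" unfolding LR_carrier using a b su
    by (intro CollectI exI[of _ "u \<otimes> a \<oplus> s \<otimes> b"] exI[of _ "s \<otimes> u"]) simp
qed

lemma LR_cring: "cring LR"
proof -
  have "LR = F\<lparr>carrier := carrier LR\<rparr>" by (simp add: local_ring_eta_def)
  then show ?thesis
    using F.subcringI'[OF LR_subring] F.subcring_iff[of "carrier LR"] subringE(1)[OF LR_subring] by metis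
qed

lemma max_ideal: "ideal (max_ideal_eta A t) LR"
proof -
  interpret LR: cring LR by (rule LR_cring)
  let ?J = "max_ideal_eta A t"
  have J: "?J = {quot A a s | a s. a \<in> PIdl t \<and> s \<in> carrier A - PIdl t}" by (simp add: max_ideal_eta_def)
  show ?thesis
  proof (rule idealI[OF LR.ring_axioms])
    show "subgroup ?J (add_monoid LR)"
    proof (rule LR.add.subgroupI)
      show "?J \<subseteq> carrier LR" unfolding J LR_carrier using P.a_subset by blast
      show "?J \<noteq> {}" unfolding J using zero_P one_notin_P by blast
      fix x assume "x \<in> ?J"
      then obtain a s where a: "a \<in> PIdl t" "s \<in> carrier A" "s \<notin> PIdl t" "x = quot A a s" by (auto simp: J)
      have ac: "a \<in> carrier A" "s \<in> nonzero A" using a nonzero_notin_P by auto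
      have "quot A (\<ominus> a) s \<oplus>\<^bsub>LR\<^esub> x = \<zero>\<^bsub>LR\<^esub>"
        using a ac by (simp add: quot_add F_zero quot_eq r_minus l_neg)
      moreover have m: "quot A (\<ominus> a) s \<in> ?J" unfolding J using a P.a_inv_closed by blast
      moreover have "?J \<subseteq> carrier LR" unfolding J LR_carrier using P.a_subset by blast
      ultimately have "\<ominus>\<^bsub>LR\<^esub> x = quot A (\<ominus> a) s"
        using \<open>x \<in> ?J\<close> by (intro LR.minus_equality) blast+
      then show "\<ominus>\<^bsub>LR\<^esub> x \<in> ?J" using m by simp
      fix y assume "y \<in> ?J"
      then obtain b u where b: "b \<in> PIdl t" "u \<in> carrier A" "u \<notin> PIdl t" "y = quot A b u" by (auto simp: J)
      have bc: "b \<in> carrier A" "u \<in> nonzero A" using b nonzero_notin_P by auto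
      have "x \<oplus>\<^bsub>LR\<^esub> y = quot A (u \<otimes> a \<oplus> s \<otimes> b) (s \<otimes> u)" using a b ac bc by (simp add: quot_add)
      moreover have "u \<otimes> a \<oplus> s \<otimes> b \<in> PIdl t" using a b by (simp add: P.I_l_closed P.a_closed)
      moreover have "s \<otimes> u \<notin> PIdl t" using a b notin_P_mult by blast
      ultimately show "x \<oplus>\<^bsub>LR\<^esub> y \<in> ?J" unfolding J using a b by blast
    qed
  next
    fix x z assume "x \<in> ?J" and "z \<in> carrier LR"
    then obtain a s b u where a: "a \<in> PIdl t" "s \<in> carrier A" "s \<notin> PIdl t" "x = quot A a s"
      and b: "b \<in> carrier A" "u \<in> carrier A" "u \<notin> PIdl t" "z = quot A b u" by (auto simp: J LR_carrier)
    have ac: "a \<in> carrier A" "s \<in> nonzero A" "u \<in> nonzero A" using a b nonzero_notin_P by auto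
    have "z \<otimes>\<^bsub>LR\<^esub> x = quot A (b \<otimes> a) (u \<otimes> s)" using a b ac by (simp add: quot_mult)
    moreover have "b \<otimes> a \<in> PIdl t" "u \<otimes> s \<notin> PIdl t" using a b notin_P_mult by (auto simp: P.I_l_closed)
    ultimately show zx: "z \<otimes>\<^bsub>LR\<^esub> x \<in> ?J" unfolding J using a b by blast
    have "x \<otimes>\<^bsub>LR\<^esub> z = z \<otimes>\<^bsub>LR\<^esub> x" using a b ac by (simp add: F.m_comm)
    then show "x \<otimes>\<^bsub>LR\<^esub> z \<in> ?J" using zx by simp
  qed
qed

text \<open>As \<open>s\<close> is a unit of the local ring, the congruence says that
  \<open>y / s\<close> is a \<open>q\<close>-th root of the class of \<open>b\<close>. This converts
  the hypothesis on residue classes into one on congruences in \<open>A\<close>.\<close>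

lemma residue_power:
  assumes y: "y \<in> carrier A" "s \<in> carrier A" "s \<notin> PIdl t" and b: "b \<in> carrier A"
    and e: "y [^] q \<ominus> b \<otimes> s [^] (q::nat) \<in> PIdl t"
  shows "is_power (residue_field_eta A t) q (residue_class_eta A t (to_frac A b))"
proof -
  interpret LR: cring LR by (rule LR_cring)
  let ?J = "max_ideal_eta A t"
  interpret J: ideal ?J LR by (rule max_ideal)
  interpret pr: ring_hom_cring LR "LR Quot ?J" "(+>\<^bsub>LR\<^esub>) ?J" by (rule J.rcos_ring_hom_cring[OF LR_cring])
  have s: "s \<in> nonzero A" using y nonzero_notin_P by blast
  let ?x = "quot A y s"
  have xL: "?x \<in> carrier LR" unfolding LR_carrier using y by blast
  have sp: "s [^] q \<notin> PIdl t" for q :: nat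
    by (induction q) (use y notin_P_mult one_notin_P in auto)
  have sq: "s [^] q \<in> nonzero A" for q :: nat using sp y nonzero_notin_P by simp
  have pow: "?x [^]\<^bsub>LR\<^esub> k = quot A (y [^] k) (s [^] k)" for k :: nat
    by (induction k) (use y s sq in \<open>simp_all add: F_one quot_mult\<close>)
  define d where "d = y [^] q \<ominus> b \<otimes> s [^] q"
  have dc: "d \<in> carrier A" using y b by (simp add: d_def)
  have yd: "y [^] q = d \<oplus> s [^] q \<otimes> b"
    unfolding d_def using diff_add_cancel[of "y [^] q" "b \<otimes> s [^] q"] y b by (simp add: a_comm m_comm)
  have sqc: "s [^] q \<in> carrier A" using y by simp
  have id: "(s' \<otimes> \<one>) \<otimes> (d \<oplus> s' \<otimes> b) = s' \<otimes> (\<one> \<otimes> d \<oplus> s' \<otimes> b)"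
    if "s' \<in> carrier A" "d \<in> carrier A" "b \<in> carrier A" for s' d b
    using that by algebra
  \<comment> \<open>Dividing \<open>y^q = d + s^q b\<close> by \<open>s^q\<close> splits the power
    into an element of the maximal ideal and \<open>b\<close>.\<close>
  have "?x [^]\<^bsub>LR\<^esub> q = quot A d (s [^] q) \<oplus>\<^bsub>LR\<^esub> to_frac A b"
    unfolding pow yd to_frac_quot using dc b sq[of q] sqc id[of "s [^] q" d b]
    by (simp add: quot_add quot_eq)
  moreover have "quot A d (s [^] q) \<in> ?J"
    unfolding max_ideal_eta_def using e sp y by (auto simp: d_def)
  ultimately have "?x [^]\<^bsub>LR\<^esub> q \<in> ?J +>\<^bsub>LR\<^esub> to_frac A b"
    by (auto simp: a_r_coset_def')
  moreover have bL: "to_frac A b \<in> carrier LR" unfolding LR_carrier to_frac_quot using b one_notin_P by blast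
  ultimately have "?J +>\<^bsub>LR\<^esub> to_frac A b = ?J +>\<^bsub>LR\<^esub> (?x [^]\<^bsub>LR\<^esub> q)"
    by (rule J.a_repr_independence')
  also have "\<dots> = (?J +>\<^bsub>LR\<^esub> ?x) [^]\<^bsub>LR Quot ?J\<^esub> q" using xL by simp
  finally show ?thesis unfolding is_power_def residue_field_eta_def residue_class_eta_def
    using xL by (intro bexI[of _ "?J +>\<^bsub>LR\<^esub> ?x"]) auto
qed

end


section \<open>The points of a group scheme acting on a torsor\<close>

lemma (in cring) subring_cring: "subring H R \<Longrightarrow> cring (R\<lparr>carrier := H\<rparr>)"
  using subcringI' subcring_iff subringE(1) by metis

text \<open>Reads the torsor isomorphism backwards: an endomorphism of \<open>L\<close> over
  \<open>A\<close> becomes a point of the group scheme with values in \<open>L\<close>.\<close>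

locale torsor_points = R: cring R + A: cring A + L: cring L
  for R :: "('r, 'm) ring_scheme" and A :: "('a, 'n) ring_scheme" and L :: "('b, 'k) ring_scheme" (structure) +
  fixes G :: "('r, 'h) hopf" and \<phi> :: "'r \<Rightarrow> 'a" and \<alpha> :: "'a \<Rightarrow> 'b" and Bs :: "'b set"
    and \<rho> :: "'b \<Rightarrow> (('b \<times> 'h) \<Rightarrow>\<^sub>0 int) set"
  assumes Bs: "subring Bs L" and \<phi>: "\<phi> \<in> ring_hom R A"
    and G: "affine_group_scheme R G"
    and torsor: "torsor R G \<phi> A \<alpha> (L\<lparr>carrier := Bs\<rparr>) \<rho>"
begin

abbreviation "B \<equiv> L\<lparr>carrier := Bs\<rparr>"
abbreviation "\<beta> \<equiv> \<alpha> \<circ> \<phi>"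

lemma Bs_carrier [simp]: "b \<in> Bs \<Longrightarrow> b \<in> carrier L" using L.subring_mem[OF Bs] .

sublocale B: cring B by (rule L.subring_cring[OF Bs])

lemma Bs_closed [simp]: "\<one> \<in> Bs" "x \<in> Bs \<Longrightarrow> y \<in> Bs \<Longrightarrow> x \<otimes> y \<in> Bs" "x \<in> Bs \<Longrightarrow> y \<in> Bs \<Longrightarrow> x \<oplus> y \<in> Bs"
  using subringE[OF Bs] by auto

sublocale G: cring G using G by (simp add: affine_group_scheme_def)

lemma scalar_hom: "scalar G \<in> ring_hom R G" using G by (simp add: affine_group_scheme_def)

sublocale sc: ring_hom_cring R G "scalar G" by unfold_locales (rule scalar_hom)

lemma \<alpha>_hom: "\<alpha> \<in> ring_hom A B" using torsor by (simp add: torsor_def Let_def)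

lemma \<alpha>_Bs [simp]: "a \<in> carrier A \<Longrightarrow> \<alpha> a \<in> Bs" using ring_hom_closed[OF \<alpha>_hom] by simp

lemma \<phi>_closed [simp]: "r \<in> carrier R \<Longrightarrow> \<phi> r \<in> carrier A" using ring_hom_closed[OF \<phi>] .

sublocale BH: tensor_algebra R \<beta> B "scalar G" G
  by unfold_locales auto

sublocale BB: tensor_product A \<alpha> B \<alpha> B
  by unfold_locales auto

sublocale H: cring BH.T by (rule BH.T_cring)

lemma \<rho>_hom: "\<rho> \<in> ring_hom B BH.T" using torsor by (simp add: torsor_def Let_def)

lemma \<rho>_\<alpha>: "a \<in> carrier A \<Longrightarrow> \<rho> (\<alpha> a) = BH.pr (\<alpha> a) \<one>\<^bsub>G\<^esub>"
  using torsor by (simp add: torsor_def Let_def)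

abbreviation "\<theta> \<equiv> \<lambda>b c. BH.pr b \<one>\<^bsub>G\<^esub> \<otimes>\<^bsub>BH.T\<^esub> \<rho> c"

lemma \<theta>_bij: "bij_betw (tensor_lift BH.T \<theta>) (carrier BB.T) (carrier BH.T)"
  using torsor by (simp add: torsor_def Let_def)

lemma \<rho>_closed [simp]: "b \<in> Bs \<Longrightarrow> \<rho> b \<in> carrier BH.T" using ring_hom_closed[OF \<rho>_hom] by simp

lemma pr_one_closed [simp]: "b \<in> Bs \<Longrightarrow> BH.pr b \<one>\<^bsub>G\<^esub> \<in> carrier BH.T" by (rule BH.pr_closed) auto

sublocale Th: tensor_balanced A \<alpha> B \<alpha> B BH.T \<theta>
proof (intro tensor_balanced.intro BB.tensor_product_axioms BH.T.abelian_group_axioms tensor_balanced_axioms.intro)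
  fix x y assume "x \<in> carrier B" "y \<in> carrier B"
  then show "\<theta> x y \<in> carrier BH.T" by simp
next
  fix x x' y assume c: "x \<in> carrier B" "x' \<in> carrier B" "y \<in> carrier B"
  have "BH.pr (x \<oplus> x') \<one>\<^bsub>G\<^esub> = BH.pr x \<one>\<^bsub>G\<^esub> \<oplus>\<^bsub>BH.T\<^esub> BH.pr x' \<one>\<^bsub>G\<^esub>"
    using BH.pr_add_left[of x x' "\<one>\<^bsub>G\<^esub>"] c by simp
  then show "\<theta> (x \<oplus>\<^bsub>B\<^esub> x') y = \<theta> x y \<oplus>\<^bsub>BH.T\<^esub> \<theta> x' y"
    using c by (simp add: H.l_distr)
next
  fix x y y' assume c: "x \<in> carrier B" "y \<in> carrier B" "y' \<in> carrier B"
  then show "\<theta> x (y \<oplus>\<^bsub>B\<^esub> y') = \<theta> x y \<oplus>\<^bsub>BH.T\<^esub> \<theta> x y'"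
    using ring_hom_add[OF \<rho>_hom, of y y'] by (simp add: H.r_distr)
next
  fix a x y assume c: "a \<in> carrier A" "x \<in> carrier B" "y \<in> carrier B"
  have "BH.pr (\<alpha> a \<otimes> x) \<one>\<^bsub>G\<^esub> = BH.pr x \<one>\<^bsub>G\<^esub> \<otimes>\<^bsub>BH.T\<^esub> BH.pr (\<alpha> a) \<one>\<^bsub>G\<^esub>"
    using BH.pr_mult[of x "\<alpha> a" "\<one>\<^bsub>G\<^esub>" "\<one>\<^bsub>G\<^esub>"] c by (simp add: L.m_comm)
  moreover have "\<rho> (\<alpha> a \<otimes> y) = BH.pr (\<alpha> a) \<one>\<^bsub>G\<^esub> \<otimes>\<^bsub>BH.T\<^esub> \<rho> y"
    using ring_hom_mult[OF \<rho>_hom, of "\<alpha> a" y] c \<rho>_\<alpha> by simp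
  ultimately show "\<theta> (\<alpha> a \<otimes>\<^bsub>B\<^esub> x) y = \<theta> x (\<alpha> a \<otimes>\<^bsub>B\<^esub> y)"
    using c by (simp add: H.m_assoc)
qed

lemma \<theta>_cases:
  assumes "\<xi> \<in> carrier BH.T"
  obtains w where "w \<in> carrier BB.T" "\<xi> = Th.lift w"
  using assms \<theta>_bij by (auto simp: bij_betw_def)

text \<open>The torsor map is onto, so the products \<open>(b \<otimes> 1) \<rho> c\<close> generate
  \<open>B \<otimes> G\<close> under differences. On these generators the action of an endomorphism
  is explicit.\<close>

lemma H_induct [consumes 1, case_names base minus]:
  assumes \<xi>: "\<xi> \<in> carrier BH.T"
    and base: "\<And>b c. b \<in> Bs \<Longrightarrow> c \<in> Bs \<Longrightarrow> Q (BH.pr b \<one>\<^bsub>G\<^esub> \<otimes>\<^bsub>BH.T\<^esub> \<rho> c)"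
    and minus: "\<And>\<xi> \<eta>. \<xi> \<in> carrier BH.T \<Longrightarrow> \<eta> \<in> carrier BH.T \<Longrightarrow> Q \<xi> \<Longrightarrow> Q \<eta> \<Longrightarrow> Q (\<xi> \<ominus>\<^bsub>BH.T\<^esub> \<eta>)"
  shows "Q \<xi>"
proof -
  obtain w where w: "w \<in> carrier BB.T" "\<xi> = Th.lift w" using \<xi> by (rule \<theta>_cases)
  have "Q (Th.lift w)" using w(1)
  proof (induction w rule: BB.T_induct)
    case (pr x y)
    then have "Q (\<theta> x y)" by (intro base) simp_all
    then show ?case unfolding Th.lift_pr[OF pr] .
  next
    case (minus U W)
    then have "Q (Th.lift U \<ominus>\<^bsub>BH.T\<^esub> Th.lift W)" by (intro assms(3) Th.lift_closed)
    then show ?case unfolding Th.lift_diff[OF minus(1,2)] .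
  qed
  then show ?thesis using w by simp
qed

text \<open>The map \<open>b \<otimes> c\<close> to \<open>b \<tau>(c)\<close> on
  \<open>B \<otimes>\<^sub>A B\<close>, transported to \<open>B \<otimes>\<^sub>R G\<close> by the
  inverse of the torsor isomorphism.\<close>

definition \<Lambda> :: "('b \<Rightarrow> 'b) \<Rightarrow> (('b \<times> 'h) \<Rightarrow>\<^sub>0 int) set \<Rightarrow> 'b" where
  "\<Lambda> \<tau> \<xi> = tensor_lift L (\<lambda>b c. b \<otimes> \<tau> c) (inv_into (carrier BB.T) Th.lift \<xi>)"

definition automorphism :: "('b \<Rightarrow> 'b) \<Rightarrow> bool" where
  "automorphism \<tau> \<longleftrightarrow> \<tau> \<in> ring_hom L L \<and> (\<forall>a\<in>carrier A. \<tau> (\<alpha> a) = \<alpha> a)"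

lemma \<Lambda>_facts:
  assumes \<tau>: "automorphism \<tau>"
  shows \<Lambda>_closed: "\<xi> \<in> carrier BH.T \<Longrightarrow> \<Lambda> \<tau> \<xi> \<in> carrier L"
    and \<Lambda>_diff: "\<xi> \<in> carrier BH.T \<Longrightarrow> \<eta> \<in> carrier BH.T \<Longrightarrow> \<Lambda> \<tau> (\<xi> \<ominus>\<^bsub>BH.T\<^esub> \<eta>) = \<Lambda> \<tau> \<xi> \<ominus> \<Lambda> \<tau> \<eta>"
    and \<Lambda>_add: "\<xi> \<in> carrier BH.T \<Longrightarrow> \<eta> \<in> carrier BH.T \<Longrightarrow> \<Lambda> \<tau> (\<xi> \<oplus>\<^bsub>BH.T\<^esub> \<eta>) = \<Lambda> \<tau> \<xi> \<oplus> \<Lambda> \<tau> \<eta>"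
    and \<Lambda>_base: "b \<in> Bs \<Longrightarrow> c \<in> Bs \<Longrightarrow> \<Lambda> \<tau> (BH.pr b \<one>\<^bsub>G\<^esub> \<otimes>\<^bsub>BH.T\<^esub> \<rho> c) = b \<otimes> \<tau> c"
proof -
  have \<tau>h: "\<tau> \<in> ring_hom L L" and \<tau>\<alpha>: "\<And>a. a \<in> carrier A \<Longrightarrow> \<tau> (\<alpha> a) = \<alpha> a"
    using \<tau> by (auto simp: automorphism_def)
  interpret \<tau>: ring_hom_cring L L \<tau> by unfold_locales (rule \<tau>h)
  interpret mu: tensor_balanced A \<alpha> B \<alpha> B L "\<lambda>b c. b \<otimes> \<tau> c"
    by (intro tensor_balanced.intro BB.tensor_product_axioms L.abelian_group_axioms tensor_balanced_axioms.intro)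
      (auto simp: L.l_distr L.r_distr \<tau>\<alpha> L.m_ac)
  have inj: "inj_on Th.lift (carrier BB.T)" using \<theta>_bij by (simp add: bij_betw_def)
  have \<Lambda>: "\<Lambda> \<tau> (Th.lift w) = mu.lift w" if "w \<in> carrier BB.T" for w
    unfolding \<Lambda>_def using inv_into_f_f[OF inj that] by simp
  show "\<Lambda> \<tau> \<xi> \<in> carrier L" if "\<xi> \<in> carrier BH.T"
    using that by (elim \<theta>_cases) (simp add: \<Lambda> mu.lift_closed)
  show "\<Lambda> \<tau> (\<xi> \<ominus>\<^bsub>BH.T\<^esub> \<eta>) = \<Lambda> \<tau> \<xi> \<ominus> \<Lambda> \<tau> \<eta>" if x: "\<xi> \<in> carrier BH.T" and y: "\<eta> \<in> carrier BH.T"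
  proof -
    obtain w where w: "w \<in> carrier BB.T" "\<xi> = Th.lift w" using x by (rule \<theta>_cases)
    obtain v where v: "v \<in> carrier BB.T" "\<eta> = Th.lift v" using y by (rule \<theta>_cases)
    show ?thesis unfolding w v Th.lift_diff[OF w(1) v(1), symmetric]
      using w v by (simp add: \<Lambda> mu.lift_diff)
  qed
  show "\<Lambda> \<tau> (\<xi> \<oplus>\<^bsub>BH.T\<^esub> \<eta>) = \<Lambda> \<tau> \<xi> \<oplus> \<Lambda> \<tau> \<eta>" if x: "\<xi> \<in> carrier BH.T" and y: "\<eta> \<in> carrier BH.T"
  proof -
    obtain w where w: "w \<in> carrier BB.T" "\<xi> = Th.lift w" using x by (rule \<theta>_cases)
    obtain v where v: "v \<in> carrier BB.T" "\<eta> = Th.lift v" using y by (rule \<theta>_cases)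
    show ?thesis unfolding w v Th.lift_add[OF w(1) v(1), symmetric]
      using w v by (simp add: \<Lambda> mu.lift_add)
  qed
  show "\<Lambda> \<tau> (BH.pr b \<one>\<^bsub>G\<^esub> \<otimes>\<^bsub>BH.T\<^esub> \<rho> c) = b \<otimes> \<tau> c" if "b \<in> Bs" "c \<in> Bs"
    using \<Lambda>[OF BB.pr_closed, of b c] that by (simp add: Th.lift_pr mu.lift_pr)
qed

lemma \<Lambda>_mult_diff:
  assumes \<tau>: "automorphism \<tau>" and c: "x \<in> carrier BH.T" "y \<in> carrier BH.T" "z \<in> carrier BH.T"
    and e: "\<Lambda> \<tau> (x \<otimes>\<^bsub>BH.T\<^esub> y) = \<Lambda> \<tau> x \<otimes> \<Lambda> \<tau> y" "\<Lambda> \<tau> (x \<otimes>\<^bsub>BH.T\<^esub> z) = \<Lambda> \<tau> x \<otimes> \<Lambda> \<tau> z"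
  shows "\<Lambda> \<tau> (x \<otimes>\<^bsub>BH.T\<^esub> (y \<ominus>\<^bsub>BH.T\<^esub> z)) = \<Lambda> \<tau> x \<otimes> \<Lambda> \<tau> (y \<ominus>\<^bsub>BH.T\<^esub> z)"
proof -
  have "x \<otimes>\<^bsub>BH.T\<^esub> (y \<ominus>\<^bsub>BH.T\<^esub> z) = x \<otimes>\<^bsub>BH.T\<^esub> y \<ominus>\<^bsub>BH.T\<^esub> x \<otimes>\<^bsub>BH.T\<^esub> z"
    using c by (simp add: a_minus_def H.r_distr H.r_minus)
  then have "\<Lambda> \<tau> (x \<otimes>\<^bsub>BH.T\<^esub> (y \<ominus>\<^bsub>BH.T\<^esub> z)) = \<Lambda> \<tau> x \<otimes> \<Lambda> \<tau> y \<ominus> \<Lambda> \<tau> x \<otimes> \<Lambda> \<tau> z"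
    using \<Lambda>_diff[OF \<tau> H.m_closed[OF c(1,2)] H.m_closed[OF c(1,3)]] e by metis
  also have "\<dots> = \<Lambda> \<tau> x \<otimes> (\<Lambda> \<tau> y \<ominus> \<Lambda> \<tau> z)"
    using \<Lambda>_closed[OF \<tau>] c by (simp add: a_minus_def L.r_distr L.r_minus)
  finally show ?thesis unfolding \<Lambda>_diff[OF \<tau> c(2,3)] .
qed

text \<open>On the generators \<open>(b \<otimes> 1) \<rho> c\<close> this is multiplicativity of
  \<open>\<rho>\<close> and of \<open>\<tau>\<close>; it extends to differences in each argument
  separately.\<close>

lemma \<Lambda>_mult:
  assumes \<tau>: "automorphism \<tau>" and x: "\<xi> \<in> carrier BH.T" and y: "\<eta> \<in> carrier BH.T"
  shows "\<Lambda> \<tau> (\<xi> \<otimes>\<^bsub>BH.T\<^esub> \<eta>) = \<Lambda> \<tau> \<xi> \<otimes> \<Lambda> \<tau> \<eta>"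
  using x
proof (induction \<xi> rule: H_induct)
  case (base b c)
  show ?case using y
  proof (induction \<eta> rule: H_induct)
    case base': (base b' c')
    have \<tau>h: "\<tau> \<in> ring_hom L L" using \<tau> by (auto simp: automorphism_def)
    have \<tau>c: "\<tau> c \<in> carrier L" "\<tau> c' \<in> carrier L" "\<tau> (c \<otimes> c') = \<tau> c \<otimes> \<tau> c'"
      using base base' ring_hom_closed[OF \<tau>h] ring_hom_mult[OF \<tau>h] by auto
    have "BH.pr b \<one>\<^bsub>G\<^esub> \<otimes>\<^bsub>BH.T\<^esub> BH.pr b' \<one>\<^bsub>G\<^esub> = BH.pr (b \<otimes> b') \<one>\<^bsub>G\<^esub>"
      using BH.pr_mult[of b b' "\<one>\<^bsub>G\<^esub>" "\<one>\<^bsub>G\<^esub>"] base base' by simp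
    moreover have "\<rho> c \<otimes>\<^bsub>BH.T\<^esub> \<rho> c' = \<rho> (c \<otimes> c')"
      using ring_hom_mult[OF \<rho>_hom, of c c'] base base' by simp
    moreover have four: "(u \<otimes>\<^bsub>BH.T\<^esub> v) \<otimes>\<^bsub>BH.T\<^esub> (w \<otimes>\<^bsub>BH.T\<^esub> z) = (u \<otimes>\<^bsub>BH.T\<^esub> w) \<otimes>\<^bsub>BH.T\<^esub> (v \<otimes>\<^bsub>BH.T\<^esub> z)"
      if "u \<in> carrier BH.T" "v \<in> carrier BH.T" "w \<in> carrier BH.T" "z \<in> carrier BH.T" for u v w z
      using that by (simp add: H.m_ac)
    ultimately have "(BH.pr b \<one>\<^bsub>G\<^esub> \<otimes>\<^bsub>BH.T\<^esub> \<rho> c) \<otimes>\<^bsub>BH.T\<^esub> (BH.pr b' \<one>\<^bsub>G\<^esub> \<otimes>\<^bsub>BH.T\<^esub> \<rho> c')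
        = BH.pr (b \<otimes> b') \<one>\<^bsub>G\<^esub> \<otimes>\<^bsub>BH.T\<^esub> \<rho> (c \<otimes> c')"
      using four[of "BH.pr b \<one>\<^bsub>G\<^esub>" "\<rho> c" "BH.pr b' \<one>\<^bsub>G\<^esub>" "\<rho> c'"] base base' pr_one_closed \<rho>_closed by metis
    then have "\<Lambda> \<tau> (BH.pr b \<one>\<^bsub>G\<^esub> \<otimes>\<^bsub>BH.T\<^esub> \<rho> c \<otimes>\<^bsub>BH.T\<^esub> (BH.pr b' \<one>\<^bsub>G\<^esub> \<otimes>\<^bsub>BH.T\<^esub> \<rho> c')) = (b \<otimes> b') \<otimes> \<tau> (c \<otimes> c')"
      using \<Lambda>_base[OF \<tau>, of "b \<otimes> b'" "c \<otimes> c'"] base base' Bs_closed by metis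
    also have "\<dots> = (b \<otimes> \<tau> c) \<otimes> (b' \<otimes> \<tau> c')" using base base' \<tau>c by (simp add: L.m_ac)
    finally show ?case unfolding \<Lambda>_base[OF \<tau> base] \<Lambda>_base[OF \<tau> base'] .
  next
    case (minus \<eta> \<zeta>)
    have "BH.pr b \<one>\<^bsub>G\<^esub> \<otimes>\<^bsub>BH.T\<^esub> \<rho> c \<in> carrier BH.T" using base by simp
    then show ?case using minus by (rule \<Lambda>_mult_diff[OF \<tau>])
  qed
next
  case (minus \<xi> \<zeta>)
  have "\<Lambda> \<tau> (\<eta> \<otimes>\<^bsub>BH.T\<^esub> (\<xi> \<ominus>\<^bsub>BH.T\<^esub> \<zeta>)) = \<Lambda> \<tau> \<eta> \<otimes> \<Lambda> \<tau> (\<xi> \<ominus>\<^bsub>BH.T\<^esub> \<zeta>)"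
    using minus y \<Lambda>_closed[OF \<tau>] by (intro \<Lambda>_mult_diff[OF \<tau>]) (metis H.m_comm L.m_comm)+
  then show ?case
    using minus y \<Lambda>_closed[OF \<tau>] H.m_comm L.m_comm BH.T.minus_closed by metis
qed

lemma \<Lambda>_scalar:
  assumes \<tau>: "automorphism \<tau>" and b: "b \<in> Bs"
  shows "\<Lambda> \<tau> (BH.pr b \<one>\<^bsub>G\<^esub>) = b"
proof -
  have \<tau>h: "\<tau> \<in> ring_hom L L" using \<tau> by (auto simp: automorphism_def)
  have "\<rho> \<one> = \<one>\<^bsub>BH.T\<^esub>" using ring_hom_one[OF \<rho>_hom] by simp
  then have "BH.pr b \<one>\<^bsub>G\<^esub> = BH.pr b \<one>\<^bsub>G\<^esub> \<otimes>\<^bsub>BH.T\<^esub> \<rho> \<one>" using b by simp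
  then show ?thesis using \<Lambda>_base[OF \<tau> b, of \<one>] ring_hom_one[OF \<tau>h] b by simp
qed

text \<open>The point of the group scheme that translates the tautological point of the torsor to
  its image under \<open>\<tau>\<close>. Its values are in \<open>L\<close>, with no rationality
  over the base built in.\<close>

definition \<chi> :: "('b \<Rightarrow> 'b) \<Rightarrow> 'h \<Rightarrow> 'b" where "\<chi> \<tau> h = \<Lambda> \<tau> (BH.pr \<one> h)"

lemma \<Lambda>_pr:
  assumes \<tau>: "automorphism \<tau>" and b: "b \<in> Bs" and h: "h \<in> carrier G"
  shows "\<Lambda> \<tau> (BH.pr b h) = b \<otimes> \<chi> \<tau> h"
proof -
  have "BH.pr b h = BH.pr b \<one>\<^bsub>G\<^esub> \<otimes>\<^bsub>BH.T\<^esub> BH.pr \<one> h"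
    using BH.pr_mult[of b \<one> "\<one>\<^bsub>G\<^esub>" h] b h by simp
  then show ?thesis using \<Lambda>_mult[OF \<tau>, of "BH.pr b \<one>\<^bsub>G\<^esub>" "BH.pr \<one> h"] b h
      BH.pr_closed[of \<one> h] by (simp add: \<chi>_def \<Lambda>_scalar[OF \<tau>])
qed

lemma \<chi>_hom:
  assumes \<tau>: "automorphism \<tau>"
  shows "\<chi> \<tau> \<in> ring_hom G L"
proof (rule ring_hom_memI)
  have pc: "BH.pr \<one> h \<in> carrier BH.T" if "h \<in> carrier G" for h using BH.pr_closed[of \<one> h] that by simp
  show "\<chi> \<tau> h \<in> carrier L" if "h \<in> carrier G" for h
    using pc that by (simp add: \<chi>_def \<Lambda>_closed[OF \<tau>])
  show "\<chi> \<tau> (h \<otimes>\<^bsub>G\<^esub> k) = \<chi> \<tau> h \<otimes> \<chi> \<tau> k" if "h \<in> carrier G" "k \<in> carrier G" for h k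
    using \<Lambda>_mult[OF \<tau> pc pc, of h k] that BH.pr_mult[of \<one> \<one> h k] by (simp add: \<chi>_def)
  show "\<chi> \<tau> (h \<oplus>\<^bsub>G\<^esub> k) = \<chi> \<tau> h \<oplus> \<chi> \<tau> k" if "h \<in> carrier G" "k \<in> carrier G" for h k
    using \<Lambda>_add[OF \<tau> pc pc, of h k] that BH.pr_add_right[of \<one> h k] by (simp add: \<chi>_def)
  show "\<chi> \<tau> \<one>\<^bsub>G\<^esub> = \<one>" by (simp add: \<chi>_def \<Lambda>_scalar[OF \<tau>])
qed

lemma \<beta>_hom: "\<beta> \<in> ring_hom R L"
proof -
  have "\<beta> \<in> ring_hom R B" by (rule ring_hom_trans[OF \<phi> \<alpha>_hom])
  then show ?thesis by (auto simp: ring_hom_def)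
qed

sublocale alg: algebra_hom R L \<beta>
  by unfold_locales (rule \<beta>_hom)

lemma \<chi>_scalar:
  assumes \<tau>: "automorphism \<tau>" and r: "r \<in> carrier R"
  shows "\<chi> \<tau> (scalar G r) = \<beta> r"
proof -
  have "BH.pr \<one> (scalar G r) = BH.pr (\<beta> r) \<one>\<^bsub>G\<^esub>"
    using BH.pr_balanced[of r \<one> "\<one>\<^bsub>G\<^esub>"] r by simp
  then show ?thesis using \<Lambda>_scalar[OF \<tau>, of "\<beta> r"] r by (simp add: \<chi>_def)
qed

text \<open>As \<open>G\<close> is finite over \<open>R\<close>, all values of one point lie in the
  span of its values on finitely many generators.\<close>

lemma \<chi>_span:
  assumes \<tau>: "automorphism \<tau>" and E: "finite E" "E \<subseteq> carrier G"
    and gen: "\<forall>h\<in>carrier G. \<exists>c\<in>E \<rightarrow> carrier R. h = (\<Oplus>\<^bsub>G\<^esub>x\<in>E. scalar G (c x) \<otimes>\<^bsub>G\<^esub> x)"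
    and h: "h \<in> carrier G"
  shows "\<chi> \<tau> h \<in> span_of R \<beta> L (\<chi> \<tau>) E"
proof -
  interpret c: ring_hom_cring G L "\<chi> \<tau>" by unfold_locales (rule \<chi>_hom[OF \<tau>])
  obtain c where c: "c \<in> E \<rightarrow> carrier R" "h = (\<Oplus>\<^bsub>G\<^esub>x\<in>E. scalar G (c x) \<otimes>\<^bsub>G\<^esub> x)" using gen h by blast
  have cE: "c x \<in> carrier R" "x \<in> carrier G" if "x \<in> E" for x using that c E by auto
  have "\<chi> \<tau> h = (\<Oplus>x\<in>E. \<chi> \<tau> (scalar G (c x) \<otimes>\<^bsub>G\<^esub> x))"
    unfolding c(2) by (subst c.hom_finsum) (use c E in \<open>auto simp: comp_def\<close>)
  also have "\<dots> = (\<Oplus>x\<in>E. \<beta> (c x) \<otimes> \<chi> \<tau> x)"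
    by (rule L.finsum_cong') (use cE \<chi>_scalar[OF \<tau>] in \<open>auto simp del: comp_apply\<close>)
  finally show ?thesis using c unfolding span_of_def by blast
qed

end


context algebra_hom
begin

lemma span_trans:
  assumes g: "\<And>j. j \<in> J \<Longrightarrow> g j \<in> carrier L" "finite J" and g': "\<And>k. k \<in> J' \<Longrightarrow> g' k \<in> span_of R h L g J"
    and x: "x \<in> span_of R h L g' J'"
  shows "x \<in> span_of R h L g J"
proof -
  obtain c where c: "c \<in> J' \<rightarrow> carrier R" "x = (\<Oplus>k\<in>J'. h (c k) \<otimes> g' k)" using x unfolding span_of_def by blast
  have "h (c k) \<otimes> g' k \<in> span_of R h L g J" if "k \<in> J'" for k
    by (rule span_smult[where g = g and J = J, OF g(1) g'[OF that] _ g(2)]) (use c that in auto)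
  then show ?thesis unfolding c(2)
    by (intro span_finsum[where g = g and J = J and f = "\<lambda>k. h (c k) \<otimes> g' k", OF g(1) g(2)])
qed

lemma span_mult_closed:
  assumes g: "\<And>j. j \<in> J \<Longrightarrow> g j \<in> carrier L" "finite J"
    and m: "\<And>j k. j \<in> J \<Longrightarrow> k \<in> J \<Longrightarrow> g j \<otimes> g k \<in> span_of R h L g J"
    and x: "x \<in> span_of R h L g J" and y: "y \<in> span_of R h L g J"
  shows "x \<otimes> y \<in> span_of R h L g J"
proof (rule span_trans[where g = g and J = J, OF g])
  show "x \<otimes> y \<in> span_of R h L (\<lambda>(i, j). g i \<otimes> g j) (J \<times> J)"
    by (rule span_mult[where g = g and g' = g and J = J and J' = J, OF g(1) g(1) g(2) g(2) x y])
qed (use m in auto)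

lemma span_diff:
  assumes g: "\<And>j. j \<in> J \<Longrightarrow> g j \<in> carrier L" "finite J" and x: "x \<in> span_of R h L g J" and y: "y \<in> span_of R h L g J"
  shows "x \<ominus> y \<in> span_of R h L g J"
proof -
  have c: "x \<in> carrier L" "y \<in> carrier L"
    using span_closed[where g = g and J = J, OF g(1)] x y by blast+
  have "h (\<ominus>\<^bsub>R\<^esub> \<one>\<^bsub>R\<^esub>) \<otimes> y = \<ominus> y" using c by (simp add: L.l_minus)
  then have "\<ominus> y \<in> span_of R h L g J"
    using span_smult[where g = g and J = J and r = "\<ominus>\<^bsub>R\<^esub> \<one>\<^bsub>R\<^esub>", OF g(1) y _ g(2)] by simp
  then show ?thesis unfolding a_minus_def by (intro span_add[where g = g and J = J, OF g(1) x])
qed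

end

section \<open>Comparison of the points of the group scheme\<close>

locale witt_torsor = witt_base L p V Ao t a1 c0 T1 T2 m1 \<sigma> K + torsor_points R A L G \<phi> \<alpha> Bs \<rho>
  for L :: "('b, 'k) ring_scheme" (structure) and p V Ao t a1 c0 T1 T2 m1 \<sigma> K
    and R :: "('r, 'm) ring_scheme" and A :: "('a, 'n) ring_scheme"
    and G :: "('r, 'h) hopf" and \<phi> \<alpha> Bs \<rho> +
  assumes R_domain: "domain R" and G_finite: "finite_over R (scalar G) G"
    and Bs_V: "Bs \<subseteq> V" and V_frac: "\<And>z. z \<in> V \<Longrightarrow> \<exists>s\<in>Bs. s \<notin> I \<and> s \<otimes> z \<in> Bs"
    and \<alpha>_Ao: "\<And>a. a \<in> carrier A \<Longrightarrow> \<alpha> a \<in> Ao" and \<beta>_K: "\<And>r. r \<in> carrier R \<Longrightarrow> \<beta> r \<in> K"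
    and \<beta>_inj: "\<And>r. r \<in> carrier R \<Longrightarrow> \<beta> r = \<zero> \<Longrightarrow> r = \<zero>\<^bsub>R\<^esub>"
begin

abbreviation "\<sigma>p \<equiv> \<sigma> ^^ p"

definition \<iota> :: "'b \<Rightarrow> 'b" where "\<iota> x = x"

lemma \<iota>_apply: "\<iota> x = x" by (simp add: \<iota>_def)

lemma aut: "automorphism \<iota>" "automorphism \<sigma>" "automorphism \<sigma>p"
proof -
  show "automorphism \<iota>" by (auto simp: automorphism_def \<iota>_apply intro: ring_hom_memI)
  show "automorphism \<sigma>" using \<sigma>_hom \<sigma>_A \<alpha>_Ao by (simp add: automorphism_def)
  show "automorphism \<sigma>p" using \<sigma>_pow_hom \<sigma>_pow_A \<alpha>_Ao by (simp add: automorphism_def)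
qed

text \<open>The shape of the expansion in \<open>first_order\<close>, for the difference of two
  values of \<open>\<Lambda>\<close> at the same tensor.\<close>

definition increment :: "nat \<Rightarrow> 'b \<Rightarrow> 'b \<Rightarrow> 'b \<Rightarrow> bool" where
  "increment k e x U \<longleftrightarrow> (\<exists>r\<in>V. x = t [^] k \<otimes> (U \<otimes> e \<oplus> t \<otimes> r))"

lemma increment_minus:
  assumes "increment k e (x \<ominus> y) U" "increment k e (x' \<ominus> y') U'" and [simp]: "U \<in> V" "U' \<in> V" "e \<in> carrier L"
    "x \<in> carrier L" "y \<in> carrier L" "x' \<in> carrier L" "y' \<in> carrier L"
  shows "increment k e ((x \<ominus> x') \<ominus> (y \<ominus> y')) (U \<ominus> U')"
proof -
  obtain r where r: "r \<in> V" "x \<ominus> y = t [^] k \<otimes> (U \<otimes> e \<oplus> t \<otimes> r)" using assms by (auto simp: increment_def)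
  obtain r' where r': "r' \<in> V" "x' \<ominus> y' = t [^] k \<otimes> (U' \<otimes> e \<oplus> t \<otimes> r')" using assms by (auto simp: increment_def)
  define tk where "tk = t [^] k"
  have ct: "tk \<in> carrier L" "U \<in> carrier L" "U' \<in> carrier L" "t \<in> carrier L" "r \<in> carrier L" "r' \<in> carrier L"
    using r r' by (auto simp: tk_def)
  note cc = ct assms(5-9)
  have "(x \<ominus> x') \<ominus> (y \<ominus> y') = (x \<ominus> y) \<ominus> (x' \<ominus> y')"
    using cc by algebra
  also have "\<dots> = tk \<otimes> (U \<otimes> e \<oplus> t \<otimes> r) \<ominus> tk \<otimes> (U' \<otimes> e \<oplus> t \<otimes> r')" using r r' by (simp add: tk_def)
  also have "\<dots> = tk \<otimes> ((U \<ominus> U') \<otimes> e \<oplus> t \<otimes> (r \<ominus> r'))"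
    using cc by algebra
  finally show ?thesis unfolding increment_def tk_def using r r' by (intro bexI[of _ "r \<ominus> r'"]) auto
qed

lemma increment_base:
  assumes "first_order \<tau> k e x \<delta>" and b: "b \<in> V" and e: "e \<in> carrier L"
  shows "increment k e (b \<otimes> \<tau> x \<ominus> b \<otimes> x) (b \<otimes> \<delta>)"
proof -
  obtain r where r: "x \<in> V" "\<delta> \<in> V" "r \<in> V" "\<tau> x = x \<oplus> t [^] k \<otimes> (\<delta> \<otimes> e \<oplus> t \<otimes> r)"
    using assms by (auto simp: first_order_def)
  define tk where "tk = t [^] k"
  have cc [simp]: "tk \<in> carrier L" "x \<in> carrier L" "\<delta> \<in> carrier L" "t \<in> carrier L" "r \<in> carrier L" "b \<in> carrier L" "e \<in> carrier L"
    using r b e by (auto simp: tk_def)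
  have "b \<otimes> \<tau> x \<ominus> b \<otimes> x = b \<otimes> (x \<oplus> tk \<otimes> (\<delta> \<otimes> e \<oplus> t \<otimes> r)) \<ominus> b \<otimes> x" using r by (simp add: tk_def)
  also have "\<dots> = tk \<otimes> ((b \<otimes> \<delta>) \<otimes> e \<oplus> t \<otimes> (b \<otimes> r))"
    using cc by algebra
  finally show ?thesis unfolding increment_def tk_def using r b by (intro bexI[of _ "b \<otimes> r"]) auto
qed

text \<open>On a generator \<open>(b \<otimes> 1) \<rho> c\<close> the two differences are
  \<open>b (\<sigma> c - c)\<close> and \<open>b (\<sigma>\<^sup>p c - c)\<close>, so
  \<open>U = b \<delta>\<close> works for both. Expansions with a common \<open>U\<close> are stable
  under differences.\<close>

lemma increment_exists:
  assumes "\<xi> \<in> carrier BH.T"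
  shows "\<exists>U\<in>V. increment m (\<ominus> (Z1 [^] (p - 1))) (\<Lambda> \<sigma> \<xi> \<ominus> \<Lambda> \<iota> \<xi>) U \<and> increment n \<one> (\<Lambda> \<sigma>p \<xi> \<ominus> \<Lambda> \<iota> \<xi>) U"
  using assms
proof (induction \<xi> rule: H_induct)
  case (base b c)
  have V: "b \<in> V" "c \<in> V" using base Bs_V by auto
  obtain \<delta> where \<delta>: "derivative c \<delta>" using derivative_exists[OF V(2)] by blast
  then have "\<delta> \<in> V" by (auto simp: derivative_def first_order_def)
  then have "b \<otimes> \<delta> \<in> V" using V by simp
  moreover have "increment m (\<ominus> (Z1 [^] (p - 1))) (b \<otimes> \<sigma> c \<ominus> b \<otimes> c) (b \<otimes> \<delta>)"
    "increment n \<one> (b \<otimes> \<sigma>p c \<ominus> b \<otimes> c) (b \<otimes> \<delta>)"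
    using \<delta> V by (auto simp: derivative_def intro!: increment_base)
  moreover have "\<Lambda> \<iota> (BH.pr b \<one>\<^bsub>G\<^esub> \<otimes>\<^bsub>BH.T\<^esub> \<rho> c) = b \<otimes> c"
    by (rule trans[OF \<Lambda>_base[OF aut(1) base]]) (simp only: \<iota>_apply)
  ultimately show ?case
    unfolding \<Lambda>_base[OF aut(2) base] \<Lambda>_base[OF aut(3) base] by metis
next
  case (minus \<xi> \<eta>)
  obtain U where U: "U \<in> V" "increment m (\<ominus> (Z1 [^] (p - 1))) (\<Lambda> \<sigma> \<xi> \<ominus> \<Lambda> \<iota> \<xi>) U" "increment n \<one> (\<Lambda> \<sigma>p \<xi> \<ominus> \<Lambda> \<iota> \<xi>) U"
    using minus by blast
  obtain U' where U': "U' \<in> V" "increment m (\<ominus> (Z1 [^] (p - 1))) (\<Lambda> \<sigma> \<eta> \<ominus> \<Lambda> \<iota> \<eta>) U'" "increment n \<one> (\<Lambda> \<sigma>p \<eta> \<ominus> \<Lambda> \<iota> \<eta>) U'"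
    using minus by blast
  show ?case
    using minus(1,2) U U' increment_minus[OF U(2) U'(2)] increment_minus[OF U(3) U'(3)] \<Lambda>_closed[OF aut(1)] \<Lambda>_closed[OF aut(2)] \<Lambda>_closed[OF aut(3)]
    by (intro bexI[of _ "U \<ominus> U'"]) (simp_all add: \<Lambda>_diff aut)
qed

lemma pr_one [simp]: "h \<in> carrier G \<Longrightarrow> BH.pr \<one> h \<in> carrier BH.T"
  using BH.pr_closed[of \<one> h] by simp

text \<open>The induction is over pure tensors \<open>b \<otimes> h\<close> this time, where the
  difference of the values of \<open>\<Lambda>\<close> is \<open>b\<close> times the difference of
  the points at \<open>h\<close>. Smallness at every \<open>h\<close> in \<open>G\<close> thus
  spreads to the whole tensor product.\<close>

lemma \<Lambda>p_small:
  assumes all: "\<And>h U. h \<in> carrier G \<Longrightarrow> U \<in> V \<Longrightarrow> increment m (\<ominus> (Z1 [^] (p - 1))) (\<chi> \<sigma> h \<ominus> \<chi> \<iota> h) U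
      \<Longrightarrow> increment n \<one> (\<chi> \<sigma>p h \<ominus> \<chi> \<iota> h) U \<Longrightarrow> U \<in> I"
    and \<xi>: "\<xi> \<in> carrier BH.T"
  shows "\<exists>y\<in>I. \<Lambda> \<sigma>p \<xi> \<ominus> \<Lambda> \<iota> \<xi> = t [^] n \<otimes> y"
  using \<xi>
proof (induction \<xi> rule: BH.T_induct)
  case (pr b h)
  then have b: "b \<in> Bs" "b \<in> V" and h: "h \<in> carrier G" using Bs_V by auto
  obtain U where U: "U \<in> V" "increment m (\<ominus> (Z1 [^] (p - 1))) (\<chi> \<sigma> h \<ominus> \<chi> \<iota> h) U" "increment n \<one> (\<chi> \<sigma>p h \<ominus> \<chi> \<iota> h) U"
    using increment_exists[OF pr_one[OF h]] unfolding \<chi>_def by blast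
  have "U \<in> I" using all[OF h U(1) U(2) U(3)] .
  obtain s where s: "s \<in> V" "\<chi> \<sigma>p h \<ominus> \<chi> \<iota> h = t [^] n \<otimes> (U \<otimes> \<one> \<oplus> t \<otimes> s)"
    using U(3) by (auto simp: increment_def)
  have \<chi>c: "\<chi> \<sigma>p h \<in> carrier L" "\<chi> \<iota> h \<in> carrier L"
    using ring_hom_closed[OF \<chi>_hom[OF aut(3)] h] ring_hom_closed[OF \<chi>_hom[OF aut(1)] h] by auto
  have y: "U \<otimes> \<one> \<oplus> t \<otimes> s \<in> I" using \<open>U \<in> I\<close> s U by (simp add: I_add I_I)
  have "\<Lambda> \<sigma>p (BH.pr b h) \<ominus> \<Lambda> \<iota> (BH.pr b h) = b \<otimes> (\<chi> \<sigma>p h \<ominus> \<chi> \<iota> h)"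
    using \<chi>c b h by (simp add: \<Lambda>_pr aut a_minus_def r_distr r_minus)
  also have "\<dots> = t [^] n \<otimes> (b \<otimes> (U \<otimes> \<one> \<oplus> t \<otimes> s))" using s b U by (simp add: m_lcomm)
  finally show ?case using I_mult(2)[OF y b(2)] by blast
next
  case (minus \<xi> \<eta>)
  obtain x where x: "x \<in> I" "\<Lambda> \<sigma>p \<xi> \<ominus> \<Lambda> \<iota> \<xi> = t [^] n \<otimes> x" using minus by blast
  obtain y where y: "y \<in> I" "\<Lambda> \<sigma>p \<eta> \<ominus> \<Lambda> \<iota> \<eta> = t [^] n \<otimes> y" using minus by blast
  have id: "(x \<ominus> x') \<ominus> (y \<ominus> y') = (x \<ominus> y) \<ominus> (x' \<ominus> y')"
    if "x \<in> carrier L" "x' \<in> carrier L" "y \<in> carrier L" "y' \<in> carrier L" for x x' y y'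
    using that by algebra
  have "\<Lambda> \<sigma>p (\<xi> \<ominus>\<^bsub>BH.T\<^esub> \<eta>) \<ominus> \<Lambda> \<iota> (\<xi> \<ominus>\<^bsub>BH.T\<^esub> \<eta>) = t [^] n \<otimes> x \<ominus> t [^] n \<otimes> y"
    using minus(1,2) x y \<Lambda>_closed[OF aut(1)] \<Lambda>_closed[OF aut(3)] by (simp add: \<Lambda>_diff aut id)
  also have "\<dots> = t [^] n \<otimes> (x \<ominus> y)" using x y by (simp add: a_minus_def r_distr r_minus)
  moreover have "x \<ominus> y \<in> I" unfolding a_minus_def by (rule I_add[OF x(1) I_neg[OF y(1)]])
  ultimately show ?case by metis
qed

text \<open>If all increments were small, so would be the one at the tensor
  \<open>s \<otimes> s Z2 - s Z2 \<otimes> s\<close>. The identity sends this tensor to 0 and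
  \<open>\<sigma>\<^sup>p\<close> sends it to \<open>t^n s \<sigma>\<^sup>p(s)\<close>. But
  \<open>\<sigma>\<^sup>p(s)\<close> is congruent to \<open>s\<close>, and \<open>s\<close> is not
  in the prime \<open>I\<close>.\<close>

lemma increment_nontrivial:
  "\<exists>h U. h \<in> carrier G \<and> U \<in> V \<and> U \<notin> I \<and> increment m (\<ominus> (Z1 [^] (p - 1))) (\<chi> \<sigma> h \<ominus> \<chi> \<iota> h) U
      \<and> increment n \<one> (\<chi> \<sigma>p h \<ominus> \<chi> \<iota> h) U"
proof (rule ccontr)
  assume neg: "\<not> ?thesis"
  interpret \<tau>: ring_hom_cring L L \<sigma>p by unfold_locales (rule \<sigma>_pow_hom)
  \<comment> \<open>\<open>Z2\<close> is only known to lie in \<open>V\<close>; the multiplier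
    \<open>s\<close> moves it into the model, on which the coaction is defined.\<close>
  obtain s where s: "s \<in> Bs" "s \<notin> I" "s \<otimes> Z2 \<in> Bs" using V_frac[OF Z2_V] by blast
  have sV: "s \<in> V" using s Bs_V by blast
  define w where "w = s \<otimes> Z2"
  have w: "w \<in> Bs" using s by (simp add: w_def)
  define \<xi> where "\<xi> = (BH.pr s \<one>\<^bsub>G\<^esub> \<otimes>\<^bsub>BH.T\<^esub> \<rho> w) \<ominus>\<^bsub>BH.T\<^esub> (BH.pr w \<one>\<^bsub>G\<^esub> \<otimes>\<^bsub>BH.T\<^esub> \<rho> s)"
  have \<xi>: "\<xi> \<in> carrier BH.T" using s w by (simp add: \<xi>_def)
  obtain y where y: "y \<in> I" "\<Lambda> \<sigma>p \<xi> \<ominus> \<Lambda> \<iota> \<xi> = t [^] n \<otimes> y"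
    using \<Lambda>p_small[OF _ \<xi>] neg by blast
  have tc: "BH.pr s \<one>\<^bsub>G\<^esub> \<otimes>\<^bsub>BH.T\<^esub> \<rho> w \<in> carrier BH.T" "BH.pr w \<one>\<^bsub>G\<^esub> \<otimes>\<^bsub>BH.T\<^esub> \<rho> s \<in> carrier BH.T"
    using s w by simp_all
  have 1: "\<Lambda> \<iota> \<xi> = \<zero>"
    unfolding \<xi>_def \<Lambda>_diff[OF aut(1) tc] \<Lambda>_base[OF aut(1) s(1) w] \<Lambda>_base[OF aut(1) w s(1)]
    using s w by (simp add: m_comm[of w s] a_minus_def r_neg \<iota>_apply)
  have Z2: "\<sigma>p Z2 = Z2 \<oplus> t [^] n"
    using \<sigma>_p_T2 T2 \<sigma>_pow_A[OF t_A] by (simp add: Z2_def r_distr)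
  define tn where "tn = t [^] n"
  define s' where "s' = \<sigma>p s"
  have cc [simp]: "tn \<in> carrier L" "s \<in> carrier L" "s' \<in> carrier L" "Z2 \<in> carrier L"
    using s Z2_V by (auto simp: tn_def s'_def)
  have "\<Lambda> \<sigma>p \<xi> = s \<otimes> \<sigma>p w \<ominus> w \<otimes> \<sigma>p s"
    unfolding \<xi>_def \<Lambda>_diff[OF aut(3) tc] \<Lambda>_base[OF aut(3) s(1) w] \<Lambda>_base[OF aut(3) w s(1)] ..
  also have "\<dots> = s \<otimes> (s' \<otimes> (Z2 \<oplus> tn)) \<ominus> (s \<otimes> Z2) \<otimes> s'"
    by (simp add: w_def Z2 s'_def tn_def)
  also have "\<dots> = tn \<otimes> (s \<otimes> s')"
  proof -
    have "s \<otimes> (s' \<otimes> (z \<oplus> tn)) \<ominus> (s \<otimes> z) \<otimes> s' = tn \<otimes> (s \<otimes> s')" if "z \<in> carrier L" for z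
      using that cc by algebra
    then show ?thesis by simp
  qed
  finally have "t [^] n \<otimes> (s \<otimes> s') = t [^] n \<otimes> y" using y 1 by (simp add: tn_def a_minus_def)
  then have "s \<otimes> s' = y" using t_cancel[of "s \<otimes> s'" y n] y by simp
  then have ss: "s \<otimes> s' \<in> I" using y by simp
  obtain \<delta> where "derivative s \<delta>" using derivative_exists[OF sV] by blast
  then obtain r where r: "\<delta> \<in> V" "r \<in> V" "s' = s \<oplus> t [^] n \<otimes> (\<delta> \<otimes> \<one> \<oplus> t \<otimes> r)"
    by (auto simp: derivative_def first_order_def s'_def)
  have "t [^] n \<otimes> (\<delta> \<otimes> \<one> \<oplus> t \<otimes> r) \<in> I" using r n_pos by (intro I_t) auto
  then have "s' \<asymp> s" using eqvI[OF sV _ r(3)] by simp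
  then have "s \<otimes> s' \<asymp> s \<otimes> s" using eqv_mult eqv_refl sV by blast
  then have "s \<otimes> s \<in> I" using ss eqv_I by blast
  then show False using I_prime[OF sV sV] s by blast
qed

theorem contradiction: False
proof -
  obtain h U where h: "h \<in> carrier G" and U: "U \<in> V" "U \<notin> I"
    and inc: "increment m (\<ominus> (Z1 [^] (p - 1))) (\<chi> \<sigma> h \<ominus> \<chi> \<iota> h) U" "increment n \<one> (\<chi> \<sigma>p h \<ominus> \<chi> \<iota> h) U"
    using increment_nontrivial by blast
  define u where "u = \<chi> \<sigma> h \<ominus> \<chi> \<iota> h"
  define v where "v = \<chi> \<sigma>p h \<ominus> \<chi> \<iota> h"
  obtain r where r: "r \<in> V" "u = t [^] m \<otimes> (U \<otimes> \<ominus> (Z1 [^] (p - 1)) \<oplus> t \<otimes> r)"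
    using inc by (auto simp: increment_def u_def)
  obtain s where s: "s \<in> V" "v = t [^] n \<otimes> (U \<otimes> \<one> \<oplus> t \<otimes> s)"
    using inc by (auto simp: increment_def v_def)
  obtain E where E: "finite E" "E \<subseteq> carrier G"
    and gen: "\<forall>h\<in>carrier G. \<exists>c\<in>E \<rightarrow> carrier R. h = (\<Oplus>\<^bsub>G\<^esub>x\<in>E. scalar G (c x) \<otimes>\<^bsub>G\<^esub> x)"
    using G_finite unfolding finite_over_def by blast
  interpret c0: ring_hom_cring G L "\<chi> \<iota>" by unfold_locales (rule \<chi>_hom[OF aut(1)])
  interpret c1: ring_hom_cring G L "\<chi> \<sigma>" by unfold_locales (rule \<chi>_hom[OF aut(2)])
  interpret cp: ring_hom_cring G L "\<chi> \<sigma>p" by unfold_locales (rule \<chi>_hom[OF aut(3)])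
  \<comment> \<open>Products of one value of each of the three points, on generators of
    \<open>G\<close>. Their span is closed under multiplication because each point is multiplicative
    and its values lie in a finite span.\<close>
  define g2 where "g2 = (\<lambda>(i, j). \<chi> \<sigma> i \<otimes> \<chi> \<sigma>p j)"
  define g where "g = (\<lambda>(i, j). \<chi> \<iota> i \<otimes> g2 j)"
  define J where "J = E \<times> (E \<times> E)"
  let ?S = "span_of R \<beta> L g J"
  have J: "finite J" using E by (simp add: J_def)
  have g2c: "g2 j \<in> carrier L" if "j \<in> E \<times> E" for j
    using that E by (auto simp: g2_def)
  have gc: "g j \<in> carrier L" if "j \<in> J" for j
    using that E g2c by (auto simp: g_def J_def)
  have prods: "\<chi> \<iota> x \<otimes> (\<chi> \<sigma> y \<otimes> \<chi> \<sigma>p z) \<in> ?S" if xyz: "x \<in> carrier G" "y \<in> carrier G" "z \<in> carrier G" for x y z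
  proof -
    have 2: "\<chi> \<sigma> y \<otimes> \<chi> \<sigma>p z \<in> span_of R \<beta> L g2 (E \<times> E)"
      unfolding g2_def
      by (rule alg.span_mult[where g = "\<chi> \<sigma>" and g' = "\<chi> \<sigma>p" and J = E and J' = E])
        (use E \<chi>_span[OF aut(2) E gen xyz(2)] \<chi>_span[OF aut(3) E gen xyz(3)] in auto)
    show ?thesis unfolding g_def J_def
      by (rule alg.span_mult[where g = "\<chi> \<iota>" and g' = g2 and J = E and J' = "E \<times> E"])
        (use E \<chi>_span[OF aut(1) E gen xyz(1)] 2 g2c in auto)
  qed
  have gg: "g j \<otimes> g k \<in> ?S" if jk: "j \<in> J" "k \<in> J" for j k
  proof -
    obtain x y z where j: "j = (x, (y, z))" "x \<in> carrier G" "y \<in> carrier G" "z \<in> carrier G"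
      using jk E by (auto simp: J_def)
    obtain x' y' z' where k: "k = (x', (y', z'))" "x' \<in> carrier G" "y' \<in> carrier G" "z' \<in> carrier G"
      using jk E by (auto simp: J_def)
    have "g j \<otimes> g k = \<chi> \<iota> (x \<otimes>\<^bsub>G\<^esub> x') \<otimes> (\<chi> \<sigma> (y \<otimes>\<^bsub>G\<^esub> y') \<otimes> \<chi> \<sigma>p (z \<otimes>\<^bsub>G\<^esub> z'))"
      using j k by (simp add: g_def g2_def m_ac)
    then show ?thesis using prods[OF G.m_closed[OF j(2) k(2)] G.m_closed[OF j(3) k(3)] G.m_closed[OF j(4) k(4)]] by (simp only:)
  qed
  have S_mult: "x \<otimes> y \<in> ?S" if "x \<in> ?S" "y \<in> ?S" for x y
    by (rule alg.span_mult_closed[where g = g and J = J, OF gc J gg that])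
  have S_one: "\<one> \<in> ?S" using prods[of "\<one>\<^bsub>G\<^esub>" "\<one>\<^bsub>G\<^esub>" "\<one>\<^bsub>G\<^esub>"] by simp
  have S_pow: "x [^] (k::nat) \<in> ?S" if "x \<in> ?S" for x k
  proof (induction k)
    case 0
    show ?case unfolding nat_pow_0 by (rule S_one)
  next
    case (Suc k)
    show ?case unfolding nat_pow_Suc by (rule S_mult[OF Suc that])
  qed
  have S_gen: "\<chi> \<iota> h \<in> ?S" "\<chi> \<sigma> h \<in> ?S" "\<chi> \<sigma>p h \<in> ?S"
    using prods[of h "\<one>\<^bsub>G\<^esub>" "\<one>\<^bsub>G\<^esub>"] prods[of "\<one>\<^bsub>G\<^esub>" h "\<one>\<^bsub>G\<^esub>"] prods[of "\<one>\<^bsub>G\<^esub>" "\<one>\<^bsub>G\<^esub>" h] h by simp_all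
  have uv: "u \<in> ?S" "v \<in> ?S"
    unfolding u_def v_def using S_gen by (auto intro!: alg.span_diff[where g = g and J = J, OF gc J])
  \<comment> \<open>There are \<open>d + 1\<close> monomials of degree \<open>d\<close> in
    \<open>u\<close> and \<open>v\<close>, one more than the span has generators.\<close>
  define d where "d = card J"
  have mon: "u [^] (d - i) \<otimes> v [^] i \<in> ?S" for i
    using S_mult S_pow uv by blast
  have "\<exists>c. (\<forall>i\<in>{..d}. c i \<in> carrier R) \<and> (\<exists>i\<in>{..d}. c i \<noteq> \<zero>\<^bsub>R\<^esub>) \<and>
      (\<Oplus>i\<in>{..d}. \<beta> (c i) \<otimes> (u [^] (d - i) \<otimes> v [^] i)) = \<zero>"
    by (rule alg.span_dependent[where g = g and J = J and x = "\<lambda>i. u [^] (d - i) \<otimes> v [^] i", OF R_domain gc J mon])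
      (auto simp: d_def)
  then obtain c where c: "\<And>i. i \<le> d \<Longrightarrow> c i \<in> carrier R" "\<exists>i\<le>d. c i \<noteq> \<zero>\<^bsub>R\<^esub>"
      "(\<Oplus>i\<in>{..d}. \<beta> (c i) \<otimes> (u [^] (d - i) \<otimes> v [^] i)) = \<zero>" by auto
  have "c i = \<zero>\<^bsub>R\<^esub>" if i: "i \<le> d" for i
    using no_relation[where \<rho> = "\<lambda>i. \<beta> (c i)", OF U r(1) s(1) r(2) s(2) \<beta>_K[OF c(1)] c(3) i] \<beta>_inj[OF c(1)[OF i]] by blast
  then show False using c by blast
qed

end


section \<open>Witt equations\<close>

text \<open>The generators of the kernel are evaluated at \<open>T1\<close> and \<open>T2\<close>,
  which gives the two component equations in \<open>L\<close>. Surjectivity of the evaluation gives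
  the last conclusion, since a polynomial value is a sum of products of the named elements.\<close>

lemma given_by_witt_equationD:
  fixes S :: "('a, 'm) ring_scheme" and L :: "('b, 'n) ring_scheme" (structure)
  assumes S: "cring S" and L: "cring L" and \<psi>: "\<psi> \<in> ring_hom S L" and p: "p > 0"
    and c: "c1 \<in> carrier S" "c2 \<in> carrier S"
    and eq: "given_by_witt_equation p S \<psi> L \<sigma> (T1, T2) (c1, c2)"
  shows "T1 \<in> carrier L" "T2 \<in> carrier L" "T1 [^] p \<ominus> T1 = \<psi> c1"
    "T2 [^] p \<ominus> T2 \<ominus> witt_carry p L (T1 [^] p) (\<ominus> T1) = \<psi> c2"
    "\<sigma> T1 = T1 \<oplus> \<one>" "\<sigma> T2 = T2 \<ominus> witt_carry p L T1 \<one>"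
    "\<And>H. subring H L \<Longrightarrow> \<psi> ` carrier S \<subseteq> H \<Longrightarrow> T1 \<in> H \<Longrightarrow> T2 \<in> H \<Longrightarrow> H = carrier L"
proof -
  interpret S: cring S by (rule S)
  interpret L: cring L by (rule L)
  define P1 where "P1 = UP S"
  define P2 where "P2 = UP P1"
  have cP1: "cring P1" unfolding P1_def by (rule UP_cring.UP_cring[OF UP_cring.intro[OF S]])
  have cP2: "cring P2" unfolding P2_def by (rule UP_cring.UP_cring[OF UP_cring.intro[OF cP1]])
  interpret P1: cring P1 by (rule cP1)
  interpret P2: cring P2 by (rule cP2)
  define h1 where "h1 = UnivPoly.eval S L \<psi> T1"
  define ev where "ev = UnivPoly.eval P1 L h1 T2"
  let ?m1 = "up_ring.monom P1" and ?m2 = "up_ring.monom P2"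
  define X1 where "X1 = ?m2 (?m1 \<one>\<^bsub>S\<^esub> 1) 0"
  define X2 where "X2 = ?m2 \<one>\<^bsub>P1\<^esub> 1"
  define d1 where "d1 = ?m2 (?m1 c1 0) 0"
  define d2 where "d2 = ?m2 (?m1 c2 0) 0"
  define w1 where "w1 = X1 [^]\<^bsub>P2\<^esub> p \<ominus>\<^bsub>P2\<^esub> X1 \<ominus>\<^bsub>P2\<^esub> d1"
  define w2 where "w2 = X2 [^]\<^bsub>P2\<^esub> p \<ominus>\<^bsub>P2\<^esub> X2 \<ominus>\<^bsub>P2\<^esub> witt_carry p P2 (X1 [^]\<^bsub>P2\<^esub> p) (\<ominus>\<^bsub>P2\<^esub> X1) \<ominus>\<^bsub>P2\<^esub> d2"
  have facts: "T1 \<in> carrier L" "T2 \<in> carrier L" "ev ` carrier P2 = carrier L"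
    "a_kernel P2 L ev = Idl\<^bsub>P2\<^esub> {w1, w2}"
    "\<sigma> T1 = T1 \<oplus> \<one>" "\<sigma> T2 = (T2 \<oplus> \<zero>) \<ominus> witt_carry p L T1 \<one>"
    using eq unfolding given_by_witt_equation_def Let_def w1_def w2_def d1_def d2_def X1_def X2_def
      ev_def h1_def P2_def P1_def witt_sub_def witt_add_def fst_conv snd_conv by blast+
  show T: "T1 \<in> carrier L" "T2 \<in> carrier L" and "\<sigma> T1 = T1 \<oplus> \<one>" using facts by auto
  have h: "ring_hom_cring S L \<psi>" by (intro ring_hom_cring.intro S L ring_hom_cring_axioms.intro \<psi>)
  interpret E1: UP_pre_univ_prop S L \<psi> P1
    by (intro UP_pre_univ_prop.intro h UP_cring.intro S) (rule eq_reflection[OF P1_def])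
  have h1: "h1 \<in> ring_hom P1 L" unfolding h1_def by (rule E1.eval_ring_hom[OF T(1)])
  have h': "ring_hom_cring P1 L h1" by (intro ring_hom_cring.intro cP1 L ring_hom_cring_axioms.intro h1)
  interpret E2: UP_pre_univ_prop P1 L h1 P2
    by (intro UP_pre_univ_prop.intro h' UP_cring.intro cP1) (rule eq_reflection[OF P2_def])
  have ev: "ev \<in> ring_hom P2 L" unfolding ev_def by (rule E2.eval_ring_hom[OF T(2)])
  interpret ev: ring_hom_cring P2 L ev by (intro ring_hom_cring.intro cP2 L ring_hom_cring_axioms.intro ev)
  have m1c: "?m1 a n \<in> carrier P1" if "a \<in> carrier S" for a n using that by (rule E1.monom_closed)
  have m2c: "?m2 a n \<in> carrier P2" if "a \<in> carrier P1" for a n using that by (rule E2.monom_closed)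
  have car: "X1 \<in> carrier P2" "X2 \<in> carrier P2" "d1 \<in> carrier P2" "d2 \<in> carrier P2"
    unfolding X1_def X2_def d1_def d2_def using c by (auto intro!: m1c m2c)
  have evX: "ev X1 = T1" "ev X2 = T2" "ev d1 = \<psi> c1" "ev d2 = \<psi> c2"
  proof -
    have h1m: "h1 (?m1 \<one>\<^bsub>S\<^esub> 1) = T1" unfolding h1_def by (rule E1.eval_monom1[OF T(1)])
    have h1c: "h1 (?m1 a 0) = \<psi> a" if "a \<in> carrier S" for a unfolding h1_def by (rule E1.eval_const[OF T(1) that])
    have evc: "ev (?m2 q 0) = h1 q" if "q \<in> carrier P1" for q unfolding ev_def by (rule E2.eval_const[OF T(2) that])
    show "ev X1 = T1" unfolding X1_def using evc[OF m1c[OF S.one_closed]] h1m by simp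
    show "ev X2 = T2" unfolding X2_def ev_def by (rule E2.eval_monom1[OF T(2)])
    show "ev d1 = \<psi> c1" "ev d2 = \<psi> c2" unfolding d1_def d2_def using evc m1c h1c c by simp_all
  qed
  have pc: "witt_carry p P2 (X1 [^]\<^bsub>P2\<^esub> p) (\<ominus>\<^bsub>P2\<^esub> X1) \<in> carrier P2"
    unfolding witt_carry_def using car by (intro P2.finsum_closed) auto
  have lc: "witt_carry p L (T1 [^] p) (\<ominus> T1) \<in> carrier L" "witt_carry p L T1 \<one> \<in> carrier L"
    unfolding witt_carry_def using T by (auto intro!: L.finsum_closed)
  have wc: "w1 \<in> carrier P2" "w2 \<in> carrier P2" using car pc by (auto simp: w1_def w2_def)
  have "{w1, w2} \<subseteq> a_kernel P2 L ev" unfolding facts(4) using wc by (intro P2.genideal_self) auto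
  then have z: "ev w1 = \<zero>" "ev w2 = \<zero>" unfolding a_kernel_def' by auto
  have \<psi>c: "\<psi> c1 \<in> carrier L" "\<psi> c2 \<in> carrier L" using c ring_hom_closed[OF \<psi>] by auto
  have diff: "ev (x \<ominus>\<^bsub>P2\<^esub> y) = ev x \<ominus> ev y" if "x \<in> carrier P2" "y \<in> carrier P2" for x y
    using that by (simp add: a_minus_def)
  have carry: "ev (witt_carry p P2 (X1 [^]\<^bsub>P2\<^esub> p) (\<ominus>\<^bsub>P2\<^esub> X1)) = witt_carry p L (T1 [^] p) (\<ominus> T1)"
    using ring_hom_carry[OF cP2 L ev, of "X1 [^]\<^bsub>P2\<^esub> p" "\<ominus>\<^bsub>P2\<^esub> X1" p] car evX by simp
  have eqI: "x = y" if "x \<ominus> y = \<zero>" "x \<in> carrier L" "y \<in> carrier L" for x y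
    using that by (metis L.r_right_minus_eq)
  have "ev w1 = T1 [^] p \<ominus> T1 \<ominus> \<psi> c1"
    unfolding w1_def using car evX by (simp add: diff)
  then show "T1 [^] p \<ominus> T1 = \<psi> c1" using z T \<psi>c by - (rule eqI, auto)
  have "ev w2 = T2 [^] p \<ominus> T2 \<ominus> witt_carry p L (T1 [^] p) (\<ominus> T1) \<ominus> \<psi> c2"
    unfolding w2_def using car evX pc by (simp add: diff carry)
  then show "T2 [^] p \<ominus> T2 \<ominus> witt_carry p L (T1 [^] p) (\<ominus> T1) = \<psi> c2" using z T \<psi>c lc by - (rule eqI, auto)
  show "\<sigma> T2 = T2 \<ominus> witt_carry p L T1 \<one>" using facts T by simp
  fix H assume H: "subring H L" "\<psi> ` carrier S \<subseteq> H" "T1 \<in> H" "T2 \<in> H"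
  have h1H: "h1 q \<in> H" if "q \<in> carrier P1" for q
  proof -
    have e: "h1 q = (\<Oplus>i\<in>{..deg S q}. \<psi> (up_ring.coeff P1 q i) \<otimes> T1 [^] i)"
      unfolding h1_def by (rule E1.eval_on_carrier[OF that])
    have c: "\<psi> (up_ring.coeff P1 q i) \<in> H" for i using H(2) E1.coeff_closed[OF that] by blast
    show ?thesis unfolding e
    proof (rule L.subring_finsum[OF H(1)])
      show "\<psi> (up_ring.coeff P1 q i) \<otimes> T1 [^] i \<in> H" for i
        by (rule subringE(6)[OF H(1) c L.subring_pow[OF H(1,3)]])
    qed
  qed
  have "ev q \<in> H" if "q \<in> carrier P2" for q
  proof -
    have e: "ev q = (\<Oplus>i\<in>{..deg P1 q}. h1 (up_ring.coeff P2 q i) \<otimes> T2 [^] i)"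
      unfolding ev_def by (rule E2.eval_on_carrier[OF that])
    show ?thesis unfolding e
    proof (rule L.subring_finsum[OF H(1)])
      show "h1 (up_ring.coeff P2 q i) \<otimes> T2 [^] i \<in> H" for i
        by (rule subringE(6)[OF H(1) h1H[OF E2.coeff_closed[OF that]] L.subring_pow[OF H(1,4)]])
    qed
  qed
  then have "carrier L \<subseteq> H" unfolding facts(3)[symmetric] by (rule image_subsetI)
  then show "H = carrier L" by (rule equalityI[OF subringE(1)[OF H(1)]])
qed


section \<open>The discrete valuation ring\<close>

text \<open>Both \<open>a\<close> and 0 are limits of the constant sequence 0, and limits are
  unique.\<close>

lemma adically_complete_separated:
  assumes "cring A" and t: "t \<in> carrier A" and c: "adically_complete A t"
    and a: "a \<in> carrier A" "\<And>n. a \<in> PIdl\<^bsub>A\<^esub> (t [^]\<^bsub>A\<^esub> (n::nat))"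
  shows "a = \<zero>\<^bsub>A\<^esub>"
proof -
  interpret A: cring A by fact
  have z: "\<zero>\<^bsub>A\<^esub> \<in> PIdl\<^bsub>A\<^esub> (t [^]\<^bsub>A\<^esub> (n::nat))" for n
    unfolding cgenideal_def using t by (intro CollectI exI[of _ "\<zero>\<^bsub>A\<^esub>"]) simp
  have e: "x \<ominus>\<^bsub>A\<^esub> \<zero>\<^bsub>A\<^esub> = x" if "x \<in> carrier A" for x using that by (simp add: a_minus_def)
  have "\<exists>!x. x \<in> carrier A \<and> (\<forall>n. x \<ominus>\<^bsub>A\<^esub> \<zero>\<^bsub>A\<^esub> \<in> PIdl\<^bsub>A\<^esub> (t [^]\<^bsub>A\<^esub> (n::nat)))"
    using c[unfolded adically_complete_def, rule_format, of "\<lambda>_. \<zero>\<^bsub>A\<^esub>"] z e[OF A.zero_closed] by simp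
  moreover have "\<forall>n. a \<ominus>\<^bsub>A\<^esub> \<zero>\<^bsub>A\<^esub> \<in> PIdl\<^bsub>A\<^esub> (t [^]\<^bsub>A\<^esub> (n::nat))" unfolding e[OF a(1)] using a(2) by blast
  moreover have "\<forall>n. \<zero>\<^bsub>A\<^esub> \<ominus>\<^bsub>A\<^esub> \<zero>\<^bsub>A\<^esub> \<in> PIdl\<^bsub>A\<^esub> (t [^]\<^bsub>A\<^esub> (n::nat))" unfolding e[OF A.zero_closed] using z by blast
  ultimately show ?thesis using a(1) A.zero_closed by blast
qed

lemma uniformiser_adic_prime:
  assumes R: "discrete_valuation_ring R" "uniformiser R \<pi>" "adically_complete R \<pi>"
  shows "adic_prime R \<pi>"
proof -
  interpret R: principal_domain R using R by (simp add: discrete_valuation_ring_def)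
  have \<pi>: "\<pi> \<in> carrier R" "maximalideal (PIdl\<^bsub>R\<^esub> \<pi>) R" using R by (auto simp: uniformiser_def)
  have "PIdl\<^bsub>R\<^esub> \<zero>\<^bsub>R\<^esub> = {\<zero>\<^bsub>R\<^esub>}"
  proof
    show "{\<zero>\<^bsub>R\<^esub>} \<subseteq> PIdl\<^bsub>R\<^esub> \<zero>\<^bsub>R\<^esub>" using R.cgenideal_self[OF R.zero_closed] by simp
  qed (auto simp: cgenideal_def)
  \<comment> \<open>Otherwise the zero ideal would be maximal and \<open>R\<close> a field.\<close>
  then have "\<pi> \<noteq> \<zero>\<^bsub>R\<^esub>"
    using \<pi> R.zeromaximalideal_eq_field R by (auto simp: discrete_valuation_ring_def)
  then show ?thesis
    using R.integral \<pi>(1)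
    by (intro adic_prime.intro R.is_cring adic_prime_axioms.intro \<pi>(1) R.maximalideal_prime[OF \<pi>(2)])
      (blast, rule adically_complete_separated[OF R.is_cring \<pi>(1) R(3)])
qed

lemma FactRing_cases:
  fixes R (structure)
  shows "x \<in> carrier (R Quot J) \<Longrightarrow> \<exists>s\<in>carrier R. x = J +> s"
  by (auto simp add: FactRing_def A_RCOSETS_def')

lemma (in cring) coset_zero_iff:
  assumes J: "ideal J R" and a: "a \<in> carrier R"
  shows "J +> a = \<zero>\<^bsub>R Quot J\<^esub> \<longleftrightarrow> a \<in> J"
proof -
  interpret J: ideal J R by (rule J)
  interpret h: ring_hom_cring R "R Quot J" "(+>) J" by (rule J.rcos_ring_hom_cring[OF is_cring])
  have "a \<ominus> \<zero> = a" using a by (simp add: a_minus_def)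
  then have "a \<in> J \<longleftrightarrow> J +> a = J +> \<zero>"
    using quotient_eq_iff_same_a_r_cos[OF J a zero_closed] by simp
  then show ?thesis unfolding h.hom_zero by blast
qed

lemma perfect_residue_root:
  assumes "cring R" and J: "ideal J R" and perf: "perfect_field (R Quot J) p" and r: "r \<in> carrier R"
  shows "\<exists>s\<in>carrier R. r \<ominus>\<^bsub>R\<^esub> s [^]\<^bsub>R\<^esub> p \<in> J"
proof -
  interpret R: cring R by fact
  interpret J: ideal J R by fact
  interpret h: ring_hom_cring R "R Quot J" "(+>\<^bsub>R\<^esub>) J" by (rule J.rcos_ring_hom_cring[OF R.is_cring])
  have "J +>\<^bsub>R\<^esub> r \<in> carrier (R Quot J)" using r by simp
  then obtain y where y: "y \<in> carrier (R Quot J)" "y [^]\<^bsub>R Quot J\<^esub> p = J +>\<^bsub>R\<^esub> r"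
    using perf unfolding perfect_field_def is_power_def by blast
  then obtain s where s: "s \<in> carrier R" "y = J +>\<^bsub>R\<^esub> s" using FactRing_cases by metis
  have "J +>\<^bsub>R\<^esub> r = J +>\<^bsub>R\<^esub> (s [^]\<^bsub>R\<^esub> p)" using y s by simp
  then show ?thesis using R.quotient_eq_iff_same_a_r_cos[OF J r] s by (intro bexI[of _ s]) auto
qed

lemma residue_inverse:
  assumes "cring R" and J: "ideal J R" and fld: "field (R Quot J)" and r: "r \<in> carrier R" "r \<notin> J"
  shows "\<exists>s\<in>carrier R. r \<otimes>\<^bsub>R\<^esub> s \<ominus>\<^bsub>R\<^esub> \<one>\<^bsub>R\<^esub> \<in> J"
proof -
  interpret R: cring R by fact
  interpret J: ideal J R by fact
  interpret h: ring_hom_cring R "R Quot J" "(+>\<^bsub>R\<^esub>) J" by (rule J.rcos_ring_hom_cring[OF R.is_cring])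
  interpret Q: field "R Quot J" by (rule fld)
  have "J +>\<^bsub>R\<^esub> r \<noteq> \<zero>\<^bsub>R Quot J\<^esub>" using R.coset_zero_iff J r by blast
  then have "J +>\<^bsub>R\<^esub> r \<in> Units (R Quot J)" using r Q.field_Units by simp
  then obtain y where y: "y \<in> carrier (R Quot J)" "(J +>\<^bsub>R\<^esub> r) \<otimes>\<^bsub>R Quot J\<^esub> y = \<one>\<^bsub>R Quot J\<^esub>"
    unfolding Units_def by blast
  then obtain s where s: "s \<in> carrier R" "y = J +>\<^bsub>R\<^esub> s" using FactRing_cases by metis
  have "J +>\<^bsub>R\<^esub> (r \<otimes>\<^bsub>R\<^esub> s) = J +>\<^bsub>R\<^esub> \<one>\<^bsub>R\<^esub>" using y s r by simp
  then show ?thesis using R.quotient_eq_iff_same_a_r_cos[OF J, of "r \<otimes>\<^bsub>R\<^esub> s" "\<one>\<^bsub>R\<^esub>"] s r by (intro bexI[of _ s]) auto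
qed

text \<open>This is \<open>p_independent\<close> for the domain \<open>A\<close> modulo
  \<open>(t)\<close>, with elements of the quotient replaced by representatives.\<close>

lemma (in adic_prime) quotient_p_independent:
  fixes p :: nat
  assumes p: "Factorial_Ring.prime p" "add_pow A p \<one> = \<zero>"
    and g: "g \<in> carrier A"
    and nonpower: "\<And>y s. y \<in> carrier A \<Longrightarrow> s \<in> carrier A \<Longrightarrow> y [^] p \<ominus> g \<otimes> s [^] p \<in> PIdl t \<Longrightarrow> s \<in> PIdl t"
    and b: "\<And>j. j < p \<Longrightarrow> b j \<in> carrier A"
    and rel: "(\<Oplus>j\<in>{..<p}. b j [^] p \<otimes> g [^] j) \<in> PIdl t" and j: "j < p"
  shows "b j \<in> PIdl t"
proof -
  let ?J = "PIdl t"
  have "domain (A Quot ?J)" by (rule P.quotient_is_domain)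
  then interpret Q: "domain" "A Quot ?J" .
  interpret h: ring_hom_cring A "A Quot ?J" "(+>) ?J" by (rule P.rcos_ring_hom_cring)
  have zero: "?J +> a = \<zero>\<^bsub>A Quot ?J\<^esub> \<longleftrightarrow> a \<in> ?J" if "a \<in> carrier A" for a
    by (rule coset_zero_iff[OF P.is_ideal that])
  have addp: "?J +> add_pow A n a = add_pow (A Quot ?J) (n::nat) (?J +> a)" if "a \<in> carrier A" for n a
    using that by (induction n) simp_all
  have "add_pow (A Quot ?J) p \<one>\<^bsub>A Quot ?J\<^esub> = \<zero>\<^bsub>A Quot ?J\<^esub>"
    using addp[OF one_closed, of p] p by simp
  then interpret Q: char_p_domain "A Quot ?J" p
    by unfold_locales (use p in auto)
  have "?J +> b j = \<zero>\<^bsub>A Quot ?J\<^esub>"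
  proof (rule Q.p_independent[where x = "?J +> g" and b = "\<lambda>j. ?J +> b j"])
    show "?J +> g \<in> carrier (A Quot ?J)" using g by simp
    fix y s assume "y \<in> carrier (A Quot ?J)" "s \<in> carrier (A Quot ?J)"
      and e: "y [^]\<^bsub>A Quot ?J\<^esub> p = (?J +> g) \<otimes>\<^bsub>A Quot ?J\<^esub> s [^]\<^bsub>A Quot ?J\<^esub> p"
    then obtain y' s' where y: "y' \<in> carrier A" "y = ?J +> y'" and s: "s' \<in> carrier A" "s = ?J +> s'"
      using FactRing_cases by metis
    have "?J +> (y' [^] p) = ?J +> (g \<otimes> s' [^] p)" using e y s g by simp
    then have "y' [^] p \<ominus> g \<otimes> s' [^] p \<in> ?J"
      using quotient_eq_iff_same_a_r_cos[OF P.is_ideal, of "y' [^] p" "g \<otimes> s' [^] p"] y s g by simp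
    then have "s' \<in> ?J" by (rule nonpower[OF y(1) s(1)])
    then show "s = \<zero>\<^bsub>A Quot ?J\<^esub>" using zero[OF s(1)] s by simp
  next
    show "?J +> b j \<in> carrier (A Quot ?J)" if "j < p" for j using b that by simp
    have c: "(\<lambda>j. b j [^] p \<otimes> g [^] j) \<in> {..<p} \<rightarrow> carrier A" using b g by auto
    have "?J +> (\<Oplus>j\<in>{..<p}. b j [^] p \<otimes> g [^] j)
        = (\<Oplus>\<^bsub>A Quot ?J\<^esub>j\<in>{..<p}. (?J +> b j) [^]\<^bsub>A Quot ?J\<^esub> p \<otimes>\<^bsub>A Quot ?J\<^esub> (?J +> g) [^]\<^bsub>A Quot ?J\<^esub> j)"
      unfolding h.hom_finsum[OF c] by (rule Q.finsum_cong') (use b g in auto)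
    moreover have "?J +> (\<Oplus>j\<in>{..<p}. b j [^] p \<otimes> g [^] j) = \<zero>\<^bsub>A Quot ?J\<^esub>"
      using zero[OF finsum_closed[OF c]] rel by blast
    ultimately show "(\<Oplus>\<^bsub>A Quot ?J\<^esub>j\<in>{..<p}. (?J +> b j) [^]\<^bsub>A Quot ?J\<^esub> p \<otimes>\<^bsub>A Quot ?J\<^esub> (?J +> g) [^]\<^bsub>A Quot ?J\<^esub> j) = \<zero>\<^bsub>A Quot ?J\<^esub>"
      by simp
  qed (rule j)
  then show ?thesis using zero[OF b[OF j]] by simp
qed


section \<open>The local ring of the model at the generic point of its special fibre\<close>

text \<open>Ramification index 1 says that the maximal ideal of the local ring at \<open>Q\<close>
  is generated by the image of \<open>t\<close>. Clearing denominators gives a statement inside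
  \<open>B\<close>.\<close>

lemma unramified_prime:
  assumes B: "cring B" and Q: "primeideal Q B" and \<alpha>: "\<alpha> \<in> ring_hom A B" and A: "cring A"
    and t: "t \<in> carrier A" and ram: "has_ramification_index \<alpha> (PIdl\<^bsub>A\<^esub> t) B Q 1" and q: "q \<in> Q"
  shows "\<exists>s\<in>carrier B - Q. \<exists>b\<in>carrier B. s \<otimes>\<^bsub>B\<^esub> q = b \<otimes>\<^bsub>B\<^esub> \<alpha> t"
proof -
  interpret B: cring B by (rule B)
  interpret A: cring A by (rule A)
  interpret Q: primeideal Q B by (rule Q)
  interpret \<alpha>: ring_hom_cring A B \<alpha> by unfold_locales (rule \<alpha>)
  let ?S = "carrier B - Q"
  interpret loc: ring_localization B ?S
  proof
    show "\<one>\<^bsub>B\<^esub> \<in> ?S" using Q.one_imp_carrier Q.I_notcarr by auto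
  qed (use Q.I_prime in auto)
  interpret lc: cring "localization B ?S" by (rule loc.loc_cring)
  let ?L = "localization B ?S"
  let ?f = "\<lambda>a. fraction B ?S a \<one>\<^bsub>B\<^esub>"
  have Qc: "Q \<subseteq> carrier B" using Q.Icarr by blast
  have im: "?f ` Q \<subseteq> carrier ?L" using Qc loc.S_one by auto
  have "Idl\<^bsub>?L\<^esub> ((\<lambda>a. fraction B ?S (\<alpha> a) \<one>\<^bsub>B\<^esub>) ` (PIdl\<^bsub>A\<^esub> t)) = Idl\<^bsub>?L\<^esub> (?f ` Q)"
    using ram lc.ideals_set_pow_one[OF lc.genideal_ideal[OF im]]
    unfolding has_ramification_index_def Let_def by simp
  moreover have "(\<lambda>a. fraction B ?S (\<alpha> a) \<one>\<^bsub>B\<^esub>) ` (PIdl\<^bsub>A\<^esub> t) = ?f ` (\<alpha> ` (PIdl\<^bsub>A\<^esub> t))"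
    by (simp add: image_image)
  moreover have "?f q \<in> Idl\<^bsub>?L\<^esub> (?f ` Q)" using lc.genideal_self[OF im] q by blast
  ultimately have mem: "?f q \<in> Idl\<^bsub>?L\<^esub> (?f ` (\<alpha> ` (PIdl\<^bsub>A\<^esub> t)))" by simp
  have tB: "\<alpha> t \<in> carrier B" using t by simp
  have sub: "\<alpha> ` (PIdl\<^bsub>A\<^esub> t) \<subseteq> PIdl\<^bsub>B\<^esub> (\<alpha> t)"
  proof
    fix x assume "x \<in> \<alpha> ` (PIdl\<^bsub>A\<^esub> t)"
    then obtain r where r: "r \<in> carrier A" "x = \<alpha> (r \<otimes>\<^bsub>A\<^esub> t)" unfolding cgenideal_def by blast
    then have "x = \<alpha> r \<otimes>\<^bsub>B\<^esub> \<alpha> t" "\<alpha> r \<in> carrier B" using t by simp_all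
    then show "x \<in> PIdl\<^bsub>B\<^esub> (\<alpha> t)" unfolding cgenideal_def by blast
  qed
  obtain s where "s \<in> ?S" "s \<otimes>\<^bsub>B\<^esub> q \<in> PIdl\<^bsub>B\<^esub> (\<alpha> t)"
    using loc.ideal_extension_mem[OF B.cgenideal_ideal[OF tB] sub _ mem] q Qc by blast
  then show ?thesis unfolding cgenideal_def by blast
qed

locale model_prime = A: adic_prime A t0 + char_p_ring L p
  for A :: "('a, 'n) ring_scheme" and t0 and L :: "('b, 'k) ring_scheme" (structure) and p +
  fixes \<alpha> :: "'a \<Rightarrow> 'b" and Bs Q :: "'b set"
  assumes Bs: "subring Bs L" and \<alpha>: "\<alpha> \<in> ring_hom A L" and \<alpha>_Bs: "\<And>a. a \<in> carrier A \<Longrightarrow> \<alpha> a \<in> Bs"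
    and unit: "\<alpha> t0 \<in> Units L" and generic: "\<And>x. x \<in> carrier L \<Longrightarrow> \<exists>n::nat. \<alpha> t0 [^] n \<otimes> x \<in> Bs"
    and Q: "primeideal Q (L\<lparr>carrier := Bs\<rparr>)"
    and contract: "\<And>a. a \<in> carrier A \<Longrightarrow> \<alpha> a \<in> Q \<longleftrightarrow> a \<in> PIdl\<^bsub>A\<^esub> t0"
    and unram: "\<And>q. q \<in> Q \<Longrightarrow> \<exists>s\<in>Bs - Q. \<exists>b\<in>Bs. s \<otimes> q = b \<otimes> \<alpha> t0"
begin

abbreviation "t \<equiv> \<alpha> t0"

sublocale \<alpha>: ring_hom_cring A L \<alpha> by unfold_locales (rule \<alpha>)

lemma Bs_carrier [simp]: "b \<in> Bs \<Longrightarrow> b \<in> carrier L" using subring_mem[OF Bs] .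

lemma Bs_closed [simp]: "\<one> \<in> Bs" "x \<in> Bs \<Longrightarrow> y \<in> Bs \<Longrightarrow> x \<otimes> y \<in> Bs" "x \<in> Bs \<Longrightarrow> y \<in> Bs \<Longrightarrow> x \<oplus> y \<in> Bs"
    "x \<in> Bs \<Longrightarrow> \<ominus> x \<in> Bs"
  using subringE[OF Bs] by auto

lemma Q_Bs [simp]: "q \<in> Q \<Longrightarrow> q \<in> Bs"
  using ideal.Icarr[OF primeideal.axioms(1)[OF Q]] by simp

lemma Q_mult: "q \<in> Q \<Longrightarrow> x \<in> Bs \<Longrightarrow> x \<otimes> q \<in> Q"
  using ideal.I_l_closed[OF primeideal.axioms(1)[OF Q], of q x] by simp

lemma Q_prime: "x \<in> Bs \<Longrightarrow> y \<in> Bs \<Longrightarrow> x \<otimes> y \<in> Q \<Longrightarrow> x \<in> Q \<or> y \<in> Q"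
  using primeideal.I_prime[OF Q, of x y] by simp

lemma one_Q: "\<one> \<notin> Q"
proof
  assume "\<one> \<in> Q"
  then have "Q = Bs" using ideal.one_imp_carrier[OF primeideal.axioms(1)[OF Q]] by simp
  then show False using primeideal.I_notcarr[OF Q] by simp
qed

text \<open>The elements of \<open>L\<close> that belong to the local ring at \<open>Q\<close>. No
  new denominators are adjoined, which is why \<open>V\<close> is contained in
  \<open>A[Z1][Z2]\<close> with \<open>A\<close> itself in place of its localization.\<close>

definition V :: "'b set" where "V = {z \<in> carrier L. \<exists>s\<in>Bs - Q. s \<otimes> z \<in> Bs}"

lemma VI: "z \<in> carrier L \<Longrightarrow> s \<in> Bs \<Longrightarrow> s \<notin> Q \<Longrightarrow> s \<otimes> z \<in> Bs \<Longrightarrow> z \<in> V" by (auto simp: V_def)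

lemma VE:
  assumes "z \<in> V" obtains s where "z \<in> carrier L" "s \<in> Bs" "s \<notin> Q" "s \<otimes> z \<in> Bs"
  using assms by (auto simp: V_def)

lemma notQ_mult: "s \<in> Bs \<Longrightarrow> s \<notin> Q \<Longrightarrow> u \<in> Bs \<Longrightarrow> u \<notin> Q \<Longrightarrow> s \<otimes> u \<notin> Q"
  using Q_prime by blast

lemma Bs_V: "Bs \<subseteq> V" using one_Q by (auto intro!: VI[of _ \<one>])

lemma V_subring: "subring V L"
proof (rule subringI)
  show "V \<subseteq> carrier L" by (auto simp: V_def)
  show "\<one> \<in> V" using Bs_V by auto
  fix x assume "x \<in> V"
  then obtain s where s: "x \<in> carrier L" "s \<in> Bs" "s \<notin> Q" "s \<otimes> x \<in> Bs" by (rule VE)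
  have "s \<otimes> \<ominus> x = \<ominus> (s \<otimes> x)" using s by (simp add: r_minus)
  then have "s \<otimes> \<ominus> x \<in> Bs" using s by simp
  then show "\<ominus> x \<in> V" using s by (intro VI[of _ s]) auto
  fix y assume "y \<in> V"
  then obtain u where u: "y \<in> carrier L" "u \<in> Bs" "u \<notin> Q" "u \<otimes> y \<in> Bs" by (rule VE)
  have su: "s \<otimes> u \<in> Bs" "s \<otimes> u \<notin> Q" using s u notQ_mult by auto
  have sc: "s \<in> carrier L" "u \<in> carrier L" using s u by auto
  have "(s \<otimes> u) \<otimes> (x \<otimes> y) = (s \<otimes> x) \<otimes> (u \<otimes> y)" using s(1) u(1) sc by (simp add: m_ac)
  then have "(s \<otimes> u) \<otimes> (x \<otimes> y) \<in> Bs" using s(4) u(4) Bs_closed(2) by metis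
  then show "x \<otimes> y \<in> V" using su s(1) u(1) by (intro VI[of _ "s \<otimes> u"]) auto
  have "(s \<otimes> u) \<otimes> (x \<oplus> y) = u \<otimes> (s \<otimes> x) \<oplus> s \<otimes> (u \<otimes> y)" using s(1) u(1) sc by (simp add: r_distr m_ac)
  then have "(s \<otimes> u) \<otimes> (x \<oplus> y) \<in> Bs" using s u Bs_closed(2,3) by metis
  then show "x \<oplus> y \<in> V" using su s(1) u(1) by (intro VI[of _ "s \<otimes> u"]) auto
qed

text \<open>Membership in \<open>t V\<close> is tested by the prime \<open>Q\<close>, up to a
  multiplier outside \<open>Q\<close>. One direction holds because \<open>t\<close> is in
  \<open>Q\<close>; the other is the unramified hypothesis. Primality of \<open>t\<close> in
  \<open>V\<close> is then inherited from \<open>Q\<close>.\<close>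

lemma tV_iff:
  assumes z: "z \<in> carrier L"
  shows "(\<exists>v\<in>V. z = t \<otimes> v) \<longleftrightarrow> (\<exists>s\<in>Bs - Q. s \<otimes> z \<in> Q)"
proof
  assume "\<exists>v\<in>V. z = t \<otimes> v"
  then obtain v s where v: "z = t \<otimes> v" "v \<in> carrier L" "s \<in> Bs" "s \<notin> Q" "s \<otimes> v \<in> Bs" by (auto elim!: VE)
  have "t \<in> Q" using contract[OF A.t] A.cgenideal_self[OF A.t] by blast
  then have "(s \<otimes> v) \<otimes> t \<in> Q" using v by (intro Q_mult)
  moreover have "s \<otimes> z = (s \<otimes> v) \<otimes> t" using v(2,3) unfolding v(1) by (simp add: m_ac)
  ultimately have "s \<otimes> z \<in> Q" by simp
  then show "\<exists>s\<in>Bs - Q. s \<otimes> z \<in> Q" using v(3,4) by blast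
next
  assume "\<exists>s\<in>Bs - Q. s \<otimes> z \<in> Q"
  then obtain s where s: "s \<in> Bs" "s \<notin> Q" "s \<otimes> z \<in> Q" by blast
  obtain u b where u: "u \<in> Bs" "u \<notin> Q" "b \<in> Bs" "u \<otimes> (s \<otimes> z) = b \<otimes> t" using unram[OF s(3)] by blast
  define v where "v = inv t \<otimes> z"
  have it: "inv t \<in> carrier L" "inv t \<otimes> t = \<one>" "t \<otimes> inv t = \<one>" using unit by auto
  have v: "v \<in> carrier L" "z = t \<otimes> v" using z it by (auto simp: v_def m_assoc[symmetric])
  have c: "u \<in> carrier L" "s \<in> carrier L" "b \<in> carrier L" "t \<in> carrier L" using u s by auto
  have "(u \<otimes> s) \<otimes> v = inv t \<otimes> (u \<otimes> (s \<otimes> z))" using c z it(1) by (simp add: v_def m_ac)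
  also have "\<dots> = b \<otimes> (inv t \<otimes> t)" unfolding u(4) using c it(1) by (simp add: m_ac)
  also have "\<dots> = b" using c it by simp
  finally have "(u \<otimes> s) \<otimes> v \<in> Bs" using u by simp
  then have "v \<in> V" using v u s notQ_mult by (intro VI[of _ "u \<otimes> s"]) auto
  then show "\<exists>v\<in>V. z = t \<otimes> v" using v by blast
qed

lemma tV_\<alpha>:
  assumes a: "a \<in> carrier A"
  shows "(\<exists>v\<in>V. \<alpha> a = t \<otimes> v) \<longleftrightarrow> a \<in> PIdl\<^bsub>A\<^esub> t0"
proof -
  have "\<alpha> a \<in> Q" if "s \<in> Bs" "s \<notin> Q" "s \<otimes> \<alpha> a \<in> Q" for s
    using Q_prime[OF that(1) \<alpha>_Bs[OF a] that(3)] that(2) by blast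
  moreover have "\<one> \<otimes> \<alpha> a = \<alpha> a" using a by simp
  ultimately show ?thesis
    unfolding tV_iff[OF \<alpha>.hom_closed[OF a]] contract[OF a, symmetric] using one_Q Bs_closed(1) by (metis DiffE DiffI)
qed

sublocale valued L p V "\<alpha> ` carrier A" t
proof (intro valued.intro valued_axioms.intro char_p_ring_axioms)
  show "subring V L" by (rule V_subring)
  show "subring (\<alpha> ` carrier A) L"
    by (rule ring_hom_ring.img_is_subring[OF ring_hom_ringI2[OF A.ring_axioms ring_axioms \<alpha>] A.carrier_is_subring])
  show "\<alpha> ` carrier A \<subseteq> V" using \<alpha>_Bs Bs_V by blast
  show "t \<in> \<alpha> ` carrier A" by simp
  show "t \<in> Units L" by (rule unit)
next
  fix x y z assume V: "x \<in> V" "y \<in> V" "z \<in> V" and e: "x \<otimes> y = t \<otimes> z"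
  obtain s where s: "x \<in> carrier L" "s \<in> Bs" "s \<notin> Q" "s \<otimes> x \<in> Bs" using V(1) by (rule VE)
  obtain u where u: "y \<in> carrier L" "u \<in> Bs" "u \<notin> Q" "u \<otimes> y \<in> Bs" using V(2) by (rule VE)
  have "x \<otimes> y \<in> carrier L" using s u by simp
  then obtain r where r: "r \<in> Bs" "r \<notin> Q" "r \<otimes> (x \<otimes> y) \<in> Q" using e V(3) tV_iff[of "x \<otimes> y"] by blast
  have c: "s \<in> carrier L" "u \<in> carrier L" "r \<in> carrier L" using s u r by auto
  have "r \<otimes> ((s \<otimes> x) \<otimes> (u \<otimes> y)) = (s \<otimes> u) \<otimes> (r \<otimes> (x \<otimes> y))" using c s(1) u(1) by (simp add: m_ac)
  moreover have "(s \<otimes> u) \<otimes> (r \<otimes> (x \<otimes> y)) \<in> Q" by (rule Q_mult[OF r(3)]) (use s u in auto)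
  ultimately have "r \<otimes> ((s \<otimes> x) \<otimes> (u \<otimes> y)) \<in> Q" by simp
  then have "s \<otimes> x \<in> Q \<or> u \<otimes> y \<in> Q"
    using Q_prime[of r "(s \<otimes> x) \<otimes> (u \<otimes> y)"] Q_prime[OF s(4) u(4)] r Bs_closed(2)[OF s(4) u(4)] by blast
  then show "(\<exists>w\<in>V. x = t \<otimes> w) \<or> (\<exists>w\<in>V. y = t \<otimes> w)"
    unfolding tV_iff[OF s(1)] tV_iff[OF u(1)] using s u by blast
next
  fix x assume x: "x \<in> V"
  show "t \<otimes> x \<noteq> \<one>"
  proof
    assume "t \<otimes> x = \<one>"
    then have "\<alpha> \<one>\<^bsub>A\<^esub> = t \<otimes> x" by simp
    then have "\<one>\<^bsub>A\<^esub> \<in> PIdl\<^bsub>A\<^esub> t0" using tV_\<alpha>[OF A.one_closed] x by blast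
    then show False using A.one_notin_P by blast
  qed
  assume "t \<otimes> x \<in> \<alpha> ` carrier A"
  then obtain a where a: "a \<in> carrier A" "\<alpha> a = t \<otimes> x" by auto
  then have "a \<in> PIdl\<^bsub>A\<^esub> t0" using tV_\<alpha> x by blast
  then obtain r where r: "r \<in> carrier A" "a = r \<otimes>\<^bsub>A\<^esub> t0" unfolding A.mem_PIdl by blast
  have xc: "x \<in> carrier L" using x by (auto simp: V_def)
  have "t \<otimes> x = t \<otimes> \<alpha> r" unfolding a(2)[symmetric] r(2) using r(1) by (simp add: m_comm)
  then have "x = \<alpha> r" using Units_l_cancel[OF unit xc] r by simp
  then show "x \<in> \<alpha> ` carrier A" using r by blast
next
  show "\<exists>n::nat. t [^] n \<otimes> x \<in> V" if "x \<in> carrier L" for x using generic[OF that] Bs_V by blast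
qed

lemma I_\<alpha>: "a \<in> carrier A \<Longrightarrow> \<alpha> a \<in> I \<longleftrightarrow> a \<in> PIdl\<^bsub>A\<^esub> t0"
  using tV_\<alpha> unfolding I_def by blast

lemma V_frac: "z \<in> V \<Longrightarrow> \<exists>s\<in>Bs. s \<notin> I \<and> s \<otimes> z \<in> Bs"
proof -
  assume "z \<in> V"
  then obtain s where s: "s \<in> Bs" "s \<notin> Q" "s \<otimes> z \<in> Bs" by (rule VE)
  have "s \<notin> I"
  proof
    assume "s \<in> I"
    then have "\<exists>v\<in>V. s = t \<otimes> v" unfolding I_def by blast
    then obtain u where u: "u \<in> Bs" "u \<notin> Q" "u \<otimes> s \<in> Q" unfolding tV_iff[OF Bs_carrier[OF s(1)]] by blast
    then show False using notQ_mult s by blast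
  qed
  then show ?thesis using s by blast
qed

end


lemma (in adic_prime) clear_denominator:
  assumes b: "b \<in> carrier A" and e: "int k + z = int w" and x: "x = to_frac A t [^]\<^bsub>F\<^esub> z \<otimes>\<^bsub>F\<^esub> to_frac A b"
  shows "to_frac A (t [^] k) \<otimes>\<^bsub>F\<^esub> x = to_frac A (t [^] w \<otimes> b)" "x \<in> carrier GF"
proof -
  have c: "to_frac A t [^]\<^bsub>F\<^esub> z \<in> carrier F" by (rule F.unit_int_pow_closed[OF unit_tF])
  have xF: "x \<in> carrier F" unfolding x using c b by simp
  have tc: "to_frac A t [^]\<^bsub>F\<^esub> k \<in> carrier F" by simp
  have bc: "to_frac A b \<in> carrier F" using b by simp
  have "to_frac A (t [^] k) \<otimes>\<^bsub>F\<^esub> x = to_frac A t [^]\<^bsub>F\<^esub> k \<otimes>\<^bsub>F\<^esub> to_frac A t [^]\<^bsub>F\<^esub> z \<otimes>\<^bsub>F\<^esub> to_frac A b"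
    unfolding x tF_pow[symmetric] by (rule F.m_assoc[OF tc c bc, symmetric])
  also have "\<dots> = to_frac A (t [^] w \<otimes> b)"
    unfolding F.unit_int_pow[OF unit_tF e] using b by simp
  finally show *: "to_frac A (t [^] k) \<otimes>\<^bsub>F\<^esub> x = to_frac A (t [^] w \<otimes> b)" .
  have "x = quot A (t [^] w \<otimes> b) (t [^] k)" by (rule quot_eqI[OF xF _ *]) (use b in simp)
  then show "x \<in> carrier GF" using b quot_GF by simp
qed

context model_prime
begin

lemma \<alpha>_diff: "x \<in> carrier A \<Longrightarrow> y \<in> carrier A \<Longrightarrow> \<alpha> (x \<ominus>\<^bsub>A\<^esub> y) = \<alpha> x \<ominus> \<alpha> y"
  by (simp add: a_minus_def)

lemma eqv_\<alpha>: "x \<in> carrier A \<Longrightarrow> y \<in> carrier A \<Longrightarrow> eqv (\<alpha> x) (\<alpha> y) \<longleftrightarrow> x \<ominus>\<^bsub>A\<^esub> y \<in> PIdl\<^bsub>A\<^esub> t0"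
  using I_\<alpha>[of "x \<ominus>\<^bsub>A\<^esub> y"] \<alpha>_Bs Bs_V by (auto simp: eqv_def \<alpha>_diff)

lemma eqv_\<alpha>_pow:
  assumes "y \<in> carrier A" "g \<in> carrier A" "s \<in> carrier A"
  shows "eqv (\<alpha> y [^] (q::nat)) (\<alpha> g \<otimes> \<alpha> s [^] q) \<longleftrightarrow> y [^]\<^bsub>A\<^esub> q \<ominus>\<^bsub>A\<^esub> g \<otimes>\<^bsub>A\<^esub> s [^]\<^bsub>A\<^esub> q \<in> PIdl\<^bsub>A\<^esub> t0"
  using eqv_\<alpha>[of "y [^]\<^bsub>A\<^esub> q" "g \<otimes>\<^bsub>A\<^esub> s [^]\<^bsub>A\<^esub> q"] assms by simp

text \<open>Elements of the image are lifted along \<open>\<alpha>\<close>, and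
  \<open>I_\<alpha>\<close> translates congruences modulo \<open>I\<close> into congruences modulo
  \<open>t0\<close>, so the statement reduces to the one for \<open>A\<close>.\<close>

lemma image_p_independent:
  assumes ch: "add_pow A p \<one>\<^bsub>A\<^esub> = \<zero>\<^bsub>A\<^esub>"
    and g: "g \<in> \<alpha> ` carrier A"
    and np: "\<And>y s. y \<in> \<alpha> ` carrier A \<Longrightarrow> s \<in> \<alpha> ` carrier A \<Longrightarrow> eqv (y [^] p) (g \<otimes> s [^] p) \<Longrightarrow> s \<in> I"
    and b: "\<And>j. j < p \<Longrightarrow> b j \<in> \<alpha> ` carrier A"
    and rel: "(\<Oplus>j\<in>{..<p}. b j [^] p \<otimes> g [^] j) \<in> I" and j: "j < p"
  shows "b j \<in> I"
proof -
  obtain g' where g': "g' \<in> carrier A" "g = \<alpha> g'" using g by blast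
  have "\<exists>b'. \<forall>j<p. b' j \<in> carrier A \<and> b j = \<alpha> (b' j)"
    using b by (intro choice) (metis imageE)
  then obtain b' where b': "\<And>j. j < p \<Longrightarrow> b' j \<in> carrier A" "\<And>j. j < p \<Longrightarrow> b j = \<alpha> (b' j)" by blast
  let ?f = "\<lambda>j. b' j [^]\<^bsub>A\<^esub> p \<otimes>\<^bsub>A\<^esub> g' [^]\<^bsub>A\<^esub> j"
  have f: "?f \<in> {..<p} \<rightarrow> carrier A" using b' g' by auto
  have "(\<Oplus>j\<in>{..<p}. b j [^] p \<otimes> g [^] j) = \<alpha> (\<Oplus>\<^bsub>A\<^esub>j\<in>{..<p}. ?f j)"
    unfolding \<alpha>.hom_finsum[OF f] by (rule finsum_cong') (use b' g' in auto)
  then have rel': "(\<Oplus>\<^bsub>A\<^esub>j\<in>{..<p}. ?f j) \<in> PIdl\<^bsub>A\<^esub> t0"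
    using rel I_\<alpha>[OF A.finsum_closed[OF f]] by simp
  have "b' j \<in> PIdl\<^bsub>A\<^esub> t0"
  proof (rule A.quotient_p_independent[where g = g' and b = b', OF prime_p ch g'(1) _ b'(1) rel' j])
    fix y s assume c: "y \<in> carrier A" "s \<in> carrier A"
      and "y [^]\<^bsub>A\<^esub> p \<ominus>\<^bsub>A\<^esub> g' \<otimes>\<^bsub>A\<^esub> s [^]\<^bsub>A\<^esub> p \<in> PIdl\<^bsub>A\<^esub> t0"
    then have "eqv (\<alpha> y [^] p) (g \<otimes> \<alpha> s [^] p)" using eqv_\<alpha>_pow[OF c(1) g'(1) c(2)] g'(2) by simp
    then have "\<alpha> s \<in> I" using np[of "\<alpha> y" "\<alpha> s"] c by blast
    then show "s \<in> PIdl\<^bsub>A\<^esub> t0" using I_\<alpha> c by blast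
  qed
  then show ?thesis using I_\<alpha> b' j by simp
qed

end

section \<open>From the geometric hypotheses to the contradiction\<close>

theorem proposition2p4p5:
  fixes p :: nat and R :: "'r ring" and \<pi> :: 'r
    and A :: "'a ring" and \<phi> :: "'r \<Rightarrow> 'a"
    and L :: "'b ring" and \<psi> :: "('a \<times> 'a) set \<Rightarrow> 'b" and \<sigma> :: "'b \<Rightarrow> 'b"
    and G1 :: "('r, 'g) hopf" and B1 :: "'b set" and \<rho>1 :: "'b \<Rightarrow> (('b \<times> 'g) \<Rightarrow>\<^sub>0 int) set"
    and G2 :: "('r, 'h) hopf" and B :: "'b set" and \<rho>2 :: "'b \<Rightarrow> (('b \<times> 'h) \<Rightarrow>\<^sub>0 int) set"
    and T1 T2 :: 'b and a1 a2 :: "('a \<times> 'a) set" and m1 m2 :: int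
  assumes p: "Factorial_Ring.prime p" "p > 2"
    and R: "discrete_valuation_ring R" "uniformiser R \<pi>" "adically_complete R \<pi>"
      "prime_characteristic R p" "perfect_field (R Quot (PIdl\<^bsub>R\<^esub> \<pi>)) p"
    and X: "affine_formal_scheme R \<pi> \<phi> A" "normal_ring A"
      "connected_spec (special_fibre A (\<phi> \<pi>))" "flat_over R \<phi> A"
      "domain (special_fibre A (\<phi> \<pi>))"
    and f_K: "cyclic_torsor (p\<^sup>2) (generic_fibre A (\<phi> \<pi>)) \<psi> L \<sigma>"
      "\<not> has_section (generic_fibre A (\<phi> \<pi>)) \<psi> L"
    and model: "integral_model p R \<pi> \<phi> A \<psi> L \<sigma> G1 B1 \<rho>1 G2 B \<rho>2"
    and ramification: "\<forall>Q\<in>spec (L\<lparr>carrier := B\<rparr>).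
      contraction A (\<psi> \<circ> to_frac A) Q = PIdl\<^bsub>A\<^esub> (\<phi> \<pi>) \<longrightarrow>
      has_ramification_index (\<psi> \<circ> to_frac A) (PIdl\<^bsub>A\<^esub> (\<phi> \<pi>)) (L\<lparr>carrier := B\<rparr>) Q 1"
    and irreducible: "irreducible_spec (special_fibre (L\<lparr>carrier := B\<rparr>) (\<psi> (to_frac A (\<phi> \<pi>))))"
    and equation: "given_by_witt_equation p (generic_fibre A (\<phi> \<pi>)) \<psi> L \<sigma> (T1, T2)
      (to_frac A (\<phi> \<pi>) [^]\<^bsub>frac_field A\<^esub> (- int p * m1) \<otimes>\<^bsub>frac_field A\<^esub> a1,
       to_frac A (\<phi> \<pi>) [^]\<^bsub>frac_field A\<^esub> m2 \<otimes>\<^bsub>frac_field A\<^esub> a2)"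
    and a: "a1 \<in> carrier (generic_fibre A (\<phi> \<pi>))" "a2 \<in> carrier (generic_fibre A (\<phi> \<pi>))"
      "val_eta A (\<phi> \<pi>) a1 = 0" "val_eta A (\<phi> \<pi>) a2 = 0"
      "\<not> is_power (residue_field_eta A (\<phi> \<pi>)) p (residue_class_eta A (\<phi> \<pi>) a1)"
    and m: "m1 > 0" "m1 * (int p * (int p - 1) + 1) \<ge> - m2"
  shows "\<nexists>(G :: ('r, 'k) hopf) \<rho>.
    finite_flat_group_scheme R G (p\<^sup>2) \<and> torsor R G \<phi> A (\<psi> \<circ> to_frac A) (L\<lparr>carrier := B\<rparr>) \<rho>"
proof
  assume "\<exists>(G :: ('r, 'k) hopf) \<rho>.
    finite_flat_group_scheme R G (p\<^sup>2) \<and> torsor R G \<phi> A (\<psi> \<circ> to_frac A) (L\<lparr>carrier := B\<rparr>) \<rho>"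
  then obtain G :: "('r, 'k) hopf" and \<rho> where G: "finite_flat_group_scheme R G (p\<^sup>2)"
    and T: "torsor R G \<phi> A (\<psi> \<circ> to_frac A) (L\<lparr>carrier := B\<rparr>) \<rho>" by blast
  define \<alpha> where "\<alpha> = \<psi> \<circ> to_frac A"
  note T = T[folded \<alpha>_def]
  interpret R: adic_prime R \<pi> by (rule uniformiser_adic_prime[OF R(1-3)])
  have A: "cring A" and \<phi>: "\<phi> \<in> ring_hom R A" and complete: "adically_complete A (\<phi> \<pi>)"
    using X(1) by (auto simp: affine_formal_scheme_def)
  define t0 where "t0 = \<phi> \<pi>"
  have t0: "t0 \<in> carrier A" unfolding t0_def by (rule ring_hom_closed[OF \<phi> R.t])
  \<comment> \<open>Integrality of the special fibre makes \<open>(t0)\<close> prime, flatness over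
    \<open>R\<close> makes \<open>t0\<close> regular, and completeness gives separatedness.\<close>
  interpret A: adic_prime A t0
  proof (intro adic_prime.intro A adic_prime_axioms.intro t0)
    have "ideal (PIdl\<^bsub>A\<^esub> t0) A" by (rule cring.cgenideal_ideal[OF A t0])
    then show "primeideal (PIdl\<^bsub>A\<^esub> t0) A"
      using cring.quot_domain_imp_primeideal[OF A] X(5) by (simp add: special_fibre_def t0_def)
    show "a = \<zero>\<^bsub>A\<^esub>" if "a \<in> carrier A" "t0 \<otimes>\<^bsub>A\<^esub> a = \<zero>\<^bsub>A\<^esub>" for a
      using flat_regular[OF R.is_domain A \<phi> X(4) R.t R.t_nonzero that[unfolded t0_def]] .
    show "a = \<zero>\<^bsub>A\<^esub>" if "a \<in> carrier A" "\<And>n. a \<in> PIdl\<^bsub>A\<^esub> (t0 [^]\<^bsub>A\<^esub> (n::nat))" for a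
      by (rule adically_complete_separated[OF A t0 complete[folded t0_def] that])
  qed
  let ?GF = "generic_fibre A t0"
  let ?F = "frac_field A"
  have L: "cring L" and \<psi>: "\<psi> \<in> ring_hom ?GF L" and \<sigma>: "\<sigma> \<in> ring_hom L L"
    and \<sigma>_\<psi>: "\<And>a. a \<in> carrier ?GF \<Longrightarrow> \<sigma> (\<psi> a) = \<psi> a"
    using f_K(1) by (auto simp: cyclic_torsor_def t0_def)
  interpret L: cring L by (rule L)
  have \<alpha>: "\<alpha> \<in> ring_hom A L" unfolding \<alpha>_def by (rule ring_hom_trans[OF A.to_frac_GF_hom \<psi>])
  interpret \<alpha>: ring_hom_cring A L \<alpha> by unfold_locales (rule \<alpha>)
  have \<alpha>_eq: "\<alpha> a = \<psi> (to_frac A a)" for a by (simp add: \<alpha>_def)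
  have chA: "add_pow A p \<one>\<^bsub>A\<^esub> = \<zero>\<^bsub>A\<^esub>"
  proof -
    interpret \<phi>: ring_hom_cring R A \<phi> by unfold_locales (rule \<phi>)
    have "\<phi> (add_pow R p \<one>\<^bsub>R\<^esub>) = \<phi> \<zero>\<^bsub>R\<^esub>" using R(4) by (simp add: prime_characteristic_def)
    then show ?thesis using ring_hom_add_pow[OF R.is_cring A \<phi> R.one_closed, of p] by simp
  qed
  have chL: "add_pow L p \<one>\<^bsub>L\<^esub> = \<zero>\<^bsub>L\<^esub>"
    using ring_hom_add_pow[OF A L \<alpha> A.one_closed, of p] chA by simp
  have unit: "\<alpha> t0 \<in> Units L"
  proof -
    let ?u = "quot A \<one>\<^bsub>A\<^esub> t0"
    have u: "?u \<in> carrier ?GF" using A.quot_GF[OF A.one_closed, of 1] t0 by simp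
    have "\<psi> ?u \<otimes>\<^bsub>L\<^esub> \<alpha> t0 = \<psi> (?u \<otimes>\<^bsub>?GF\<^esub> to_frac A t0)"
      unfolding \<alpha>_eq by (rule ring_hom_mult[OF \<psi> u A.to_frac_GF[OF t0], symmetric])
    also have "?u \<otimes>\<^bsub>?GF\<^esub> to_frac A t0 = \<one>\<^bsub>?GF\<^esub>"
      using t0 by (simp add: A.to_frac_quot A.quot_mult A.F_one A.quot_eq)
    also have "\<psi> \<one>\<^bsub>?GF\<^esub> = \<one>\<^bsub>L\<^esub>" by (rule ring_hom_one[OF \<psi>])
    finally have 1: "\<psi> ?u \<otimes>\<^bsub>L\<^esub> \<alpha> t0 = \<one>\<^bsub>L\<^esub>" .
    have c: "\<psi> ?u \<in> carrier L" "\<alpha> t0 \<in> carrier L" using ring_hom_closed[OF \<psi> u] t0 by auto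
    then have "\<alpha> t0 \<otimes>\<^bsub>L\<^esub> \<psi> ?u = \<one>\<^bsub>L\<^esub>" using 1 L.m_comm by metis
    then show ?thesis using 1 c unfolding Units_def by blast
  qed
  have B: "subring B L" and gp: "generic_part L (\<alpha> t0) B = carrier L"
    using model unfolding integral_model_def Let_def \<alpha>_def t0_def by blast+
  let ?B = "L\<lparr>carrier := B\<rparr>"
  have cB: "cring ?B" by (rule L.subring_cring[OF B])
  have \<alpha>B: "\<alpha> \<in> ring_hom A ?B" and ff: "contraction A \<alpha> ` spec ?B = spec A"
    using T by (auto simp: torsor_def Let_def faithfully_flat_over_def)
  \<comment> \<open>Faithful flatness provides a prime of the model above \<open>(t0)\<close>; the
    hypothesis on ramification is applied to it.\<close>
  have "PIdl\<^bsub>A\<^esub> t0 \<in> spec A" using A.t_prime by (simp add: spec_def)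
  then obtain Q where Q: "Q \<in> spec ?B" "contraction A \<alpha> Q = PIdl\<^bsub>A\<^esub> t0" using ff by (metis imageE)
  have Qp: "primeideal Q ?B" using Q by (simp add: spec_def)
  have ram: "has_ramification_index \<alpha> (PIdl\<^bsub>A\<^esub> t0) ?B Q 1"
    using ramification Q by (simp add: \<alpha>_def t0_def)
  interpret M: model_prime A t0 L p \<alpha> B Q
  proof (intro model_prime.intro A.adic_prime_axioms char_p_ring.intro L char_p_ring_axioms.intro
      model_prime_axioms.intro p(1) chL B \<alpha> unit Qp)
    show "\<alpha> a \<in> B" if "a \<in> carrier A" for a using ring_hom_closed[OF \<alpha>B that] by simp
    show "\<exists>n::nat. \<alpha> t0 [^]\<^bsub>L\<^esub> n \<otimes>\<^bsub>L\<^esub> x \<in> B" if "x \<in> carrier L" for x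
      using that gp unfolding generic_part_def by blast
    show "\<alpha> a \<in> Q \<longleftrightarrow> a \<in> PIdl\<^bsub>A\<^esub> t0" if "a \<in> carrier A" for a
      using that Q(2) unfolding contraction_def by blast
    show "\<exists>s\<in>B - Q. \<exists>b\<in>B. s \<otimes>\<^bsub>L\<^esub> q = b \<otimes>\<^bsub>L\<^esub> \<alpha> t0" if "q \<in> Q" for q
      using unramified_prime[OF cB Qp \<alpha>B A t0 ram that] by simp
  qed
  obtain b1 where b1: "b1 \<in> carrier A" "b1 \<notin> PIdl\<^bsub>A\<^esub> t0" "a1 = to_frac A b1"
    using A.val_eta_zero a by (auto simp: t0_def)
  obtain b2 where b2: "b2 \<in> carrier A" "b2 \<notin> PIdl\<^bsub>A\<^esub> t0" "a2 = to_frac A b2"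
    using A.val_eta_zero a by (auto simp: t0_def)
  define M1 where "M1 = nat m1"
  have M1: "int M1 = m1" "M1 > 0" using m(1) by (auto simp: M1_def)
  define k2 where "k2 = M1 * (p * (p - 1) + 1)"
  \<comment> \<open>The inequality between \<open>m1\<close> and \<open>m2\<close> makes this
    exponent nonnegative, so the conversion to a natural number loses nothing and
    \<open>t0^w2 b2\<close> is the value of \<open>c0\<close>.\<close>
  define w2 where "w2 = nat (int k2 + m2)"
  have "int (p - 1) = int p - 1" using p(2) by simp
  then have "int k2 = m1 * (int p * (int p - 1) + 1)" by (simp add: k2_def M1 distrib_left)
  then have w2: "int k2 + m2 = int w2" using m(2) by (simp add: w2_def)
  define c1 where "c1 = to_frac A t0 [^]\<^bsub>?F\<^esub> (- int p * m1) \<otimes>\<^bsub>?F\<^esub> a1"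
  define c2 where "c2 = to_frac A t0 [^]\<^bsub>?F\<^esub> m2 \<otimes>\<^bsub>?F\<^esub> a2"
  have "int (p * M1) + - int p * m1 = int 0" using M1 by simp
  note c1 = A.clear_denominator[OF b1(1) this c1_def[unfolded b1(3)]]
  note c2 = A.clear_denominator[OF b2(1) w2 c2_def[unfolded b2(3)]]
  \<comment> \<open>Identities in the function field are transferred to \<open>L\<close> after
    clearing denominators, since \<open>\<psi>\<close> is only defined on the generic fibre.\<close>
  have scaled: "\<alpha> t0 [^]\<^bsub>L\<^esub> k \<otimes>\<^bsub>L\<^esub> \<psi> x = \<alpha> b"
    if e: "to_frac A (t0 [^]\<^bsub>A\<^esub> (k::nat)) \<otimes>\<^bsub>?F\<^esub> x = to_frac A b" and x: "x \<in> carrier ?GF" for k x b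
  proof -
    have tk: "t0 [^]\<^bsub>A\<^esub> k \<in> carrier A" by simp
    have "\<psi> (to_frac A (t0 [^]\<^bsub>A\<^esub> k)) \<otimes>\<^bsub>L\<^esub> \<psi> x = \<psi> (to_frac A (t0 [^]\<^bsub>A\<^esub> k) \<otimes>\<^bsub>?GF\<^esub> x)"
      by (rule ring_hom_mult[OF \<psi> A.to_frac_GF[OF tk] x, symmetric])
    then have "\<alpha> (t0 [^]\<^bsub>A\<^esub> k) \<otimes>\<^bsub>L\<^esub> \<psi> x = \<alpha> b" unfolding \<alpha>_eq A.GF_simps e .
    then show ?thesis using t0 by simp
  qed
  note W = given_by_witt_equationD[OF A.GF_cring L \<psi> _ c1(2) c2(2)
      equation[folded t0_def, folded c1_def c2_def]]
  have p0: "p > 0" using p(2) by simp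
  note W = W[OF p0]
  have eq1: "\<alpha> t0 [^]\<^bsub>L\<^esub> (p * M1) \<otimes>\<^bsub>L\<^esub> (T1 [^]\<^bsub>L\<^esub> p \<ominus>\<^bsub>L\<^esub> T1) = \<alpha> b1"
    unfolding W(3) using scaled[OF c1] b1 by simp
  have eq2: "\<alpha> t0 [^]\<^bsub>L\<^esub> (M1 * (p * (p - 1) + 1)) \<otimes>\<^bsub>L\<^esub>
      (T2 [^]\<^bsub>L\<^esub> p \<ominus>\<^bsub>L\<^esub> T2 \<ominus>\<^bsub>L\<^esub> witt_carry p L (T1 [^]\<^bsub>L\<^esub> p) (\<ominus>\<^bsub>L\<^esub> T1)) = \<alpha> (t0 [^]\<^bsub>A\<^esub> w2 \<otimes>\<^bsub>A\<^esub> b2)"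
    unfolding W(4) using scaled[OF c2] by (simp only: k2_def)
  \<comment> \<open>A congruence of this kind with \<open>s\<close> outside \<open>I\<close> would
    make the residue class of \<open>a1\<close> a \<open>p\<close>-th power, against the
    hypothesis.\<close>
  have np: "s \<in> M.I" if ys: "y \<in> \<alpha> ` carrier A" "s \<in> \<alpha> ` carrier A"
    and e: "M.eqv (y [^]\<^bsub>L\<^esub> p) (\<alpha> b1 \<otimes>\<^bsub>L\<^esub> s [^]\<^bsub>L\<^esub> p)" for y s
  proof (rule ccontr)
    assume s: "s \<notin> M.I"
    obtain y' s' where c: "y' \<in> carrier A" "y = \<alpha> y'" "s' \<in> carrier A" "s = \<alpha> s'" using ys by blast
    have "y' [^]\<^bsub>A\<^esub> p \<ominus>\<^bsub>A\<^esub> b1 \<otimes>\<^bsub>A\<^esub> s' [^]\<^bsub>A\<^esub> p \<in> PIdl\<^bsub>A\<^esub> t0"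
      using e unfolding c(2,4) M.eqv_\<alpha>_pow[OF c(1) b1(1) c(3)] .
    moreover have "s' \<notin> PIdl\<^bsub>A\<^esub> t0" using s c M.I_\<alpha> by blast
    ultimately show False
      using A.residue_power[OF c(1,3) _ b1(1)] a(5) unfolding t0_def[symmetric] b1(3) by blast
  qed
  have gen: "H = carrier L" if H: "subring H L" "\<alpha> ` carrier A \<subseteq> H" "inv\<^bsub>L\<^esub> \<alpha> t0 \<in> H" "T1 \<in> H" "T2 \<in> H" for H
  proof (rule W(7)[OF H(1) _ H(4,5)])
    show "\<psi> ` carrier ?GF \<subseteq> H"
    proof
      fix x assume "x \<in> \<psi> ` carrier ?GF"
      then obtain b n where b: "b \<in> carrier A" "x = \<psi> (quot A b (t0 [^]\<^bsub>A\<^esub> (n::nat)))" by (auto simp: A.GF_carrier)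
      have xc: "x \<in> carrier L" unfolding b(2) by (rule ring_hom_closed[OF \<psi> A.quot_GF[OF b(1)]])
      have ic: "inv\<^bsub>L\<^esub> \<alpha> t0 \<in> carrier L" "inv\<^bsub>L\<^esub> \<alpha> t0 \<otimes>\<^bsub>L\<^esub> \<alpha> t0 = \<one>\<^bsub>L\<^esub>" using unit by auto
      have tc: "\<alpha> t0 \<in> carrier L" using t0 by simp
      have e: "\<alpha> t0 [^]\<^bsub>L\<^esub> n \<otimes>\<^bsub>L\<^esub> x = \<alpha> b"
        unfolding b(2) by (rule scaled[OF A.tF_quot[OF b(1)] A.quot_GF[OF b(1)]])
      have "x = (inv\<^bsub>L\<^esub> \<alpha> t0 \<otimes>\<^bsub>L\<^esub> \<alpha> t0) [^]\<^bsub>L\<^esub> n \<otimes>\<^bsub>L\<^esub> x" unfolding ic(2) using xc by simp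
      also have "\<dots> = inv\<^bsub>L\<^esub> \<alpha> t0 [^]\<^bsub>L\<^esub> n \<otimes>\<^bsub>L\<^esub> (\<alpha> t0 [^]\<^bsub>L\<^esub> n \<otimes>\<^bsub>L\<^esub> x)"
        using L.nat_pow_distrib[OF ic(1) tc] ic(1) tc xc by (simp add: L.m_assoc)
      finally have "x = inv\<^bsub>L\<^esub> \<alpha> t0 [^]\<^bsub>L\<^esub> n \<otimes>\<^bsub>L\<^esub> \<alpha> b" unfolding e .
      moreover have "inv\<^bsub>L\<^esub> \<alpha> t0 [^]\<^bsub>L\<^esub> n \<otimes>\<^bsub>L\<^esub> \<alpha> b \<in> H"
        by (rule subringE(6)[OF H(1) L.subring_pow[OF H(1,3)]]) (use H(2) b(1) in blast)
      ultimately show "x \<in> H" by simp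
    qed
  qed
  have \<sigma>_\<alpha>: "\<sigma> a = a" if "a \<in> \<alpha> ` carrier A" for a
    using that \<sigma>_\<psi> A.to_frac_GF by (auto simp: \<alpha>_eq)
  let ?\<beta> = "\<alpha> \<circ> \<phi>"
  have \<beta>: "?\<beta> \<in> ring_hom R L" by (rule ring_hom_trans[OF \<phi> \<alpha>])
  interpret \<beta>: ring_hom_cring R L ?\<beta> by unfold_locales (rule \<beta>)
  have \<phi>c: "\<phi> r \<in> carrier A" if "r \<in> carrier R" for r by (rule ring_hom_closed[OF \<phi> that])
  have \<phi>I: "\<phi> r \<in> PIdl\<^bsub>A\<^esub> t0" if "r \<in> PIdl\<^bsub>R\<^esub> \<pi>" for r
    using that ring_hom_mult[OF \<phi> _ R.t] \<phi>c unfolding R.mem_PIdl A.mem_PIdl t0_def by blast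
  have \<beta>I: "?\<beta> r \<in> M.I" if "r \<in> PIdl\<^bsub>R\<^esub> \<pi>" for r
    using that \<phi>I M.I_\<alpha>[OF \<phi>c] R.P.a_subset by auto
  \<comment> \<open>An element outside \<open>(\<pi>)\<close> has an inverse modulo
    \<open>\<pi>\<close>. If its image were divisible by \<open>t0\<close>, then 1 would be as
    well.\<close>
  have \<beta>_unit: "?\<beta> r \<notin> M.I" if r: "r \<in> carrier R" "r \<notin> PIdl\<^bsub>R\<^esub> \<pi>" for r
  proof
    assume "?\<beta> r \<in> M.I"
    then have rI: "\<phi> r \<in> PIdl\<^bsub>A\<^esub> t0" using M.I_\<alpha>[OF \<phi>c[OF r(1)]] by simp
    have fld: "field (R Quot PIdl\<^bsub>R\<^esub> \<pi>)" using R(5) by (simp add: perfect_field_def)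
    obtain s where s: "s \<in> carrier R" "r \<otimes>\<^bsub>R\<^esub> s \<ominus>\<^bsub>R\<^esub> \<one>\<^bsub>R\<^esub> \<in> PIdl\<^bsub>R\<^esub> \<pi>"
      using residue_inverse[OF R.is_cring R.P.is_ideal fld r] by blast
    interpret \<phi>: ring_hom_cring R A \<phi> by unfold_locales (rule \<phi>)
    have "\<phi> (r \<otimes>\<^bsub>R\<^esub> s \<ominus>\<^bsub>R\<^esub> \<one>\<^bsub>R\<^esub>) = \<phi> r \<otimes>\<^bsub>A\<^esub> \<phi> s \<ominus>\<^bsub>A\<^esub> \<one>\<^bsub>A\<^esub>" using r s by (simp add: a_minus_def)
    then have 1: "\<phi> r \<otimes>\<^bsub>A\<^esub> \<phi> s \<ominus>\<^bsub>A\<^esub> \<one>\<^bsub>A\<^esub> \<in> PIdl\<^bsub>A\<^esub> t0" using \<phi>I[OF s(2)] by simp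
    have 2: "\<phi> r \<otimes>\<^bsub>A\<^esub> \<phi> s \<in> PIdl\<^bsub>A\<^esub> t0" by (rule A.P.I_r_closed[OF rI \<phi>c[OF s(1)]])
    have "\<one>\<^bsub>A\<^esub> = \<phi> r \<otimes>\<^bsub>A\<^esub> \<phi> s \<ominus>\<^bsub>A\<^esub> (\<phi> r \<otimes>\<^bsub>A\<^esub> \<phi> s \<ominus>\<^bsub>A\<^esub> \<one>\<^bsub>A\<^esub>)"
    proof -
      have "\<one>\<^bsub>A\<^esub> = x \<ominus>\<^bsub>A\<^esub> (x \<ominus>\<^bsub>A\<^esub> \<one>\<^bsub>A\<^esub>)" if "x \<in> carrier A" for x
        using that by (simp add: a_minus_def A.minus_add A.a_assoc[symmetric] A.r_neg)
      then show ?thesis using \<phi>c r s by simp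
    qed
    then have "\<one>\<^bsub>A\<^esub> \<in> PIdl\<^bsub>A\<^esub> t0"
      using A.P.a_closed[OF 2 A.P.a_inv_closed[OF 1]] by (simp add: a_minus_def)
    then show False using A.one_notin_P by blast
  qed
  have \<beta>_val: "\<exists>(e::nat) r0. r0 \<in> carrier R \<and> ?\<beta> r0 \<notin> M.I \<and> ?\<beta> r = \<alpha> t0 [^]\<^bsub>L\<^esub> e \<otimes>\<^bsub>L\<^esub> ?\<beta> r0"
    if r: "r \<in> carrier R" "r \<noteq> \<zero>\<^bsub>R\<^esub>" for r
  proof -
    obtain e r0 where r0: "r0 \<in> carrier R" "r0 \<notin> PIdl\<^bsub>R\<^esub> \<pi>" "r = \<pi> [^]\<^bsub>R\<^esub> (e::nat) \<otimes>\<^bsub>R\<^esub> r0"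
      using R.factor_t[OF r] by blast
    have "?\<beta> r = ?\<beta> (\<pi> [^]\<^bsub>R\<^esub> e) \<otimes>\<^bsub>L\<^esub> ?\<beta> r0" unfolding r0(3) by (rule ring_hom_mult[OF \<beta> R.nat_pow_closed[OF R.t] r0(1)])
    moreover have "?\<beta> (\<pi> [^]\<^bsub>R\<^esub> e) = ?\<beta> \<pi> [^]\<^bsub>L\<^esub> e" by (rule \<beta>.hom_pow[OF R.t])
    ultimately have "?\<beta> r = \<alpha> t0 [^]\<^bsub>L\<^esub> e \<otimes>\<^bsub>L\<^esub> ?\<beta> r0" unfolding t0_def comp_apply by metis
    then show ?thesis using \<beta>_unit[OF r0(1,2)] r0(1) by blast
  qed
  \<comment> \<open>A nonzero \<open>r\<close> is sent to a power of the unit \<open>t\<close> of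
    \<open>L\<close> times an element outside \<open>I\<close>, and such a product is
    nonzero.\<close>
  have \<beta>_inj: "r = \<zero>\<^bsub>R\<^esub>" if r: "r \<in> carrier R" "?\<beta> r = \<zero>\<^bsub>L\<^esub>" for r
  proof (rule ccontr)
    assume "r \<noteq> \<zero>\<^bsub>R\<^esub>"
    then obtain e r0 where r0: "r0 \<in> carrier R" "?\<beta> r0 \<notin> M.I" "?\<beta> r = \<alpha> t0 [^]\<^bsub>L\<^esub> (e::nat) \<otimes>\<^bsub>L\<^esub> ?\<beta> r0"
      using \<beta>_val[OF r(1)] by blast
    have c: "?\<beta> r0 \<in> carrier L" by (rule \<beta>.hom_closed[OF r0(1)])
    have "\<alpha> t0 [^]\<^bsub>L\<^esub> e \<otimes>\<^bsub>L\<^esub> ?\<beta> r0 = \<alpha> t0 [^]\<^bsub>L\<^esub> e \<otimes>\<^bsub>L\<^esub> \<zero>\<^bsub>L\<^esub>" using r0(3) r(2) t0 by simp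
    then have "?\<beta> r0 = \<zero>\<^bsub>L\<^esub>" by (rule M.t_cancel[OF c L.zero_closed])
    then show False using r0(2) M.I_zero by simp
  qed
  interpret W: witt_base L p M.V "\<alpha> ` carrier A" "\<alpha> t0" "\<alpha> b1" "\<alpha> (t0 [^]\<^bsub>A\<^esub> w2 \<otimes>\<^bsub>A\<^esub> b2)" T1 T2 M1 \<sigma> "?\<beta> ` carrier R"
  proof (intro witt_base.intro witt_action.intro witt_extension.intro M.valued_axioms witt_extension_axioms.intro
      witt_action_axioms.intro witt_base_axioms.intro M1(2) W(1,2) eq1 eq2 \<sigma> \<sigma>_\<alpha> W(5,6))
    show "\<alpha> b1 \<in> \<alpha> ` carrier A" "\<alpha> (t0 [^]\<^bsub>A\<^esub> w2 \<otimes>\<^bsub>A\<^esub> b2) \<in> \<alpha> ` carrier A" using b1 b2 by auto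
    show "s \<in> M.I" if "y \<in> \<alpha> ` carrier A" "s \<in> \<alpha> ` carrier A" "M.eqv (y [^]\<^bsub>L\<^esub> p) (\<alpha> b1 \<otimes>\<^bsub>L\<^esub> s [^]\<^bsub>L\<^esub> p)" for y s
      by (rule np[OF that])
    show "b j \<in> M.I" if "g \<in> \<alpha> ` carrier A"
      "\<And>y s. y \<in> \<alpha> ` carrier A \<Longrightarrow> s \<in> \<alpha> ` carrier A \<Longrightarrow> M.eqv (y [^]\<^bsub>L\<^esub> p) (g \<otimes>\<^bsub>L\<^esub> s [^]\<^bsub>L\<^esub> p) \<Longrightarrow> s \<in> M.I"
      "\<And>j. j < p \<Longrightarrow> b j \<in> \<alpha> ` carrier A"
      "(\<Oplus>\<^bsub>L\<^esub>j\<in>{..<p}. b j [^]\<^bsub>L\<^esub> p \<otimes>\<^bsub>L\<^esub> g [^]\<^bsub>L\<^esub> j) \<in> M.I" "j < p" for g b j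
      by (rule M.image_p_independent[OF chA that])
    show "H = carrier L" if "subring H L" "\<alpha> ` carrier A \<subseteq> H" "inv\<^bsub>L\<^esub> \<alpha> t0 \<in> H" "T1 \<in> H" "T2 \<in> H" for H
      by (rule gen[OF that])
    show "subring (?\<beta> ` carrier R) L"
      by (rule ring_hom_ring.img_is_subring[OF ring_hom_ringI2[OF R.ring_axioms L.ring_axioms \<beta>] R.carrier_is_subring])
    show "?\<beta> ` carrier R \<subseteq> \<alpha> ` carrier A" using \<phi>c by auto
    show "\<alpha> t0 \<in> ?\<beta> ` carrier R" using R.t by (auto simp: t0_def)
  next
    fix r assume "r \<in> ?\<beta> ` carrier R"
    then obtain r' where r': "r' \<in> carrier R" "r = ?\<beta> r'" by blast
    obtain s where s: "s \<in> carrier R" "r' \<ominus>\<^bsub>R\<^esub> s [^]\<^bsub>R\<^esub> p \<in> PIdl\<^bsub>R\<^esub> \<pi>"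
      using perfect_residue_root[OF R.is_cring R.P.is_ideal R(5) r'(1)] by blast
    have "\<phi> (s [^]\<^bsub>R\<^esub> p) \<in> carrier A" by (rule \<phi>c[OF R.nat_pow_closed[OF s(1)]])
    moreover have "\<phi> (r' \<ominus>\<^bsub>R\<^esub> s [^]\<^bsub>R\<^esub> p) = \<phi> r' \<ominus>\<^bsub>A\<^esub> \<phi> (s [^]\<^bsub>R\<^esub> p)"
    proof -
      interpret \<phi>: ring_hom_cring R A \<phi> by unfold_locales (rule \<phi>)
      show ?thesis using r' s by (simp add: a_minus_def)
    qed
    ultimately have "M.eqv (\<alpha> (\<phi> r')) (\<alpha> (\<phi> (s [^]\<^bsub>R\<^esub> p)))"
      using \<phi>I[OF s(2)] M.eqv_\<alpha>[OF \<phi>c[OF r'(1)]] by metis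
    moreover have "\<alpha> (\<phi> (s [^]\<^bsub>R\<^esub> p)) = ?\<beta> s [^]\<^bsub>L\<^esub> p" using \<beta>.hom_pow[OF s(1)] by (metis comp_apply)
    ultimately have "M.eqv r (?\<beta> s [^]\<^bsub>L\<^esub> p)" using r'(2) by (metis comp_apply)
    then show "\<exists>s\<in>?\<beta> ` carrier R. M.eqv r (s [^]\<^bsub>L\<^esub> p)" using s(1) by blast
    assume "r \<noteq> \<zero>\<^bsub>L\<^esub>"
    then have "r' \<noteq> \<zero>\<^bsub>R\<^esub>" using r' \<beta>.hom_zero by metis
    then show "\<exists>(e::nat) r0. r0 \<in> ?\<beta> ` carrier R \<and> r0 \<notin> M.I \<and> r = \<alpha> t0 [^]\<^bsub>L\<^esub> e \<otimes>\<^bsub>L\<^esub> r0"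
      using \<beta>_val[OF r'(1)] r'(2) by blast
  qed
  interpret X: torsor_points R A L G \<phi> \<alpha> B \<rho>
    by (intro torsor_points.intro R.is_cring A L torsor_points_axioms.intro B \<phi> T)
      (use G in \<open>simp add: finite_flat_group_scheme_def\<close>)
  interpret C: witt_torsor L p M.V "\<alpha> ` carrier A" "\<alpha> t0" "\<alpha> b1" "\<alpha> (t0 [^]\<^bsub>A\<^esub> w2 \<otimes>\<^bsub>A\<^esub> b2)" T1 T2 M1 \<sigma>
    "?\<beta> ` carrier R" R A G \<phi> \<alpha> B \<rho>
  proof (intro witt_torsor.intro W.witt_base_axioms X.torsor_points_axioms witt_torsor_axioms.intro R.is_domain M.Bs_V)
    show "finite_over R (scalar G) G" using G by (simp add: finite_flat_group_scheme_def)
    show "\<exists>s\<in>B. s \<notin> M.I \<and> s \<otimes>\<^bsub>L\<^esub> z \<in> B" if "z \<in> M.V" for z by (rule M.V_frac[OF that])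
    show "\<alpha> a \<in> \<alpha> ` carrier A" if "a \<in> carrier A" for a using that by blast
    show "?\<beta> r \<in> ?\<beta> ` carrier R" if "r \<in> carrier R" for r using that by blast
    show "r = \<zero>\<^bsub>R\<^esub>" if "r \<in> carrier R" "?\<beta> r = \<zero>\<^bsub>L\<^esub>" for r by (rule \<beta>_inj[OF that])
  qed
  show False by (rule C.contradiction)
qed

end
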